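(* Let $N\ge7$ be a prime and $G=PSL(2,N)$. Let $D_0,D_1,D_2,D_3$ be reduced orbits on $X(N)$ of points whose stabilizers in $G$ have order $1$, $2$, $3$, $N$ respectively. Let $\theta_1$ be the nontrivial character of the stabilizer $H_1$ of order $2$ and $\theta_2$ a nontrivial character of the stabilizer $H_2$ of order $3$. Then: \begin{itemize} \item[(1)] $\deg_{eq}(rD_0)=r\cdot k[G]$ for all $r\ge1$. \item[(2)] For $r\ge0$ (with $r\geq 1$ in the first formula), $\deg_{eq}(2rD_1)=r\cdot k[G]$ and $\deg_{eq}((2r+1)D_1)=r\cdot k[G]+\mathrm{Ind}_{H_1}^G\theta_1$. \item[(3)] For $r\ge0$ (with $r\ge1$ in the first formula), $\deg_{eq}(3rD_2)=r\cdot k[G]$, $\deg_{eq}((3r+1)D_2)=r\cdot k[G]+\mathrm{Ind}_{H_2}^G\theta_2$, and $\deg_{eq}((3r+2)D_2)=r\cdot k[G]+2\,\mathrm{Ind}_{H_2}^G\theta_2$. \item[(4)] For $1\le r\le N-1$, let $q_r$ and $n_r$ be the numbers of quadratic residues, respectively quadratic non-residues, modulo $N$ in the set $\{N-r,\dots,N-1\}$. Then $$\deg_{eq}(rD_3)=r\Big(\sum_\beta X_\beta+V+\sum_\alpha W_\alpha\Big)+\begin{cases}q_rW'+n_rW'',&N\equiv1\pmod4,\\ q_rX'+n_rX'',&N\equiv3\pmod4,\end{cases}$$ where the sums run over all irreducible representations $X_\beta$ and $W_\alpha$ up to equivalence. \end{itemize}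
   Context: Curve and group. $\mathbb F=GF(N)$, $G=PSL(2,N)$. $X(N)$ is the modular curve of full level $N$: its complex points are $\Gamma(N)\backslash H^*$, where $H^*=H\cup\mathbb Q\cup\{\infty\}$, $H$ is the upper half-plane, and $\Gamma(N)$ is the kernel of $SL_2(\mathbb Z)\to SL_2(\mathbb Z/N\mathbb Z)$. $G\cong\overline{\Gamma(1)}/\overline{\Gamma(N)}$ (bars denote images in $PSL_2(\mathbb Z)$) acts on $X(N)$ with quotient $X(1)\cong\mathbb P^1$. The base field $k$ is $\mathbb C$, or a field of good positive characteristic $\ell$ (i.e. $X(N)$ has good reduction in characteristic $\ell$ and $\ell\nmid|G|$) containing a primitive $|G|$-th root of unity; in the latter case $X(N)$ means the reduction, and representations of $G$ over $k$ are identified with complex representations through Brauer characters, after fixing an embedding of the $|G|$-th roots of unity of $k$ into $\mathbb C^\times$. Equivariant degree. For a point $P$ of $X(N)$ let $G_P$ be its stabilizer and let $\theta_P$ (the ramification character) be the character of $G_P$ on the cotangent space to $X(N)$ at $P$. The reduced orbit of $P$ is the divisor $D=\sum_{g\in G/G_P}g(P)$. For $r\ge1$ the equivariant degree of $rD$ is $\deg_{eq}(rD)=\mathrm{Ind}_{G_P}^G\big(\sum_{\ell=1}^r\theta_P^{-\ell}\big)$, considered up to equivalence of representations. $k[G]$ is the regular representation. Irreducible representations. Let $\varepsilon$ generate $\mathbb F^\times$, and let $T\subset\mathbb F(\sqrt\varepsilon)^\times$ be the cyclic subgroup of order $N+1$ (norm-one elements), with generator $\tau$. The conjugacy classes of $G$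 are represented by $1$, $\begin{pmatrix}x&0\\0&x^{-1}\end{pmatrix}$, $\begin{pmatrix}1&1\\0&1\end{pmatrix}$, $\begin{pmatrix}1&\varepsilon\\0&1\end{pmatrix}$, $\begin{pmatrix}x&\varepsilon y\\ y&x\end{pmatrix}$ (the last corresponding to $x+\sqrt\varepsilon y\in T$). The irreducible representations and their character values on these five types, in this order, are: the trivial one $\mathbf 1$; $V$: $(N,1,0,0,-1)$; $W_\alpha$ of dimension $N+1$: $(N+1,\alpha(x)+\alpha(x^{-1}),1,1,0)$, for homomorphisms $\alpha:\mathbb F^\times\to\mathbb C^\times$ with $\alpha(-1)=1$, $\alpha\ne\alpha^{-1}$, $W_\alpha\cong W_{\alpha^{-1}}$; $X_\beta$ of dimension $N-1$: $(N-1,0,-1,-1,-\beta(x+\sqrt\varepsilon y)-\beta(x-\sqrt\varepsilon y))$, for homomorphisms $\beta:T\to\mathbb C^\times$ with $\beta(-1)=1$, $\beta\neq\beta^{-1}$, $X_\beta\cong X_{\beta^{-1}}$. Let $\zeta$ be a primitive $N$-th root of unity in $\mathbb C$, $q=\sum_{(a/N)=1}\zeta^a$, $q'=\sum_{(a/N)=-1}\zeta^a$. If $N\equiv1\pmod4$, there are two more irreducibles, of dimension $\frac{N+1}2$: $W'$: $(\frac{N+1}2,\alpha_0(x),1+q,1+q',0)$ and $W''$: $(\frac{N+1}2,\alpha_0(x),1+q',1+q,0)$, where $\alpha_0(\varepsilon)=-1$. If $N\equiv3\pmod4$, there are two more irreducibles, of dimension $\frac{N-1}2$: $X'$: $(\frac{N-1}2,0,q,q',-\beta_0(x+\sqrt\varepsilon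 y))$ and $X''$: $(\frac{N-1}2,0,q',q,-\beta_0(x+\sqrt\varepsilon y))$, where $\beta_0(\tau)=-1$. Convention on $\zeta$: it is chosen so that for a point $P$ with stabilizer $H_3=\langle\begin{pmatrix}1&1\\0&1\end{pmatrix}\rangle\subset G$ (over $\mathbb C$, the image of $\infty$), the ramification character $\theta_P$ takes the value $\zeta$ on $\begin{pmatrix}1&1\\0&1\end{pmatrix}$. *)

theory Defs
  imports
    "HOL-Complex_Analysis.Complex_Analysis"
    "HOL-Number_Theory.Number_Theory"
    "HOL-Algebra.Coset"
    "HOL-Algebra.Generated_Groups"
    "HOL-Library.Function_Algebras"
    "Jordan_Normal_Form.Char_Poly"
begin

section \<open>The group \<open>PSL(2,N)\<close>\<close>

definition SL2 :: "'a::comm_ring_1 mat monoid" where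
  "SL2 = \<lparr>carrier = {A \<in> carrier_mat 2 2. Determinant.det A = 1},
          monoid.mult = (*), one = 1\<^sub>m 2\<rparr>"

text \<open>A finite field \<open>'f\<close> with \<open>N\<close> elements plays the role of \<open>GF(N)\<close>.
  An element of \<open>PSL2\<close> is a coset \<open>{A, -A}\<close>.\<close>

definition PSL2 :: "'f::field mat set monoid" where
  "PSL2 = SL2 Mod {1\<^sub>m 2, - 1\<^sub>m 2}"

definition mat2 :: "'a \<Rightarrow> 'a \<Rightarrow> 'a \<Rightarrow> 'a \<Rightarrow> 'a mat" where
  "mat2 a b c d = mat_of_rows_list 2 [[a, b], [c, d]]"

definition pclass :: "'f::field mat \<Rightarrow> 'f mat set" where
  "pclass A = {1\<^sub>m 2, - 1\<^sub>m 2} #>\<^bsub>SL2\<^esub> A"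

definition unip :: "'f::field mat set" where
  "unip = pclass (mat2 1 1 0 1)"

definition principal_cong :: "nat \<Rightarrow> int mat set" where
  "principal_cong N = {A \<in> carrier SL2. \<forall>i<2. \<forall>j<2. [A $$ (i,j) = 1\<^sub>m 2 $$ (i,j)] (mod int N)}"

text \<open>All matrices in \<open>SL\<^sub>2(\<int>)\<close> whose reduction modulo \<open>N\<close> represents the given element of
  \<open>PSL2\<close>; this realises the isomorphism of \<open>PSL2\<close> with the quotient of the images of
  \<open>\<Gamma>(1)\<close> and \<open>\<Gamma>(N)\<close> in \<open>PSL\<^sub>2(\<int>)\<close>.\<close>

definition lifts :: "'f::field mat set \<Rightarrow> int mat set" where
  "lifts g = {A \<in> carrier SL2. map_mat of_int A \<in> g}"


section \<open>Matrix representations\<close>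

type_synonym ('g, 'k) rep = "'g \<Rightarrow> 'k mat"

definition is_rep :: "('g, 'm) monoid_scheme \<Rightarrow> nat \<Rightarrow> ('g, 'k::field) rep \<Rightarrow> bool" where
  "is_rep G n \<rho> \<longleftrightarrow>
     (\<forall>g\<in>carrier G. \<rho> g \<in> carrier_mat n n) \<and>
     \<rho> \<one>\<^bsub>G\<^esub> = 1\<^sub>m n \<and>
     (\<forall>g\<in>carrier G. \<forall>h\<in>carrier G. \<rho> (g \<otimes>\<^bsub>G\<^esub> h) = \<rho> g * \<rho> h)"

definition irreducible_rep :: "('g, 'm) monoid_scheme \<Rightarrow> ('g, 'k::field) rep \<Rightarrow> bool" where
  "irreducible_rep G \<rho> \<longleftrightarrow> (\<exists>n>0. is_rep G n \<rho> \<and>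
     (\<forall>U \<subseteq> carrier_vec n.
        0\<^sub>v n \<in> U \<and> (\<forall>u\<in>U. \<forall>v\<in>U. u + v \<in> U) \<and> (\<forall>c. \<forall>u\<in>U. c \<cdot>\<^sub>v u \<in> U) \<and>
        (\<forall>g\<in>carrier G. \<forall>u\<in>U. \<rho> g *\<^sub>v u \<in> U)
        \<longrightarrow> U = {0\<^sub>v n} \<or> U = carrier_vec n))"

definition rep_equiv :: "('g, 'm) monoid_scheme \<Rightarrow> ('g, 'k::field) rep \<Rightarrow> ('g, 'k) rep \<Rightarrow> bool" where
  "rep_equiv G \<rho> \<sigma> \<longleftrightarrow> (\<exists>P Q. \<forall>g\<in>carrier G. similar_mat_wit (\<rho> g) (\<sigma> g) P Q)"

definition dsum :: "('g, 'k::field) rep list \<Rightarrow> ('g, 'k) rep" where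
  "dsum \<rho>s = (\<lambda>g. diag_block_mat (map (\<lambda>\<rho>. \<rho> g) \<rho>s))"

definition copies :: "nat \<Rightarrow> ('g, 'k::field) rep \<Rightarrow> ('g, 'k) rep" where
  "copies n \<rho> = dsum (replicate n \<rho>)"

definition char_rep :: "('g \<Rightarrow> 'k) \<Rightarrow> ('g, 'k::field) rep" where
  "char_rep \<psi> = (\<lambda>g. Matrix.mat 1 1 (\<lambda>_. \<psi> g))"

definition linear_char :: "('g, 'm) monoid_scheme \<Rightarrow> 'g set \<Rightarrow> ('g \<Rightarrow> 'k::field) \<Rightarrow> bool" where
  "linear_char G H \<psi> \<longleftrightarrow>
     (\<forall>h\<in>H. \<psi> h \<noteq> 0) \<and> (\<forall>g\<in>H. \<forall>h\<in>H. \<psi> (g \<otimes>\<^bsub>G\<^esub> h) = \<psi> g * \<psi> h)"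

definition nontrivial_char :: "('g, 'm) monoid_scheme \<Rightarrow> 'g set \<Rightarrow> ('g \<Rightarrow> 'k::field) \<Rightarrow> bool" where
  "nontrivial_char G H \<psi> \<longleftrightarrow> linear_char G H \<psi> \<and> (\<exists>h\<in>H. \<psi> h \<noteq> 1)"

definition regular_rep :: "('g, 'm) monoid_scheme \<Rightarrow> ('g, 'k::field) rep" where
  "regular_rep G = (let es = (SOME es. distinct es \<and> set es = carrier G); n = length es in
     (\<lambda>g. Matrix.mat n n (\<lambda>(i,j). if g \<otimes>\<^bsub>G\<^esub> es ! j = es ! i then 1 else 0)))"

text \<open>The matrix form of the representation induced from a subgroup \<open>H\<close> of a finite group,
  with respect to a transversal \<open>ts\<close> of the left cosets of \<open>H\<close>; its equivalence class does not
  depend on the transversal. The block in position \<open>(i,j)\<close> is \<open>\<sigma>(ts\<^sub>i\<inverse> g ts\<^sub>j)\<close> or zero.\<close>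

definition left_transversal :: "('g, 'm) monoid_scheme \<Rightarrow> 'g set \<Rightarrow> 'g list \<Rightarrow> bool" where
  "left_transversal G H ts \<longleftrightarrow> set ts \<subseteq> carrier G \<and>
     (\<forall>g\<in>carrier G. \<exists>!i. i < length ts \<and> inv\<^bsub>G\<^esub> (ts ! i) \<otimes>\<^bsub>G\<^esub> g \<in> H)"

definition Ind :: "('g, 'm) monoid_scheme \<Rightarrow> 'g set \<Rightarrow> ('g, 'k::field) rep \<Rightarrow> ('g, 'k) rep" where
  "Ind G H \<sigma> = (let ts = (SOME ts. left_transversal G H ts); m = length ts;
       d = dim_row (\<sigma> \<one>\<^bsub>G\<^esub>) in
     (\<lambda>g. Matrix.mat (m * d) (m * d) (\<lambda>(i,j).
        let h = inv\<^bsub>G\<^esub> (ts ! (i div d)) \<otimes>\<^bsub>G\<^esub> g \<otimes>\<^bsub>G\<^esub> ts ! (j div d) in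
        if h \<in> H then \<sigma> h $$ (i mod d, j mod d) else 0)))"

definition mat_trace :: "'k::comm_ring_1 mat \<Rightarrow> 'k" where
  "mat_trace A = sum_list (diag_mat A)"

text \<open>The value of the Brauer character at an element acting by \<open>A\<close>: the sum, with
  multiplicity, of the complex lifts of the eigenvalues.\<close>

definition brauer :: "('k::field \<Rightarrow> complex) \<Rightarrow> 'k mat \<Rightarrow> complex" where
  "brauer lift A = (\<Sum>x | poly (char_poly A) x = 0.
      of_nat (Polynomial.order x (char_poly A)) * lift x)"


section \<open>Equivariant degree\<close>

text \<open>Here \<open>X\<close> is the set of points of a curve, \<open>act\<close> the action of \<open>G\<close> on it and \<open>\<theta> P\<close> the
  ramification character at \<open>P\<close>. Divisors are integer-valued functions on points.\<close>

definition stab :: "('g, 'm) monoid_scheme \<Rightarrow> ('g \<Rightarrow> 'p \<Rightarrow> 'p) \<Rightarrow> 'p \<Rightarrow> 'g set" where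
  "stab G act P = {g \<in> carrier G. act g P = P}"

definition reduced_orbit :: "('g, 'm) monoid_scheme \<Rightarrow> ('g \<Rightarrow> 'p \<Rightarrow> 'p) \<Rightarrow> 'p \<Rightarrow> 'p \<Rightarrow> int" where
  "reduced_orbit G act P = (\<lambda>Q. if \<exists>g\<in>carrier G. Q = act g P then 1 else 0)"

definition mult_div :: "nat \<Rightarrow> ('p \<Rightarrow> int) \<Rightarrow> 'p \<Rightarrow> int" where
  "mult_div r D = (\<lambda>Q. int r * D Q)"

text \<open>\<open>E\<close> is meant to be \<open>r\<close> times a reduced orbit with \<open>r \<ge> 1\<close>, in which case \<open>r\<close> is unique and
  \<open>P\<close> is unique up to the action of \<open>G\<close>.\<close>

definition deg_eq :: "('g, 'm) monoid_scheme \<Rightarrow> 'p set \<Rightarrow> ('g \<Rightarrow> 'p \<Rightarrow> 'p) \<Rightarrow>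
    ('p \<Rightarrow> 'g \<Rightarrow> 'k::field) \<Rightarrow> ('p \<Rightarrow> int) \<Rightarrow> ('g, 'k) rep" where
  "deg_eq G X act \<theta> E =
     (let (P, r) = (SOME (P, r). P \<in> X \<and> 1 \<le> r \<and> E = mult_div r (reduced_orbit G act P)) in
      Ind G (stab G act P) (dsum (map (\<lambda>l. char_rep (\<lambda>h. inverse (\<theta> P h) ^ l)) [1..<Suc r])))"


section \<open>Cotangent spaces\<close>

definition ideal_square :: "'r::comm_ring set \<Rightarrow> 'r set" where
  "ideal_square M = {x. \<exists>(n::nat) a b. (\<forall>i<n. a i \<in> M \<and> b i \<in> M) \<and> x = (\<Sum>i<n. a i * b i)}"

text \<open>The scalar by which a map \<open>s\<close> acts on \<open>M / M\<^sup>2\<close>, when this is a line.\<close>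

definition cotangent_scalar :: "('k \<Rightarrow> 'r \<Rightarrow> 'r) \<Rightarrow> 'r::comm_ring set \<Rightarrow> ('r \<Rightarrow> 'r) \<Rightarrow> 'k" where
  "cotangent_scalar smul M s = (THE c. \<forall>f\<in>M. s f - smul c f \<in> ideal_square M)"


section \<open>The complex curve \<open>X(N)\<close>\<close>

definition upper_half :: "complex set" where
  "upper_half = {z. 0 < Im z}"

text \<open>The Riemann sphere, in which the extended upper half-plane lives.\<close>

datatype sphere = Fin complex | Inf

definition Hstar :: "sphere set" where
  "Hstar = Fin ` upper_half \<union> Fin ` (\<rat> :: complex set) \<union> {Inf}"

definition moebius :: "int mat \<Rightarrow> complex \<Rightarrow> complex" where
  "moebius A z = (of_int (A $$ (0,0)) * z + of_int (A $$ (0,1))) /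
                 (of_int (A $$ (1,0)) * z + of_int (A $$ (1,1)))"

fun moebius_sphere :: "int mat \<Rightarrow> sphere \<Rightarrow> sphere" where
  "moebius_sphere A (Fin z) =
     (if of_int (A $$ (1,0)) * z + of_int (A $$ (1,1)) = 0 then Inf else Fin (moebius A z))"
| "moebius_sphere A Inf =
     (if A $$ (1,0) = 0 then Inf else Fin (of_int (A $$ (0,0)) / of_int (A $$ (1,0))))"

definition cong_orbit :: "nat \<Rightarrow> sphere \<Rightarrow> sphere set" where
  "cong_orbit N z = (\<lambda>A. moebius_sphere A z) ` principal_cong N"

definition XC :: "nat \<Rightarrow> sphere set set" where
  "XC N = cong_orbit N ` Hstar"

definition XC_act :: "'f::field mat set \<Rightarrow> sphere set \<Rightarrow> sphere set" where
  "XC_act g P = {moebius_sphere A z | A z. A \<in> lifts g \<and> z \<in> P}"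

text \<open>The standard local parametrisations \<open>\<phi>\<close> of \<open>X(N)\<close> near \<open>0\<close> with \<open>\<phi> 0 = P\<close>, giving the
  complex structure: \<open>u \<mapsto> [z + u]\<close> at the image of \<open>z \<in> H\<close> (\<open>\<Gamma>(N)\<close> has no elliptic
  points), and at the cusp \<open>A\<infinity>\<close> the parameter \<open>q = exp(2\<pi>iw/N)\<close> of the point \<open>[A w]\<close>.\<close>

definition interior_chart :: "nat \<Rightarrow> complex \<Rightarrow> complex \<Rightarrow> sphere set" where
  "interior_chart N z = (\<lambda>u. cong_orbit N (Fin (z + u)))"

definition cusp_chart :: "nat \<Rightarrow> int mat \<Rightarrow> complex \<Rightarrow> sphere set" where
  "cusp_chart N A = (\<lambda>q. cong_orbit N (moebius_sphere A
      (if q = 0 then Inf else Fin (of_nat N * Ln q / (2 * of_real pi * \<i>)))))"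

definition XC_charts :: "nat \<Rightarrow> sphere set \<Rightarrow> (complex \<Rightarrow> sphere set) set" where
  "XC_charts N P =
     {interior_chart N z | z. z \<in> upper_half \<and> cong_orbit N (Fin z) = P} \<union>
     {cusp_chart N A | A. A \<in> carrier SL2 \<and> cong_orbit N (moebius_sphere A Inf) = P}"

text \<open>Functions that are holomorphic near \<open>P\<close> and vanish at \<open>P\<close>. Their values away from \<open>P\<close> are
  irrelevant, and passing to germs would not change the quotient by the square of this ideal.\<close>

definition XC_max_ideal :: "nat \<Rightarrow> sphere set \<Rightarrow> (sphere set \<Rightarrow> complex) set" where
  "XC_max_ideal N P = {f. (\<forall>\<phi>\<in>XC_charts N P. (f \<circ> \<phi>) analytic_on {0}) \<and> f P = 0}"

text \<open>An element \<open>g\<close> acts on functions from the left, by \<open>f \<mapsto> f \<circ> g\<inverse>\<close>.\<close>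

definition XC_ram :: "nat \<Rightarrow> sphere set \<Rightarrow> 'f::field mat set \<Rightarrow> complex" where
  "XC_ram N P g = cotangent_scalar (\<lambda>c f Q. c * f Q) (XC_max_ideal N P)
      (\<lambda>f. f \<circ> XC_act (inv\<^bsub>PSL2\<^esub> g))"


section \<open>The reduction of \<open>X(N)\<close> in positive characteristic\<close>

text \<open>The base ring \<open>\<int>[1/N, exp(2\<pi>i/N)]\<close> over which the model of \<open>X(N)\<close> is smooth.\<close>

definition base_ring :: "nat \<Rightarrow> complex set" where
  "base_ring N = {poly (map_poly of_int p) (exp (2 * of_real pi * \<i> / of_nat N)) / of_nat N ^ k
                  | (p::int poly) (k::nat). True}"

definition on_upper_half :: "(complex \<Rightarrow> complex) \<Rightarrow> complex \<Rightarrow> complex" where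
  "on_upper_half f = (\<lambda>z. if z \<in> upper_half then f z else 0)"

text \<open>The coordinate ring of the model over \<open>base_ring N\<close> of the complement of the cusps: the
  \<open>\<Gamma>(N)\<close>-invariant holomorphic functions on \<open>H\<close> that are meromorphic at all cusps, with all
  coefficients of all their expansions there in \<open>base_ring N\<close>. By the \<open>q\<close>-expansion principle it is
  the integral closure of \<open>base_ring N\<close>\<open>[j]\<close> in the field of modular functions of level \<open>N\<close> over
  the \<open>N\<close>-th cyclotomic field. Functions on \<open>H\<close> are extended by zero.\<close>

definition integral_modular_functions :: "nat \<Rightarrow> (complex \<Rightarrow> complex) set" where
  "integral_modular_functions N = {f.
     f holomorphic_on upper_half \<and> (\<forall>z. z \<notin> upper_half \<longrightarrow> f z = 0) \<and>
     (\<forall>A\<in>principal_cong N. \<forall>z\<in>upper_half. f (moebius A z) = f z) \<and>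
     (\<forall>A\<in>carrier SL2. \<exists>(m::nat) a. (\<forall>n. a n \<in> base_ring N) \<and>
        (\<forall>z\<in>upper_half. let q = exp (2 * of_real pi * \<i> * z / of_nat N) in
           (\<lambda>n. a n * q ^ n) sums (q ^ m * f (moebius A z))))}"

definition ring_hom_on :: "'a::comm_ring_1 set \<Rightarrow> ('a \<Rightarrow> 'b::comm_ring_1) \<Rightarrow> bool" where
  "ring_hom_on R \<phi> \<longleftrightarrow> \<phi> 1 = 1 \<and>
     (\<forall>x\<in>R. \<forall>y\<in>R. \<phi> (x + y) = \<phi> x + \<phi> y \<and> \<phi> (x * y) = \<phi> x * \<phi> y)"

text \<open>\<open>K\<close> (with \<open>emb\<close> the inclusion of \<open>k\<close>) is the function field of the base change along
  \<open>\<phi> : base_ring N \<rightarrow> k\<close> of the above model, and \<open>\<sigma>\<close> is the induced action of \<open>PSL2\<close> on it. With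
  \<open>B = integral_modular_functions N\<close> and \<open>\<pp>\<close> the kernel of \<open>\<phi>\<close>, the conditions that \<open>red\<close> has
  kernel \<open>\<pp>B\<close> and that its image is linearly disjoint from \<open>k\<close> over the residue field
  \<open>\<phi>(base_ring N)\<close> together say that \<open>red\<close> induces an injection of the tensor product of \<open>B\<close> and
  \<open>k\<close> over \<open>base_ring N\<close> into \<open>K\<close>; the condition with \<open>kspan\<close> says that \<open>K\<close> is the fraction field
  of its image. Good reduction away from \<open>N\<close> is what makes such a \<open>K\<close> exist.\<close>

definition is_reduction :: "nat \<Rightarrow> (complex \<Rightarrow> 'k::field) \<Rightarrow> ('k \<Rightarrow> 'K::field) \<Rightarrow>
    ((complex \<Rightarrow> complex) \<Rightarrow> 'K) \<Rightarrow> ('f::field mat set \<Rightarrow> 'K \<Rightarrow> 'K) \<Rightarrow> bool" where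
  "is_reduction N \<phi> emb red \<sigma> \<longleftrightarrow>
    (let R = base_ring N; B = integral_modular_functions N;
         kspan = {\<Sum>i<n. emb (c i) * red (b i) | (n::nat) c b. \<forall>i<n. b i \<in> B} in
     ring_hom_on R \<phi> \<and> ring_hom_on UNIV emb \<and>
     (\<forall>f\<in>B. \<forall>g\<in>B. red (\<lambda>z. f z + g z) = red f + red g \<and> red (\<lambda>z. f z * g z) = red f * red g) \<and>
     (\<forall>r\<in>R. red (on_upper_half (\<lambda>_. r)) = emb (\<phi> r)) \<and>
     (\<forall>f\<in>B. red f = 0 \<longleftrightarrow> (\<exists>(n::nat) p b. (\<forall>i<n. p i \<in> R \<and> \<phi> (p i) = 0 \<and> b i \<in> B) \<and>
        f = (\<lambda>z. \<Sum>i<n. p i * b i z))) \<and>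
     (\<forall>(n::nat) b c. (\<forall>i<n. b i \<in> B) \<and> (\<exists>i<n. c i \<noteq> 0) \<and>
        (\<Sum>i<n. emb (c i) * red (b i)) = 0 \<longrightarrow>
        (\<exists>r. (\<forall>i<n. r i \<in> R) \<and> (\<exists>i<n. \<phi> (r i) \<noteq> 0) \<and>
           (\<Sum>i<n. emb (\<phi> (r i)) * red (b i)) = 0)) \<and>
     (\<forall>x. \<exists>u\<in>kspan. \<exists>v\<in>kspan. v \<noteq> 0 \<and> x = u / v) \<and>
     (\<forall>g\<in>carrier PSL2. bij (\<sigma> g) \<and> ring_hom_on UNIV (\<sigma> g) \<and> (\<forall>c. \<sigma> g (emb c) = emb c) \<and>
        (\<forall>A\<in>lifts (inv\<^bsub>PSL2\<^esub> g). \<forall>f\<in>B. \<sigma> g (red f) = red (on_upper_half (f \<circ> moebius A)))))"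

text \<open>The points of the nonsingular projective curve with function field \<open>K\<close>: the discrete
  valuation rings of \<open>K/k\<close> with residue field \<open>k\<close>, i.e. the \<open>k\<close>-rational points.\<close>

definition valuation_ideal :: "'K::field set \<Rightarrow> 'K set" where
  "valuation_ideal V = {f \<in> V. f = 0 \<or> inverse f \<notin> V}"

definition curve_points :: "('k::field \<Rightarrow> 'K::field) \<Rightarrow> 'K set set" where
  "curve_points emb = {V. range emb \<subseteq> V \<and>
     (\<forall>x\<in>V. \<forall>y\<in>V. x - y \<in> V \<and> x * y \<in> V) \<and>
     (\<exists>t\<in>V. t \<noteq> 0 \<and> inverse t \<notin> V \<and>
        (\<forall>f. f \<noteq> 0 \<longrightarrow> (\<exists>(n::int) u. u \<in> V \<and> u \<noteq> 0 \<and> inverse u \<in> V \<and> f = u * t powi n))) \<and>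
     (\<forall>f\<in>V. \<exists>c. f - emb c \<in> valuation_ideal V)}"

definition place_act :: "('g \<Rightarrow> 'K \<Rightarrow> 'K) \<Rightarrow> 'g \<Rightarrow> 'K set \<Rightarrow> 'K set" where
  "place_act \<sigma> g V = \<sigma> g ` V"

definition place_ram :: "('k::field \<Rightarrow> 'K::field) \<Rightarrow> ('g \<Rightarrow> 'K \<Rightarrow> 'K) \<Rightarrow> 'K set \<Rightarrow> 'g \<Rightarrow> 'k" where
  "place_ram emb \<sigma> V g = cotangent_scalar (\<lambda>c f. emb c * f) (valuation_ideal V) (\<sigma> g)"

text \<open>A field containing a primitive \<open>m\<close>-th root of unity, with an embedding of its \<open>m\<close>-th roots
  of unity into the nonzero complex numbers.\<close>

definition has_primitive_root :: "'k::field itself \<Rightarrow> nat \<Rightarrow> bool" where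
  "has_primitive_root _ m \<longleftrightarrow> (\<exists>w::'k. w ^ m = 1 \<and> (\<forall>i. 0 < i \<and> i < m \<longrightarrow> w ^ i \<noteq> 1))"

definition root_embedding :: "nat \<Rightarrow> ('k::field \<Rightarrow> complex) \<Rightarrow> bool" where
  "root_embedding m lift \<longleftrightarrow> inj_on lift {x. x ^ m = 1} \<and>
     (\<forall>x y. x ^ m = 1 \<and> y ^ m = 1 \<longrightarrow> lift x \<noteq> 0 \<and> lift (x * y) = lift x * lift y)"


section \<open>The irreducible representations of \<open>PSL(2,N)\<close>\<close>

definition unit_group :: "'f::field monoid" where
  "unit_group = \<lparr>carrier = UNIV - {0}, monoid.mult = (*), one = 1\<rparr>"

text \<open>The norm-one group \<open>T\<close>, where \<open>(x, y)\<close> stands for \<open>x + \<surd>\<epsilon> y\<close>.\<close>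

definition norm_one_group :: "'f::field \<Rightarrow> ('f \<times> 'f) monoid" where
  "norm_one_group \<epsilon> = \<lparr>carrier = {(x, y). x\<^sup>2 - \<epsilon> * y\<^sup>2 = 1},
     monoid.mult = (\<lambda>(x, y) (x', y'). (x * x' + \<epsilon> * y * y', x * y' + y * x')), one = (1, 0)\<rparr>"

definition generates :: "('g, 'm) monoid_scheme \<Rightarrow> 'g \<Rightarrow> bool" where
  "generates M a \<longleftrightarrow> a \<in> carrier M \<and> generate M {a} = carrier M"

text \<open>Complex characters, normalised to vanish outside the carrier so that equality of
  characters is equality of functions.\<close>

definition complex_chars :: "('g, 'm) monoid_scheme \<Rightarrow> ('g \<Rightarrow> complex) set" where
  "complex_chars M = {\<psi>. linear_char M (carrier M) \<psi> \<and> (\<forall>x. x \<notin> carrier M \<longrightarrow> \<psi> x = 0)}"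

definition inv_char :: "('g \<Rightarrow> complex) \<Rightarrow> 'g \<Rightarrow> complex" where
  "inv_char \<psi> = (\<lambda>x. inverse (\<psi> x))"

definition W_params :: "('f::field \<Rightarrow> complex) set" where
  "W_params = {\<alpha> \<in> complex_chars unit_group. \<alpha> (- 1) = 1 \<and> \<alpha> \<noteq> inv_char \<alpha>}"

definition X_params :: "'f::field \<Rightarrow> ('f \<times> 'f \<Rightarrow> complex) set" where
  "X_params \<epsilon> = {\<beta> \<in> complex_chars (norm_one_group \<epsilon>). \<beta> (- 1, 0) = 1 \<and> \<beta> \<noteq> inv_char \<beta>}"

text \<open>A list with exactly one member of each pair \<open>{\<psi>, \<psi>\<inverse>}\<close> of parameters.\<close>

definition lists_up_to_inverse :: "('g \<Rightarrow> complex) set \<Rightarrow> ('g \<Rightarrow> complex) list \<Rightarrow> bool" where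
  "lists_up_to_inverse A \<psi>s \<longleftrightarrow> distinct \<psi>s \<and> set \<psi>s \<subseteq> A \<and>
     (\<forall>\<psi>\<in>A. (\<psi> \<in> set \<psi>s) \<noteq> (inv_char \<psi> \<in> set \<psi>s))"

text \<open>\<open>\<rho>\<close> is irreducible with the given character values on the five types of conjugacy classes;
  \<open>chr\<close> assigns to a matrix the character value (the trace, or the Brauer character value).
  The excluded parameters of the second and fifth types give the identity.\<close>

definition irrep_with_values :: "'f::field \<Rightarrow> ('k::field mat \<Rightarrow> complex) \<Rightarrow> complex \<Rightarrow>
    ('f \<Rightarrow> complex) \<Rightarrow> complex \<Rightarrow> complex \<Rightarrow> ('f \<times> 'f \<Rightarrow> complex) \<Rightarrow>
    ('f mat set, 'k) rep \<Rightarrow> bool" where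
  "irrep_with_values \<epsilon> chr d a b b' t \<rho> \<longleftrightarrow>
     irreducible_rep PSL2 \<rho> \<and>
     chr (\<rho> (pclass (1\<^sub>m 2))) = d \<and>
     (\<forall>x. x \<noteq> 0 \<and> x \<noteq> 1 \<and> x \<noteq> - 1 \<longrightarrow> chr (\<rho> (pclass (mat2 x 0 0 (inverse x)))) = a x) \<and>
     chr (\<rho> (pclass (mat2 1 1 0 1))) = b \<and>
     chr (\<rho> (pclass (mat2 1 \<epsilon> 0 1))) = b' \<and>
     (\<forall>x y. (x, y) \<in> carrier (norm_one_group \<epsilon>) \<and> y \<noteq> 0 \<longrightarrow>
        chr (\<rho> (pclass (mat2 x (\<epsilon> * y) y x))) = t (x, y))"

definition is_V :: "nat \<Rightarrow> 'f::field \<Rightarrow> ('k::field mat \<Rightarrow> complex) \<Rightarrow> ('f mat set, 'k) rep \<Rightarrow> bool" where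
  "is_V N \<epsilon> chr = irrep_with_values \<epsilon> chr (of_nat N) (\<lambda>_. 1) 0 0 (\<lambda>_. - 1)"

definition is_W :: "nat \<Rightarrow> 'f::field \<Rightarrow> ('k::field mat \<Rightarrow> complex) \<Rightarrow> ('f \<Rightarrow> complex) \<Rightarrow>
    ('f mat set, 'k) rep \<Rightarrow> bool" where
  "is_W N \<epsilon> chr \<alpha> = irrep_with_values \<epsilon> chr (of_nat N + 1)
     (\<lambda>x. \<alpha> x + \<alpha> (inverse x)) 1 1 (\<lambda>_. 0)"

definition is_X :: "nat \<Rightarrow> 'f::field \<Rightarrow> ('k::field mat \<Rightarrow> complex) \<Rightarrow> ('f \<times> 'f \<Rightarrow> complex) \<Rightarrow>
    ('f mat set, 'k) rep \<Rightarrow> bool" where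
  "is_X N \<epsilon> chr \<beta> = irrep_with_values \<epsilon> chr (of_nat N - 1)
     (\<lambda>_. 0) (- 1) (- 1) (\<lambda>(x, y). - \<beta> (x, y) - \<beta> (x, - y))"

definition residue_sum :: "nat \<Rightarrow> complex \<Rightarrow> complex" where
  "residue_sum N \<zeta> = (\<Sum>a | a \<in> {1..<N} \<and> Legendre (int a) (int N) = 1. \<zeta> ^ a)"

definition nonresidue_sum :: "nat \<Rightarrow> complex \<Rightarrow> complex" where
  "nonresidue_sum N \<zeta> = (\<Sum>a | a \<in> {1..<N} \<and> Legendre (int a) (int N) = - 1. \<zeta> ^ a)"

text \<open>The pair \<open>W', W''\<close> if \<open>N \<equiv> 1 (mod 4)\<close>, and the pair \<open>X', X''\<close> if \<open>N \<equiv> 3 (mod 4)\<close>.\<close>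

definition is_half_pair :: "nat \<Rightarrow> 'f::field \<Rightarrow> 'f \<times> 'f \<Rightarrow> complex \<Rightarrow> ('k::field mat \<Rightarrow> complex) \<Rightarrow>
    ('f mat set, 'k) rep \<Rightarrow> ('f mat set, 'k) rep \<Rightarrow> bool" where
  "is_half_pair N \<epsilon> \<tau> \<zeta> chr E' E'' \<longleftrightarrow> (let q = residue_sum N \<zeta>; q' = nonresidue_sum N \<zeta> in
     (if N mod 4 = 1 then
        (\<exists>\<alpha>\<^sub>0 \<in> complex_chars unit_group. \<alpha>\<^sub>0 \<epsilon> = - 1 \<and>
          irrep_with_values \<epsilon> chr ((of_nat N + 1) / 2) \<alpha>\<^sub>0 (1 + q) (1 + q') (\<lambda>_. 0) E' \<and>
          irrep_with_values \<epsilon> chr ((of_nat N + 1) / 2) \<alpha>\<^sub>0 (1 + q') (1 + q) (\<lambda>_. 0) E'')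
      else
        (\<exists>\<beta>\<^sub>0 \<in> complex_chars (norm_one_group \<epsilon>). \<beta>\<^sub>0 \<tau> = - 1 \<and>
          irrep_with_values \<epsilon> chr ((of_nat N - 1) / 2) (\<lambda>_. 0) q q' (\<lambda>s. - \<beta>\<^sub>0 s) E' \<and>
          irrep_with_values \<epsilon> chr ((of_nat N - 1) / 2) (\<lambda>_. 0) q' q (\<lambda>s. - \<beta>\<^sub>0 s) E'')))"

definition num_residues :: "nat \<Rightarrow> nat \<Rightarrow> nat" where
  "num_residues N r = card {a \<in> {N - r..N - 1}. Legendre (int a) (int N) = 1}"

definition num_nonresidues :: "nat \<Rightarrow> nat \<Rightarrow> nat" where
  "num_nonresidues N r = card {a \<in> {N - r..N - 1}. Legendre (int a) (int N) = - 1}"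


section \<open>The degree formulas\<close>

text \<open>Points, action and ramification characters of \<open>X(N)\<close> over the base field are given by
  \<open>X\<close>, \<open>act\<close>, \<open>\<theta>\<close>; character values of representations by \<open>chr\<close>; and \<open>lift\<close> identifies roots of
  unity of the base field with complex ones. The number \<open>\<zeta>\<close> is the value at \<open>unip\<close> of
  the ramification character of a point \<open>P0\<close> of \<open>D\<close> whose stabilizer is generated by \<open>unip\<close>;
  such points exist in every orbit with stabilizers of order \<open>N\<close>.\<close>

definition free_orbit_formula :: "'p set \<Rightarrow> ('f::field mat set \<Rightarrow> 'p \<Rightarrow> 'p) \<Rightarrow>
    ('p \<Rightarrow> 'f mat set \<Rightarrow> 'k::field) \<Rightarrow> bool" where
  "free_orbit_formula X act \<theta> \<longleftrightarrow>
    (\<forall>P\<in>X. \<forall>D. card (stab PSL2 act P) = 1 \<and> D = reduced_orbit PSL2 act P \<longrightarrow>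
      (\<forall>r\<ge>1. rep_equiv PSL2 (deg_eq PSL2 X act \<theta> (mult_div r D)) (copies r (regular_rep PSL2))))"

definition order2_formula :: "'p set \<Rightarrow> ('f::field mat set \<Rightarrow> 'p \<Rightarrow> 'p) \<Rightarrow>
    ('p \<Rightarrow> 'f mat set \<Rightarrow> 'k::field) \<Rightarrow> bool" where
  "order2_formula X act \<theta> \<longleftrightarrow>
    (\<forall>P\<in>X. \<forall>D H \<theta>1. H = stab PSL2 act P \<and> card H = 2 \<and> D = reduced_orbit PSL2 act P \<and>
        nontrivial_char PSL2 H \<theta>1 \<longrightarrow>
      (\<forall>r\<ge>1. rep_equiv PSL2 (deg_eq PSL2 X act \<theta> (mult_div (2 * r) D))
          (copies r (regular_rep PSL2))) \<and>
      (\<forall>r. rep_equiv PSL2 (deg_eq PSL2 X act \<theta> (mult_div (2 * r + 1) D))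
          (dsum [copies r (regular_rep PSL2), Ind PSL2 H (char_rep \<theta>1)])))"

definition order3_formula :: "'p set \<Rightarrow> ('f::field mat set \<Rightarrow> 'p \<Rightarrow> 'p) \<Rightarrow>
    ('p \<Rightarrow> 'f mat set \<Rightarrow> 'k::field) \<Rightarrow> bool" where
  "order3_formula X act \<theta> \<longleftrightarrow>
    (\<forall>P\<in>X. \<forall>D H \<theta>2. H = stab PSL2 act P \<and> card H = 3 \<and> D = reduced_orbit PSL2 act P \<and>
        nontrivial_char PSL2 H \<theta>2 \<longrightarrow>
      (\<forall>r\<ge>1. rep_equiv PSL2 (deg_eq PSL2 X act \<theta> (mult_div (3 * r) D))
          (copies r (regular_rep PSL2))) \<and>
      (\<forall>r. rep_equiv PSL2 (deg_eq PSL2 X act \<theta> (mult_div (3 * r + 1) D))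
          (dsum [copies r (regular_rep PSL2), Ind PSL2 H (char_rep \<theta>2)])) \<and>
      (\<forall>r. rep_equiv PSL2 (deg_eq PSL2 X act \<theta> (mult_div (3 * r + 2) D))
          (dsum [copies r (regular_rep PSL2), copies 2 (Ind PSL2 H (char_rep \<theta>2))])))"

definition cusp_formula :: "nat \<Rightarrow> 'f::field \<Rightarrow> 'f \<times> 'f \<Rightarrow> 'p set \<Rightarrow> ('f mat set \<Rightarrow> 'p \<Rightarrow> 'p) \<Rightarrow>
    ('p \<Rightarrow> 'f mat set \<Rightarrow> 'k::field) \<Rightarrow> ('k mat \<Rightarrow> complex) \<Rightarrow> ('k \<Rightarrow> complex) \<Rightarrow> bool" where
  "cusp_formula N \<epsilon> \<tau> X act \<theta> chr lift \<longleftrightarrow>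
    (\<forall>P\<in>X. \<forall>P0\<in>X. \<forall>D \<zeta> V W Y E' E'' \<alpha>s \<beta>s.
      card (stab PSL2 act P) = N \<and> D = reduced_orbit PSL2 act P \<and>
      D P0 = 1 \<and> stab PSL2 act P0 = generate PSL2 {unip} \<and> \<zeta> = lift (\<theta> P0 unip) \<and>
      is_V N \<epsilon> chr V \<and> (\<forall>\<alpha>\<in>W_params. is_W N \<epsilon> chr \<alpha> (W \<alpha>)) \<and>
      (\<forall>\<beta>\<in>X_params \<epsilon>. is_X N \<epsilon> chr \<beta> (Y \<beta>)) \<and>
      is_half_pair N \<epsilon> \<tau> \<zeta> chr E' E'' \<and>
      lists_up_to_inverse W_params \<alpha>s \<and> lists_up_to_inverse (X_params \<epsilon>) \<beta>s \<longrightarrow>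
      (\<forall>r. 1 \<le> r \<and> r \<le> N - 1 \<longrightarrow>
        rep_equiv PSL2 (deg_eq PSL2 X act \<theta> (mult_div r D))
          (dsum [copies r (dsum [dsum (map Y \<beta>s), V, dsum (map W \<alpha>s)]),
                 copies (num_residues N r) E', copies (num_nonresidues N r) E''])))"

end

theory Submission
  imports Defs "Jordan_Normal_Form.Schur_Decomposition" "HOL-Algebra.Multiplicative_Group"
begin

text \<open>
  Replacing \<open>P\<close> by another point of its orbit conjugates \<open>\<theta>\<^sub>P\<close>, so \<open>deg_eq (r D)\<close> is the sum of
  \<open>Ind \<theta>\<^sub>P\<^bsup>-l\<^esup>\<close> for \<open>1 \<le> l \<le> r\<close>. As \<open>\<theta>\<^sub>P\<close> is faithful, its powers over a full period run through all
  characters of the cyclic stabilizer, whose inductions add up to the regular representation. For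
  stabilizers of order \<open>2\<close> there is one nontrivial character, and for order \<open>3\<close> the two are exchanged
  by conjugation in \<open>G\<close>. At a cusp, the values at \<open>1\<close> and \<open>unip\<close> of the character of an irreducible
  representation determine the eigenvalues of \<open>unip\<close>, because \<open>1, \<zeta>, \<dots>, \<zeta>\<^bsup>N-2\<^esup>\<close> are linearly independent
  over the rationals. By Frobenius reciprocity all \<open>X\<^sub>\<beta>\<close>, \<open>V\<close>, \<open>W\<^sub>\<alpha>\<close> and one of the two half-size
  representations embed in \<open>Ind \<theta>\<^sub>P\<^bsup>-l\<^esup>\<close>, the latter according to the quadratic character of \<open>-l\<close>, and
  their dimensions add up to the index of the stabilizer. This uses Schur's lemma without
  semisimplicity or algebraic closure, hence works over both kinds of base field.

  Over the complex numbers \<open>\<theta>\<^sub>P\<close> is computed in the charts. In characteristic \<open>\<ell>\<close> an automorphism that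
  fixes a point and acts trivially on its cotangent line fixes an averaged uniformizer, hence the
  whole function field; since a nontrivial normal subset of \<open>G\<close> has more than \<open>N\<close> elements,
  this is impossible for a nontrivial element of a stabilizer of order at most \<open>N\<close>.
\<close>

section \<open>Direct sums of representations\<close>

text \<open>The constituents are given only by complex character values, which in characteristic
  \<ell> are Brauer lifts, and neither complete reducibility nor orthogonality of characters is at
  hand. So multiplicities are never computed by inner products: each expected constituent gets a
  nonzero intertwiner into the induced representation, pairwise inequivalence makes the joint map
  injective, and equality of degrees makes it square. Inequivalence is read off from dimensions and
  from one character value at a generator of each torus. For the same reason equivalences are
  explicit matrices with trivial kernel, and \<open>rep_dim\<close> records only sizes: induced and
  block matrices are compared without being shown multiplicative. The interval {N-r, ..., N-1}
  arises because at a cusp the power -l of \<theta> equals the power N-l, and eigenvalues are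
  labelled by exponents in 0, ..., N-1. Both models of the curve enter through an action on points
  and its effect on cotangent lines, so the representation theory is done once.\<close>

definition rep_dim :: "('g, 'm) monoid_scheme \<Rightarrow> nat \<Rightarrow> ('g, 'k::field) rep \<Rightarrow> bool" where
  "rep_dim G n \<rho> \<longleftrightarrow> (\<forall>g\<in>carrier G. \<rho> g \<in> carrier_mat n n)"

lemma rep_dimD: "rep_dim G n \<rho> \<Longrightarrow> g \<in> carrier G \<Longrightarrow> \<rho> g \<in> carrier_mat n n"
  by (simp add: rep_dim_def)

text \<open>Replaces conjugation \<open>P * \<sigma> g * Q\<close> by the intertwining relation,
  which is checked entry by entry without the inverse matrix.\<close>

lemma rep_equiv_intro:
  assumes "rep_dim G n \<rho>" "rep_dim G n \<sigma>" "P \<in> carrier_mat n n" "Q \<in> carrier_mat n n"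
    "P * Q = 1\<^sub>m n" "Q * P = 1\<^sub>m n" "\<And>g. g \<in> carrier G \<Longrightarrow> \<rho> g * P = P * \<sigma> g"
  shows "rep_equiv G \<rho> \<sigma>"
  unfolding rep_equiv_def
proof (intro exI ballI)
  fix g assume g: "g \<in> carrier G"
  note d = rep_dimD[OF assms(1) g] rep_dimD[OF assms(2) g]
  have "P * \<sigma> g * Q = \<rho> g * (P * Q)"
    unfolding assms(7)[OF g, symmetric] using d assms(3,4) by simp
  then show "similar_mat_wit (\<rho> g) (\<sigma> g) P Q"
    using d assms by (intro similar_mat_witI[of _ _ n]) auto
qed

text \<open>A square matrix over a field with trivial kernel has nonzero determinant, so no inverse
  has to be written down. The equivalences between induced, regular and decomposed representations
  are obtained this way.\<close>

lemma rep_equiv_intertwiner: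
  fixes T :: "'k::field mat"
  assumes "rep_dim G n \<rho>" "rep_dim G n \<sigma>" "T \<in> carrier_mat n n"
    "\<And>g. g \<in> carrier G \<Longrightarrow> \<rho> g * T = T * \<sigma> g"
    "\<And>v. v \<in> carrier_vec n \<Longrightarrow> T *\<^sub>v v = 0\<^sub>v n \<Longrightarrow> v = 0\<^sub>v n"
  shows "rep_equiv G \<rho> \<sigma>"
proof -
  have "Determinant.det T \<noteq> 0"
    using assms(5) det_0_iff_vec_prod_zero_field[OF assms(3)] by blast
  from det_non_zero_imp_unit[OF assms(3) this, of "()"]
  obtain Q where "Q \<in> carrier_mat n n" "T * Q = 1\<^sub>m n" "Q * T = 1\<^sub>m n"
    by (auto simp: Units_def ring_mat_def)
  with assms show ?thesis by (intro rep_equiv_intro[of G n \<rho> \<sigma> T Q]) auto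
qed

lemma rep_equiv_refl: "rep_dim G n \<rho> \<Longrightarrow> rep_equiv G \<rho> \<rho>"
  unfolding rep_equiv_def rep_dim_def
  by (intro exI[of _ "1\<^sub>m n"] ballI) (auto intro: similar_mat_wit_refl)

lemma rep_equiv_sym: "rep_equiv G \<rho> \<sigma> \<Longrightarrow> rep_equiv G \<sigma> \<rho>"
  unfolding rep_equiv_def by (meson similar_mat_wit_sym)

lemma rep_equiv_trans [trans]:
  "rep_equiv G \<rho> \<sigma> \<Longrightarrow> rep_equiv G \<sigma> \<tau> \<Longrightarrow> rep_equiv G \<rho> \<tau>"
  unfolding rep_equiv_def by (meson similar_mat_wit_trans)

section \<open>Calculus of block sums\<close>

lemma dsum_Nil: "dsum [] = (\<lambda>g. 0\<^sub>m 0 0)"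
  by (simp add: dsum_def)

lemma dsum_singleton [simp]: "dsum [\<rho>] = \<rho>"
  by (simp add: dsum_def del: diag_block_mat.simps)

lemma dsum_append: fixes xs :: "('a \<Rightarrow> 'b::field mat) list" shows "dsum (xs @ ys) = dsum [dsum xs, dsum ys]"
  unfolding dsum_def
proof (rule ext)
  fix g
  let ?f = "\<lambda>zs :: ('a \<Rightarrow> 'b mat) list. diag_block_mat (map (\<lambda>\<rho>. \<rho> g) zs)"
  have "?f (xs @ ys) = (let A = ?f xs; B = ?f ys
     in four_block_mat A (0\<^sub>m (dim_row A) (dim_col B)) (0\<^sub>m (dim_row B) (dim_col A)) B)"
    by (simp only: map_append diag_block_mat_append)
  also have "\<dots> = diag_block_mat ([?f xs] @ [?f ys])"
    by (simp only: diag_block_mat_append diag_block_mat_singleton)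
  finally have "?f (xs @ ys) = diag_block_mat [?f xs, ?f ys]" by (simp del: diag_block_mat.simps)
  then show "?f (xs @ ys) = diag_block_mat (map (\<lambda>\<rho>. \<rho> g)
      [\<lambda>g. diag_block_mat (map (\<lambda>\<rho>. \<rho> g) xs), \<lambda>g. diag_block_mat (map (\<lambda>\<rho>. \<rho> g) ys)])"
    by (simp del: diag_block_mat.simps)
qed

text \<open>The binary form exposes a four-block matrix, for which rules on products and similarity
  exist; inductions on lists run through it.\<close>

lemma dsum_Cons: "dsum (x # xs) = dsum [x, dsum xs]"
  using dsum_append[of "[x]" xs] by simp

lemma dsum_two: "dsum [x, y] g = four_block_mat (x g) (0\<^sub>m (dim_row (x g)) (dim_col (y g)))
   (0\<^sub>m (dim_row (y g)) (dim_col (x g))) (y g)"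
  using diag_block_mat_append[of "[x g]" "[y g]"]
  by (simp add: dsum_def Let_def del: diag_block_mat.simps)

lemma rep_dim_dsum:
  "list_all2 (rep_dim G) ns xs \<Longrightarrow> rep_dim G (sum_list ns) (dsum xs)"
proof (induction rule: list_all2_induct)
  case Nil
  then show ?case by (auto simp: rep_dim_def dsum_Nil)
next
  case (Cons n ns x xs)
  then show ?case
    by (subst dsum_Cons) (auto simp: rep_dim_def dsum_two intro!: four_block_carrier_mat)
qed

lemma rep_dim_dsum2: "rep_dim G n x \<Longrightarrow> rep_dim G m y \<Longrightarrow> rep_dim G (n + m) (dsum [x, y])"
  using rep_dim_dsum[of G "[n, m]" "[x, y]"] by simp

lemma rep_dim_dsum_uniform: 
  "(\<And>x. x \<in> set xs \<Longrightarrow> rep_dim G n x) \<Longrightarrow> rep_dim G (length xs * n) (dsum xs)"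
  using rep_dim_dsum[of G "replicate (length xs) n" xs]
  by (auto simp: list_all2_conv_all_nth sum_list_replicate)

lemma dsum_flatten: "dsum (map dsum xss) = dsum (concat xss)"
proof (induction xss)
  case (Cons a xss)
  then show ?case using dsum_append[of a "concat xss"] dsum_Cons[of "dsum a" "map dsum xss"] by simp
qed simp

lemma dsum_cong2:
  assumes "rep_equiv G x x'" "rep_equiv G y y'"
  shows "rep_equiv G (dsum [x, y]) (dsum [x', y'])"
proof -
  from assms obtain P Q P' Q' where w: "\<And>g. g \<in> carrier G \<Longrightarrow> similar_mat_wit (x g) (x' g) P Q"
    "\<And>g. g \<in> carrier G \<Longrightarrow> similar_mat_wit (y g) (y' g) P' Q'"
    unfolding rep_equiv_def by blast
  let ?n = "dim_row P" let ?m = "dim_row P'"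
  have "similar_mat_wit (dsum [x, y] g) (dsum [x', y'] g)
     (four_block_mat P (0\<^sub>m ?n ?m) (0\<^sub>m ?m ?n) P') (four_block_mat Q (0\<^sub>m ?n ?m) (0\<^sub>m ?m ?n) Q')"
    if g: "g \<in> carrier G" for g
  proof -
    note D = similar_mat_witD[OF refl w(1)[OF g]] similar_mat_witD[OF refl w(2)[OF g]]
    have e: "dim_row (x g) = ?n" "dim_row (y g) = ?m"
      using carrier_matD(1)[OF D(6)] carrier_matD(1)[OF D(13)] by simp_all
    note d = D(4,5,11,12)[unfolded e]
    note p = D(6,7,13,14)[unfolded e]
    \<comment> \<open>The similarity rule for four blocks conjugates the off-diagonal blocks too, so
      the zero blocks are presented as conjugates of zero.\<close>
    have z: "0\<^sub>m ?n ?m = P * 0\<^sub>m ?n ?m * Q'" "0\<^sub>m ?m ?n = P' * 0\<^sub>m ?m ?n * Q"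
      by (simp_all only: right_mult_zero_mat[OF p(1)] right_mult_zero_mat[OF p(3)]
          left_mult_zero_mat[OF p(2)] left_mult_zero_mat[OF p(4)])
    show ?thesis
      unfolding dsum_two carrier_matD[OF d(1)] carrier_matD[OF d(2)] carrier_matD[OF d(3)] carrier_matD[OF d(4)]
      by (rule similar_mat_wit_four_block[OF w(1)[OF g] w(2)[OF g] z d(1) d(3) zero_carrier_mat zero_carrier_mat])
  qed
  then show ?thesis unfolding rep_equiv_def by blast
qed

lemma dsum_cong: "list_all2 (rep_equiv G) xs ys \<Longrightarrow> rep_equiv G (dsum xs) (dsum ys)"
proof (induction rule: list_all2_induct)
  case Nil
  show ?case by (rule rep_equiv_refl[of _ 0]) (auto simp: rep_dim_def dsum_Nil)
next
  case (Cons x xs y ys)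
  then have "rep_equiv G (dsum [x, dsum xs]) (dsum [y, dsum ys])" by (intro dsum_cong2)
  then show ?case by (simp only: dsum_Cons[of x xs, symmetric] dsum_Cons[of y ys, symmetric])
qed

text \<open>The intertwiner is the permutation matrix exchanging the two blocks; its inverse is the
  same matrix with the sizes interchanged.\<close>

lemma dsum_swap:
  fixes x y :: "('a, 'b::field) rep"
  assumes "rep_dim G n x" "rep_dim G m y"
  shows "rep_equiv G (dsum [x, y]) (dsum [y, x])"
proof (rule rep_equiv_intro)
  let ?P = "four_block_mat (0\<^sub>m n m :: 'b mat) (1\<^sub>m n) (1\<^sub>m m) (0\<^sub>m m n)"
  let ?Q = "four_block_mat (0\<^sub>m m n :: 'b mat) (1\<^sub>m m) (1\<^sub>m n) (0\<^sub>m n m)"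
  have one: "four_block_mat (1\<^sub>m a) (0\<^sub>m a b) (0\<^sub>m b a) (1\<^sub>m b) = 1\<^sub>m (a + b)" for a b :: nat
    by (rule eq_matI) auto
  show "rep_dim G (n + m) (dsum [x, y])" by (rule rep_dim_dsum2[OF assms])
  show "rep_dim G (n + m) (dsum [y, x])" using rep_dim_dsum2[OF assms(2,1)] by (simp add: add.commute)
  show "?P \<in> carrier_mat (n + m) (n + m)" "?Q \<in> carrier_mat (n + m) (n + m)"
    by (simp_all add: carrier_matI)
  have o: "1\<^sub>m a * 1\<^sub>m a = (1\<^sub>m a :: 'b mat)" "1\<^sub>m a + 0\<^sub>m a a = (1\<^sub>m a :: 'b mat)" 
    "0\<^sub>m a a + 1\<^sub>m a = (1\<^sub>m a :: 'b mat)" "0\<^sub>m a b * 1\<^sub>m b = (0\<^sub>m a b :: 'b mat)" 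
    "1\<^sub>m a * 0\<^sub>m a b = (0\<^sub>m a b :: 'b mat)" "0\<^sub>m a b + 0\<^sub>m a b = (0\<^sub>m a b :: 'b mat)"
    "0\<^sub>m a c * 0\<^sub>m c b = (0\<^sub>m a b :: 'b mat)" for a b c :: nat
    by (auto intro: left_mult_one_mat[of _ a a] left_mult_one_mat[of _ a b] right_mult_one_mat[of _ a b])
  have "?P * ?Q = four_block_mat (1\<^sub>m n) (0\<^sub>m n m) (0\<^sub>m m n) (1\<^sub>m m)"
    by (subst mult_four_block_mat[of _ n m _ n _ m _ _ n _ m]) (simp_all only: zero_carrier_mat one_carrier_mat o)
  then show "?P * ?Q = 1\<^sub>m (n + m)" by (simp only: one)
  have "?Q * ?P = four_block_mat (1\<^sub>m m) (0\<^sub>m m n) (0\<^sub>m n m) (1\<^sub>m n)"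
    by (subst mult_four_block_mat[of _ m n _ m _ n _ _ m _ n]) (simp_all only: zero_carrier_mat one_carrier_mat o)
  then show "?Q * ?P = 1\<^sub>m (n + m)" by (simp only: one add.commute)
  fix g assume g: "g \<in> carrier G"
  note d = rep_dimD[OF assms(1) g] rep_dimD[OF assms(2) g]
  show "dsum [x, y] g * ?P = ?P * dsum [y, x] g"
    unfolding dsum_two
    using d mult_four_block_mat[of "x g" n n "0\<^sub>m n m" m "0\<^sub>m m n" m "y g" "0\<^sub>m n m" m "1\<^sub>m n" n "1\<^sub>m m" "0\<^sub>m m n"]
      mult_four_block_mat[of "0\<^sub>m n m" n m "1\<^sub>m n" n "1\<^sub>m m" m "0\<^sub>m m n" "y g" m "0\<^sub>m m n" n "0\<^sub>m n m" "x g"]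
    by simp
qed

text \<open>Needed at the end of the cusp formula, where the constituents arrive ordered by the
  exponent l while the formula groups them by multiplicity. The head of one list is carried to its
  place in the other by a single swap of blocks.\<close>

lemma dsum_perm:
  assumes "mset xs = mset ys" "\<And>x. x \<in> set xs \<Longrightarrow> \<exists>n. rep_dim G n x"
  shows "rep_equiv G (dsum xs) (dsum ys)"
  using assms
proof (induction xs arbitrary: ys)
  case Nil
  then show ?case by (auto intro!: rep_equiv_refl[of _ 0] simp: rep_dim_def dsum_Nil)
next
  case (Cons x xs)
  from Cons.prems(1) have "x \<in> set ys" by (metis list.set_intros(1) set_mset_mset)
  then obtain as bs where ys: "ys = as @ x # bs" by (metis split_list)
  have m: "mset xs = mset (as @ bs)" using Cons.prems(1) by (simp add: ys)
  have dl: "\<exists>n. rep_dim G n (dsum zs)" if "set zs \<subseteq> set (x # xs)" for zs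
  proof -
    from that Cons.prems(2) have "\<forall>i<length zs. \<exists>n. rep_dim G n (zs ! i)" by (meson nth_mem subsetD)
    then obtain f where "\<forall>i<length zs. rep_dim G (f i) (zs ! i)" by metis
    then have "list_all2 (rep_dim G) (map f [0..<length zs]) zs" by (auto simp: list_all2_conv_all_nth)
    then show ?thesis using rep_dim_dsum by blast
  qed
  have s: "set as \<subseteq> set (x # xs)" "set bs \<subseteq> set (x # xs)"
    using arg_cong[OF m, of set_mset] by auto
  obtain a b c where d: "rep_dim G a x" "rep_dim G b (dsum as)" "rep_dim G c (dsum bs)"
    using dl[OF s(1)] dl[OF s(2)] Cons.prems(2) by fastforce
  obtain e where e: "rep_dim G e x" using Cons.prems(2) by fastforce
  have "rep_equiv G (dsum (x # xs)) (dsum (x # (as @ bs)))"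
    using Cons.IH[OF m] Cons.prems(2) e dsum_Cons[of x xs] dsum_Cons[of x "as @ bs"]
    by (auto intro!: dsum_cong2 rep_equiv_refl)
  \<comment> \<open>The head \<open>x\<close> stands in front of the prefix \<open>as\<close>; after
    this regrouping one binary swap moves it behind.\<close>
  also have "dsum (x # (as @ bs)) = dsum [dsum [x, dsum as], dsum bs]"
    using dsum_append[of "x # as" bs] dsum_Cons[of x as] by simp
  also have "rep_equiv G \<dots> (dsum [dsum [dsum as, x], dsum bs])"
    by (rule dsum_cong2[OF dsum_swap[OF d(1,2)] rep_equiv_refl[OF d(3)]])
  also have "dsum [dsum [dsum as, x], dsum bs] = dsum ys"
    using dsum_append[of "as @ [x]" bs] dsum_append[of as "[x]"] by (simp add: ys)
  finally show ?case .
qed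

section \<open>Induced representations\<close>

lemma sum_single:
  fixes f :: "nat \<Rightarrow> 'a::comm_monoid_add"
  assumes "k < n" "\<And>i. i < n \<Longrightarrow> i \<noteq> k \<Longrightarrow> f i = 0"
  shows "(\<Sum>i<n. f i) = f k"
proof -
  have "(\<Sum>i<n. f i) = (\<Sum>i\<in>{k}. f i)"
    using assms by (intro sum.mono_neutral_right) auto
  then show ?thesis by simp
qed

lemma sum_single_eq:
  fixes f :: "nat \<Rightarrow> 'a::comm_monoid_add"
  shows "k < n \<Longrightarrow> (\<And>i. i < n \<Longrightarrow> i \<noteq> k \<Longrightarrow> f i = 0) \<Longrightarrow> f k = x \<Longrightarrow> (\<Sum>i<n. f i) = x"
  using sum_single[of k n f] by simp

lemma sum_div_mod:
  fixes f :: "nat \<Rightarrow> 'a::comm_monoid_add"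
  shows "(\<Sum>k<d * m. f k) = (\<Sum>l<d. \<Sum>j<m. f (l * m + j))"
proof -
  have "(\<Sum>j<m. f (l * m + j)) = sum f {l * m..<l * m + m}" for l
    by (rule sum.reindex_bij_witness[of _ "\<lambda>k. k - l * m" "\<lambda>j. l * m + j"]) auto
  then show ?thesis by (simp add: sum.nat_group)
qed

lemma index_mult_mat_sum:
  "A \<in> carrier_mat n m \<Longrightarrow> B \<in> carrier_mat m p \<Longrightarrow> i < n \<Longrightarrow> j < p \<Longrightarrow>
    (A * B) $$ (i, j) = (\<Sum>k<m. A $$ (i, k) * B $$ (k, j))"
  by (auto simp: scalar_prod_def atLeast0LessThan intro!: sum.cong)

lemma index_mult_mat_vec_sum:
  "A \<in> carrier_mat n m \<Longrightarrow> v \<in> carrier_vec m \<Longrightarrow> i < n \<Longrightarrow>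
    (A *\<^sub>v v) $ i = (\<Sum>k<m. A $$ (i, k) * v $ k)"
  by (auto simp: scalar_prod_def atLeast0LessThan intro!: sum.cong)

lemma div_mod_block: "j < m \<Longrightarrow> (l * m + j) div m = l \<and> (l * m + j) mod m = (j::nat)"
  by simp

lemma block_index_bound: "l < d \<Longrightarrow> j < m \<Longrightarrow> l * m + j < d * (m::nat)"
proof -
  assume "l < d" "j < m"
  then have "l * m + j < Suc l * m" "Suc l * m \<le> d * m" by (simp, intro mult_le_mono1) auto
  then show ?thesis by linarith
qed

text \<open>All blocks have size m, so a position is determined by quotient and remainder; this
  closed form replaces the recursive block construction in later entry computations.\<close>

lemma dsum_uniform_entry:
  assumes "\<And>x. x \<in> set xs \<Longrightarrow> x g \<in> carrier_mat m m" "l < length xs" "l' < length xs" "i < m" "j < m"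
  shows "dsum xs g $$ (l * m + i, l' * m + j) = (if l = l' then (xs ! l) g $$ (i, j) else 0)"
  using assms
proof (induction xs arbitrary: l l')
  case (Cons x xs)
  have dim: "dim_row (dsum xs g) = length xs * m" "dim_col (dsum xs g) = length xs * m"
  proof -
    have "map dim_row (map (\<lambda>\<rho>. \<rho> g) xs) = replicate (length xs) m"
      "map dim_col (map (\<lambda>\<rho>. \<rho> g) xs) = replicate (length xs) m"
      using carrier_matD[OF Cons.prems(1)] by (auto intro!: replicate_eqI)
    then show "dim_row (dsum xs g) = length xs * m" "dim_col (dsum xs g) = length xs * m"
      unfolding dsum_def dim_diag_block_mat by (simp_all add: sum_list_replicate)
  qed
  have x: "x g \<in> carrier_mat m m" using Cons.prems(1) by simp
  note xd = carrier_matD[OF x]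
  have b: "l * m + i < m + length xs * m" "l' * m + j < m + length xs * m"
    using block_index_bound[OF Cons.prems(2,4)] block_index_bound[OF Cons.prems(3,5)] by simp_all
  have e: "dsum (x # xs) g $$ (l * m + i, l' * m + j) =
     (if l * m + i < m then if l' * m + j < m then x g $$ (l * m + i, l' * m + j) else 0
      else if l' * m + j < m then 0 else dsum xs g $$ (l * m + i - m, l' * m + j - m))"
    unfolding dsum_Cons[of x xs] dsum_two using b xd dim by auto
  show ?case
  proof (cases l)
    case 0
    show ?thesis
    proof (cases l')
      case 0 with \<open>l = 0\<close> show ?thesis unfolding e using Cons.prems(4,5) by simp
    next
      case (Suc n) with \<open>l = 0\<close> show ?thesis unfolding e using Cons.prems(4,5) by simp
    qed
  next
    case (Suc n)
    show ?thesis
    proof (cases l')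
      case 0 with Suc show ?thesis unfolding e using Cons.prems(4,5) by simp
    next
      case (Suc n')
      have "dsum xs g $$ (n * m + i, n' * m + j) = (if n = n' then (xs ! n) g $$ (i, j) else 0)"
        using Cons.prems \<open>l = Suc n\<close> Suc by (intro Cons.IH) auto
      with Suc \<open>l = Suc n\<close> show ?thesis unfolding e using Cons.prems(4,5) by simp
    qed
  qed
qed simp

lemma dsum_char_rep_entry:
  "l < length \<psi>s \<Longrightarrow> l' < length \<psi>s \<Longrightarrow>
    dsum (map char_rep \<psi>s) h $$ (l, l') = (if l = l' then (\<psi>s ! l) h else 0)"
proof -
  assume l: "l < length \<psi>s" "l' < length \<psi>s"
  have "dsum (map char_rep \<psi>s) h $$ (l * 1 + 0, l' * 1 + 0) =
      (if l = l' then (map char_rep \<psi>s ! l) h $$ (0, 0) else 0)"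
    by (rule dsum_uniform_entry) (use l in \<open>auto simp: char_rep_def\<close>)
  then show ?thesis using l by (simp add: char_rep_def)
qed

lemma dim_dsum_char_rep: "dim_row (dsum (map char_rep \<psi>s) h) = length \<psi>s"
  by (simp add: dsum_def dim_diag_block_mat char_rep_def comp_def sum_list_triv)

section \<open>Transversals and matrices of induced characters\<close>

locale finite_subgroup = group G for G (structure) +
  fixes H
  assumes finite_carrier: "finite (carrier G)" and subgroup_H: "subgroup H G"
begin

lemma H_carrier: "h \<in> H \<Longrightarrow> h \<in> carrier G"
  using subgroup_H by (auto dest: subgroup.mem_carrier)

lemma H_mult: "g \<in> H \<Longrightarrow> h \<in> H \<Longrightarrow> g \<otimes> h \<in> H"
  using subgroup_H by (auto dest: subgroup.m_closed)

lemma H_inv: "h \<in> H \<Longrightarrow> inv h \<in> H"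
  using subgroup_H by (auto dest: subgroup.m_inv_closed)

lemma H_one: "\<one> \<in> H"
  using subgroup_H by (auto dest: subgroup.one_closed)

lemma inv_mult_in_H_sym: "x \<in> carrier G \<Longrightarrow> y \<in> carrier G \<Longrightarrow> inv x \<otimes> y \<in> H \<longleftrightarrow> inv y \<otimes> x \<in> H"
  using H_inv[of "inv x \<otimes> y"] H_inv[of "inv y \<otimes> x"] by (auto simp: inv_mult_group)

lemma inv_mult_in_H_trans:
  "x \<in> carrier G \<Longrightarrow> y \<in> carrier G \<Longrightarrow> z \<in> carrier G \<Longrightarrow> inv x \<otimes> y \<in> H \<Longrightarrow> inv y \<otimes> z \<in> H \<Longrightarrow>
    inv x \<otimes> z \<in> H"
proof -
  assume *: "x \<in> carrier G" "y \<in> carrier G" "z \<in> carrier G" "inv x \<otimes> y \<in> H" "inv y \<otimes> z \<in> H"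
  have "(inv x \<otimes> y) \<otimes> (inv y \<otimes> z) = inv x \<otimes> (y \<otimes> inv y) \<otimes> z"
    using *(1-3) by (simp only: m_assoc inv_closed m_closed)
  then have "(inv x \<otimes> y) \<otimes> (inv y \<otimes> z) = inv x \<otimes> z" using *(1-3) by simp
  then show ?thesis using H_mult[OF *(4,5)] by simp
qed

text \<open>\<open>Ind\<close> picks a transversal by choice, so one must exist before its matrix
  can be computed. The representative \<open>c g\<close> is selected by a predicate in which only
  the coset of \<open>g\<close> matters, hence \<open>c\<close> is constant on cosets.\<close>

lemma left_transversal_exists: "\<exists>ts. left_transversal G H ts"
proof -
  define c where "c g = (SOME x. x \<in> carrier G \<and> inv x \<otimes> g \<in> H)" for g
  have c: "c g \<in> carrier G \<and> inv (c g) \<otimes> g \<in> H" if "g \<in> carrier G" for g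
    unfolding c_def by (rule someI[of _ g]) (use that H_one in auto)
  have cc: "c g = c x" if "g \<in> carrier G" "x \<in> carrier G" "inv x \<otimes> g \<in> H" for g x
  proof -
    have "(y \<in> carrier G \<and> inv y \<otimes> g \<in> H) = (y \<in> carrier G \<and> inv y \<otimes> x \<in> H)" for y
      using inv_mult_in_H_trans[of y g x] inv_mult_in_H_trans[of y x g] inv_mult_in_H_sym[of x g] that by blast
    then show ?thesis unfolding c_def by simp
  qed
  obtain ts where ts: "distinct ts" "set ts = c ` carrier G"
    using finite_distinct_list[of "c ` carrier G"] finite_carrier by auto
  have "left_transversal G H ts"
    unfolding left_transversal_def
  proof (intro conjI ballI)
    show "set ts \<subseteq> carrier G" using ts c by auto
    fix g assume g: "g \<in> carrier G"
    then have "c g \<in> set ts" using ts by auto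
    then obtain i where i: "i < length ts" "ts ! i = c g" by (auto simp: in_set_conv_nth)
    show "\<exists>!i. i < length ts \<and> inv ts ! i \<otimes> g \<in> H"
    proof (intro ex1I[of _ i] conjI)
      fix j assume j: "j < length ts \<and> inv ts ! j \<otimes> g \<in> H"
      then have "ts ! j \<in> c ` carrier G" using ts(2) nth_mem by blast
      then obtain x where x: "x \<in> carrier G" "ts ! j = c x" by auto
      have "c g = c (ts ! j)" using cc[of g "ts ! j"] j g x c by auto
      also have "\<dots> = ts ! j" using cc[of x "c x"] x c by auto
      finally show "j = i" using i j ts(1) by (metis nth_eq_iff_index_eq)
    qed (use i c[OF g] in auto)
  qed
  then show ?thesis by blast
qed

definition "ts = (SOME ts. left_transversal G H ts)"
definition "m = length ts"

lemma transversal: "left_transversal G H ts"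
  unfolding ts_def by (rule someI_ex[OF left_transversal_exists])

lemma t_carrier [simp]: "i < m \<Longrightarrow> ts ! i \<in> carrier G"
  using transversal by (auto simp: left_transversal_def m_def dest: nth_mem)

lemma t_ex1: "g \<in> carrier G \<Longrightarrow> \<exists>!i. i < m \<and> inv (ts ! i) \<otimes> g \<in> H"
  using transversal by (auto simp: left_transversal_def m_def)

text \<open>Every element is uniquely \<open>ts ! i \<otimes> h\<close>, so \<open>m\<close> is the
  index of \<open>H\<close>; this turns dimension counts into counts of group elements.\<close>

lemma card_transversal: "m * card H = card (carrier G)"
proof -
  have "bij_betw (\<lambda>(i, h). ts ! i \<otimes> h) ({..<m} \<times> H) (carrier G)"
  proof (rule bij_betwI')
    fix x y assume "x \<in> {..<m} \<times> H" "y \<in> {..<m} \<times> H"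
    then obtain i h j k where xy: "x = (i, h)" "y = (j, k)" "i < m" "j < m" "h \<in> H" "k \<in> H" by auto
    have "i = j \<and> h = k" if e: "ts ! i \<otimes> h = ts ! j \<otimes> k"
    proof -
      have "inv (ts ! i) \<otimes> (ts ! i \<otimes> h) = h" "inv (ts ! j) \<otimes> (ts ! j \<otimes> k) = k"
        using xy H_carrier by (simp_all flip: m_assoc)
      then have "i = j" using t_ex1[of "ts ! i \<otimes> h"] e xy H_carrier by (metis m_closed t_carrier)
      then show ?thesis using e xy H_carrier by simp
    qed
    then show "((case x of (i, h) \<Rightarrow> ts ! i \<otimes> h) = (case y of (i, h) \<Rightarrow> ts ! i \<otimes> h)) = (x = y)"
      using xy by auto
  next
    fix x assume "x \<in> {..<m} \<times> H"
    then show "(case x of (i, h) \<Rightarrow> ts ! i \<otimes> h) \<in> carrier G" using H_carrier by auto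
  next
    fix g assume g: "g \<in> carrier G"
    then obtain i where "i < m" "inv (ts ! i) \<otimes> g \<in> H" using t_ex1 by blast
    moreover have "g = ts ! i \<otimes> (inv (ts ! i) \<otimes> g)" using \<open>i < m\<close> g by (simp flip: m_assoc)
    ultimately show "\<exists>x\<in>{..<m} \<times> H. g = (case x of (i, h) \<Rightarrow> ts ! i \<otimes> h)" by auto
  qed
  from bij_betw_same_card[OF this] show ?thesis by (simp add: card_cartesian_product)
qed

lemma Ind_char: "Ind G H (char_rep \<psi>) g = Matrix.mat m m (\<lambda>(i, j).
    if inv (ts ! i) \<otimes> g \<otimes> ts ! j \<in> H then \<psi> (inv (ts ! i) \<otimes> g \<otimes> ts ! j) else 0)"
  by (rule eq_matI) (auto simp: Ind_def ts_def[symmetric] m_def[symmetric] char_rep_def Let_def)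

lemma Ind_char_entry: "i < m \<Longrightarrow> j < m \<Longrightarrow> Ind G H (char_rep \<psi>) g $$ (i, j) =
    (if inv (ts ! i) \<otimes> g \<otimes> ts ! j \<in> H then \<psi> (inv (ts ! i) \<otimes> g \<otimes> ts ! j) else 0)"
  by (simp add: Ind_char)

lemma rep_dim_Ind_char: "rep_dim G m (Ind G H (char_rep \<psi>))"
  by (simp add: rep_dim_def Ind_char)

lemma Ind_char_cong: "(\<And>h. h \<in> H \<Longrightarrow> \<psi> h = \<psi>' h) \<Longrightarrow> Ind G H (char_rep \<psi>) = Ind G H (char_rep \<psi>')"
  by (rule ext, rule eq_matI) (auto simp: Ind_char)

lemma Ind_dsum_entry: 
  assumes "i < m * length \<psi>s" "j < m * length \<psi>s"
  shows "Ind G H (dsum (map char_rep \<psi>s)) g $$ (i, j) =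
    (if i mod length \<psi>s = j mod length \<psi>s then 
       Ind G H (char_rep (\<psi>s ! (i mod length \<psi>s))) g $$ (i div length \<psi>s, j div length \<psi>s) else 0)"
proof -
  \<comment> \<open>An index below \<open>m * length \<psi>s\<close> exists only for a nonempty
    list, which keeps \<open>div\<close> and \<open>mod\<close> away from their values at divisor
    0.\<close>
  have "0 < length \<psi>s" using assms by (cases \<psi>s) auto
  moreover have "i div length \<psi>s < m" "j div length \<psi>s < m" 
    using assms by (auto simp: less_mult_imp_div_less mult.commute)
  moreover have "Ind G H (dsum (map char_rep \<psi>s)) g $$ (i, j) =
     (let h = inv (ts ! (i div length \<psi>s)) \<otimes> g \<otimes> ts ! (j div length \<psi>s) in
      if h \<in> H then dsum (map char_rep \<psi>s) h $$ (i mod length \<psi>s, j mod length \<psi>s) else 0)"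
    using assms by (simp add: Ind_def ts_def[symmetric] m_def[symmetric] dim_dsum_char_rep Let_def)
  ultimately show ?thesis by (auto simp: Let_def dsum_char_rep_entry Ind_char_entry)
qed

lemma Ind_dsum_carrier: "rep_dim G (m * length \<psi>s) (Ind G H (dsum (map char_rep \<psi>s)))"
  by (simp add: rep_dim_def Ind_def ts_def[symmetric] m_def[symmetric] dim_dsum_char_rep Let_def)

end

text \<open>The intertwiner is the permutation matrix of \<open>\<pi>\<close>.\<close>

lemma rep_equiv_reindex:
  assumes "rep_dim G n \<rho>" "rep_dim G n \<sigma>" "bij_betw \<pi> {..<n} {..<n}"
    "\<And>g i j. g \<in> carrier G \<Longrightarrow> i < n \<Longrightarrow> j < n \<Longrightarrow> \<rho> g $$ (\<pi> i, \<pi> j) = \<sigma> g $$ (i, j)"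
  shows "rep_equiv G \<rho> (\<sigma> :: ('a, 'k::field) rep)"
proof (rule rep_equiv_intertwiner[OF assms(1,2)])
  let ?T = "Matrix.mat n n (\<lambda>(i, j). if i = \<pi> j then 1 else (0::'k))"
  have \<pi>: "\<pi> i < n" if "i < n" for i using assms(3) that by (auto dest: bij_betwE)
  have inj: "\<pi> i = \<pi> j \<longleftrightarrow> i = j" if "i < n" "j < n" for i j
    using assms(3) that by (auto simp: bij_betw_def inj_on_def)
  show T: "?T \<in> carrier_mat n n" by simp
  show "\<rho> g * ?T = ?T * \<sigma> g" if g: "g \<in> carrier G" for g
  proof (rule eq_matI)
    fix i j assume "i < dim_row (?T * \<sigma> g)" "j < dim_col (?T * \<sigma> g)"
    then have ij: "i < n" "j < n" using rep_dimD[OF assms(2) g] by auto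
    obtain i' where i': "i' < n" "i = \<pi> i'" using assms(3) ij by (auto simp: bij_betw_def)
    have "(\<rho> g * ?T) $$ (i, j) = (\<Sum>k<n. \<rho> g $$ (i, k) * ?T $$ (k, j))"
      by (rule index_mult_mat_sum[OF rep_dimD[OF assms(1) g] T ij])
    also have "\<dots> = \<rho> g $$ (i, \<pi> j)"
      using ij \<pi> by (subst sum_single[of "\<pi> j"]) auto
    also have "\<dots> = \<sigma> g $$ (i', j)" using assms(4)[OF g i'(1) ij(2)] i' by simp
    also have "\<dots> = (\<Sum>k<n. ?T $$ (i, k) * \<sigma> g $$ (k, j))"
      using ij i' inj by (subst sum_single[of i']) auto
    also have "\<dots> = (?T * \<sigma> g) $$ (i, j)"
      by (rule index_mult_mat_sum[OF T rep_dimD[OF assms(2) g] ij, symmetric])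
    finally show "(\<rho> g * ?T) $$ (i, j) = (?T * \<sigma> g) $$ (i, j)" .
  qed (use rep_dimD[OF assms(1) g] rep_dimD[OF assms(2) g] in auto)
  show "v = 0\<^sub>v n" if v: "v \<in> carrier_vec n" "?T *\<^sub>v v = 0\<^sub>v n" for v
  proof (rule eq_vecI)
    fix i assume i: "i < dim_vec (0\<^sub>v n :: 'k vec)"
    then have "0 = (?T *\<^sub>v v) $ (\<pi> i)" using v(2) \<pi> by simp
    also have "\<dots> = (\<Sum>k<n. ?T $$ (\<pi> i, k) * v $ k)"
      by (rule index_mult_mat_vec_sum[OF T v(1)]) (use i \<pi> in auto)
    also have "\<dots> = v $ i" using i inj \<pi> by (subst sum_single[of i]) auto
    finally show "v $ i = 0\<^sub>v n $ i" using i by simp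
  qed (use v in auto)
qed

context finite_subgroup begin

text \<open>\<open>Ind\<close> orders its basis by coset first and character second, the block sum
  the other way round. The permutation transposes this grid: l m + j goes to j d + l, where d is the
  number of characters.\<close>

lemma Ind_dsum:
  "rep_equiv G (Ind G H (dsum (map char_rep \<psi>s))) (dsum (map (\<lambda>\<psi>. Ind G H (char_rep \<psi>)) \<psi>s))"
    (is "rep_equiv G ?A ?B")
proof -
  let ?d = "length \<psi>s"
  let ?\<pi> = "\<lambda>k. (k mod m) * ?d + k div m"
  have bound: "l < ?d \<Longrightarrow> i < m \<Longrightarrow> l * m + i < m * ?d" for l i
    using block_index_bound[of l ?d i m] by (simp add: mult.commute)
  have bound': "l < ?d \<Longrightarrow> i < m \<Longrightarrow> i * ?d + l < m * ?d" for l i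
    using block_index_bound[of i m l ?d] by simp
  have dm: "k div m < ?d \<and> k mod m < m" if "k < m * ?d" for k
    using that by (cases m) (auto simp: less_mult_imp_div_less mult.commute)
  have dm': "k div ?d < m \<and> k mod ?d < ?d" if "k < m * ?d" for k
    using that by (cases ?d) (auto simp: less_mult_imp_div_less mult.commute)
  have \<pi>: "?\<pi> k < m * ?d" "?\<pi> k mod ?d = k div m" "?\<pi> k div ?d = k mod m" if "k < m * ?d" for k
    using dm[OF that] bound'[of "k div m" "k mod m"] div_mod_block[of "k div m" ?d "k mod m"] by simp_all
  have \<pi>': "(k mod ?d) * m + k div ?d < m * ?d" "((k mod ?d) * m + k div ?d) mod m = k div ?d"
    "((k mod ?d) * m + k div ?d) div m = k mod ?d" if "k < m * ?d" for k
    using dm'[OF that] bound[of "k mod ?d" "k div ?d"] div_mod_block[of "k div ?d" m "k mod ?d"] by simp_all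
  show ?thesis
  proof (rule rep_equiv_reindex[where n = "m * ?d" and \<pi> = ?\<pi>])
    show "rep_dim G (m * ?d) ?A" by (rule Ind_dsum_carrier)
    show "rep_dim G (m * ?d) ?B"
      using rep_dim_dsum_uniform[of "map (\<lambda>\<psi>. Ind G H (char_rep \<psi>)) \<psi>s" G m] rep_dim_Ind_char
      by (auto simp: mult.commute)
    show "bij_betw ?\<pi> {..<m * ?d} {..<m * ?d}"
    proof (rule bij_betw_byWitness[where f' = "\<lambda>k. (k mod ?d) * m + k div ?d"])
      show "\<forall>k\<in>{..<m * ?d}. (?\<pi> k mod ?d) * m + ?\<pi> k div ?d = k"
        by (intro ballI) (simp only: \<pi> lessThan_iff div_mult_mod_eq)
      show "\<forall>k\<in>{..<m * ?d}. ?\<pi> ((k mod ?d) * m + k div ?d) = k"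
        by (intro ballI) (simp only: \<pi>' lessThan_iff div_mult_mod_eq)
      show "?\<pi> ` {..<m * ?d} \<subseteq> {..<m * ?d}"
        by (intro image_subsetI) (simp only: \<pi> lessThan_iff)
      show "(\<lambda>k. (k mod ?d) * m + k div ?d) ` {..<m * ?d} \<subseteq> {..<m * ?d}"
        by (intro image_subsetI) (simp only: \<pi>' lessThan_iff)
    qed
    fix g i j assume g: "g \<in> carrier G" and ij: "i < m * ?d" "j < m * ?d"
    have "?B g $$ ((i div m) * m + i mod m, (j div m) * m + j mod m) = 
      (if i div m = j div m then Ind G H (char_rep (\<psi>s ! (i div m))) g $$ (i mod m, j mod m) else 0)"
      by (subst dsum_uniform_entry) (use dm[OF ij(1)] dm[OF ij(2)] rep_dimD[OF rep_dim_Ind_char g] in auto)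
    also have "\<dots> = ?A g $$ (?\<pi> i, ?\<pi> j)"
      using dm[OF ij(1)] dm[OF ij(2)] by (simp only: Ind_dsum_entry[OF \<pi>(1)[OF ij(1)] \<pi>(1)[OF ij(2)]]
          \<pi>(2,3)[OF ij(1)] \<pi>(2,3)[OF ij(2)])
    finally show "?A g $$ (?\<pi> i, ?\<pi> j) = ?B g $$ (i, j)" by (simp only: div_mult_mod_eq)
  qed
qed

lemma linear_char_mult: "linear_char G H \<psi> \<Longrightarrow> g \<in> H \<Longrightarrow> h \<in> H \<Longrightarrow> \<psi> (g \<otimes> h) = \<psi> g * \<psi> h"
  by (simp add: linear_char_def)

lemma linear_char_nonzero: "linear_char G H \<psi> \<Longrightarrow> h \<in> H \<Longrightarrow> \<psi> h \<noteq> 0"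
  by (simp add: linear_char_def)

lemma linear_char_one:
  assumes "linear_char G H \<psi>"
  shows "\<psi> \<one> = 1"
proof -
  have "\<psi> \<one> = \<psi> \<one> * \<psi> \<one>" using linear_char_mult[OF assms H_one H_one] by simp
  then show ?thesis using linear_char_nonzero[OF assms H_one] by simp
qed

text \<open>Frobenius reciprocity: \<open>F\<close> is a map into row vectors, equivariant for \<open>H\<close> on the left and
  for \<open>G\<close> on the right.\<close>

lemma Ind_intertwiner:
  fixes F :: "'a \<Rightarrow> 'k::field vec"
  assumes "rep_dim G n \<rho>" "\<And>x. x \<in> carrier G \<Longrightarrow> F x \<in> carrier_vec n"
    "\<And>h x. h \<in> H \<Longrightarrow> x \<in> carrier G \<Longrightarrow> F (h \<otimes> x) = \<psi> h \<cdot>\<^sub>v F x"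
    "\<And>x g. x \<in> carrier G \<Longrightarrow> g \<in> carrier G \<Longrightarrow> F (x \<otimes> g) = (\<rho> g)\<^sup>T *\<^sub>v F x"
    "T = Matrix.mat m n (\<lambda>(i, j). F (inv (ts ! i)) $ j)" "g \<in> carrier G"
  shows "Ind G H (char_rep \<psi>) g * T = T * \<rho> g"
proof (rule eq_matI)
  note d = rep_dimD[OF assms(1,6)] rep_dimD[OF rep_dim_Ind_char assms(6), of \<psi>]
  have T: "T \<in> carrier_mat m n" by (simp add: assms(5))
  fix i j assume "i < dim_row (T * \<rho> g)" "j < dim_col (T * \<rho> g)"
  then have ij: "i < m" "j < n" using d T by auto
  let ?x = "inv (ts ! i)"
  have "inv g \<otimes> ts ! i \<in> carrier G" using ij assms(6) by simp
  \<comment> \<open>Row i of the induced matrix has a single nonzero entry, in the column k of the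
    coset containing \<open>inv g \<otimes> ts ! i\<close>.\<close>
  then obtain k where k: "k < m" "inv (ts ! k) \<otimes> (inv g \<otimes> ts ! i) \<in> H"
    and k': "\<And>k'. k' < m \<Longrightarrow> inv (ts ! k') \<otimes> (inv g \<otimes> ts ! i) \<in> H \<Longrightarrow> k' = k"
    using t_ex1 by blast
  have sw: "inv (ts ! k') \<otimes> (inv g \<otimes> ts ! i) \<in> H \<longleftrightarrow> ?x \<otimes> g \<otimes> ts ! k' \<in> H" if "k' < m" for k'
    using inv_mult_in_H_sym[of "ts ! k'" "inv g \<otimes> ts ! i"] that ij assms(6)
    by (simp add: inv_mult_group m_assoc)
  let ?h = "?x \<otimes> g \<otimes> ts ! k"
  have h: "?h \<in> H" using k sw by blast
  \<comment> \<open>Moving \<open>?h\<close> out of the argument of \<open>F\<close> is where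
    equivariance under \<open>H\<close> on the left enters.\<close>
  have hx: "?h \<otimes> inv (ts ! k) = ?x \<otimes> g"
    using k ij assms(6) by (simp add: m_assoc)
  have "(Ind G H (char_rep \<psi>) g * T) $$ (i, j) = (\<Sum>k<m. Ind G H (char_rep \<psi>) g $$ (i, k) * T $$ (k, j))"
    by (rule index_mult_mat_sum[OF d(2) T ij])
  also have "\<dots> = \<psi> ?h * F (inv (ts ! k)) $ j"
  proof (subst sum_single[of k])
    fix l assume l: "l < m" "l \<noteq> k"
    then have "?x \<otimes> g \<otimes> ts ! l \<notin> H" using k' sw by blast
    then show "Ind G H (char_rep \<psi>) g $$ (i, l) * T $$ (l, j) = 0"
      using l(1) ij(1) by (simp add: Ind_char_entry)
  next
    have "Ind G H (char_rep \<psi>) g $$ (i, k) = \<psi> ?h" using h k(1) ij(1) by (simp add: Ind_char_entry)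
    then show "Ind G H (char_rep \<psi>) g $$ (i, k) * T $$ (k, j) = \<psi> ?h * F (inv (ts ! k)) $ j"
      using k(1) ij by (simp add: assms(5))
  qed (rule k(1))
  also have "\<dots> = F (?x \<otimes> g) $ j"
    using assms(3)[OF h, of "inv (ts ! k)"] assms(2)[of "inv (ts ! k)"] ij k by (simp add: hx)
  also have "\<dots> = ((\<rho> g)\<^sup>T *\<^sub>v F ?x) $ j" using assms(4)[of ?x g] ij assms(6) by simp
  also have "\<dots> = (\<Sum>k<n. (\<rho> g)\<^sup>T $$ (j, k) * F ?x $ k)"
    by (rule index_mult_mat_vec_sum) (use d(1) assms(2)[of ?x] ij in auto)
  also have "\<dots> = (\<Sum>k<n. T $$ (i, k) * \<rho> g $$ (k, j))"
    using ij d(1) by (intro sum.cong) (auto simp: assms(5))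
  also have "\<dots> = (T * \<rho> g) $$ (i, j)"
    by (rule index_mult_mat_sum[OF T d(1) ij, symmetric])
  finally show "(Ind G H (char_rep \<psi>) g * T) $$ (i, j) = (T * \<rho> g) $$ (i, j)" .
next
  note c = carrier_matD[OF rep_dimD[OF assms(1,6)]] carrier_matD[OF rep_dimD[OF rep_dim_Ind_char assms(6), of \<psi>]]
  have "dim_row T = m" "dim_col T = n" by (simp_all add: assms(5))
  then show "dim_row (Ind G H (char_rep \<psi>) g * T) = dim_row (T * \<rho> g)"
    "dim_col (Ind G H (char_rep \<psi>) g * T) = dim_col (T * \<rho> g)" using c by simp_all
qed

end

text \<open>Use the equivariant map whose value \<open>F x\<close> has as j-th entry
  \<open>\<psi>\<close> at inv y x t_j, or 0 if this is outside \<open>H\<close>. Left translation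
  of x by y h inv y becomes left translation by h. Each row of the resulting matrix has one nonzero
  entry and each column is met, so it is injective.\<close>

lemma Ind_conj:
  fixes \<psi> \<psi>' :: "'a \<Rightarrow> 'k::field"
  assumes "finite_subgroup G H" "finite_subgroup G H'" and y: "y \<in> carrier G"
    and H': "H' = (\<lambda>h. y \<otimes>\<^bsub>G\<^esub> h \<otimes>\<^bsub>G\<^esub> inv\<^bsub>G\<^esub> y) ` H"
    and \<psi>: "linear_char G H \<psi>" "\<And>h. h \<in> H \<Longrightarrow> \<psi>' (y \<otimes>\<^bsub>G\<^esub> h \<otimes>\<^bsub>G\<^esub> inv\<^bsub>G\<^esub> y) = \<psi> h"
  shows "rep_equiv G (Ind G H' (char_rep \<psi>')) (Ind G H (char_rep \<psi>))"
proof -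
  interpret A: finite_subgroup G H by fact
  interpret B: finite_subgroup G H' by fact
  note assoc = A.m_assoc A.inv_closed A.m_closed
  have "inj_on (\<lambda>h. y \<otimes>\<^bsub>G\<^esub> h \<otimes>\<^bsub>G\<^esub> inv\<^bsub>G\<^esub> y) H"
    using y A.H_carrier by (intro inj_onI) simp
  then have "card H' = card H" unfolding H' by (rule card_image)
  moreover have "card H > 0" using A.finite_carrier A.H_carrier A.H_one
    by (metis card_gt_0_iff empty_iff finite_subset subsetI)
  \<comment> \<open>Conjugate subgroups have equal order and hence equal index, so both induced
    matrices have the same size.\<close>
  ultimately have m: "B.m = A.m" using A.card_transversal B.card_transversal by (metis mult_cancel2 not_gr0)
  define a where "a x j = inv\<^bsub>G\<^esub> y \<otimes>\<^bsub>G\<^esub> x \<otimes>\<^bsub>G\<^esub> A.ts ! j" for x j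
  define F where "F x = Matrix.vec A.m (\<lambda>j. if a x j \<in> H then \<psi> (a x j) else 0)" for x
  define T where "T = Matrix.mat B.m A.m (\<lambda>(i, j). F (inv\<^bsub>G\<^esub> (B.ts ! i)) $ j)"
  have F: "F x \<in> carrier_vec A.m" for x by (simp add: F_def)
  have a_car: "a x j \<in> carrier G" if "x \<in> carrier G" "j < A.m" for x j
    unfolding a_def using that y by simp
  \<comment> \<open>The only column with an entry in \<open>H\<close> is that of the coset
    containing inv x y.\<close>
  have a1: "\<exists>k<A.m. a x k \<in> H \<and> (\<forall>l<A.m. a x l \<in> H \<longrightarrow> l = k)" if x: "x \<in> carrier G" for x
  proof -
    have "a x l \<in> H \<longleftrightarrow> inv\<^bsub>G\<^esub> (A.ts ! l) \<otimes>\<^bsub>G\<^esub> (inv\<^bsub>G\<^esub> x \<otimes>\<^bsub>G\<^esub> y) \<in> H" if "l < A.m" for l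
    proof -
      have "a x l = inv\<^bsub>G\<^esub> (inv\<^bsub>G\<^esub> x \<otimes>\<^bsub>G\<^esub> y) \<otimes>\<^bsub>G\<^esub> A.ts ! l"
        unfolding a_def using that x y by (simp add: A.inv_mult_group)
      then show ?thesis using A.inv_mult_in_H_sym[of "inv\<^bsub>G\<^esub> x \<otimes>\<^bsub>G\<^esub> y" "A.ts ! l"] that x y by simp
    qed
    with A.t_ex1[of "inv\<^bsub>G\<^esub> x \<otimes>\<^bsub>G\<^esub> y"] x y show ?thesis by (metis A.inv_closed A.m_closed)
  qed
  have F3: "F (h' \<otimes>\<^bsub>G\<^esub> x) = \<psi>' h' \<cdot>\<^sub>v F x" if h': "h' \<in> H'" and x: "x \<in> carrier G" for h' x
  proof -
    obtain h where h: "h \<in> H" "h' = y \<otimes>\<^bsub>G\<^esub> h \<otimes>\<^bsub>G\<^esub> inv\<^bsub>G\<^esub> y" using h' H' by auto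
    note hc = A.H_carrier[OF h(1)]
    show ?thesis
    proof (rule eq_vecI)
      fix j assume "j < dim_vec (\<psi>' h' \<cdot>\<^sub>v F x)"
      then have j: "j < A.m" by (simp add: F_def)
      have "a (h' \<otimes>\<^bsub>G\<^esub> x) j = (inv\<^bsub>G\<^esub> y \<otimes>\<^bsub>G\<^esub> y) \<otimes>\<^bsub>G\<^esub> (h \<otimes>\<^bsub>G\<^esub> a x j)"
        unfolding a_def h(2) using x y hc j A.t_carrier[OF j] by (simp only: assoc)
      then have e: "a (h' \<otimes>\<^bsub>G\<^esub> x) j = h \<otimes>\<^bsub>G\<^esub> a x j" using a_car[OF x j] y hc by simp
      have "a x j \<in> H" if "h \<otimes>\<^bsub>G\<^esub> a x j \<in> H"
      proof -
        have "a x j = inv\<^bsub>G\<^esub> h \<otimes>\<^bsub>G\<^esub> (h \<otimes>\<^bsub>G\<^esub> a x j)"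
          using a_car[OF x j] hc by (simp flip: A.m_assoc)
        then show ?thesis using A.H_mult[OF A.H_inv[OF h(1)] that] by simp
      qed
      then have "h \<otimes>\<^bsub>G\<^esub> a x j \<in> H \<longleftrightarrow> a x j \<in> H" using A.H_mult[OF h(1)] by blast
      then show "F (h' \<otimes>\<^bsub>G\<^esub> x) $ j = (\<psi>' h' \<cdot>\<^sub>v F x) $ j"
        using j \<psi>(2)[OF h(1), folded h(2)] A.linear_char_mult[OF \<psi>(1) h(1), of "a x j"] by (simp add: F_def e)
    qed (simp add: F_def)
  qed
  have F4: "F (x \<otimes>\<^bsub>G\<^esub> g) = (Ind G H (char_rep \<psi>) g)\<^sup>T *\<^sub>v F x" if x: "x \<in> carrier G" and g: "g \<in> carrier G" for x g
  proof (rule eq_vecI)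
    let ?I = "Ind G H (char_rep \<psi>) g"
    have I: "?I \<in> carrier_mat A.m A.m" using rep_dimD[OF A.rep_dim_Ind_char g] .
    fix j assume "j < dim_vec (?I\<^sup>T *\<^sub>v F x)"
    then have j: "j < A.m" using carrier_matD[OF I] by simp
    obtain k where k: "k < A.m" "a x k \<in> H" "\<And>l. l < A.m \<Longrightarrow> a x l \<in> H \<Longrightarrow> l = k" using a1[OF x] by blast
    let ?b = "inv\<^bsub>G\<^esub> (A.ts ! k) \<otimes>\<^bsub>G\<^esub> g \<otimes>\<^bsub>G\<^esub> A.ts ! j"
    have b: "?b \<in> carrier G" using k(1) j g by simp
    have "a x k \<otimes>\<^bsub>G\<^esub> ?b = inv\<^bsub>G\<^esub> y \<otimes>\<^bsub>G\<^esub> x \<otimes>\<^bsub>G\<^esub> (A.ts ! k \<otimes>\<^bsub>G\<^esub> inv\<^bsub>G\<^esub> (A.ts ! k)) \<otimes>\<^bsub>G\<^esub> g \<otimes>\<^bsub>G\<^esub> A.ts ! j"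
      unfolding a_def using x y g A.t_carrier[OF j] A.t_carrier[OF k(1)] by (simp only: assoc)
    also have "\<dots> = a (x \<otimes>\<^bsub>G\<^esub> g) j"
      unfolding a_def using x y g A.t_carrier[OF j] A.t_carrier[OF k(1)] by (simp add: A.m_assoc)
    finally have e: "a (x \<otimes>\<^bsub>G\<^esub> g) j = a x k \<otimes>\<^bsub>G\<^esub> ?b" by simp
    have "?b \<in> H" if "a x k \<otimes>\<^bsub>G\<^esub> ?b \<in> H"
    proof -
      have "?b = inv\<^bsub>G\<^esub> (a x k) \<otimes>\<^bsub>G\<^esub> (a x k \<otimes>\<^bsub>G\<^esub> ?b)"
        using a_car[OF x k(1)] b by (simp del: A.m_assoc flip: A.m_assoc[of "inv\<^bsub>G\<^esub> (a x k)" "a x k" ?b])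
      then show ?thesis using A.H_mult[OF A.H_inv[OF k(2)] that] by simp
    qed
    then have bi: "a x k \<otimes>\<^bsub>G\<^esub> ?b \<in> H \<longleftrightarrow> ?b \<in> H" using A.H_mult[OF k(2)] by blast
    have "(?I\<^sup>T *\<^sub>v F x) $ j = (\<Sum>l<A.m. ?I\<^sup>T $$ (j, l) * F x $ l)"
      by (rule index_mult_mat_vec_sum[of _ A.m]) (use I F j in simp_all)
    also have "\<dots> = ?I\<^sup>T $$ (j, k) * F x $ k"
    proof (rule sum_single[OF k(1)])
      fix l assume "l < A.m" "l \<noteq> k"
      then have "F x $ l = 0" using k(3) by (auto simp: F_def)
      then show "?I\<^sup>T $$ (j, l) * F x $ l = 0" by simp
    qed
    also have "\<dots> = (if ?b \<in> H then \<psi> ?b * \<psi> (a x k) else 0)"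
      using k(1,2) j carrier_matD[OF I] by (simp add: A.Ind_char_entry F_def)
    also have "\<dots> = F (x \<otimes>\<^bsub>G\<^esub> g) $ j"
      using A.linear_char_mult[OF \<psi>(1) k(2), of ?b] bi j by (simp add: F_def e mult.commute)
    finally show "F (x \<otimes>\<^bsub>G\<^esub> g) $ j = (?I\<^sup>T *\<^sub>v F x) $ j" by simp
  next
    show "dim_vec (F (x \<otimes>\<^bsub>G\<^esub> g)) = dim_vec ((Ind G H (char_rep \<psi>) g)\<^sup>T *\<^sub>v F x)"
      using carrier_matD[OF rep_dimD[OF A.rep_dim_Ind_char g, of \<psi>]] by (simp add: F_def)
  qed
  show ?thesis
  proof (rule rep_equiv_intertwiner[where n = "A.m" and T = T])
    show "rep_dim G A.m (Ind G H' (char_rep \<psi>'))" using B.rep_dim_Ind_char m by simp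
    show "rep_dim G A.m (Ind G H (char_rep \<psi>))" by (rule A.rep_dim_Ind_char)
    show T: "T \<in> carrier_mat A.m A.m" by (simp add: T_def m)
    show "Ind G H' (char_rep \<psi>') g * T = T * Ind G H (char_rep \<psi>) g" if "g \<in> carrier G" for g
      by (rule B.Ind_intertwiner[OF A.rep_dim_Ind_char F F3 F4 T_def that])
    fix v :: "'k vec" assume v: "v \<in> carrier_vec A.m" "T *\<^sub>v v = 0\<^sub>v A.m"
    show "v = 0\<^sub>v A.m"
    proof (rule eq_vecI)
      fix j assume "j < dim_vec (0\<^sub>v A.m :: 'k vec)"
      then have j: "j < A.m" by simp
      \<comment> \<open>This selects the row isolating \<open>v $ j\<close>: its coset of
        \<open>H'\<close> contains t_j inv y, so the argument of \<open>\<psi>\<close> lands in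
        \<open>H\<close> exactly at column j.\<close>
      have "A.ts ! j \<otimes>\<^bsub>G\<^esub> inv\<^bsub>G\<^esub> y \<in> carrier G" using j y by simp
      from B.t_ex1[OF this] obtain i where i: "i < A.m" 
        "inv\<^bsub>G\<^esub> (B.ts ! i) \<otimes>\<^bsub>G\<^esub> (A.ts ! j \<otimes>\<^bsub>G\<^esub> inv\<^bsub>G\<^esub> y) \<in> H'" using m by auto
      let ?x = "inv\<^bsub>G\<^esub> (B.ts ! i)"
      have si: "B.ts ! i \<in> carrier G" using B.t_carrier i m by simp
      obtain h where h: "h \<in> H" "?x \<otimes>\<^bsub>G\<^esub> (A.ts ! j \<otimes>\<^bsub>G\<^esub> inv\<^bsub>G\<^esub> y) = y \<otimes>\<^bsub>G\<^esub> h \<otimes>\<^bsub>G\<^esub> inv\<^bsub>G\<^esub> y" 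
        using i(2) unfolding H' by auto
      note hc = A.H_carrier[OF h(1)]
      have "(?x \<otimes>\<^bsub>G\<^esub> A.ts ! j) \<otimes>\<^bsub>G\<^esub> inv\<^bsub>G\<^esub> y = (y \<otimes>\<^bsub>G\<^esub> h) \<otimes>\<^bsub>G\<^esub> inv\<^bsub>G\<^esub> y"
        using h(2) si y hc A.t_carrier[OF j] by (simp only: assoc)
      then have xt: "?x \<otimes>\<^bsub>G\<^esub> A.ts ! j = y \<otimes>\<^bsub>G\<^esub> h" using si y hc A.t_carrier[OF j] by simp
      have "a ?x j = inv\<^bsub>G\<^esub> y \<otimes>\<^bsub>G\<^esub> (?x \<otimes>\<^bsub>G\<^esub> A.ts ! j)"
        unfolding a_def using si y A.t_carrier[OF j] by (simp only: assoc)
      then have aj: "a ?x j \<in> H" using h(1) y hc by (simp add: xt flip: A.m_assoc)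
      have al: "a ?x l \<notin> H" if "l < A.m" "l \<noteq> j" for l
        using a1[of ?x] aj that si j by (metis A.inv_closed)
      have "0 = (T *\<^sub>v v) $ i" using v(2) i(1) by simp
      also have "\<dots> = (\<Sum>l<A.m. T $$ (i, l) * v $ l)" by (rule index_mult_mat_vec_sum[OF T v(1) i(1)])
      also have "\<dots> = T $$ (i, j) * v $ j"
        by (rule sum_single[OF j]) (use al i(1) m in \<open>simp add: T_def F_def\<close>)
      also have "\<dots> = \<psi> (a ?x j) * v $ j" using aj i(1) j m by (simp add: T_def F_def)
      finally show "v $ j = 0\<^sub>v A.m $ j" using A.linear_char_nonzero[OF \<psi>(1) aj] j by simp
    qed (use v in simp)
  qed
qed

section \<open>The regular representation as a sum of induced characters\<close>

context finite_subgroup begin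

definition "es = (SOME es. distinct es \<and> set es = carrier G)"

lemma es: "distinct es" "set es = carrier G"
proof -
  have "\<exists>es. distinct es \<and> set es = carrier G" using finite_distinct_list[OF finite_carrier] by blast
  from someI_ex[OF this] show "distinct es" "set es = carrier G" unfolding es_def by auto
qed

lemma regular_rep_eq: "regular_rep G g = Matrix.mat (length es) (length es)
    (\<lambda>(i, j). if g \<otimes> es ! j = es ! i then 1 else 0)"
  by (simp add: regular_rep_def es_def[symmetric] Let_def)

lemma rep_dim_regular: "rep_dim G (length es) (regular_rep G)"
  by (simp add: rep_dim_def regular_rep_eq)

text \<open>The column of the intertwiner for the l-th character and the j-th coset is the function
  on \<open>G\<close> supported on t_j H whose value is the inverse of \<open>\<psi>s ! l\<close> at
  inv t_j x; left translation acts on these functions by the induced matrices. The matrix splits by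
  cosets, and on each coset injectivity is the independence hypothesis.\<close>

lemma sum_Ind_regular:
  fixes \<psi>s :: "('a \<Rightarrow> 'k::field) list"
  assumes len: "length \<psi>s = card H" and lin: "\<And>\<psi>. \<psi> \<in> set \<psi>s \<Longrightarrow> linear_char G H \<psi>"
    and indep: "\<And>c :: nat \<Rightarrow> 'k. (\<And>h. h \<in> H \<Longrightarrow> (\<Sum>l<length \<psi>s. inverse ((\<psi>s ! l) h) * c l) = 0) \<Longrightarrow>
       \<forall>l<length \<psi>s. c l = 0"
  shows "rep_equiv G (dsum (map (\<lambda>\<psi>. Ind G H (char_rep \<psi>)) \<psi>s)) (regular_rep G)"
proof (rule rep_equiv_sym)
  let ?d = "length \<psi>s" let ?n = "length es" let ?xs = "map (\<lambda>\<psi>. Ind G H (char_rep \<psi>)) \<psi>s"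
  have n: "?n = ?d * m" using card_transversal es distinct_card[OF es(1)] len by (simp add: mult.commute)
  define b where "b x j = inv (ts ! j) \<otimes> x" for x j
  define t where "t x l j = (if b x j \<in> H then inverse ((\<psi>s ! l) (b x j)) else 0)" for x l j
  define T where "T = Matrix.mat ?n ?n (\<lambda>(x, k). t (es ! x) (k div m) (k mod m))"
  have T_entry: "T $$ (x, l * m + j) = t (es ! x) l j" if "x < ?n" "l < ?d" "j < m" for x l j
    using that block_index_bound[of l ?d j m] n by (simp add: T_def)
  have linl: "linear_char G H (\<psi>s ! l)" if "l < ?d" for l using lin that by simp
  have dimxs: "rep_dim G ?n (dsum ?xs)"
    using rep_dim_dsum_uniform[of ?xs G m] rep_dim_Ind_char n by auto
  show "rep_equiv G (regular_rep G) (dsum ?xs)"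
  proof (rule rep_equiv_intertwiner[OF rep_dim_regular dimxs])
    show T: "T \<in> carrier_mat ?n ?n" by (simp add: T_def)
    show "regular_rep G g * T = T * dsum ?xs g" if g: "g \<in> carrier G" for g
    proof (rule eq_matI)
      note dd = rep_dimD[OF rep_dim_regular g] rep_dimD[OF dimxs g]
      fix x k assume "x < dim_row (T * dsum ?xs g)" "k < dim_col (T * dsum ?xs g)"
      then have xk: "x < ?n" "k < ?n" using carrier_matD[OF T] carrier_matD[OF dd(2)] by simp_all
      define l j where "l = k div m" "j = k mod m"
      have kd: "k < ?d * m" using xk(2) unfolding n .
      then have "0 < m" by (cases m) auto
      then have lj: "l < ?d" "j < m" "k = l * m + j"
        unfolding l_j_def using less_mult_imp_div_less[OF kd] div_mult_mod_eq[of k m, symmetric] by simp_all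
      let ?x = "es ! x"
      have x: "?x \<in> carrier G" using xk(1) es(2) nth_mem by blast
      have gx: "inv g \<otimes> ?x \<in> carrier G" using x g by simp
      then obtain z where z: "z < ?n" "es ! z = inv g \<otimes> ?x" using es(2) by (metis in_set_conv_nth)
      have zz: "g \<otimes> es ! z' = ?x \<longleftrightarrow> z' = z" if "z' < ?n" for z'
      proof
        assume "g \<otimes> es ! z' = ?x"
        then have "es ! z' = inv g \<otimes> ?x"
          using es(2) that g nth_mem by (metis inv_solve_left x)
        then show "z' = z" using z es(1) that by (metis nth_eq_iff_index_eq)
      next
        assume "z' = z"
        then show "g \<otimes> es ! z' = ?x" using z(2) x g by (simp flip: m_assoc)
      qed
      have "(regular_rep G g * T) $$ (x, k) = (\<Sum>z'<?n. regular_rep G g $$ (x, z') * T $$ (z', k))"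
        by (rule index_mult_mat_sum[OF dd(1) T xk])
      also have "\<dots> = regular_rep G g $$ (x, z) * T $$ (z, k)"
        by (rule sum_single[OF z(1)]) (use zz xk(1) in \<open>simp add: regular_rep_eq\<close>)
      also have "\<dots> = t (inv g \<otimes> ?x) l j"
        using zz[OF z(1)] xk z lj by (simp add: regular_rep_eq T_entry)
      finally have L: "(regular_rep G g * T) $$ (x, k) = t (inv g \<otimes> ?x) l j" .
      \<comment> \<open>The element \<open>?x\<close> lies in one coset only, so all summands except
        the one for i vanish.\<close>
      obtain i where i: "i < m" "b ?x i \<in> H" "\<And>i'. i' < m \<Longrightarrow> b ?x i' \<in> H \<Longrightarrow> i' = i"
        using t_ex1[OF x] unfolding b_def by blast
      let ?c = "inv (ts ! i) \<otimes> g \<otimes> ts ! j"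
      have "(T * dsum ?xs g) $$ (x, k) = (\<Sum>k'<?n. T $$ (x, k') * dsum ?xs g $$ (k', k))"
        by (rule index_mult_mat_sum[OF T dd(2) xk])
      also have "\<dots> = (\<Sum>l'<?d. \<Sum>j'<m. T $$ (x, l' * m + j') * dsum ?xs g $$ (l' * m + j', l * m + j))"
        unfolding n sum_div_mod lj(3) ..
      also have "\<dots> = (\<Sum>l'<?d. \<Sum>j'<m. t ?x l' j' * (if l' = l then Ind G H (char_rep (\<psi>s ! l')) g $$ (j', j) else 0))"
      proof (intro sum.cong refl arg_cong2[where f = "(*)"])
        fix l' j' assume "l' \<in> {..<?d}" "j' \<in> {..<m}"
        then have lj': "l' < ?d" "j' < m" by auto
        show "T $$ (x, l' * m + j') = t ?x l' j'" by (rule T_entry[OF xk(1) lj'])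
        have "dsum ?xs g $$ (l' * m + j', l * m + j) = (if l' = l then (?xs ! l') g $$ (j', j) else 0)"
          by (rule dsum_uniform_entry) (use lj lj' rep_dimD[OF rep_dim_Ind_char g] in auto)
        then show "dsum ?xs g $$ (l' * m + j', l * m + j) =
           (if l' = l then Ind G H (char_rep (\<psi>s ! l')) g $$ (j', j) else 0)" using lj' by simp
      qed
      also have "\<dots> = (\<Sum>j'<m. t ?x l j' * Ind G H (char_rep (\<psi>s ! l)) g $$ (j', j))"
      proof -
        have "(\<Sum>l'<?d. \<Sum>j'<m. t ?x l' j' * (if l' = l then Ind G H (char_rep (\<psi>s ! l')) g $$ (j', j) else 0)) =
          (\<Sum>j'<m. t ?x l j' * (if l = l then Ind G H (char_rep (\<psi>s ! l)) g $$ (j', j) else 0))"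
          by (rule sum_single[OF lj(1)]) simp
        then show ?thesis by simp
      qed
      also have "\<dots> = t ?x l i * Ind G H (char_rep (\<psi>s ! l)) g $$ (i, j)"
        by (rule sum_single[OF i(1)]) (use i(3) in \<open>auto simp: t_def\<close>)
      also have "\<dots> = (if ?c \<in> H then inverse ((\<psi>s ! l) (b ?x i)) * (\<psi>s ! l) ?c else 0)"
        using i(1,2) lj by (simp add: t_def Ind_char_entry)
      also have "\<dots> = t (inv g \<otimes> ?x) l j"
      proof -
        have cc: "?c \<in> carrier G" "b ?x i \<in> carrier G" using i(1) lj(2) g x by (simp_all add: b_def)
        \<comment> \<open>The factorisation (inv t_i g t_j)(inv t_j inv g x) = inv t_i x has its
          right side in \<open>H\<close>. So one factor lies in \<open>H\<close> exactly if the
          other does, and then multiplicativity of the character gives the entry.\<close>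
        have "?c \<otimes> b (inv g \<otimes> ?x) j = inv (ts ! i) \<otimes> g \<otimes> (ts ! j \<otimes> inv (ts ! j)) \<otimes> inv g \<otimes> ?x"
          unfolding b_def using t_carrier[OF i(1)] t_carrier[OF lj(2)] g x by (simp only: m_assoc inv_closed m_closed)
        also have "\<dots> = inv (ts ! i) \<otimes> (g \<otimes> inv g) \<otimes> ?x"
          using t_carrier[OF i(1)] t_carrier[OF lj(2)] g x by (simp add: m_assoc)
        also have "\<dots> = b ?x i" using t_carrier[OF i(1)] g x by (simp add: b_def)
        finally have cb: "?c \<otimes> b (inv g \<otimes> ?x) j = b ?x i" .
        have bc: "b (inv g \<otimes> ?x) j \<in> carrier G" using lj(2) g x by (simp add: b_def)
        have bb: "b (inv g \<otimes> ?x) j = inv ?c \<otimes> b ?x i" using cb bc cc by (metis inv_solve_left)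
        have cb2: "?c = b ?x i \<otimes> inv (b (inv g \<otimes> ?x) j)" using cb bc cc by (metis inv_solve_right)
        show ?thesis
        proof (cases "?c \<in> H")
          case True
          then have bH: "b (inv g \<otimes> ?x) j \<in> H" using bb H_mult[OF H_inv i(2)] by simp
          have "(\<psi>s ! l) (b ?x i) = (\<psi>s ! l) ?c * (\<psi>s ! l) (b (inv g \<otimes> ?x) j)"
            using linear_char_mult[OF linl[OF lj(1)] True bH] by (simp add: cb)
          then show ?thesis using True bH linear_char_nonzero[OF linl[OF lj(1)]] i(2) by (simp add: t_def field_simps)
        next
          case False
          then have "b (inv g \<otimes> ?x) j \<notin> H" using cb2 H_mult[OF i(2) H_inv] by metis
          then show ?thesis using False by (simp add: t_def)
        qed
      qed
      finally show "(regular_rep G g * T) $$ (x, k) = (T * dsum ?xs g) $$ (x, k)" using L by simp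
    qed (use carrier_matD[OF T] carrier_matD[OF rep_dimD[OF rep_dim_regular g]] carrier_matD[OF rep_dimD[OF dimxs g]] in simp_all)
    fix v :: "'k vec" assume v: "v \<in> carrier_vec ?n" "T *\<^sub>v v = 0\<^sub>v ?n"
    show "v = 0\<^sub>v ?n"
    proof (rule eq_vecI)
      fix k assume "k < dim_vec (0\<^sub>v ?n :: 'k vec)"
      then have k: "k < ?n" by simp
      define l j where "l = k div m" "j = k mod m"
      have kd: "k < ?d * m" using k unfolding n .
      then have "0 < m" by (cases m) auto
      then have lj: "l < ?d" "j < m" "k = l * m + j"
        unfolding l_j_def using less_mult_imp_div_less[OF kd] div_mult_mod_eq[of k m, symmetric] by simp_all
      \<comment> \<open>Evaluating \<open>T *\<^sub>v v\<close> at the group element t_j h sees only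
        the entries of v that belong to the coset j.\<close>
      have "(\<Sum>l'<?d. inverse ((\<psi>s ! l') h) * v $ (l' * m + j)) = 0" if h: "h \<in> H" for h
      proof -
        have "ts ! j \<otimes> h \<in> carrier G" using h H_carrier lj(2) by simp
        then obtain x where x: "x < ?n" "es ! x = ts ! j \<otimes> h" using es(2) by (metis in_set_conv_nth)
        have bj: "b (es ! x) j = h" unfolding b_def x(2) using H_carrier[OF h] t_carrier[OF lj(2)] by (simp flip: m_assoc)
        have bH: "b (es ! x) j' \<notin> H" if "j' < m" "j' \<noteq> j" for j'
          using t_ex1[of "es ! x"] bj h that lj(2) x es(2) nth_mem[OF x(1)] unfolding b_def by metis
        have "0 = (T *\<^sub>v v) $ x" using v(2) x(1) by simp
        also have "\<dots> = (\<Sum>k'<?n. T $$ (x, k') * v $ k')" by (rule index_mult_mat_vec_sum[OF T v(1) x(1)])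
        also have "\<dots> = (\<Sum>l'<?d. \<Sum>j'<m. T $$ (x, l' * m + j') * v $ (l' * m + j'))"
          unfolding n sum_div_mod ..
        also have "\<dots> = (\<Sum>l'<?d. inverse ((\<psi>s ! l') h) * v $ (l' * m + j))"
        proof (rule sum.cong[OF refl])
          fix l' assume "l' \<in> {..<?d}"
          then have l': "l' < ?d" by simp
          have "(\<Sum>j'<m. T $$ (x, l' * m + j') * v $ (l' * m + j')) = T $$ (x, l' * m + j) * v $ (l' * m + j)"
            by (rule sum_single[OF lj(2)]) (use bH x(1) l' in \<open>simp add: T_entry t_def\<close>)
          then show "(\<Sum>j'<m. T $$ (x, l' * m + j') * v $ (l' * m + j')) = inverse ((\<psi>s ! l') h) * v $ (l' * m + j)"
            using T_entry[OF x(1) l' lj(2)] bj h by (simp add: t_def)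
        qed
        finally show ?thesis by simp
      qed
      then have "\<forall>l'<?d. v $ (l' * m + j) = 0" by (rule indep)
      then have "v $ (l * m + j) = 0" using lj(1) by blast
      then show "v $ k = 0\<^sub>v ?n $ k" using k lj(3) by simp
    qed (use v in simp)
  qed
qed

end

section \<open>Irreducible representations\<close>

text \<open>Stands in for dimension theory: if m < n, padding with zeros gives square matrices whose
  product is 1 in one order, hence in both, although the padded \<open>A\<close> has a zero row
  m.\<close>

lemma mat_dims_eq_of_inverse:
  fixes A :: "'k::field mat"
  assumes A: "A \<in> carrier_mat m n" and B: "B \<in> carrier_mat n m" and AB: "A * B = 1\<^sub>m m" and BA: "B * A = 1\<^sub>m n"
  shows "m = n"
proof -
  have *: "\<not> m < n" if "A \<in> carrier_mat m n" "B \<in> carrier_mat n m" "A * B = 1\<^sub>m m" "B * A = 1\<^sub>m n"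
    for A B :: "'k mat" and m n
  proof
    assume mn: "m < n"
    let ?A = "Matrix.mat n n (\<lambda>(i, j). if i < m then A $$ (i, j) else 0)"
    let ?B = "Matrix.mat n n (\<lambda>(i, j). if j < m then B $$ (i, j) else 0)"
    have c: "?A \<in> carrier_mat n n" "?B \<in> carrier_mat n n" by simp_all
    have "?B * ?A = 1\<^sub>m n"
    proof (rule eq_matI)
      fix i j assume "i < dim_row (1\<^sub>m n :: 'k mat)" "j < dim_col (1\<^sub>m n :: 'k mat)"
      then have ij: "i < n" "j < n" by simp_all
      have "(?B * ?A) $$ (i, j) = (\<Sum>k<n. ?B $$ (i, k) * ?A $$ (k, j))"
        by (rule index_mult_mat_sum[OF c(2) c(1) ij])
      also have "\<dots> = (\<Sum>k<m. B $$ (i, k) * A $$ (k, j))"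
        using ij mn by (intro sum.mono_neutral_cong_right) auto
      also have "\<dots> = (B * A) $$ (i, j)"
        by (rule index_mult_mat_sum[OF that(2) that(1) ij, symmetric])
      finally show "(?B * ?A) $$ (i, j) = 1\<^sub>m n $$ (i, j)" using that(4) by simp
    qed simp_all
    then have "?A * ?B = 1\<^sub>m n" using mat_mult_left_right_inverse[OF c(2,1)] by simp
    then have "(?A * ?B) $$ (m, m) = 1" using mn by simp
    moreover have "(?A * ?B) $$ (m, m) = (\<Sum>k<n. ?A $$ (m, k) * ?B $$ (k, m))"
      by (rule index_mult_mat_sum[OF c mn mn])
    ultimately show False using mn by simp
  qed
  show ?thesis using *[OF A B AB BA] *[OF B A BA AB] by simp
qed

lemma mat_cancel_left:
  fixes R :: "'k::field mat"
  assumes R: "R \<in> carrier_mat p q" and X: "X \<in> carrier_mat q r" and Y: "Y \<in> carrier_mat q r"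
    and inj: "\<And>v. v \<in> carrier_vec q \<Longrightarrow> R *\<^sub>v v = 0\<^sub>v p \<Longrightarrow> v = 0\<^sub>v q" and eq: "R * X = R * Y"
  shows "X = Y"
proof (rule eq_matI)
  fix i j assume "i < dim_row Y" "j < dim_col Y"
  then have ij: "i < q" "j < r" using Y by simp_all
  have c: "col X j \<in> carrier_vec q" "col Y j \<in> carrier_vec q" using X Y by auto
  have "R *\<^sub>v (col X j - col Y j) = R *\<^sub>v col X j - R *\<^sub>v col Y j"
    by (rule mult_minus_distrib_mat_vec[OF R c])
  also have "R *\<^sub>v col X j = col (R * X) j" using col_mult2[OF R X ij(2)] by simp
  also have "R *\<^sub>v col Y j = col (R * Y) j" using col_mult2[OF R Y ij(2)] by simp
  also have "col (R * X) j - col (R * Y) j = 0\<^sub>v p" using eq R Y by auto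
  finally have "col X j - col Y j = 0\<^sub>v q" using c by (intro inj) auto
  then have "(col X j - col Y j) $ i = 0" using ij by simp
  then show "X $$ (i, j) = Y $$ (i, j)" using ij X Y by simp
qed (use X Y in simp_all)

text \<open>\<open>irreducible_rep\<close> with its dimension exposed, so that dimensions can be
  compared and added up.\<close>

definition irr :: "('g, 'm) monoid_scheme \<Rightarrow> nat \<Rightarrow> ('g, 'k::field) rep \<Rightarrow> bool" where
  "irr G n \<rho> \<longleftrightarrow> n > 0 \<and> is_rep G n \<rho> \<and>
     (\<forall>U \<subseteq> carrier_vec n.
        0\<^sub>v n \<in> U \<and> (\<forall>u\<in>U. \<forall>v\<in>U. u + v \<in> U) \<and> (\<forall>c. \<forall>u\<in>U. c \<cdot>\<^sub>v u \<in> U) \<and>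
        (\<forall>g\<in>carrier G. \<forall>u\<in>U. \<rho> g *\<^sub>v u \<in> U)
        \<longrightarrow> U = {0\<^sub>v n} \<or> U = carrier_vec n)"

lemma irreducible_rep_iff_irr: "irreducible_rep G \<rho> \<longleftrightarrow> (\<exists>n. irr G n \<rho>)"
  unfolding irreducible_rep_def irr_def by blast

lemma irr_rep_dim: "irr G n \<rho> \<Longrightarrow> rep_dim G n \<rho>"
  by (auto simp: irr_def is_rep_def rep_dim_def)

lemma irr_invariant:
  assumes "irr G n \<rho>" "U \<subseteq> carrier_vec n" "0\<^sub>v n \<in> U" "\<And>u v. u \<in> U \<Longrightarrow> v \<in> U \<Longrightarrow> u + v \<in> U"
    "\<And>c u. u \<in> U \<Longrightarrow> c \<cdot>\<^sub>v u \<in> U" "\<And>g u. g \<in> carrier G \<Longrightarrow> u \<in> U \<Longrightarrow> \<rho> g *\<^sub>v u \<in> U"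
  shows "U = {0\<^sub>v n} \<or> U = carrier_vec n"
proof -
  have "U \<subseteq> carrier_vec n \<longrightarrow> 0\<^sub>v n \<in> U \<and> (\<forall>u\<in>U. \<forall>v\<in>U. u + v \<in> U) \<and> (\<forall>c. \<forall>u\<in>U. c \<cdot>\<^sub>v u \<in> U) \<and>
        (\<forall>g\<in>carrier G. \<forall>u\<in>U. \<rho> g *\<^sub>v u \<in> U) \<longrightarrow> U = {0\<^sub>v n} \<or> U = carrier_vec n"
    using assms(1) unfolding irr_def by (elim conjE allE[of _ U])
  with assms(2-) show ?thesis by simp
qed

lemma mult_unit_vec_zero:
  fixes T :: "'k::field mat"
  assumes T: "T \<in> carrier_mat p n" and "\<And>v. v \<in> carrier_vec n \<Longrightarrow> T *\<^sub>v v = 0\<^sub>v p"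
  shows "T = 0\<^sub>m p n"
proof (rule eq_matI)
  fix i j assume "i < dim_row (0\<^sub>m p n :: 'k mat)" "j < dim_col (0\<^sub>m p n :: 'k mat)"
  then have ij: "i < p" "j < n" by simp_all
  have "T *\<^sub>v unit_vec n j = 0\<^sub>v p" using assms(2) by simp
  then have "(T *\<^sub>v unit_vec n j) $ i = 0" using ij by simp
  then show "T $$ (i, j) = 0\<^sub>m p n $$ (i, j)" using ij T by simp
qed (use T in simp_all)

text \<open>The kernel of an intertwiner is invariant and, for nonzero \<open>T\<close>, not
  everything.\<close>

lemma irr_kernel:
  fixes T :: "'k::field mat"
  assumes irr: "irr G n \<rho>" and T: "T \<in> carrier_mat p n" and M: "rep_dim G p M"
    and eq: "\<And>g. g \<in> carrier G \<Longrightarrow> M g * T = T * \<rho> g" and nz: "T \<noteq> 0\<^sub>m p n"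
    and v: "v \<in> carrier_vec n" "T *\<^sub>v v = 0\<^sub>v p"
  shows "v = 0\<^sub>v n"
proof -
  let ?U = "{v \<in> carrier_vec n. T *\<^sub>v v = 0\<^sub>v p}"
  have "?U = {0\<^sub>v n} \<or> ?U = carrier_vec n"
  proof (rule irr_invariant[OF irr])
    show "0\<^sub>v n \<in> ?U" using T by auto
    show "u + v \<in> ?U" if "u \<in> ?U" "v \<in> ?U" for u v
      using that T mult_add_distrib_mat_vec[OF T, of u v] by simp
    have "c \<cdot>\<^sub>v 0\<^sub>v p = (0\<^sub>v p :: 'k vec)" for c by (rule eq_vecI) simp_all
    then show "c \<cdot>\<^sub>v u \<in> ?U" if "u \<in> ?U" for c u
      using that T mult_mat_vec[OF T, of u c] by simp
    show "\<rho> g *\<^sub>v u \<in> ?U" if g: "g \<in> carrier G" and u: "u \<in> ?U" for g u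
    proof -
      note d = rep_dimD[OF irr_rep_dim[OF irr] g] rep_dimD[OF M g]
      have "T *\<^sub>v (\<rho> g *\<^sub>v u) = (T * \<rho> g) *\<^sub>v u" using T d u by simp
      also have "\<dots> = M g *\<^sub>v (T *\<^sub>v u)" unfolding eq[OF g, symmetric] using T d u by simp
      also have "\<dots> = 0\<^sub>v p" using u d by auto
      finally show ?thesis using d u by simp
    qed
  qed auto
  moreover have "?U \<noteq> carrier_vec n" using mult_unit_vec_zero[OF T] nz by blast
  ultimately show ?thesis using v by blast
qed

text \<open>Kernel and image are both invariant. A right inverse R is assembled from preimages of
  the unit vectors, and cancelling the injective \<open>S\<close> in S (R S) = S makes it
  two-sided.\<close>

lemma irr_schur:
  fixes S :: "'k::field mat"
  assumes \<rho>: "irr G n \<rho>" and \<sigma>: "irr G m \<sigma>" and S: "S \<in> carrier_mat m n"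
    and eq: "\<And>g. g \<in> carrier G \<Longrightarrow> \<sigma> g * S = S * \<rho> g" and nz: "S \<noteq> 0\<^sub>m m n"
  shows "rep_equiv G \<sigma> \<rho>"
proof -
  note inj = irr_kernel[OF \<rho> S irr_rep_dim[OF \<sigma>] eq nz]
  let ?U = "{S *\<^sub>v v | v. v \<in> carrier_vec n}"
  have "?U = {0\<^sub>v m} \<or> ?U = carrier_vec m"
  proof (rule irr_invariant[OF \<sigma>])
    show "?U \<subseteq> carrier_vec m" using S by auto
    have "0\<^sub>v m = S *\<^sub>v 0\<^sub>v n" using S by auto
    then show "0\<^sub>v m \<in> ?U" by (smt (verit) mem_Collect_eq zero_carrier_vec)
    show "u + v \<in> ?U" if uv: "u \<in> ?U" "v \<in> ?U" for u v
    proof -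
      from uv obtain a b where "a \<in> carrier_vec n" "b \<in> carrier_vec n" "u = S *\<^sub>v a" "v = S *\<^sub>v b" by auto
      then show ?thesis using mult_add_distrib_mat_vec[OF S, of a b] by (auto intro!: exI[of _ "a + b"])
    qed
    show "c \<cdot>\<^sub>v u \<in> ?U" if u: "u \<in> ?U" for c u
    proof -
      from u obtain a where "a \<in> carrier_vec n" "u = S *\<^sub>v a" by auto
      then show ?thesis using mult_mat_vec[OF S, of a c] by (auto intro!: exI[of _ "c \<cdot>\<^sub>v a"])
    qed
    show "\<sigma> g *\<^sub>v u \<in> ?U" if g: "g \<in> carrier G" and u: "u \<in> ?U" for g u
    proof -
      note d = rep_dimD[OF irr_rep_dim[OF \<rho>] g] rep_dimD[OF irr_rep_dim[OF \<sigma>] g]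
      from u obtain a where a: "a \<in> carrier_vec n" "u = S *\<^sub>v a" by auto
      have "\<sigma> g *\<^sub>v u = (\<sigma> g * S) *\<^sub>v a" using a d S by simp
      also have "\<dots> = S *\<^sub>v (\<rho> g *\<^sub>v a)" unfolding eq[OF g] using a d S by simp
      finally show ?thesis using a d by (auto intro!: exI[of _ "\<rho> g *\<^sub>v a"])
    qed
  qed
  moreover have "?U \<noteq> {0\<^sub>v m}"
  proof
    assume *: "?U = {0\<^sub>v m}"
    have "S = 0\<^sub>m m n" by (rule mult_unit_vec_zero[OF S]) (use * in blast)
    then show False using nz by simp
  qed
  ultimately have surj: "?U = carrier_vec m" by blast
  have "\<exists>w. w \<in> carrier_vec n \<and> S *\<^sub>v w = unit_vec m j" for j
  proof -
    have "unit_vec m j \<in> ?U" unfolding surj by simp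
    then show ?thesis by (smt (verit) mem_Collect_eq)
  qed
  then obtain w where w: "\<And>j. w j \<in> carrier_vec n" "\<And>j. S *\<^sub>v w j = unit_vec m j" by metis
  define R where "R = mat_of_cols n (map w [0..<m])"
  have R: "R \<in> carrier_mat n m" unfolding R_def by (intro carrier_matI) simp_all
  have SR: "S * R = 1\<^sub>m m"
  proof (rule mat_col_eqI)
    fix j assume "j < dim_col (1\<^sub>m m :: 'k mat)"
    then have j: "j < m" by simp
    have "col (S * R) j = S *\<^sub>v col R j" by (rule col_mult2[OF S R j])
    also have "col R j = w j" unfolding R_def using j w(1) by (subst col_mat_of_cols) simp_all
    finally show "col (S * R) j = col (1\<^sub>m m) j" using w j by simp
  qed (use S R in simp_all)
  have "S * (R * S) = (S * R) * S" by (rule assoc_mult_mat[OF S R S, symmetric])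
  also have "\<dots> = S * 1\<^sub>m n" using S SR by simp
  finally have SRS: "S * (R * S) = S * 1\<^sub>m n" .
  have RS: "R * S = 1\<^sub>m n"
    by (rule mat_cancel_left[OF S mult_carrier_mat[OF R S] one_carrier_mat _ SRS]) (rule inj)
  have "m = n" by (rule mat_dims_eq_of_inverse[OF S R SR RS])
  then show ?thesis
    using rep_equiv_intro[of G n \<sigma> \<rho> S R] irr_rep_dim[OF \<rho>] irr_rep_dim[OF \<sigma>] S R SR RS eq by simp
qed

text \<open>The projections to the head and to the tail of a block sum are themselves intertwiners;
  if both kill \<open>S\<close>, then \<open>S\<close> is zero.\<close>

lemma dsum_intertwiner_component:
  fixes S :: "'k::field mat"
  assumes "list_all2 (rep_dim G) ns \<rho>s" "S \<in> carrier_mat (sum_list ns) n" "rep_dim G n \<rho>"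
    "\<And>g. g \<in> carrier G \<Longrightarrow> dsum \<rho>s g * S = S * \<rho> g" "S \<noteq> 0\<^sub>m (sum_list ns) n"
  shows "\<exists>i<length \<rho>s. \<exists>S'\<in>carrier_mat (ns ! i) n. S' \<noteq> 0\<^sub>m (ns ! i) n \<and>
    (\<forall>g\<in>carrier G. (\<rho>s ! i) g * S' = S' * \<rho> g)"
  using assms
proof (induction arbitrary: S rule: list_all2_induct)
  case Nil
  then have "S = 0\<^sub>m 0 n" by (intro eq_matI) auto
  with Nil show ?case by simp
next
  case (Cons a ns \<sigma> \<rho>s)
  let ?q = "sum_list ns"
  have q: "rep_dim G ?q (dsum \<rho>s)" using rep_dim_dsum Cons(2) by blast
  have S: "S \<in> carrier_mat (a + ?q) n" using Cons.prems(1) by simp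
  define P where "P = (Matrix.mat a (a + ?q) (\<lambda>(i, j). if i = j then 1 else 0) :: 'k mat)"
  define Q where "Q = (Matrix.mat ?q (a + ?q) (\<lambda>(i, j). if i + a = j then 1 else 0) :: 'k mat)"
  have PQ: "P \<in> carrier_mat a (a + ?q)" "Q \<in> carrier_mat ?q (a + ?q)" by (simp_all add: P_def Q_def)
  have PS: "(P * S) $$ (i, j) = S $$ (i, j)" if "i < a" "j < n" for i j
    unfolding index_mult_mat_sum[OF PQ(1) S that]
    by (rule sum_single_eq[of i]) (use that in \<open>simp_all add: P_def\<close>)
  have QS: "(Q * S) $$ (i, j) = S $$ (i + a, j)" if "i < ?q" "j < n" for i j
    unfolding index_mult_mat_sum[OF PQ(2) S that]
    by (rule sum_single_eq[of "i + a"]) (use that in \<open>simp_all add: Q_def\<close>)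
  have comm: "\<sigma> g * P = P * dsum (\<sigma> # \<rho>s) g" "dsum \<rho>s g * Q = Q * dsum (\<sigma> # \<rho>s) g"
    if g: "g \<in> carrier G" for g
  proof -
    note d = rep_dimD[OF Cons(1) g] rep_dimD[OF q g]
    note dd = carrier_matD[OF d(1)] carrier_matD[OF d(2)]
    have D: "dsum (\<sigma> # \<rho>s) g = four_block_mat (\<sigma> g) (0\<^sub>m a ?q) (0\<^sub>m ?q a) (dsum \<rho>s g)"
      unfolding dsum_Cons[of \<sigma> \<rho>s] dsum_two dd ..
    have DC: "dsum (\<sigma> # \<rho>s) g \<in> carrier_mat (a + ?q) (a + ?q)" unfolding D using d by (rule four_block_carrier_mat)
    show "\<sigma> g * P = P * dsum (\<sigma> # \<rho>s) g"
    proof (rule eq_matI)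
      fix i j assume "i < dim_row (P * dsum (\<sigma> # \<rho>s) g)" "j < dim_col (P * dsum (\<sigma> # \<rho>s) g)"
      then have ij: "i < a" "j < a + ?q" using PQ DC by simp_all
      have "(P * dsum (\<sigma> # \<rho>s) g) $$ (i, j) = dsum (\<sigma> # \<rho>s) g $$ (i, j)"
        unfolding index_mult_mat_sum[OF PQ(1) DC ij]
        by (rule sum_single_eq[of i]) (use ij in \<open>simp_all add: P_def\<close>)
      also have "\<dots> = (if j < a then \<sigma> g $$ (i, j) else 0)" unfolding D using ij dd by simp
      also have "\<dots> = (\<sigma> g * P) $$ (i, j)"
      proof (cases "j < a")
        case c1: True
        show ?thesis unfolding index_mult_mat_sum[OF d(1) PQ(1) ij]
          by (rule sym, rule sum_single_eq[of j]) (use ij c1 in \<open>simp_all add: P_def\<close>)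
      next
        case False
        then show ?thesis unfolding index_mult_mat_sum[OF d(1) PQ(1) ij]
          using ij by (simp add: P_def)
      qed
      finally show "(\<sigma> g * P) $$ (i, j) = (P * dsum (\<sigma> # \<rho>s) g) $$ (i, j)" by simp
    qed (use PQ DC dd in simp_all)
    show "dsum \<rho>s g * Q = Q * dsum (\<sigma> # \<rho>s) g"
    proof (rule eq_matI)
      fix i j assume "i < dim_row (Q * dsum (\<sigma> # \<rho>s) g)" "j < dim_col (Q * dsum (\<sigma> # \<rho>s) g)"
      then have ij: "i < ?q" "j < a + ?q" using PQ DC by simp_all
      have "(Q * dsum (\<sigma> # \<rho>s) g) $$ (i, j) = dsum (\<sigma> # \<rho>s) g $$ (i + a, j)"
        unfolding index_mult_mat_sum[OF PQ(2) DC ij]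
        by (rule sum_single_eq[of "i + a"]) (use ij in \<open>simp_all add: Q_def\<close>)
      also have "\<dots> = (if j < a then 0 else dsum \<rho>s g $$ (i, j - a))" unfolding D using ij dd by simp
      also have "\<dots> = (dsum \<rho>s g * Q) $$ (i, j)"
      proof (cases "j < a")
        case c1: False
        show ?thesis unfolding index_mult_mat_sum[OF d(2) PQ(2) ij]
          by (rule sym, rule sum_single_eq[of "j - a"]) (use ij c1 in \<open>simp_all add: Q_def\<close>)
      next
        case True
        then show ?thesis unfolding index_mult_mat_sum[OF d(2) PQ(2) ij]
          using ij by (simp add: Q_def)
      qed
      finally show "(dsum \<rho>s g * Q) $$ (i, j) = (Q * dsum (\<sigma> # \<rho>s) g) $$ (i, j)" by simp
    qed (use PQ DC dd in simp_all)
  qed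
  have DC: "dsum (\<sigma> # \<rho>s) g \<in> carrier_mat (a + ?q) (a + ?q)" if g: "g \<in> carrier G" for g
    using rep_dimD[OF rep_dim_dsum2[OF Cons(1) q] g] dsum_Cons[of \<sigma> \<rho>s] by simp
  have iP: "\<sigma> g * (P * S) = (P * S) * \<rho> g" and iQ: "dsum \<rho>s g * (Q * S) = (Q * S) * \<rho> g"
    if g: "g \<in> carrier G" for g
  proof -
    note d = rep_dimD[OF Cons(1) g] rep_dimD[OF q g] rep_dimD[OF Cons.prems(2) g]
    have "\<sigma> g * (P * S) = (\<sigma> g * P) * S" using assoc_mult_mat[OF d(1) PQ(1) S] by simp
    also have "\<dots> = P * (dsum (\<sigma> # \<rho>s) g * S)"
      unfolding comm(1)[OF g] by (rule assoc_mult_mat[OF PQ(1) DC[OF g] S])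
    also have "\<dots> = (P * S) * \<rho> g"
      unfolding Cons.prems(3)[OF g] using assoc_mult_mat[OF PQ(1) S d(3)] by simp
    finally show "\<sigma> g * (P * S) = (P * S) * \<rho> g" .
    have "dsum \<rho>s g * (Q * S) = (dsum \<rho>s g * Q) * S" using assoc_mult_mat[OF d(2) PQ(2) S] by simp
    also have "\<dots> = Q * (dsum (\<sigma> # \<rho>s) g * S)"
      unfolding comm(2)[OF g] by (rule assoc_mult_mat[OF PQ(2) DC[OF g] S])
    also have "\<dots> = (Q * S) * \<rho> g"
      unfolding Cons.prems(3)[OF g] using assoc_mult_mat[OF PQ(2) S d(3)] by simp
    finally show "dsum \<rho>s g * (Q * S) = (Q * S) * \<rho> g" .
  qed
  have c: "P * S \<in> carrier_mat a n" "Q * S \<in> carrier_mat ?q n" using PQ S by auto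
  show ?case
  proof (cases "P * S = 0\<^sub>m a n")
    case False
    then show ?thesis using iP c(1) by (intro exI[of _ 0]) auto
  next
    case True
    have "Q * S \<noteq> 0\<^sub>m ?q n"
    proof
      assume z: "Q * S = 0\<^sub>m ?q n"
      have "S = 0\<^sub>m (a + ?q) n"
      proof (rule eq_matI)
        fix i j assume "i < dim_row (0\<^sub>m (a + ?q) n :: 'k mat)" "j < dim_col (0\<^sub>m (a + ?q) n :: 'k mat)"
        then have ij: "i < a + ?q" "j < n" by simp_all
        show "S $$ (i, j) = 0\<^sub>m (a + ?q) n $$ (i, j)"
        proof (cases "i < a")
          case True with \<open>P * S = _\<close> PS[of i j] ij show ?thesis by simp
        next
          case False with z QS[of "i - a" j] ij show ?thesis by simp
        qed
      qed (use S in simp_all)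
      then show False using Cons.prems(4) by simp
    qed
    from Cons.IH[OF c(2) Cons.prems(2) iQ this]
    obtain i S' where "i < length \<rho>s" "S' \<in> carrier_mat (ns ! i) n" "S' \<noteq> 0\<^sub>m (ns ! i) n"
      "\<forall>g\<in>carrier G. (\<rho>s ! i) g * S' = S' * \<rho> g" by auto
    then show ?thesis by (intro exI[of _ "Suc i"]) auto
  qed
qed

text \<open>Injective maps are joined one constituent at a time. If the new map \<open>T\<close>
  were not independent of the previous \<open>R\<close>, irreducibility would put its whole image
  inside that of \<open>R\<close>; the resulting factor is a nonzero intertwiner into the tail sum,
  and Schur's lemma contradicts inequivalence.\<close>

lemma multiplicity_free_sum:
  fixes M :: "('g, 'k::field) rep"
  assumes "list_all2 (irr G) ns \<rho>s" "sorted_wrt (\<lambda>\<rho> \<sigma>. \<not> rep_equiv G \<rho> \<sigma>) \<rho>s" and M: "rep_dim G p M"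
    and "\<And>i. i < length \<rho>s \<Longrightarrow> \<exists>T\<in>carrier_mat p (ns ! i). T \<noteq> 0\<^sub>m p (ns ! i) \<and>
      (\<forall>g\<in>carrier G. M g * T = T * (\<rho>s ! i) g)"
  shows "\<exists>R\<in>carrier_mat p (sum_list ns). (\<forall>g\<in>carrier G. M g * R = R * dsum \<rho>s g) \<and>
    (\<forall>v\<in>carrier_vec (sum_list ns). R *\<^sub>v v = 0\<^sub>v p \<longrightarrow> v = 0\<^sub>v (sum_list ns))"
  using assms(1,2,4)
proof (induction rule: list_all2_induct)
  case Nil
  show ?case
  proof (intro bexI[of _ "0\<^sub>m p 0"] conjI ballI impI)
    fix g assume "g \<in> carrier G"
    then show "M g * 0\<^sub>m p 0 = 0\<^sub>m p 0 * dsum [] g"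
      using rep_dimD[OF M] by (intro eq_matI) (auto simp: dsum_Nil)
  qed auto
next
  case (Cons n ns \<rho> \<rho>s)
  let ?q = "sum_list ns"
  have tail: "\<exists>T\<in>carrier_mat p (ns ! i). T \<noteq> 0\<^sub>m p (ns ! i) \<and> (\<forall>g\<in>carrier G. M g * T = T * (\<rho>s ! i) g)"
    if "i < length \<rho>s" for i using Cons.prems(2)[of "Suc i"] that by simp
  have "sorted_wrt (\<lambda>\<rho> \<sigma>. \<not> rep_equiv G \<rho> \<sigma>) \<rho>s" using Cons.prems(1) by simp
  from Cons.IH[OF this tail] obtain R where R: "R \<in> carrier_mat p ?q"
    and Req: "\<And>g. g \<in> carrier G \<Longrightarrow> M g * R = R * dsum \<rho>s g"
    and Rinj: "\<And>v. v \<in> carrier_vec ?q \<Longrightarrow> R *\<^sub>v v = 0\<^sub>v p \<Longrightarrow> v = 0\<^sub>v ?q" by blast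
  obtain T where T: "T \<in> carrier_mat p n" and Tnz: "T \<noteq> 0\<^sub>m p n"
    and Teq: "\<And>g. g \<in> carrier G \<Longrightarrow> M g * T = T * \<rho> g" using Cons.prems(2)[of 0] by auto
  note irr = Cons.hyps(1)
  have dims: "list_all2 (rep_dim G) ns \<rho>s"
    using Cons.hyps(2) by (rule list_all2_mono) (rule irr_rep_dim)
  have q: "rep_dim G ?q (dsum \<rho>s)" by (rule rep_dim_dsum[OF dims])
  \<comment> \<open>The vectors that \<open>T\<close> sends into the range of \<open>R\<close>;
    invariance leaves only zero or everything.\<close>
  let ?U = "{v \<in> carrier_vec n. \<exists>w\<in>carrier_vec ?q. T *\<^sub>v v + R *\<^sub>v w = 0\<^sub>v p}"
  have "?U = {0\<^sub>v n} \<or> ?U = carrier_vec n"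
  proof (rule irr_invariant[OF irr])
    have "T *\<^sub>v 0\<^sub>v n + R *\<^sub>v 0\<^sub>v ?q = 0\<^sub>v p" using T R by (intro eq_vecI) auto
    then show "0\<^sub>v n \<in> ?U" by (auto intro!: bexI[of _ "0\<^sub>v ?q"])
    show "u + v \<in> ?U" if uv: "u \<in> ?U" "v \<in> ?U" for u v
    proof -
      from uv obtain a b where ab: "u \<in> carrier_vec n" "v \<in> carrier_vec n" "a \<in> carrier_vec ?q" "b \<in> carrier_vec ?q"
        "T *\<^sub>v u + R *\<^sub>v a = 0\<^sub>v p" "T *\<^sub>v v + R *\<^sub>v b = 0\<^sub>v p" by auto
      note c = mult_mat_vec_carrier[OF T ab(1)] mult_mat_vec_carrier[OF T ab(2)]
        mult_mat_vec_carrier[OF R ab(3)] mult_mat_vec_carrier[OF R ab(4)]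
      have "T *\<^sub>v (u + v) + R *\<^sub>v (a + b) = (T *\<^sub>v u + T *\<^sub>v v) + (R *\<^sub>v a + R *\<^sub>v b)"
        using mult_add_distrib_mat_vec[OF T ab(1,2)] mult_add_distrib_mat_vec[OF R ab(3,4)] by simp
      also have "\<dots> = (T *\<^sub>v u + R *\<^sub>v a) + (T *\<^sub>v v + R *\<^sub>v b)"
        using c by (intro eq_vecI) auto
      also have "\<dots> = 0\<^sub>v p" using ab by simp
      finally show ?thesis using ab(1-4) by (auto intro!: bexI[of _ "a + b"])
    qed
    show "c \<cdot>\<^sub>v u \<in> ?U" if u: "u \<in> ?U" for c u
    proof -
      from u obtain a where a: "u \<in> carrier_vec n" "a \<in> carrier_vec ?q" "T *\<^sub>v u + R *\<^sub>v a = 0\<^sub>v p" by auto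
      note cc = mult_mat_vec_carrier[OF T a(1)] mult_mat_vec_carrier[OF R a(2)]
      have "T *\<^sub>v (c \<cdot>\<^sub>v u) + R *\<^sub>v (c \<cdot>\<^sub>v a) = c \<cdot>\<^sub>v (T *\<^sub>v u + R *\<^sub>v a)"
        unfolding mult_mat_vec[OF T a(1)] mult_mat_vec[OF R a(2)]
        by (rule smult_add_distrib_vec[OF cc, symmetric])
      also have "\<dots> = 0\<^sub>v p" unfolding a(3) by (intro eq_vecI) auto
      finally show ?thesis using a(1,2) by (auto intro!: bexI[of _ "c \<cdot>\<^sub>v a"])
    qed
    show "\<rho> g *\<^sub>v u \<in> ?U" if g: "g \<in> carrier G" and u: "u \<in> ?U" for g u
    proof -
      note d = rep_dimD[OF irr_rep_dim[OF irr] g] rep_dimD[OF M g] rep_dimD[OF q g]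
      from u obtain a where a: "u \<in> carrier_vec n" "a \<in> carrier_vec ?q" "T *\<^sub>v u + R *\<^sub>v a = 0\<^sub>v p" by auto
      have "T *\<^sub>v (\<rho> g *\<^sub>v u) = (T * \<rho> g) *\<^sub>v u"
        using assoc_mult_mat_vec[OF T d(1) a(1)] by simp
      also have "\<dots> = M g *\<^sub>v (T *\<^sub>v u)"
        unfolding Teq[OF g, symmetric] by (rule assoc_mult_mat_vec[OF d(2) T a(1)])
      finally have 1: "T *\<^sub>v (\<rho> g *\<^sub>v u) = M g *\<^sub>v (T *\<^sub>v u)" .
      have "R *\<^sub>v (dsum \<rho>s g *\<^sub>v a) = (R * dsum \<rho>s g) *\<^sub>v a"
        using assoc_mult_mat_vec[OF R d(3) a(2)] by simp
      also have "\<dots> = M g *\<^sub>v (R *\<^sub>v a)"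
        unfolding Req[OF g, symmetric] by (rule assoc_mult_mat_vec[OF d(2) R a(2)])
      finally have 2: "R *\<^sub>v (dsum \<rho>s g *\<^sub>v a) = M g *\<^sub>v (R *\<^sub>v a)" .
      have "T *\<^sub>v (\<rho> g *\<^sub>v u) + R *\<^sub>v (dsum \<rho>s g *\<^sub>v a) = M g *\<^sub>v (T *\<^sub>v u + R *\<^sub>v a)"
        unfolding 1 2
        by (rule mult_add_distrib_mat_vec[OF d(2) mult_mat_vec_carrier[OF T a(1)] mult_mat_vec_carrier[OF R a(2)], symmetric])
      also have "\<dots> = 0\<^sub>v p" unfolding a(3) using d(2) by (intro eq_vecI) auto
      finally show ?thesis
        using mult_mat_vec_carrier[OF d(1) a(1)] mult_mat_vec_carrier[OF d(3) a(2)] by blast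
    qed
  qed auto
  moreover have "?U \<noteq> carrier_vec n"
  proof
    assume full: "?U = carrier_vec n"
    have "\<exists>w. w \<in> carrier_vec ?q \<and> T *\<^sub>v unit_vec n j + R *\<^sub>v w = 0\<^sub>v p" for j
    proof -
      have "unit_vec n j \<in> ?U" unfolding full by simp
      then show ?thesis by blast
    qed
    then obtain w where w: "\<And>j. w j \<in> carrier_vec ?q" "\<And>j. T *\<^sub>v unit_vec n j + R *\<^sub>v w j = 0\<^sub>v p" by metis
    \<comment> \<open>The columns w j solve R (w j) = -T e_j, so R S = -T. Injectivity of
      \<open>R\<close> then makes \<open>S\<close> commute with the group.\<close>
    define S where "S = mat_of_cols ?q (map w [0..<n])"
    have S: "S \<in> carrier_mat ?q n" unfolding S_def by (intro carrier_matI) simp_all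
    have RS: "R * S = - T"
    proof (rule mat_col_eqI)
      fix j assume "j < dim_col (- T)"
      then have j: "j < n" using T by simp
      have "col (R * S) j = R *\<^sub>v col S j" by (rule col_mult2[OF R S j])
      also have "col S j = w j" unfolding S_def using j w(1) by (subst col_mat_of_cols) simp_all
      also have "R *\<^sub>v w j = - (T *\<^sub>v unit_vec n j)"
      proof (rule eq_vecI)
        fix i assume "i < dim_vec (- (T *\<^sub>v unit_vec n j))"
        then have i: "i < p" using T by simp
        have "(T *\<^sub>v unit_vec n j + R *\<^sub>v w j) $ i = 0" unfolding w(2) using i by simp
        then have "(T *\<^sub>v unit_vec n j) $ i + (R *\<^sub>v w j) $ i = 0"
          using i carrier_matD[OF R] by (simp del: index_mult_mat_vec)
        then show "(R *\<^sub>v w j) $ i = (- (T *\<^sub>v unit_vec n j)) $ i"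
          using i carrier_matD[OF T] by (simp add: add_eq_0_iff del: index_mult_mat_vec)
      qed (use T R in simp)
      also have "- (T *\<^sub>v unit_vec n j) = col (- T) j"
        using j T by (intro eq_vecI) simp_all
      finally show "col (R * S) j = col (- T) j" .
    qed (use T R S in simp_all)
    have Seq: "dsum \<rho>s g * S = S * \<rho> g" if g: "g \<in> carrier G" for g
    proof -
      note d = rep_dimD[OF irr_rep_dim[OF irr] g] rep_dimD[OF M g] rep_dimD[OF q g]
      have "R * (dsum \<rho>s g * S) = (R * dsum \<rho>s g) * S" by (rule assoc_mult_mat[OF R d(3) S, symmetric])
      also have "\<dots> = M g * (R * S)" unfolding Req[OF g, symmetric] by (rule assoc_mult_mat[OF d(2) R S])
      also have "\<dots> = - (M g * T)" unfolding RS using d(2) T by simp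
      also have "\<dots> = (R * S) * \<rho> g" unfolding Teq[OF g] RS using d(1) T by simp
      also have "\<dots> = R * (S * \<rho> g)" by (rule assoc_mult_mat[OF R S d(1)])
      finally show ?thesis
        by (rule mat_cancel_left[OF R mult_carrier_mat[OF d(3) S] mult_carrier_mat[OF S d(1)] Rinj, rotated -1])
    qed
    have "S \<noteq> 0\<^sub>m ?q n"
    proof
      assume "S = 0\<^sub>m ?q n"
      then have z: "- T = 0\<^sub>m p n" using RS R by simp
      have "T = 0\<^sub>m p n"
      proof (rule eq_matI)
        fix i j assume "i < dim_row (0\<^sub>m p n :: 'k mat)" "j < dim_col (0\<^sub>m p n :: 'k mat)"
        then have ij: "i < p" "j < n" by simp_all
        then have "(- T) $$ (i, j) = 0" unfolding z by simp
        then show "T $$ (i, j) = 0\<^sub>m p n $$ (i, j)" using ij carrier_matD[OF T] by simp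
      qed (use T in simp_all)
      with Tnz show False by simp
    qed
    from dsum_intertwiner_component[OF dims S irr_rep_dim[OF irr] Seq this]
    obtain i S' where i: "i < length \<rho>s" "S' \<in> carrier_mat (ns ! i) n" "S' \<noteq> 0\<^sub>m (ns ! i) n"
      "\<And>g. g \<in> carrier G \<Longrightarrow> (\<rho>s ! i) g * S' = S' * \<rho> g" by blast
    have "irr G (ns ! i) (\<rho>s ! i)" using Cons.hyps(2) i(1) by (simp add: list_all2_conv_all_nth)
    from rep_equiv_sym[OF irr_schur[OF irr this i(2) i(4) i(3)]]
    have "rep_equiv G \<rho> (\<rho>s ! i)" .
    with Cons.prems(1) i(1) show False by simp
  qed
  ultimately have U: "?U = {0\<^sub>v n}" by blast
  \<comment> \<open>The juxtaposition of \<open>T\<close> and \<open>R\<close>, written as four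
    blocks with an empty lower row so that the block product rule applies.\<close>
  let ?X = "four_block_mat T R (0\<^sub>m 0 n) (0\<^sub>m 0 ?q)"
  have X: "?X \<in> carrier_mat p (n + ?q)" using four_block_carrier_mat[OF T zero_carrier_mat[of 0 ?q], of R "0\<^sub>m 0 n"] by simp
  show ?case
  proof (intro bexI[of _ ?X] conjI ballI impI)
    show "?X \<in> carrier_mat p (sum_list (n # ns))" using X by simp
    fix g assume g: "g \<in> carrier G"
    note d = rep_dimD[OF irr_rep_dim[OF irr] g] rep_dimD[OF M g] rep_dimD[OF q g]
    have D: "dsum (\<rho> # \<rho>s) g = four_block_mat (\<rho> g) (0\<^sub>m n ?q) (0\<^sub>m ?q n) (dsum \<rho>s g)"
      unfolding dsum_Cons[of \<rho> \<rho>s] dsum_two carrier_matD[OF d(1)] carrier_matD[OF d(3)] ..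
    have M4: "M g = four_block_mat (M g) (0\<^sub>m p 0) (0\<^sub>m 0 p) (0\<^sub>m 0 0)"
      using d(2) by (intro eq_matI) auto
    have "M g * ?X = four_block_mat (M g * T + 0\<^sub>m p 0 * 0\<^sub>m 0 n) (M g * R + 0\<^sub>m p 0 * 0\<^sub>m 0 ?q)
       (0\<^sub>m 0 p * T + 0\<^sub>m 0 0 * 0\<^sub>m 0 n) (0\<^sub>m 0 p * R + 0\<^sub>m 0 0 * 0\<^sub>m 0 ?q)"
      by (subst M4, rule mult_four_block_mat[OF d(2) zero_carrier_mat[of p 0] zero_carrier_mat[of 0 p] zero_carrier_mat[of 0 0] T R]) simp_all
    also have "\<dots> = four_block_mat (T * \<rho> g) (R * dsum \<rho>s g) (0\<^sub>m 0 n) (0\<^sub>m 0 ?q)"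
      using mult_carrier_mat[OF T d(1)] mult_carrier_mat[OF R d(3)] T R
      by (intro cong_four_block_mat) (simp_all add: Teq[OF g] Req[OF g])
    also have "\<dots> = four_block_mat (T * \<rho> g + R * 0\<^sub>m ?q n) (T * 0\<^sub>m n ?q + R * dsum \<rho>s g)
       (0\<^sub>m 0 n * \<rho> g + 0\<^sub>m 0 ?q * 0\<^sub>m ?q n) (0\<^sub>m 0 n * 0\<^sub>m n ?q + 0\<^sub>m 0 ?q * dsum \<rho>s g)"
      using mult_carrier_mat[OF T d(1)] mult_carrier_mat[OF R d(3)] T R d
      by (intro cong_four_block_mat) simp_all
    also have "\<dots> = ?X * dsum (\<rho> # \<rho>s) g"
      unfolding D by (rule mult_four_block_mat[OF T R zero_carrier_mat[of 0 n] zero_carrier_mat[of 0 ?q] d(1) _ _ d(3), symmetric]) simp_all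
    finally show "M g * ?X = ?X * dsum (\<rho> # \<rho>s) g" .
  next
    fix v assume v: "v \<in> carrier_vec (sum_list (n # ns))" "?X *\<^sub>v v = 0\<^sub>v p"
    define a where "a = vec_first v n" 
    define b where "b = vec_last v ?q"
    have ab: "a \<in> carrier_vec n" "b \<in> carrier_vec ?q" by (simp_all add: a_def b_def)
    have vab: "v = a @\<^sub>v b" using v(1) by (simp add: a_def b_def)
    have c: "T *\<^sub>v a + R *\<^sub>v b \<in> carrier_vec p" using T R ab by auto
    have "?X *\<^sub>v v = (T *\<^sub>v a + R *\<^sub>v b) @\<^sub>v (0\<^sub>m 0 n *\<^sub>v a + 0\<^sub>m 0 ?q *\<^sub>v b)"
      unfolding vab by (rule four_block_mat_mult_vec[OF T R zero_carrier_mat[of 0 n] zero_carrier_mat[of 0 ?q] ab])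
    then have "(T *\<^sub>v a + R *\<^sub>v b) @\<^sub>v (0\<^sub>m 0 n *\<^sub>v a + 0\<^sub>m 0 ?q *\<^sub>v b) = 0\<^sub>v p" using v(2) by simp
    then have z: "T *\<^sub>v a + R *\<^sub>v b = 0\<^sub>v p"
    proof -
      assume e: "(T *\<^sub>v a + R *\<^sub>v b) @\<^sub>v (0\<^sub>m 0 n *\<^sub>v a + 0\<^sub>m 0 ?q *\<^sub>v b) = 0\<^sub>v p"
      show ?thesis
      proof (rule eq_vecI)
        fix i assume "i < dim_vec (0\<^sub>v p :: 'k vec)"
        then have i: "i < p" by simp
        then have "((T *\<^sub>v a + R *\<^sub>v b) @\<^sub>v (0\<^sub>m 0 n *\<^sub>v a + 0\<^sub>m 0 ?q *\<^sub>v b)) $ i = 0" unfolding e by simp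
        then show "(T *\<^sub>v a + R *\<^sub>v b) $ i = 0\<^sub>v p $ i" using i carrier_matD[OF R] by (simp add: index_append_vec)
      qed (use carrier_matD[OF R] in simp)
    qed
    then have "a \<in> ?U" using ab by blast
    then have a0: "a = 0\<^sub>v n" using U by blast
    have "T *\<^sub>v 0\<^sub>v n = 0\<^sub>v p" using T by (intro eq_vecI) auto
    then have "R *\<^sub>v b = 0\<^sub>v p" using z mult_mat_vec_carrier[OF R ab(2)] by (simp add: a0)
    then have "b = 0\<^sub>v ?q" by (rule Rinj[OF ab(2)])
    then show "v = 0\<^sub>v (sum_list (n # ns))" unfolding vab a0 by (intro eq_vecI) (auto simp: index_append_vec)
  qed
qed

text \<open>When the dimensions exhaust p, the injective map is square. This takes the place of
  complete reducibility.\<close>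

lemma multiplicity_free_equiv:
  fixes M :: "('g, 'k::field) rep"
  assumes "list_all2 (irr G) ns \<rho>s" "sorted_wrt (\<lambda>\<rho> \<sigma>. \<not> rep_equiv G \<rho> \<sigma>) \<rho>s" "rep_dim G p M"
    "\<And>i. i < length \<rho>s \<Longrightarrow> \<exists>T\<in>carrier_mat p (ns ! i). T \<noteq> 0\<^sub>m p (ns ! i) \<and>
      (\<forall>g\<in>carrier G. M g * T = T * (\<rho>s ! i) g)" "sum_list ns = p"
  shows "rep_equiv G M (dsum \<rho>s)"
proof -
  from multiplicity_free_sum[OF assms(1-4)] assms(5)
  obtain R where "R \<in> carrier_mat p p" "\<And>g. g \<in> carrier G \<Longrightarrow> M g * R = R * dsum \<rho>s g"
    "\<And>v. v \<in> carrier_vec p \<Longrightarrow> R *\<^sub>v v = 0\<^sub>v p \<Longrightarrow> v = 0\<^sub>v p" by blast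
  moreover have "rep_dim G p (dsum \<rho>s)"
    using rep_dim_dsum[OF list_all2_mono[OF assms(1) irr_rep_dim]] assms(5) by simp
  ultimately show ?thesis using rep_equiv_intertwiner[OF assms(3)] by blast
qed

lemma is_rep_mult: "is_rep G n \<rho> \<Longrightarrow> g \<in> carrier G \<Longrightarrow> h \<in> carrier G \<Longrightarrow> \<rho> (g \<otimes>\<^bsub>G\<^esub> h) = \<rho> g * \<rho> h"
  by (simp add: is_rep_def)

lemma is_rep_carrier: "is_rep G n \<rho> \<Longrightarrow> g \<in> carrier G \<Longrightarrow> \<rho> g \<in> carrier_mat n n"
  by (simp add: is_rep_def)

lemma is_rep_one: "is_rep G n \<rho> \<Longrightarrow> \<rho> \<one>\<^bsub>G\<^esub> = 1\<^sub>m n"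
  by (simp add: is_rep_def)

context finite_subgroup begin

text \<open>Frobenius reciprocity in terms of rows: \<open>w\<close> is an eigenvector of the
  transposed matrices because the intertwiner stands to the left of \<open>\<rho> g\<close>.\<close>

lemma frobenius:
  fixes \<rho> :: "('a, 'k::field) rep"
  assumes \<rho>: "is_rep G n \<rho>" and w: "w \<in> carrier_vec n" "w \<noteq> 0\<^sub>v n"
    and ev: "\<And>h. h \<in> H \<Longrightarrow> (\<rho> h)\<^sup>T *\<^sub>v w = \<psi> h \<cdot>\<^sub>v w"
  shows "\<exists>T\<in>carrier_mat m n. T \<noteq> 0\<^sub>m m n \<and> (\<forall>g\<in>carrier G. Ind G H (char_rep \<psi>) g * T = T * \<rho> g)"
proof -
  define F where "F x = (\<rho> x)\<^sup>T *\<^sub>v w" for x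
  define T where "T = Matrix.mat m n (\<lambda>(i, j). F (inv (ts ! i)) $ j)"
  have rd: "rep_dim G n \<rho>" using \<rho> by (simp add: is_rep_def rep_dim_def)
  have tc: "(\<rho> x)\<^sup>T \<in> carrier_mat n n" if "x \<in> carrier G" for x using is_rep_carrier[OF \<rho> that] by simp
  have F: "F x \<in> carrier_vec n" if "x \<in> carrier G" for x
    unfolding F_def using tc[OF that] w(1) by (rule mult_mat_vec_carrier)
  have F4: "F (x \<otimes> g) = (\<rho> g)\<^sup>T *\<^sub>v F x" if "x \<in> carrier G" "g \<in> carrier G" for x g
    unfolding F_def is_rep_mult[OF \<rho> that] transpose_mult[OF is_rep_carrier[OF \<rho> that(1)] is_rep_carrier[OF \<rho> that(2)]]
    by (rule assoc_mult_mat_vec[OF tc[OF that(2)] tc[OF that(1)] w(1)])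
  have F3: "F (h \<otimes> x) = \<psi> h \<cdot>\<^sub>v F x" if "h \<in> H" "x \<in> carrier G" for h x
  proof -
    have "F (h \<otimes> x) = (\<rho> x)\<^sup>T *\<^sub>v (\<psi> h \<cdot>\<^sub>v w)"
      using F4[OF H_carrier[OF that(1)] that(2)] ev[OF that(1)] by (simp add: F_def)
    then show ?thesis using mult_mat_vec[OF tc[OF that(2)] w(1)] by (simp add: F_def)
  qed
  have T: "T \<in> carrier_mat m n" by (simp add: T_def)
  have "T \<noteq> 0\<^sub>m m n"
  proof
    assume z: "T = 0\<^sub>m m n"
    \<comment> \<open>A zero matrix kills \<open>F\<close> at the inverse of a representative;
      translating by that representative kills \<open>F\<close> at the identity, where its value is
      \<open>w\<close>.\<close>
    obtain i where i: "i < m" using t_ex1[OF one_closed] by blast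
    have "F (inv (ts ! i)) = 0\<^sub>v n"
    proof (rule eq_vecI)
      fix j assume "j < dim_vec (0\<^sub>v n :: 'k vec)"
      then have j: "j < n" by simp
      have "F (inv (ts ! i)) $ j = T $$ (i, j)" using i j by (simp add: T_def)
      then show "F (inv (ts ! i)) $ j = 0\<^sub>v n $ j" using i j by (simp add: z)
    qed (use F[of "inv (ts ! i)"] i in simp)
    then have "F (inv (ts ! i) \<otimes> ts ! i) = (\<rho> (ts ! i))\<^sup>T *\<^sub>v 0\<^sub>v n"
      using F4[of "inv (ts ! i)" "ts ! i"] i by simp
    also have "\<dots> = 0\<^sub>v n" using tc[of "ts ! i"] i by (intro eq_vecI) auto
    finally have "F \<one> = 0\<^sub>v n" using i by simp
    moreover have "F \<one> = w" using w(1) by (simp add: F_def is_rep_one[OF \<rho>])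
    ultimately show False using w(2) by simp
  qed
  moreover have "Ind G H (char_rep \<psi>) g * T = T * \<rho> g" if "g \<in> carrier G" for g
    by (rule Ind_intertwiner[OF rd F F3 F4 T_def that])
  ultimately show ?thesis using T by blast
qed

end

section \<open>Eigenvalues and character values\<close>

lemma algebraic_int_of_int_span:
  fixes v :: "nat \<Rightarrow> complex" and a :: "nat \<Rightarrow> nat \<Rightarrow> int"
  assumes "i0 < d" "v i0 \<noteq> 0" "\<And>i. i < d \<Longrightarrow> z * v i = (\<Sum>j<d. of_int (a i j) * v j)"
  shows "algebraic_int z"
proof -
  \<comment> \<open>The number z is an eigenvalue of this integer matrix, whose characteristic
    polynomial is monic with integer coefficients.\<close>
  define A where "A = Matrix.mat d d (\<lambda>(i, j). a i j)"
  have A: "A \<in> carrier_mat d d" by (simp add: A_def)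
  define B where "B = (map_mat of_int A :: complex mat)"
  have B: "B \<in> carrier_mat d d" using A by (simp add: B_def)
  let ?v = "Matrix.vec d v"
  have "?v \<noteq> 0\<^sub>v d"
  proof
    assume "?v = 0\<^sub>v d"
    then have "?v $ i0 = 0" using assms(1) by simp
    then show False using assms(1,2) by simp
  qed
  moreover have "B *\<^sub>v ?v = z \<cdot>\<^sub>v ?v"
  proof (rule eq_vecI)
    fix i assume "i < dim_vec (z \<cdot>\<^sub>v ?v)"
    then have i: "i < d" by simp
    have "(B *\<^sub>v ?v) $ i = (\<Sum>j<d. B $$ (i, j) * ?v $ j)"
      by (rule index_mult_mat_vec_sum[OF B _ i]) simp
    also have "\<dots> = z * v i" unfolding assms(3)[OF i] using i by (simp add: B_def A_def)
    finally show "(B *\<^sub>v ?v) $ i = (z \<cdot>\<^sub>v ?v) $ i" using i by simp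
  qed (use B in simp)
  ultimately have "eigenvalue B z"
    unfolding eigenvalue_def eigenvector_def using B by (intro exI[of _ ?v]) simp
  then have "poly (char_poly B) z = 0" using eigenvalue_root_char_poly[OF B] by simp
  moreover have "char_poly B = map_poly of_int (char_poly A)"
    unfolding B_def by (rule of_int_hom.char_poly_hom[OF A])
  moreover have "lead_coeff (char_poly A) = 1" using degree_monic_char_poly[OF A] by simp
  ultimately show ?thesis unfolding algebraic_int_altdef_ipoly by metis
qed

text \<open>Eisenstein's argument for the minimal polynomial of \<open>\<zeta> - 1\<close>.\<close>

lemma prime_root_of_unity_independent:
  fixes \<zeta> :: complex and c :: "nat \<Rightarrow> int"
  assumes N: "prime N" and \<zeta>: "\<zeta> ^ N = 1" "\<zeta> \<noteq> 1"
    and c: "(\<Sum>i<N - 1. of_int (c i) * (\<zeta> - 1) ^ i) = 0" and i: "i < N - 1"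
  shows "c i = 0"
proof -
  define d where "d = N - 1"
  have N1: "N > 1" using N by (rule prime_gt_1_nat)
  have Nd: "N = Suc d" "d > 0" using N1 by (simp_all add: d_def)
  define y where "y = \<zeta> - 1"
  have y0: "y \<noteq> 0" using \<zeta>(2) by (simp add: y_def)
  \<comment> \<open>The ring generated by y, as the integer span of d powers; closure under
    multiplication by y rests on the formula \<open>yd\<close> for y^d.\<close>
  define S where "S = {z. \<exists>c :: nat \<Rightarrow> int. z = (\<Sum>i<d. of_int (c i) * y ^ i)}"
  have SI: "(\<Sum>i<d. of_int (c i) * y ^ i) \<in> S" for c :: "nat \<Rightarrow> int" unfolding S_def by blast
  have S_add: "a + b \<in> S" if "a \<in> S" "b \<in> S" for a b
  proof -
    from that obtain e f :: "nat \<Rightarrow> int" where "a = (\<Sum>i<d. of_int (e i) * y ^ i)" "b = (\<Sum>i<d. of_int (f i) * y ^ i)"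
      unfolding S_def by blast
    then have "a + b = (\<Sum>i<d. of_int (e i + f i) * y ^ i)" by (simp add: sum.distrib algebra_simps)
    then show ?thesis using SI[of "\<lambda>i. e i + f i"] by simp
  qed
  have S_int: "of_int k * a \<in> S" if "a \<in> S" for a k
  proof -
    from that obtain e :: "nat \<Rightarrow> int" where "a = (\<Sum>i<d. of_int (e i) * y ^ i)" unfolding S_def by blast
    then have "of_int k * a = (\<Sum>i<d. of_int (k * e i) * y ^ i)" by (simp add: sum_distrib_left algebra_simps)
    then show ?thesis using SI[of "\<lambda>i. k * e i"] by simp
  qed
  have S_pow: "y ^ j \<in> S" if "j < d" for j
  proof -
    have "(\<Sum>i<d. of_int (if i = j then 1 else 0) * y ^ i) = y ^ j"
      by (rule sum_single_eq[OF that]) auto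
    then show ?thesis using SI[of "\<lambda>i. if i = j then 1 else 0"] by simp
  qed
  have S_sum: "(\<Sum>i<n. f i) \<in> S" if "\<And>i. i < n \<Longrightarrow> f i \<in> S" for f and n :: nat
    using that
  proof (induction n)
    case 0
    show ?case using SI[of "\<lambda>_. 0"] by simp
  next
    case (Suc n) then show ?case using S_add by simp
  qed
  define b where "b i = int (N choose Suc i) div int N" for i
  have b: "int (N choose Suc i) = int N * b i" if "i < d" for i
  proof -
    have "N dvd (N choose Suc i)" using N that Nd by (intro dvd_choose_prime) auto
    then have "int N dvd int (N choose Suc i)" by simp
    then show ?thesis unfolding b_def by simp
  qed
  \<comment> \<open>Expand (1 + y)^N = 1 and divide by y. All coefficients except the leading one
    are divisible by N.\<close>
  have E: "(\<Sum>i<N. of_nat (N choose Suc i) * y ^ i) = 0"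
  proof -
    have "(y + 1) ^ N = 1" using \<zeta>(1) by (simp add: y_def)
    then have "(\<Sum>k\<le>N. of_nat (N choose k) * y ^ k) = 1" by (subst (asm) binomial_ring) simp
    then have "(\<Sum>k<N. of_nat (N choose Suc k) * y ^ Suc k) = 0"
      using sum.atMost_shift[of "\<lambda>k. of_nat (N choose k) * y ^ k" N] by simp
    then have "y * (\<Sum>i<N. of_nat (N choose Suc i) * y ^ i) = 0"
      by (simp add: sum_distrib_left mult_ac)
    then show ?thesis using y0 by simp
  qed
  define r where "r = (\<Sum>i<d. of_int (- b i) * y ^ i)"
  have rS: "r \<in> S" unfolding r_def by (rule SI)
  have yd: "y ^ d = of_nat N * r"
  proof -
    have "(\<Sum>i<N. of_nat (N choose Suc i) * y ^ i) =
        of_nat (N choose N) * y ^ d + (\<Sum>i<d. of_nat (N choose Suc i) * y ^ i)"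
      by (subst (1) Nd(1), subst sum.lessThan_Suc) (simp only: Nd(1) add.commute)
    then have "y ^ d + (\<Sum>i<d. of_nat (N choose Suc i) * y ^ i) = 0"
      unfolding E by (simp only: binomial_n_n of_nat_1 mult_1)
    also have "(\<Sum>i<d. of_nat (N choose Suc i) * y ^ i) = - of_nat N * r"
      unfolding r_def sum_distrib_left
    proof (rule sum.cong[OF refl])
      fix i assume "i \<in> {..<d}"
      then have "(of_nat (N choose Suc i) :: complex) = of_nat N * of_int (b i)"
        using b[of i] by (metis lessThan_iff of_int_mult of_int_of_nat_eq)
      then show "of_nat (N choose Suc i) * y ^ i = - of_nat N * (of_int (- b i) * y ^ i)" by simp
    qed
    finally show ?thesis by (simp add: add_eq_0_iff)
  qed
  have S_y: "y * a \<in> S" if "a \<in> S" for a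
  proof -
    from that obtain e :: "nat \<Rightarrow> int" where e: "a = (\<Sum>i<d. of_int (e i) * y ^ i)" unfolding S_def by blast
    have "y * a = (\<Sum>i<d. of_int (e i) * y ^ Suc i)" unfolding e by (simp add: sum_distrib_left mult_ac)
    also have "\<dots> \<in> S"
    proof (rule S_sum)
      fix i assume "i < d"
      have "y ^ Suc i \<in> S"
      proof (cases "Suc i < d")
        case False
        with \<open>i < d\<close> have "Suc i = d" by simp
        then show ?thesis using yd S_int[OF rS, of "int N"] by simp
      qed (rule S_pow)
      then show "of_int (e i) * y ^ Suc i \<in> S" by (rule S_int)
    qed
    finally show ?thesis .
  qed
  have S_yk: "y ^ k * a \<in> S" if "a \<in> S" for k a
    using that by (induction k) (simp_all add: S_y mult.assoc)
  have S_mult: "a * z \<in> S" if "a \<in> S" "z \<in> S" for a z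
  proof -
    from that(1) obtain e :: "nat \<Rightarrow> int" where e: "a = (\<Sum>i<d. of_int (e i) * y ^ i)" unfolding S_def by blast
    have "a * z = (\<Sum>i<d. of_int (e i) * (y ^ i * z))" unfolding e by (simp only: sum_distrib_right mult.assoc)
    also have "\<dots> \<in> S" by (intro S_sum S_int S_yk that(2))
    finally show ?thesis .
  qed
  have S_one: "1 \<in> S" using S_pow[OF Nd(2)] by simp
  have S_power: "a ^ k \<in> S" if "a \<in> S" for a k by (induction k) (simp_all add: S_one S_mult that)
  \<comment> \<open>N is not a unit of the ring: its elements are algebraic integers, while 1/N is
    rational and not an integer.\<close>
  have no_inv: False if s: "s \<in> S" "1 = of_nat N * s" for s
  proof -
    have "\<exists>e :: nat \<Rightarrow> int. s * y ^ i = (\<Sum>j<d. of_int (e j) * y ^ j)" if "i < d" for i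
      using S_mult[OF s(1) S_pow[OF that]] unfolding S_def by blast
    then obtain e :: "nat \<Rightarrow> nat \<Rightarrow> int" where "\<And>i. i < d \<Longrightarrow> s * y ^ i = (\<Sum>j<d. of_int (e i j) * y ^ j)" by metis
    then have "algebraic_int s" by (intro algebraic_int_of_int_span[OF Nd(2), of "\<lambda>i. y ^ i" s e]) auto
    moreover have sN: "s = 1 / of_nat N" using s(2) N1 by (intro eq_divide_imp) (simp_all add: mult.commute)
    moreover have "s \<in> \<rat>" unfolding sN by simp
    ultimately have "s \<in> \<int>" by (simp add: rational_algebraic_int_is_int)
    then obtain k where k: "s = of_int k" by (auto elim: Ints_cases)
    then have "of_int (int N * k) = (1 :: complex)" using s(2) by simp
    then have "int N * k = 1" using of_int_eq_1_iff by blast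
    then have "int N dvd 1" by (metis dvd_triv_left)
    then show False using N1 by simp
  qed
  \<comment> \<open>By the relation and by \<open>E\<close>, both c 0 and N are multiples of y. If
    they were coprime, a Bezout combination would write 1 as y w, and the d-th power of this
    equation would make N a unit.\<close>
  have const: "int N dvd c 0" if c: "(\<Sum>i<d. of_int (c i) * y ^ i) = 0" for c :: "nat \<Rightarrow> int"
  proof (rule ccontr)
    assume "\<not> int N dvd c 0"
    then have "coprime (int N) (c 0)" using N by (simp add: prime_imp_coprime)
    then obtain u v where uv: "u * int N + v * c 0 = 1" using bezout_int[of "int N" "c 0"] by auto
    define c' where "c' i = (if Suc i < d then c (Suc i) else 0)" for i
    have "of_int (c 0) + y * (\<Sum>i<d. of_int (c' i) * y ^ i) = (\<Sum>i<Suc d. of_int (if i < d then c i else 0) * y ^ i)"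
      unfolding sum.lessThan_Suc_shift using Nd(2) by (simp add: sum_distrib_left c'_def mult_ac cong: if_cong)
    also have "\<dots> = (\<Sum>i<d. of_int (c i) * y ^ i)" by simp
    finally have c0: "of_int (c 0) = y * (- (\<Sum>i<d. of_int (c' i) * y ^ i))" unfolding c by (simp add: add_eq_0_iff)
    have N0: "of_nat N = y * (- (\<Sum>i<d. of_int (int (N choose Suc (Suc i))) * y ^ i))"
    proof -
      have "(\<Sum>i<Suc d. of_nat (N choose Suc i) * y ^ i) = 0" using E unfolding Nd(1) .
      then have "of_nat N + y * (\<Sum>i<d. of_int (int (N choose Suc (Suc i))) * y ^ i) = 0"
        unfolding sum.lessThan_Suc_shift by (simp add: sum_distrib_left mult_ac)
      then show ?thesis by (simp add: add_eq_0_iff)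
    qed
    define w where "w = of_int u * (- (\<Sum>i<d. of_int (int (N choose Suc (Suc i))) * y ^ i))
       + of_int v * (- (\<Sum>i<d. of_int (c' i) * y ^ i))"
    have neg: "- a \<in> S" if "a \<in> S" for a using S_int[OF that, of "-1"] by simp
    have wS: "w \<in> S" unfolding w_def by (intro S_add S_int neg SI)
    have "1 = of_int (u * int N + v * c 0)" using uv by simp
    also have "\<dots> = of_int u * of_nat N + of_int v * (of_int (c 0) :: complex)" by simp
    also have "\<dots> = y * w" unfolding c0 N0 w_def by (simp add: algebra_simps)
    finally have "1 = (y * w) ^ d" by simp
    also have "\<dots> = of_nat N * (r * w ^ d)" by (simp add: power_mult_distrib yd)
    finally show False by (rule no_inv[OF S_mult[OF rS S_power[OF wS]], of d])
  qed
  have coeffs: "\<forall>c :: nat \<Rightarrow> int. (\<Sum>i<d. of_int (c i) * y ^ i) = 0 \<longrightarrow> int N dvd c i" if "i < d" for i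
    using that
  proof (induction i)
    case 0 then show ?case using const by blast
  next
    case (Suc i)
    show ?case
    proof (intro allI impI)
      fix c :: "nat \<Rightarrow> int" assume c: "(\<Sum>i<d. of_int (c i) * y ^ i) = 0"
      obtain k where k: "c 0 = int N * k" using const[OF c] by blast
      \<comment> \<open>Subtracting k times the relation \<open>E\<close> removes the constant term
        N k, so y can be cancelled and the coefficients move down by one place.\<close>
      define g where "g j = (if Suc j < d then c (Suc j) else 0) - k * int (N choose Suc (Suc j))" for j
      have "y * (\<Sum>j<d. of_int (g j) * y ^ j) = 0"
      proof -
        have 1: "of_int (c 0) + y * (\<Sum>j<d. of_int (if Suc j < d then c (Suc j) else 0) * y ^ j)
            = (\<Sum>i<Suc d. of_int (if i < d then c i else 0) * y ^ i)"
          unfolding sum.lessThan_Suc_shift using Nd(2) by (simp add: sum_distrib_left mult_ac cong: if_cong)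
        have 2: "\<dots> = 0" using c by simp
        have "(\<Sum>i<Suc d. of_nat (N choose Suc i) * y ^ i) = 0" using E unfolding Nd(1) .
        then have 3: "of_nat N + y * (\<Sum>i<d. of_int (int (N choose Suc (Suc i))) * y ^ i) = 0"
          unfolding sum.lessThan_Suc_shift by (simp add: sum_distrib_left mult_ac)
        have "(\<Sum>j<d. of_int (g j) * y ^ j) = (\<Sum>j<d. of_int (if Suc j < d then c (Suc j) else 0) * y ^ j
            - of_int k * (of_int (int (N choose Suc (Suc j))) * y ^ j))"
          by (rule sum.cong[OF refl]) (simp only: g_def of_int_diff of_int_mult left_diff_distrib mult.assoc)
        also have "\<dots> = (\<Sum>j<d. of_int (if Suc j < d then c (Suc j) else 0) * y ^ j)
            - of_int k * (\<Sum>i<d. of_int (int (N choose Suc (Suc i))) * y ^ i)"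
          by (simp only: sum_subtractf sum_distrib_left)
        finally have "y * (\<Sum>j<d. of_int (g j) * y ^ j) = y * (\<Sum>j<d. of_int (if Suc j < d then c (Suc j) else 0) * y ^ j)
           - of_int k * (y * (\<Sum>i<d. of_int (int (N choose Suc (Suc i))) * y ^ i))"
          by (simp only: right_diff_distrib mult.left_commute)
        also have "\<dots> = - of_int (c 0) + of_int k * of_nat N" 
        proof -
          have "y * (\<Sum>j<d. of_int (if Suc j < d then c (Suc j) else 0) * y ^ j) = - of_int (c 0)"
            using 1[unfolded 2] by (simp only: add_eq_0_iff) 
          moreover have "y * (\<Sum>i<d. of_int (int (N choose Suc (Suc i))) * y ^ i) = - of_nat N"
            using 3 by (simp only: add_eq_0_iff)
          ultimately show ?thesis by simp
        qed
        also have "\<dots> = 0" using k by simp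
        finally show ?thesis .
      qed
      then have "(\<Sum>j<d. of_int (g j) * y ^ j) = 0" using y0 by simp
      then have "int N dvd g i" using Suc by auto
      moreover have "g i = c (Suc i) - k * (int N * b (Suc i))" using Suc.prems b[of "Suc i"] by (simp add: g_def)
      ultimately have "int N dvd (c (Suc i) - k * (int N * b (Suc i))) + k * (int N * b (Suc i))"
        by (intro dvd_add) auto
      then show "int N dvd c (Suc i)" by simp
    qed
  qed
  \<comment> \<open>Dividing a relation by N gives another relation, so every power of N divides
    every coefficient.\<close>
  have "\<forall>c :: nat \<Rightarrow> int. (\<Sum>i<d. of_int (c i) * y ^ i) = 0 \<longrightarrow> (\<forall>i<d. int N ^ k dvd c i)" for k
  proof (induction k)
    case (Suc k)
    show ?case
    proof (intro allI impI)
      fix c :: "nat \<Rightarrow> int" and i assume c: "(\<Sum>i<d. of_int (c i) * y ^ i) = 0" and i: "i < d"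
      have q: "c j = int N * (c j div int N)" if "j < d" for j using coeffs[OF that] c by auto
      have "of_nat N * (\<Sum>i<d. of_int (c i div int N) * y ^ i) = (\<Sum>i<d. of_int (c i) * y ^ i)"
        unfolding sum_distrib_left
      proof (rule sum.cong[OF refl])
        fix j assume "j \<in> {..<d}"
        then have "of_int (c j) = (of_nat N * of_int (c j div int N) :: complex)"
          using q[of j] by (metis lessThan_iff of_int_mult of_int_of_nat_eq)
        then show "of_nat N * (of_int (c j div int N) * y ^ j) = of_int (c j) * y ^ j" by simp
      qed
      then have "(\<Sum>i<d. of_int (c i div int N) * y ^ i) = 0" using c N1 by simp
      then have "int N ^ k dvd c i div int N" using Suc i by (elim allE[of _ "\<lambda>i. c i div int N"]) auto
      then have "int N ^ k * int N dvd (c i div int N) * int N" by (intro mult_dvd_mono) auto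
      moreover have "(c i div int N) * int N = c i" using q[OF i] by (metis mult.commute)
      ultimately show "int N ^ Suc k dvd c i" by (metis power_Suc2)
    qed
  qed simp
  then have div: "int N ^ k dvd c i" for k using c i unfolding y_def d_def by blast
  show ?thesis
  proof (rule ccontr)
    assume "c i \<noteq> 0"
    have "nat \<bar>c i\<bar> < 2 ^ nat \<bar>c i\<bar>" by (rule less_exp)
    also have "\<dots> \<le> N ^ nat \<bar>c i\<bar>" using N1 by (intro power_mono) auto
    finally have "\<bar>c i\<bar> < int N ^ nat \<bar>c i\<bar>" by (simp add: nat_less_iff)
    moreover have "int N ^ nat \<bar>c i\<bar> \<le> \<bar>c i\<bar>"
      using div[of "nat \<bar>c i\<bar>"] \<open>c i \<noteq> 0\<close> by (intro zdvd_imp_le) auto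
    ultimately show False by simp
  qed
qed

text \<open>The geometric sum is the only relation up to multiples: subtracting a multiple removes
  the top exponent, and composing with 1 + x rewrites the rest in powers of \<zeta> - 1, where
  independence is known.\<close>

lemma prime_root_of_unity_relation:
  fixes \<zeta> :: complex and a :: "nat \<Rightarrow> int"
  assumes N: "prime N" and \<zeta>: "\<zeta> ^ N = 1" "\<zeta> \<noteq> 1"
    and a: "(\<Sum>k<N. of_int (a k) * \<zeta> ^ k) = 0" and i: "i < N"
  shows "a i = a (N - 1)"
proof -
  define d where "d = N - 1"
  have Nd: "N = Suc d" "d > 0" using prime_gt_1_nat[OF N] by (simp_all add: d_def)
  have geo: "(\<Sum>k<N. \<zeta> ^ k) = 0" using \<zeta> by (simp add: geometric_sum)
  have "(\<Sum>k<N. of_int (a k - a d) * \<zeta> ^ k) = (\<Sum>k<N. of_int (a k) * \<zeta> ^ k) - of_int (a d) * (\<Sum>k<N. \<zeta> ^ k)"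
    by (simp add: sum_subtractf sum_distrib_left algebra_simps)
  also have "\<dots> = 0" using a geo by simp
  finally have rel: "(\<Sum>k<d. of_int (a k - a d) * \<zeta> ^ k) = 0" unfolding Nd(1) by simp
  define p where "p = (\<Sum>k<d. Polynomial.monom (a k - a d) k)"
  define q where "q = p \<circ>\<^sub>p [:1, 1:]"
  have dp: "degree p < d" unfolding p_def
    by (rule degree_sum_less) (use Nd in \<open>auto intro: le_less_trans[OF degree_monom_le]\<close>)
  have dq: "degree q < d" unfolding q_def by (rule le_less_trans[OF degree_pcompose_le]) (use dp in simp)
  have "poly (map_poly of_int q) (\<zeta> - 1) = poly (map_poly of_int p) \<zeta>"
    unfolding q_def by (simp add: of_int_hom.map_poly_pcompose poly_pcompose)
  also have "map_poly of_int p = (\<Sum>k<d. Polynomial.monom (of_int (a k - a d)) k :: complex poly)"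
    unfolding p_def by (simp add: of_int_poly_hom.hom_sum map_poly_monom del: of_int_diff)
  also have "poly \<dots> \<zeta> = 0" using rel by (simp add: poly_sum poly_monom)
  finally have "poly (map_poly of_int q) (\<zeta> - 1) = 0" .
  moreover have "poly (map_poly of_int q) (\<zeta> - 1) = (\<Sum>i<d. of_int (Polynomial.coeff q i) * (\<zeta> - 1) ^ i)"
  proof -
    have "degree (map_poly of_int q :: complex poly) < d" using dq by simp
    then show ?thesis
      by (subst poly_altdef, intro sum.mono_neutral_cong_left) (auto simp: coeff_eq_0)
  qed
  ultimately have "Polynomial.coeff q k = 0" if "k < d" for k
    using prime_root_of_unity_independent[OF N \<zeta>, of "Polynomial.coeff q" k] that by (simp add: d_def)
  then have "q = 0" using dq by (metis leading_coeff_0_iff)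
  then have "p = 0" unfolding q_def by (rule pcompose_eq_0) simp
  show ?thesis
  proof (cases "i = d")
    case False
    then have "i < d" using i Nd by simp
    have "Polynomial.coeff p i = a i - a d"
      unfolding p_def coeff_sum by (rule sum_single_eq[OF \<open>i < d\<close>]) auto
    then show ?thesis using \<open>p = 0\<close> by (simp add: d_def)
  qed (simp add: d_def)
qed

section \<open>Characteristic polynomials of matrices of finite order\<close>

lemma prod_linear_nonzero: "(\<Prod>a\<leftarrow>xs. [:- a, 1:]) \<noteq> (0 :: 'k::field poly)"
proof
  assume "(\<Prod>a\<leftarrow>xs. [:- a, 1:]) = (0 :: 'k poly)"
  then obtain a where "[:- a, 1 :: 'k:] = 0" unfolding prod_list_zero_iff by auto
  then show False by (simp only: pCons_eq_0_iff) simp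
qed

lemma sum_list_count:
  fixes f :: "'a \<Rightarrow> complex"
  assumes "finite S" "set xs \<subseteq> S"
  shows "(\<Sum>x\<leftarrow>xs. f x) = (\<Sum>x\<in>S. of_nat (count_list xs x) * f x)"
  using assms(2)
proof (induction xs)
  case (Cons a xs)
  have "(\<Sum>x\<in>S. of_nat (count_list (a # xs) x) * f x) =
      (\<Sum>x\<in>S. of_nat (count_list xs x) * f x + (if x = a then f x else 0))"
    by (rule sum.cong) (auto simp: algebra_simps)
  also have "\<dots> = (\<Sum>x\<leftarrow>a # xs. f x)"
    using Cons assms(1) by (simp add: sum.distrib)
  finally show ?case by simp
qed simp

lemma degree_prod_linear: "degree (\<Prod>a\<leftarrow>xs. [:- a, 1 :: 'k::field:]) = length xs"
proof (induction xs)
  case (Cons a xs)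
  have "degree ([:- a, 1:] * (\<Prod>a\<leftarrow>xs. [:- a, 1 :: 'k:])) = degree [:- a, 1 :: 'k:] + degree (\<Prod>a\<leftarrow>xs. [:- a, 1 :: 'k:])"
    by (rule degree_mult_eq[OF _ prod_linear_nonzero]) simp
  then show ?case using Cons by (simp del: mult_pCons_left)
qed simp

text \<open>Each linear factor is either split off from p or, if its root is not a root of p,
  cancelled from the cofactor.\<close>

lemma dvd_prod_linear_splits:
  fixes p :: "'k::field poly"
  assumes "p dvd (\<Prod>a\<leftarrow>as. [:- a, 1:])" "lead_coeff p = 1"
  shows "\<exists>xs. p = (\<Prod>a\<leftarrow>xs. [:- a, 1:]) \<and> set xs \<subseteq> set as"
  using assms
proof (induction as arbitrary: p)
  case Nil
  then have "p dvd 1" by simp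
  then have "degree p \<le> degree (1 :: 'k poly)" by (intro dvd_imp_degree_le) simp_all
  then obtain c where "p = [:c:]" by (metis degree_1 degree_eq_zeroE le_zero_eq)
  then have "p = 1" using Nil.prems(2) by simp
  then show ?case by (intro exI[of _ "[]"]) simp
next
  case (Cons a as)
  show ?case
  proof (cases "poly p a = 0")
    case True
    then obtain q where q: "p = [:- a, 1:] * q" by (auto simp: poly_eq_0_iff_dvd)
    have "lead_coeff q = 1" using Cons.prems(2) unfolding q lead_coeff_mult by simp
    moreover have "[:- a, 1:] * q dvd [:- a, 1:] * (\<Prod>a\<leftarrow>as. [:- a, 1:])" using Cons.prems(1) q by simp
    then have "q dvd (\<Prod>a\<leftarrow>as. [:- a, 1:])" by (subst (asm) dvd_mult_cancel_left) simp
    ultimately obtain xs where "q = (\<Prod>a\<leftarrow>xs. [:- a, 1:])" "set xs \<subseteq> set as" using Cons.IH by blast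
    then show ?thesis using q by (intro exI[of _ "a # xs"]) auto
  next
    case False
    let ?q = "\<Prod>a\<leftarrow>as. [:- a, 1:]"
    from Cons.prems(1) obtain r where r: "[:- a, 1:] * ?q = p * r" unfolding list.map prod_list.Cons by (rule dvdE)
    have "poly p a * poly r a = poly ([:- a, 1:] * ?q) a" unfolding r by simp
    also have "\<dots> = 0" by simp
    finally have "poly r a = 0" using False by simp
    then obtain s where "r = [:- a, 1:] * s" by (auto simp: poly_eq_0_iff_dvd simp del: mult_pCons_left elim: dvdE)
    then have "[:- a, 1:] * ?q = [:- a, 1:] * (p * s)" using r by (simp only: mult.left_commute)
    then have "?q = p * s" by (subst (asm) mult_cancel_left) simp
    then have "p dvd ?q" by simp
    then obtain xs where "p = (\<Prod>a\<leftarrow>xs. [:- a, 1:])" "set xs \<subseteq> set as" using Cons.IH Cons.prems(2) by blast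
    then show ?thesis by (intro exI[of _ xs]) auto
  qed
qed

text \<open>Both sides are monic of degree N and agree at N distinct points.\<close>

lemma power_minus_one_splits:
  fixes w :: "'k::field"
  assumes "N > 0" "w ^ N = 1" "inj_on (\<lambda>k. w ^ k) {..<N}"
  shows "Polynomial.monom 1 N - 1 = (\<Prod>a\<leftarrow>map (\<lambda>k. w ^ k) [0..<N]. [:- a, 1:])" (is "?p = ?q")
proof (rule poly_eqI_degree_lead_coeff[where n = N and A = "(\<lambda>k. w ^ k) ` {..<N}"])
  have q: "?q = (\<Prod>k<N. [:- (w ^ k), 1:])"
    by (induction N) (simp_all del: mult_pCons_left mult_pCons_right add: mult.commute)
  have dq: "degree ?q = N" unfolding q by (subst degree_prod_eq_sum_degree) auto
  have "lead_coeff ?q = 1" unfolding q lead_coeff_prod by simp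
  then show "Polynomial.coeff ?p N = Polynomial.coeff ?q N" using dq assms(1) by simp
  show "N \<le> card ((\<lambda>k. w ^ k) ` {..<N})" using card_image[OF assms(3)] by simp
  show "degree ?q \<le> N" using dq by simp
  show "degree ?p \<le> N" by (intro degree_diff_le) (auto simp: degree_monom_le)
  fix z assume "z \<in> (\<lambda>k. w ^ k) ` {..<N}"
  then obtain k where k: "k < N" "z = w ^ k" by auto
  have "z ^ N = (w ^ N) ^ k" unfolding k(2) by (simp add: mult.commute flip: power_mult)
  then have "poly ?p z = 0" using assms(2) by (simp add: poly_monom)
  moreover have "poly ?q z = 0" unfolding q poly_prod using k by (intro prod_zero) auto
  ultimately show "poly ?p z = poly ?q z" by simp
qed

text \<open>Over the polynomial ring the matrix x - A divides x^N - A^N = x^N - 1; take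
  determinants. No diagonalisation enters, so the argument is the same in every
  characteristic.\<close>

lemma char_poly_dvd_of_power_one:
  fixes A :: "'k::field mat"
  assumes A: "A \<in> carrier_mat n n" and AN: "A ^\<^sub>m N = 1\<^sub>m n"
  shows "char_poly A dvd (Polynomial.monom 1 N - 1) ^ n"
proof -
  define B where "B = map_mat (\<lambda>a. [:a:]) A"
  have B: "B \<in> carrier_mat n n" using A by (simp add: B_def)
  interpret h: comm_ring_hom "\<lambda>a::'k. [:a:]" by unfold_locales (simp_all add: one_pCons)
  let ?x = "[:0, 1:] :: 'k poly"
  let ?C = "?x \<cdot>\<^sub>m 1\<^sub>m n - B"
  have C: "?C \<in> carrier_mat n n" using B by auto
  have cp: "char_poly_matrix A = ?C"
    using A unfolding char_poly_matrix_def B_def by (intro eq_matI) auto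
  \<comment> \<open>The cofactor in the telescoping factorisation of x^k - B^k, built by passing
    from S to x S + B^k.\<close>
  have "\<exists>S\<in>carrier_mat n n. ?C * S = ?x ^ k \<cdot>\<^sub>m 1\<^sub>m n - B ^\<^sub>m k" for k
  proof (induction k)
    case 0
    have "?C * 0\<^sub>m n n = ?x ^ 0 \<cdot>\<^sub>m 1\<^sub>m n - B ^\<^sub>m 0" using B C by (intro eq_matI) auto
    then show ?case by (intro bexI[of _ "0\<^sub>m n n"]) auto
  next
    case (Suc k)
    then obtain S where S: "S \<in> carrier_mat n n" "?C * S = ?x ^ k \<cdot>\<^sub>m 1\<^sub>m n - B ^\<^sub>m k" by blast
    have Bk: "B ^\<^sub>m k \<in> carrier_mat n n" using B by simp
    have comm: "B * B ^\<^sub>m k = B ^\<^sub>m k * B" for k 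
    proof (induction k)
      case (Suc k)
      have Bk: "B ^\<^sub>m k \<in> carrier_mat n n" using B by simp
      have "B * B ^\<^sub>m Suc k = (B * B ^\<^sub>m k) * B" using assoc_mult_mat[OF B Bk B] by simp
      then show ?case unfolding Suc by simp
    qed (use B in simp)
    have "?C * (?x \<cdot>\<^sub>m S + B ^\<^sub>m k) = ?C * (?x \<cdot>\<^sub>m S) + ?C * B ^\<^sub>m k"
      by (rule mult_add_distrib_mat[OF C _ Bk]) (use S in simp)
    also have "?C * (?x \<cdot>\<^sub>m S) = ?x \<cdot>\<^sub>m (?C * S)" by (rule mult_smult_distrib[OF C S(1)])
    also have "?C * B ^\<^sub>m k = ?x \<cdot>\<^sub>m B ^\<^sub>m k - B ^\<^sub>m k * B"
    proof -
      have "?C * B ^\<^sub>m k = ?x \<cdot>\<^sub>m 1\<^sub>m n * B ^\<^sub>m k - B * B ^\<^sub>m k"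
        by (rule minus_mult_distrib_mat[OF _ B Bk]) simp
      then show ?thesis
        unfolding comm mult_smult_assoc_mat[OF one_carrier_mat Bk] left_mult_one_mat[OF Bk] .
    qed
    also have "?x \<cdot>\<^sub>m (?C * S) + (?x \<cdot>\<^sub>m B ^\<^sub>m k - B ^\<^sub>m k * B) = ?x ^ Suc k \<cdot>\<^sub>m 1\<^sub>m n - B ^\<^sub>m Suc k"
      unfolding S(2) using Bk B mult_carrier_mat[OF Bk B]
      by (intro eq_matI) (auto simp: algebra_simps simp del: index_mult_mat(1))
    finally show ?case using S(1) Bk by (intro bexI[of _ "?x \<cdot>\<^sub>m S + B ^\<^sub>m k"]) auto
  qed
  then obtain S where S: "S \<in> carrier_mat n n" "?C * S = ?x ^ N \<cdot>\<^sub>m 1\<^sub>m n - B ^\<^sub>m N" by blast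
  have "B ^\<^sub>m N = 1\<^sub>m n" unfolding B_def h.mat_hom_pow[OF A, symmetric] AN by (rule h.mat_hom_one)
  then have "?C * S = (?x ^ N - 1) \<cdot>\<^sub>m 1\<^sub>m n" unfolding S(2) by (intro eq_matI) auto
  then have "Determinant.det (?C * S) = (?x ^ N - 1) ^ n" by simp
  then have "char_poly A * Determinant.det S = (?x ^ N - 1) ^ n"
    unfolding char_poly_def cp det_mult[OF C S(1)] .
  moreover have "?x ^ N - 1 = Polynomial.monom 1 N - 1" by (simp add: monom_altdef)
  ultimately show ?thesis by (metis dvd_triv_left)
qed

lemma char_poly_splits_of_power_one:
  fixes A :: "'k::field mat"
  assumes A: "A \<in> carrier_mat n n" "A ^\<^sub>m N = 1\<^sub>m n"
    and w: "N > 0" "w ^ N = 1" "inj_on (\<lambda>k. w ^ k) {..<N}"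
  shows "\<exists>xs. char_poly A = (\<Prod>a\<leftarrow>xs. [:- a, 1:]) \<and> set xs \<subseteq> (\<lambda>k. w ^ k) ` {..<N} \<and> length xs = n"
proof -
  let ?as = "concat (replicate n (map (\<lambda>k. w ^ k) [0..<N]))"
  have "(\<Prod>a\<leftarrow>?as. [:- a, 1:]) = (\<Prod>a\<leftarrow>map (\<lambda>k. w ^ k) [0..<N]. [:- a, 1:]) ^ n"
    by (induction n) simp_all
  then have "char_poly A dvd (\<Prod>a\<leftarrow>?as. [:- a, 1:])"
    using char_poly_dvd_of_power_one[OF A] power_minus_one_splits[OF w] by simp
  moreover have lc: "degree (char_poly A) = n" "lead_coeff (char_poly A) = 1" using degree_monic_char_poly[OF A(1)] by simp_all
  ultimately obtain xs where xs: "char_poly A = (\<Prod>a\<leftarrow>xs. [:- a, 1:])" "set xs \<subseteq> set ?as"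
    using dvd_prod_linear_splits by blast
  have "length xs = n" using lc xs(1) degree_prod_linear[of xs] by simp
  moreover have "set ?as \<subseteq> (\<lambda>k. w ^ k) ` {..<N}" by auto
  ultimately show ?thesis using xs by blast
qed

text \<open>The common interface of ordinary and Brauer characters: a class function adding up the
  lifted eigenvalues, with multiplicity, when the characteristic polynomial splits. Over the complex
  numbers \<open>lift\<close> is the identity.\<close>

definition trace_like :: "('k::field mat \<Rightarrow> complex) \<Rightarrow> ('k \<Rightarrow> complex) \<Rightarrow> bool" where
  "trace_like chr lift \<longleftrightarrow>
    (\<forall>A B. similar_mat A B \<longrightarrow> chr A = chr B) \<and>
    (\<forall>n A xs. A \<in> carrier_mat n n \<and> char_poly A = (\<Prod>a\<leftarrow>xs. [:- a, 1:]) \<longrightarrow> chr A = (\<Sum>x\<leftarrow>xs. lift x))"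

lemma mat_trace_sum: "A \<in> carrier_mat n n \<Longrightarrow> mat_trace A = (\<Sum>i<n. A $$ (i, i))"
  by (simp add: mat_trace_def diag_mat_def interv_sum_list_conv_sum_set_nat atLeast0LessThan)

lemma mat_trace_mult_commute:
  fixes A B :: "'k::comm_ring_1 mat"
  assumes "A \<in> carrier_mat n n" "B \<in> carrier_mat n n"
  shows "mat_trace (A * B) = mat_trace (B * A)"
proof -
  have "mat_trace (A * B) = (\<Sum>i<n. \<Sum>k<n. A $$ (i, k) * B $$ (k, i))"
    unfolding mat_trace_sum[OF mult_carrier_mat[OF assms]]
    by (rule sum.cong[OF refl]) (use index_mult_mat_sum[OF assms] in simp)
  also have "\<dots> = (\<Sum>k<n. \<Sum>i<n. B $$ (k, i) * A $$ (i, k))"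
    by (subst sum.swap) (simp add: mult.commute)
  also have "\<dots> = mat_trace (B * A)"
    unfolding mat_trace_sum[OF mult_carrier_mat[OF assms(2,1)]]
    by (rule sum.cong[OF refl]) (use index_mult_mat_sum[OF assms(2,1)] in simp)
  finally show ?thesis .
qed

lemma mat_trace_similar:
  assumes "similar_mat A (B :: 'k::comm_ring_1 mat)"
  shows "mat_trace A = mat_trace B"
proof -
  from similar_matD[OF assms] obtain n P Q where c: "A \<in> carrier_mat n n" "B \<in> carrier_mat n n"
    "P \<in> carrier_mat n n" "Q \<in> carrier_mat n n" "Q * P = 1\<^sub>m n" "A = P * B * Q" by blast
  have "mat_trace A = mat_trace (P * (B * Q))" using assoc_mult_mat[OF c(3,2,4)] c(6) by simp
  also have "\<dots> = mat_trace ((B * Q) * P)" using c by (intro mat_trace_mult_commute) auto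
  also have "(B * Q) * P = B" using assoc_mult_mat[OF c(2,4,3)] c by simp
  finally show ?thesis .
qed

text \<open>A Schur triangulation puts the given list of roots on the diagonal, and the trace is
  invariant under similarity.\<close>

lemma trace_like_mat_trace: "trace_like (mat_trace :: complex mat \<Rightarrow> complex) id"
  unfolding trace_like_def
proof (intro conjI allI impI)
  fix n and A :: "complex mat" and xs
  assume A: "A \<in> carrier_mat n n \<and> char_poly A = (\<Prod>a\<leftarrow>xs. [:- a, 1:])"
  obtain B P Q where "schur_decomposition A xs = (B, P, Q)" by (cases "schur_decomposition A xs") auto
  with A have "similar_mat_wit A B P Q" "diag_mat B = xs" using schur_decomposition by blast+
  then show "mat_trace A = (\<Sum>x\<leftarrow>xs. id x)"
    using mat_trace_similar[of A B] by (auto simp: similar_mat_def mat_trace_def)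
qed (rule mat_trace_similar)

lemma order_prod_linear:
  fixes x :: "'k::field"
  shows "Polynomial.order x (\<Prod>a\<leftarrow>xs. [:- a, 1:]) = count_list xs x"
proof (induction xs)
  case (Cons a xs)
  note nz = prod_linear_nonzero
  have "Polynomial.order x [:- a, 1:] = (if a = x then 1 else 0)"
    using order_power_n_n[of x 1] by (auto intro: order_0I)
  moreover have "Polynomial.order x (\<Prod>a\<leftarrow>a # xs. [:- a, 1:]) =
      Polynomial.order x [:- a, 1:] + Polynomial.order x (\<Prod>a\<leftarrow>xs. [:- a, 1:])"
    using nz[of "a # xs"] by (simp add: order_mult del: mult_pCons_left)
  ultimately show ?case using Cons by simp
qed (simp add: order_0I)

text \<open>\<open>brauer\<close> weights each distinct root by its order, which for a product of
  linear factors is its number of occurrences.\<close>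

lemma trace_like_brauer: "trace_like (brauer lift) (lift :: 'k::field \<Rightarrow> complex)"
  unfolding trace_like_def
proof (intro conjI allI impI)
  fix A B :: "'k mat" assume "similar_mat A B"
  then show "brauer lift A = brauer lift B" by (simp add: brauer_def char_poly_similar)
next
  fix n and A :: "'k mat" and xs
  assume A: "A \<in> carrier_mat n n \<and> char_poly A = (\<Prod>a\<leftarrow>xs. [:- a, 1:])"
  have "{x. poly (\<Prod>a\<leftarrow>xs. [:- a, 1:]) x = 0} = set xs" by (induction xs) auto
  then show "brauer lift A = (\<Sum>x\<leftarrow>xs. lift x)"
    using A sum_list_count[of "set xs" xs lift] by (simp add: brauer_def order_prod_linear)
qed

lemma trace_like_one:
  fixes lift :: "'k::field \<Rightarrow> complex"
  assumes "trace_like chr lift" "lift 1 = 1"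
  shows "chr (1\<^sub>m n) = of_nat n"
proof -
  have "char_poly (1\<^sub>m n :: 'k mat) = (\<Prod>a\<leftarrow>diag_mat (1\<^sub>m n). [:- a, 1:])"
    by (rule char_poly_upper_triangular) auto
  also have "diag_mat (1\<^sub>m n :: 'k mat) = replicate n 1" by (auto simp: diag_mat_def list_eq_iff_nth_eq)
  finally have "chr (1\<^sub>m n) = (\<Sum>x\<leftarrow>replicate n 1. lift x)"
    using assms(1) unfolding trace_like_def by (meson one_carrier_mat)
  then show ?thesis by (simp add: sum_list_replicate assms(2))
qed

lemma trace_like_rep_equiv:
  "trace_like chr lift \<Longrightarrow> rep_equiv G \<rho> \<sigma> \<Longrightarrow> g \<in> carrier G \<Longrightarrow> chr (\<rho> g) = chr (\<sigma> g)"
  unfolding trace_like_def rep_equiv_def similar_mat_def by meson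

text \<open>Since \<open>1, \<zeta>, \<dots>, \<zeta>\<^bsup>N-2\<^esup>\<close> are linearly independent, the dimension and one character value
  determine all eigenvalue multiplicities.\<close>

lemma eigenvalue_of_trace:
  fixes A :: "'k::field mat" and w :: 'k and mult :: "nat \<Rightarrow> int"
  assumes chr: "trace_like chr lift" and A: "A \<in> carrier_mat n n" "A ^\<^sub>m N = 1\<^sub>m n"
    and N: "prime N" and w: "w ^ N = 1" "inj_on (\<lambda>k. w ^ k) {..<N}"
    and lift: "\<And>k. lift (w ^ k) = \<zeta> ^ k" and \<zeta>: "\<zeta> ^ N = 1" "\<zeta> \<noteq> 1"
    and mult: "chr A = (\<Sum>k<N. of_int (mult k) * \<zeta> ^ k)" "(\<Sum>k<N. mult k) = int n"
    and k: "k < N" "mult k > 0"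
  shows "\<exists>v\<in>carrier_vec n. v \<noteq> 0\<^sub>v n \<and> A\<^sup>T *\<^sub>v v = w ^ k \<cdot>\<^sub>v v"
proof -
  have N0: "N > 0" using N by (simp add: prime_gt_0_nat)
  obtain xs where xs: "char_poly A = (\<Prod>a\<leftarrow>xs. [:- a, 1:])" "set xs \<subseteq> (\<lambda>k. w ^ k) ` {..<N}" "length xs = n"
    using char_poly_splits_of_power_one[OF A N0 w] by blast
  define c where "c k = count_list xs (w ^ k)" for k
  have sum_xs: "(\<Sum>x\<leftarrow>xs. f x) = (\<Sum>k<N. of_nat (c k) * f (w ^ k))" for f :: "'k \<Rightarrow> complex"
  proof -
    have "(\<Sum>x\<leftarrow>xs. f x) = (\<Sum>x\<in>(\<lambda>k. w ^ k) ` {..<N}. of_nat (count_list xs x) * f x)"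
      using xs(2) by (intro sum_list_count) simp_all
    also have "\<dots> = (\<Sum>k<N. of_nat (c k) * f (w ^ k))"
      by (subst sum.reindex[OF w(2)]) (simp add: c_def)
    finally show ?thesis .
  qed
  have "chr A = (\<Sum>x\<leftarrow>xs. lift x)" using chr A(1) xs(1) unfolding trace_like_def by blast
  then have "chr A = (\<Sum>k<N. of_nat (c k) * \<zeta> ^ k)" using sum_xs[of lift] by (simp add: lift)
  \<comment> \<open>Actual and prescribed multiplicities satisfy a relation among powers of \<zeta>,
    so they differ by a constant; equal totals force this constant to be 0.\<close>
  then have "(\<Sum>k<N. of_int (int (c k) - mult k) * \<zeta> ^ k) = 0"
    using mult(1) by (simp add: algebra_simps sum_subtractf)
  from prime_root_of_unity_relation[OF N \<zeta> this]
  have cc: "int (c i) - mult i = int (c (N - 1)) - mult (N - 1)" if "i < N" for i using that by blast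
  have "(\<Sum>k<N. of_nat (c k)) = (of_nat n :: complex)"
    using sum_xs[of "\<lambda>_. 1"] xs(3) by (simp add: sum_list_triv)
  then have "(\<Sum>k<N. int (c k)) = int n" by (metis of_nat_eq_iff of_nat_sum)
  then have "(\<Sum>k<N. int (c k) - mult k) = 0" using mult(2) by (simp add: sum_subtractf)
  moreover have "(\<Sum>k<N. int (c k) - mult k) = (\<Sum>k<N. int (c (N - 1)) - mult (N - 1))"
    by (rule sum.cong[OF refl]) (use cc in blast)
  ultimately have "int N * (int (c (N - 1)) - mult (N - 1)) = 0" by simp
  then have "int (c k) = mult k" using cc[OF k(1)] N0 by simp
  then have "c k > 0" using k(2) by linarith
  then have "w ^ k \<in> set xs" unfolding c_def by (metis count_list_0_iff less_numeral_extra(3))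
  then have "poly (char_poly A) (w ^ k) = 0" unfolding xs(1) by (induction xs) auto
  \<comment> \<open>Passing to the transpose yields the row eigenvector that reciprocity asks
    for.\<close>
  then have "poly (char_poly (A\<^sup>T)) (w ^ k) = 0" using char_poly_transpose_mat[OF A(1)] by simp
  then have "eigenvalue (A\<^sup>T) (w ^ k)" using eigenvalue_root_char_poly[of "A\<^sup>T" n] A(1) by simp
  then show ?thesis using A(1) unfolding eigenvalue_def eigenvector_def by auto
qed

section \<open>The groups \<open>SL\<^sub>2\<close> and \<open>PSL\<^sub>2\<close>\<close>

lemma mat2_carrier [simp]: "mat2 a b c d \<in> carrier_mat 2 2"
  unfolding mat2_def mat_of_rows_list_def by (intro carrier_matI) simp_all

lemma dim_mat2 [simp]: "dim_row (mat2 a b c d) = 2" "dim_col (mat2 a b c d) = 2"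
  by (rule carrier_matD[OF mat2_carrier])+

lemma index_mat2 [simp]:
  "mat2 a b c d $$ (0, 0) = a" "mat2 a b c d $$ (0, Suc 0) = b"
  "mat2 a b c d $$ (Suc 0, 0) = c" "mat2 a b c d $$ (Suc 0, Suc 0) = d"
  by (simp_all add: mat2_def mat_of_rows_list_def)

lemma less_two_cases: "i < (2::nat) \<longleftrightarrow> i = 0 \<or> i = Suc 0"
  by auto

lemma mat2_eqI:
  assumes "A \<in> carrier_mat 2 2" "B \<in> carrier_mat 2 2" "A $$ (0, 0) = B $$ (0, 0)" "A $$ (0, Suc 0) = B $$ (0, Suc 0)"
    "A $$ (Suc 0, 0) = B $$ (Suc 0, 0)" "A $$ (Suc 0, Suc 0) = B $$ (Suc 0, Suc 0)"
  shows "A = B"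
  using assms by (intro eq_matI) (auto simp: less_two_cases)

lemma mat2_eta: "A \<in> carrier_mat 2 2 \<Longrightarrow> A = mat2 (A $$ (0, 0)) (A $$ (0, Suc 0)) (A $$ (Suc 0, 0)) (A $$ (Suc 0, Suc 0))"
  by (rule mat2_eqI) simp_all

lemma mat2_eq_iff [simp]: "mat2 a b c d = mat2 a' b' c' d' \<longleftrightarrow> a = a' \<and> b = b' \<and> c = c' \<and> d = d'"
  by (metis index_mat2)

lemma mat2_cases:
  assumes "A \<in> carrier_mat 2 2"
  obtains a b c d where "A = mat2 a b c d"
  using mat2_eta[OF assms] by blast

lemma mat2_mult [simp]: "mat2 a b c d * mat2 a' b' c' d' =
    mat2 (a * a' + b * c') (a * b' + b * d') (c * a' + d * c') (c * b' + d * (d' :: 'a::comm_ring_1))"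
  by (rule mat2_eqI) (auto simp: scalar_prod_def numeral_2_eq_2)

lemma det_mat2 [simp]: "Determinant.det (mat2 a b c d) = a * d - b * (c :: 'a::comm_ring_1)"
proof -
  let ?A = "mat2 a b c d"
  have "Determinant.det ?A = (\<Sum>j<2. ?A $$ (0, j) * cofactor ?A 0 j)"
    by (rule laplace_expansion_row) simp_all
  also have "\<dots> = a * d - b * c"
    by (simp add: numeral_2_eq_2 cofactor_def mat_delete_def det_single)
  finally show ?thesis .
qed

lemma one_mat2: "1\<^sub>m 2 = mat2 1 0 0 (1 :: 'a::comm_ring_1)"
  by (rule mat2_eqI) auto

lemma uminus_mat2 [simp]: "- mat2 a b c d = mat2 (- a) (- b) (- c) (- d :: 'a::comm_ring_1)"
  by (rule mat2_eqI) auto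

lemma map_mat_mat2 [simp]: "map_mat f (mat2 a b c d) = mat2 (f a) (f b) (f c) (f d)"
  by (rule mat2_eqI) auto

lemma SL2_simps [simp]:
  "\<one>\<^bsub>SL2\<^esub> = 1\<^sub>m 2" "A \<otimes>\<^bsub>SL2\<^esub> B = A * (B :: 'a::comm_ring_1 mat)"
  by (simp_all add: SL2_def)

lemma mat2_in_SL2 [simp]: "mat2 a b c d \<in> carrier SL2 \<longleftrightarrow> a * d - b * c = (1 :: 'a::comm_ring_1)"
  by (simp add: SL2_def)

lemma SL2_cases:
  assumes "A \<in> carrier SL2"
  obtains a b c d where "A = mat2 a b c d" "a * d - b * c = (1 :: 'a::comm_ring_1)"
proof -
  have "A \<in> carrier_mat 2 2" "Determinant.det A = 1" using assms by (auto simp: SL2_def)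
  then show ?thesis using that by (metis mat2_cases det_mat2)
qed

lemma group_SL2: "group (SL2 :: 'a::comm_ring_1 mat monoid)"
proof (rule groupI)
  fix A B C :: "'a mat"
  assume A: "A \<in> carrier SL2"
  then obtain a b c d where A2: "A = mat2 a b c d" "a * d - b * c = 1" by (rule SL2_cases)
  show "\<one>\<^bsub>SL2\<^esub> \<otimes>\<^bsub>SL2\<^esub> A = A" by (simp add: A2 one_mat2)
  have "mat2 d (- b) (- c) a \<in> carrier SL2" using A2(2) by (simp add: mult.commute)
  moreover have "mat2 d (- b) (- c) a \<otimes>\<^bsub>SL2\<^esub> A = \<one>\<^bsub>SL2\<^esub>" using A2 by (simp add: one_mat2 algebra_simps)
  ultimately show "\<exists>B\<in>carrier SL2. B \<otimes>\<^bsub>SL2\<^esub> A = \<one>\<^bsub>SL2\<^esub>" by blast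
  assume B: "B \<in> carrier SL2"
  then obtain a' b' c' d' where B2: "B = mat2 a' b' c' d'" "a' * d' - b' * c' = 1" by (rule SL2_cases)
  have "Determinant.det (A * B) = 1" using A B by (subst det_mult[of _ 2]) (auto simp: SL2_def)
  then show "A \<otimes>\<^bsub>SL2\<^esub> B \<in> carrier SL2" using A B by (auto simp: SL2_def)
  assume C: "C \<in> carrier SL2"
  show "A \<otimes>\<^bsub>SL2\<^esub> B \<otimes>\<^bsub>SL2\<^esub> C = A \<otimes>\<^bsub>SL2\<^esub> (B \<otimes>\<^bsub>SL2\<^esub> C)"
    using A B C by (auto simp: SL2_def intro: assoc_mult_mat)
qed (simp add: one_mat2)

interpretation SL2: group "SL2 :: 'a::comm_ring_1 mat monoid"
  by (rule group_SL2)

lemma inv_SL2_mat2: "a * d - b * c = (1 :: 'a::comm_ring_1) \<Longrightarrow> inv\<^bsub>SL2\<^esub> (mat2 a b c d) = mat2 d (- b) (- c) a"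
  by (rule SL2.inv_equality) (simp_all add: one_mat2 algebra_simps)

lemma SL2_carrier_mat: "A \<in> carrier SL2 \<Longrightarrow> A \<in> carrier_mat 2 2"
  by (simp add: SL2_def)

lemma SL2_mult_closed: "A \<in> carrier SL2 \<Longrightarrow> B \<in> carrier SL2 \<Longrightarrow> A * B \<in> carrier SL2"
  using SL2.m_closed by simp

lemma SL2_uminus_closed: "A \<in> carrier SL2 \<Longrightarrow> - A \<in> carrier SL2"
  by (erule SL2_cases) simp

abbreviation "center2 \<equiv> {1\<^sub>m 2, - 1\<^sub>m 2 :: 'f::field mat}"

lemma pclass_eq: "A \<in> carrier SL2 \<Longrightarrow> pclass A = {A, - A}"
  by (erule SL2_cases) (auto simp: pclass_def r_coset_def one_mat2)

lemma normal_center2: "center2 \<lhd> (SL2 :: 'f::field mat monoid)"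
proof -
  have "subgroup center2 (SL2 :: 'f mat monoid)"
    by unfold_locales (auto simp: one_mat2 inv_SL2_mat2)
  moreover have "\<forall>x\<in>carrier SL2. \<forall>h\<in>center2. x \<otimes>\<^bsub>SL2\<^esub> h \<otimes>\<^bsub>SL2\<^esub> inv\<^bsub>SL2\<^esub> x \<in> (center2 :: 'f mat set)"
  proof (intro ballI)
    fix x h :: "'f mat" assume x: "x \<in> carrier SL2" and h: "h \<in> center2"
    from x obtain a b c d where x2: "x = mat2 a b c d" "a * d - b * c = 1" by (rule SL2_cases)
    have e: "d * a - b * c = 1" "a * d - c * b = 1" "- (d * a) + b * c = -1" "- (a * d) + c * b = -1"
      using x2(2) by (simp_all add: algebra_simps)
    show "x \<otimes>\<^bsub>SL2\<^esub> h \<otimes>\<^bsub>SL2\<^esub> inv\<^bsub>SL2\<^esub> x \<in> center2"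
      using h e x2(2) by (auto simp: x2(1) inv_SL2_mat2[OF x2(2)] one_mat2 mult.commute algebra_simps)
  qed
  ultimately show ?thesis by (simp add: SL2.normal_inv_iff)
qed

lemma group_PSL2: "group (PSL2 :: 'f::field mat set monoid)"
  unfolding PSL2_def using normal_center2 by (rule normal.factorgroup_is_group)

interpretation PSL2: group "PSL2 :: 'f::field mat set monoid"
  by (rule group_PSL2)

lemma carrier_PSL2: "carrier PSL2 = pclass ` carrier (SL2 :: 'f::field mat monoid)"
  unfolding PSL2_def FactGroup_def RCOSETS_def pclass_def by auto

lemma pclass_in_PSL2 [simp]: "A \<in> carrier SL2 \<Longrightarrow> pclass A \<in> carrier (PSL2 :: 'f::field mat set monoid)"
  by (simp add: carrier_PSL2)

lemma PSL2_cases: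
  assumes "g \<in> carrier (PSL2 :: 'f::field mat set monoid)"
  obtains A where "A \<in> carrier SL2" "g = pclass A"
  using assms by (auto simp: carrier_PSL2)

lemma pclass_mult: "A \<in> carrier SL2 \<Longrightarrow> B \<in> carrier SL2 \<Longrightarrow>
    pclass A \<otimes>\<^bsub>PSL2\<^esub> pclass B = pclass (A * B :: 'f::field mat)"
  using normal.rcos_sum[OF normal_center2, of A B] by (simp add: PSL2_def pclass_def FactGroup_def)

lemma one_PSL2: "\<one>\<^bsub>PSL2\<^esub> = pclass (1\<^sub>m 2 :: 'f::field mat)"
  by (simp add: PSL2_def FactGroup_def pclass_eq[OF SL2.one_closed, simplified])

lemma inv_pclass: "A \<in> carrier SL2 \<Longrightarrow> inv\<^bsub>PSL2\<^esub> (pclass A) = pclass (inv\<^bsub>SL2\<^esub> A :: 'f::field mat)"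
  by (rule PSL2.inv_equality) (use SL2.l_inv[of A] in \<open>simp_all add: pclass_mult one_PSL2\<close>)

lemma pclass_eq_iff:
  assumes "A \<in> carrier SL2" "B \<in> carrier SL2"
  shows "pclass A = pclass B \<longleftrightarrow> A = B \<or> A = - (B :: 'f::field mat)"
proof -
  have "- (- B) = B" using assms(2) by (elim SL2_cases) simp
  moreover have "- (- A) = A" using assms(1) by (elim SL2_cases) simp
  ultimately show ?thesis unfolding pclass_eq[OF assms(1)] pclass_eq[OF assms(2)]
    by (auto simp: doubleton_eq_iff)
qed

section \<open>The field with N elements and the orders of its groups\<close>

locale prime_field =
  fixes F :: "'f::{field, finite} itself" and N :: nat
  assumes prime_N: "prime N" and N7: "N \<ge> 7" and card_F: "CARD('f) = N"
begin

lemma CHAR_F: "CHAR('f) = N"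
proof -
  have "CHAR('f) dvd N" using CHAR_dvd_CARD[where 'a = 'f] card_F by simp
  moreover have "CHAR('f) \<noteq> 1" by simp
  ultimately show ?thesis using prime_N prime_nat_iff by blast
qed

lemma of_int_eq_0: "of_int x = (0 :: 'f) \<longleftrightarrow> int N dvd x"
  by (cases x rule: int_cases2) (simp_all add: of_nat_eq_0_iff_char_dvd CHAR_F)

lemma of_int_eq_iff_F: "of_int x = (of_int y :: 'f) \<longleftrightarrow> [x = y] (mod int N)"
  using of_int_eq_0[of "x - y"] by (simp add: cong_iff_dvd_diff)

lemma of_nat_eq_0: "of_nat x = (0 :: 'f) \<longleftrightarrow> N dvd x"
  using of_int_eq_0[of "int x"] by simp

lemma of_nat_surj: "(x :: 'f) \<in> of_nat ` {..<N}"
proof -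
  have "inj_on (of_nat :: nat \<Rightarrow> 'f) {..<N}"
  proof (rule inj_onI)
    fix i j assume "i \<in> {..<N}" "j \<in> {..<N}" "of_nat i = (of_nat j :: 'f)"
    then show "i = j" using of_int_eq_iff_F[of "int i" "int j"] by (simp add: cong_def)
  qed
  then have "card (of_nat ` {..<N} :: 'f set) = CARD('f)" by (simp add: card_image card_F)
  then have "of_nat ` {..<N} = (UNIV :: 'f set)" by (intro card_subset_eq) auto
  then show ?thesis by simp
qed

lemma of_int_surj: "\<exists>k. of_int k = (x :: 'f)"
  using of_nat_surj[of x] by (metis imageE of_int_of_nat_eq)

lemma N_odd: "odd N"
  using prime_N N7 prime_odd_nat by auto

lemma numeral_nonzero: "(2 :: 'f) \<noteq> 0" "(3 :: 'f) \<noteq> 0" "(4 :: 'f) \<noteq> 0"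
proof -
  have *: "of_nat k \<noteq> (0 :: 'f)" if "0 < k" "k < 7" for k
    unfolding of_nat_eq_0 using that N7 by (auto dest: dvd_imp_le)
  have "of_nat 2 \<noteq> (0 :: 'f)" "of_nat 3 \<noteq> (0 :: 'f)" "of_nat 4 \<noteq> (0 :: 'f)" by (rule *; linarith)+
  then show "(2 :: 'f) \<noteq> 0" "(3 :: 'f) \<noteq> 0" "(4 :: 'f) \<noteq> 0" by (simp_all only: of_nat_numeral not_False_eq_True)
qed

lemma neg_eq_iff: "x = - x \<longleftrightarrow> x = (0 :: 'f)" "- x = x \<longleftrightarrow> x = (0 :: 'f)"
proof -
  have "x + x = 2 * x" by (simp only: mult_2)
  then have "x = - x \<longleftrightarrow> 2 * x = 0" by (simp only: eq_neg_iff_add_eq_0)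
  then show "x = - x \<longleftrightarrow> x = (0 :: 'f)" using numeral_nonzero by simp
  then show "- x = x \<longleftrightarrow> x = (0 :: 'f)" by metis
qed

lemma uminus_one_mat_ne: "- 1\<^sub>m 2 \<noteq> (1\<^sub>m 2 :: 'f mat)"
  using neg_eq_iff[of 1] by (simp add: one_mat2)

lemma finite_SL2: "finite (carrier SL2 :: 'f mat set)"
proof -
  have "carrier SL2 \<subseteq> (\<lambda>(a, b, c, d). mat2 a b c d) ` (UNIV :: ('f \<times> 'f \<times> 'f \<times> 'f) set)"
  proof
    fix A :: "'f mat" assume "A \<in> carrier SL2"
    then obtain a b c d where "A = mat2 a b c d" by (rule SL2_cases)
    then have "A = (\<lambda>(a, b, c, d). mat2 a b c d) (a, b, c, d)" by simp
    then show "A \<in> (\<lambda>(a, b, c, d). mat2 a b c d) ` (UNIV :: ('f \<times> 'f \<times> 'f \<times> 'f) set)" by (rule image_eqI) simp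
  qed
  then show ?thesis by (rule finite_subset) simp
qed

lemma finite_PSL2: "finite (carrier PSL2 :: 'f mat set set)"
  unfolding carrier_PSL2 using finite_SL2 by simp

text \<open>If the lower left entry is nonzero, the upper right one is determined by the other
  three; otherwise d = 1/a and b is free.\<close>

lemma card_SL2: "card (carrier SL2 :: 'f mat set) = N * (N - 1) * (N + 1)"
proof -
  let ?A = "(\<lambda>(a, d, c). mat2 a ((a * d - 1) / c) c d) ` (UNIV \<times> UNIV \<times> (UNIV - {0 :: 'f}))"
  let ?B = "(\<lambda>(a, b). mat2 a b 0 (1 / a)) ` ((UNIV - {0 :: 'f}) \<times> UNIV)"
  have eq: "carrier SL2 = ?A \<union> ?B"
  proof (intro equalityI subsetI)
    fix A :: "'f mat" assume "A \<in> carrier SL2"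
    then obtain a b c d where A: "A = mat2 a b c d" "a * d - b * c = 1" by (rule SL2_cases)
    show "A \<in> ?A \<union> ?B"
    proof (cases "c = 0")
      case True
      then have "a * d = 1" using A(2) by simp
      then have "a \<noteq> 0" by auto
      with \<open>a * d = 1\<close> have "d = 1 / a" by (simp add: nonzero_eq_divide_eq mult.commute)
      then have "A = (\<lambda>(a, b). mat2 a b 0 (1 / a)) (a, b)" using A True by simp
      then show ?thesis using \<open>a \<noteq> 0\<close> by blast
    next
      case False
      then have "b = (a * d - 1) / c" using A(2) by (simp add: field_simps)
      then have "A = (\<lambda>(a, d, c). mat2 a ((a * d - 1) / c) c d) (a, d, c)" using A by simp
      then show ?thesis using False by blast
    qed
  next
    fix A assume "A \<in> ?A \<union> ?B"
    then show "A \<in> carrier SL2"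
    proof
      assume "A \<in> ?A"
      then obtain a d c where "A = mat2 a ((a * d - 1) / c) c d" "c \<noteq> 0" by auto
      then show ?thesis by simp
    next
      assume "A \<in> ?B"
      then obtain a b where "A = mat2 a b 0 (1 / a)" "a \<noteq> 0" by auto
      then show ?thesis by simp
    qed
  qed
  have "card ?A = card ((UNIV :: 'f set) \<times> (UNIV :: 'f set) \<times> (UNIV - {0 :: 'f}))"
    by (rule card_image) (auto intro!: inj_onI)
  then have A: "card ?A = N * (N * (N - 1))" by (simp add: card_cartesian_product card_F card_Diff_singleton)
  have "card ?B = card ((UNIV - {0 :: 'f}) \<times> (UNIV :: 'f set))"
    by (rule card_image) (auto intro!: inj_onI)
  then have B: "card ?B = (N - 1) * N" by (simp add: card_cartesian_product card_F card_Diff_singleton)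
  have "?A \<inter> ?B = {}" by auto
  then have "card (carrier SL2 :: 'f mat set) = N * (N * (N - 1)) + (N - 1) * N"
    unfolding eq using A B by (subst card_Un_disjoint) auto
  then show ?thesis by (simp add: algebra_simps)
qed

text \<open>The factor 2 is the order of the centre, whose two elements differ because N is odd;
  keeping it on the left avoids division.\<close>

lemma card_PSL2: "2 * card (carrier PSL2 :: 'f mat set set) = N * (N - 1) * (N + 1)"
proof -
  have "card (rcosets\<^bsub>SL2\<^esub> (center2 :: 'f mat set)) * card (center2 :: 'f mat set) = order (SL2 :: 'f mat monoid)"
    using normal_imp_subgroup[OF normal_center2] by (intro SL2.lagrange)
  moreover have "carrier PSL2 = rcosets\<^bsub>SL2\<^esub> (center2 :: 'f mat set)" by (simp add: PSL2_def FactGroup_def)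
  moreover have "card (center2 :: 'f mat set) = 2" using uminus_one_mat_ne by (subst card_2_iff) metis
  ultimately show ?thesis by (simp add: order_def card_SL2 mult.commute)
qed

text \<open>Serves to show that the action on the function field of the reduction has no kernel.
  Conjugating a nontrivial element by a one-parameter group of unipotents gives N different
  elements, and the identity is one more.\<close>

lemma conjugates_many:
  assumes K: "K \<subseteq> carrier PSL2" "\<one>\<^bsub>PSL2\<^esub> \<in> K" "h \<in> K" "h \<noteq> \<one>\<^bsub>PSL2\<^esub>"
    and conj: "\<And>g k. g \<in> carrier (PSL2 :: 'f mat set monoid) \<Longrightarrow> k \<in> K \<Longrightarrow> g \<otimes>\<^bsub>PSL2\<^esub> k \<otimes>\<^bsub>PSL2\<^esub> inv\<^bsub>PSL2\<^esub> g \<in> K"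
  shows "card K > N"
proof -
  obtain A where A: "A \<in> carrier SL2" "h = pclass A" using K(1,3) by (auto elim: PSL2_cases)
  obtain a b c d where A2: "A = mat2 a b c d" "a * d - b * c = 1" using A(1) by (rule SL2_cases)
  have Kconj: "pclass (B * A * inv\<^bsub>SL2\<^esub> B) \<in> K" if "B \<in> carrier SL2" for B
    using conj[OF pclass_in_PSL2[OF that] K(3)] that A by (simp add: inv_pclass pclass_mult SL2_mult_closed)
  have ne: "pclass (B * A * inv\<^bsub>SL2\<^esub> B) \<noteq> \<one>\<^bsub>PSL2\<^esub>" if B: "B \<in> carrier SL2" for B
  proof
    assume "pclass (B * A * inv\<^bsub>SL2\<^esub> B) = \<one>\<^bsub>PSL2\<^esub>"
    then have "pclass B \<otimes>\<^bsub>PSL2\<^esub> h \<otimes>\<^bsub>PSL2\<^esub> inv\<^bsub>PSL2\<^esub> (pclass B) = \<one>\<^bsub>PSL2\<^esub>"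
      using B A by (simp add: inv_pclass pclass_mult SL2_mult_closed)
    then have e: "pclass B \<otimes>\<^bsub>PSL2\<^esub> h \<otimes>\<^bsub>PSL2\<^esub> inv\<^bsub>PSL2\<^esub> (pclass B) \<otimes>\<^bsub>PSL2\<^esub> pclass B = pclass B"
      using pclass_in_PSL2[OF B] by simp
    have hc: "h \<in> carrier PSL2" using K by blast
    have "pclass B \<otimes>\<^bsub>PSL2\<^esub> h = pclass B \<otimes>\<^bsub>PSL2\<^esub> \<one>\<^bsub>PSL2\<^esub>"
      using e pclass_in_PSL2[OF B] hc by (simp add: PSL2.m_assoc)
    then have "h = \<one>\<^bsub>PSL2\<^esub>"
      using pclass_in_PSL2[OF B] hc by simp
    then show False using K(4) by simp
  qed
  have "\<exists>B. (\<forall>x::'f. B x \<in> carrier SL2) \<and> inj (\<lambda>x. pclass (B x * A * inv\<^bsub>SL2\<^esub> (B x)))"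
  \<comment> \<open>Upper unipotents separate the conjugates unless A is upper triangular and not
    diagonal; that case uses lower unipotents. A nonzero entry not depending on x rules out equality
    up to the sign -1.\<close>
  proof (cases "b = 0 \<and> c \<noteq> 0 \<or> c \<noteq> 0 \<or> b = 0")
    case True
    let ?B = "\<lambda>x. mat2 1 x 0 1 :: 'f mat"
    have B: "?B x \<in> carrier SL2" for x by simp
    have e: "?B x * A * inv\<^bsub>SL2\<^esub> (?B x) = mat2 (a + x * c) (b + x * d - x * a - x * x * c) c (d - x * c)" for x
      by (simp add: A2(1) inv_SL2_mat2 algebra_simps)
    have in_SL2: "mat2 (a + x * c) (b + x * d - x * a - x * x * c) c (d - x * c) \<in> carrier SL2" for x
      using A2(2) by (simp add: algebra_simps)
    have "inj (\<lambda>x. pclass (?B x * A * inv\<^bsub>SL2\<^esub> (?B x)))"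
    proof (rule injI)
      fix x y assume "pclass (?B x * A * inv\<^bsub>SL2\<^esub> (?B x)) = pclass (?B y * A * inv\<^bsub>SL2\<^esub> (?B y))"
      then have *: "mat2 (a + x * c) (b + x * d - x * a - x * x * c) c (d - x * c) =
          mat2 (a + y * c) (b + y * d - y * a - y * y * c) c (d - y * c) \<or>
        mat2 (a + x * c) (b + x * d - x * a - x * x * c) c (d - x * c) =
          - mat2 (a + y * c) (b + y * d - y * a - y * y * c) c (d - y * c)"
        unfolding e pclass_eq_iff[OF in_SL2 in_SL2] .
      show "x = y"
      proof (cases "c = 0")
        case False
        then show ?thesis using * neg_eq_iff[of c] by simp
      next
        case c: True
        then have b: "b = 0" using True by simp
        have ad: "a * d = 1" using A2(2) c by simp
        then have a0: "a \<noteq> 0" by auto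
        have "a \<noteq> d"
        proof
          assume "a = d"
          then have "(a - 1) * (a + 1) = 0" using ad by (simp add: algebra_simps)
          then have "a = 1 \<or> a = - 1" by (auto simp: eq_neg_iff_add_eq_0)
          then have "A = 1\<^sub>m 2 \<or> A = - 1\<^sub>m 2" using \<open>a = d\<close> b c by (auto simp: A2(1) one_mat2)
          then have "h = \<one>\<^bsub>PSL2\<^esub>" unfolding A(2) one_PSL2 using A(1) SL2.one_closed[where 'a = 'f] by (simp add: pclass_eq_iff)
          then show False using K(4) by simp
        qed
        moreover have "x * d - x * a = y * d - y * a" using * c b a0 neg_eq_iff[of a] by auto
        then have "x * (d - a) = y * (d - a)" by (simp add: algebra_simps)
        ultimately show ?thesis by simp
      qed
    qed
    then show ?thesis using B by (intro exI[of _ ?B]) blast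
  next
    case False
    let ?B = "\<lambda>x. mat2 1 0 x 1 :: 'f mat"
    have c: "c = 0" and b: "b \<noteq> 0" using False by auto
    have e: "?B x * A * inv\<^bsub>SL2\<^esub> (?B x) = mat2 (a - x * b) b (x * a - x * x * b - x * d) (x * b + d)" for x
      by (simp add: A2(1) inv_SL2_mat2 c algebra_simps)
    have in_SL2: "mat2 (a - x * b) b (x * a - x * x * b - x * d) (x * b + d) \<in> carrier SL2" for x
      using A2(2) c by (simp add: algebra_simps)
    have "inj (\<lambda>x. pclass (?B x * A * inv\<^bsub>SL2\<^esub> (?B x)))"
    proof (rule injI)
      fix x y assume "pclass (?B x * A * inv\<^bsub>SL2\<^esub> (?B x)) = pclass (?B y * A * inv\<^bsub>SL2\<^esub> (?B y))"
      then have "mat2 (a - x * b) b (x * a - x * x * b - x * d) (x * b + d) =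
          mat2 (a - y * b) b (y * a - y * y * b - y * d) (y * b + d) \<or>
        mat2 (a - x * b) b (x * a - x * x * b - x * d) (x * b + d) =
          - mat2 (a - y * b) b (y * a - y * y * b - y * d) (y * b + d)"
        unfolding e pclass_eq_iff[OF in_SL2 in_SL2] .
      then show "x = y" using b neg_eq_iff[of b] by simp
    qed
    then show ?thesis by (intro exI[of _ ?B]) simp
  qed
  then obtain B where B: "\<And>x::'f. B x \<in> carrier SL2" "inj (\<lambda>x. pclass (B x * A * inv\<^bsub>SL2\<^esub> (B x)))" by blast
  let ?R = "range (\<lambda>x. pclass (B x * A * inv\<^bsub>SL2\<^esub> (B x)))"
  have "card ?R = N" using card_image[OF B(2)] card_F by simp
  moreover have "\<one>\<^bsub>PSL2\<^esub> \<notin> ?R" using ne B(1) by (metis (no_types, lifting) rangeE)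
  ultimately have "card (insert \<one>\<^bsub>PSL2\<^esub> ?R) = Suc N" by simp
  moreover have "insert \<one>\<^bsub>PSL2\<^esub> ?R \<subseteq> K" using K(2) Kconj B(1) by auto
  ultimately show ?thesis using card_mono[of K] finite_subset[OF K(1) finite_PSL2] by (metis Suc_le_eq)
qed

end

section \<open>Squares, elements of order three, integral lifts\<close>

context prime_field begin

text \<open>Each fibre of squaring has at most two points, and the fibre over 0 has only
  one.\<close>

lemma card_squares: "N + 1 \<le> 2 * card (range (\<lambda>x::'f. x\<^sup>2))"
proof -
  let ?S = "range (\<lambda>x::'f. x\<^sup>2)"
  have fib: "card {x::'f. x\<^sup>2 = s} \<le> 2" if "s \<in> ?S" for s
  proof -
    from that obtain y where "s = y\<^sup>2" by auto
    then have "{x::'f. x\<^sup>2 = s} \<subseteq> {y, - y}" by (auto simp: power2_eq_iff)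
    then have "card {x::'f. x\<^sup>2 = s} \<le> card {y, - y}" by (intro card_mono) auto
    also have "\<dots> \<le> 2" by (simp add: card_insert_if)
    finally show ?thesis .
  qed
  have "(UNIV :: 'f set) = (\<Union>s\<in>?S. {x. x\<^sup>2 = s})" by auto
  then have "CARD('f) \<le> (\<Sum>s\<in>?S. card {x::'f. x\<^sup>2 = s})" using card_UN_le[of ?S "\<lambda>s. {x. x\<^sup>2 = s}"] by simp
  also have "\<dots> = card {x::'f. x\<^sup>2 = 0} + (\<Sum>s\<in>?S - {0}. card {x::'f. x\<^sup>2 = s})"
    by (subst sum.remove[of _ 0]) auto
  also have "{x::'f. x\<^sup>2 = 0} = {0}" by auto
  also have "(\<Sum>s\<in>?S - {0}. card {x::'f. x\<^sup>2 = s}) \<le> (\<Sum>s\<in>?S - {0}. 2)"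
    by (rule sum_mono) (use fib in blast)
  also have "\<dots> = 2 * (card ?S - 1)" by (subst sum_constant, subst card_Diff_singleton) auto
  finally have "N \<le> 1 + 2 * (card ?S - 1)" using card_F by simp
  moreover have "card ?S > 0" by (simp add: card_gt_0_iff)
  ultimately show ?thesis by linarith
qed

text \<open>The squares and the values e - 3 y^2 each fill more than half of the field, so they
  meet.\<close>

lemma binary_form_represents: "\<exists>x y. x\<^sup>2 + 3 * y\<^sup>2 = (e :: 'f)"
proof (rule ccontr)
  assume no: "\<not> ?thesis"
  let ?S = "range (\<lambda>x::'f. x\<^sup>2)"
  let ?S' = "(\<lambda>s. e - 3 * s) ` ?S"
  have "card ?S' = card ?S" using numeral_nonzero by (intro card_image inj_onI) simp
  moreover have "?S \<inter> ?S' = {}"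
  proof (rule ccontr)
    assume "?S \<inter> ?S' \<noteq> {}"
    then obtain x y where "x\<^sup>2 = e - 3 * y\<^sup>2" by auto
    then have "x\<^sup>2 + 3 * y\<^sup>2 = e" by simp
    with no show False by blast
  qed
  then have "card (?S \<union> ?S') = card ?S + card ?S'" by (intro card_Un_disjoint) auto
  moreover have "card (?S \<union> ?S') \<le> CARD('f)" by (intro card_mono) auto
  ultimately show False using card_squares card_F by linarith
qed

text \<open>Let A be a lift of h with cube 1 and Y a matrix of trace zero and determinant 1. Then Y
  inverts A by conjugation exactly if the trace of Y A is 0. This leaves one linear and one
  quadratic condition on the entries p, q, r of Y, and the discriminant -3 of A turns them into
  representing a number by x^2 + 3 y^2.\<close>

lemma order3_conj_inverse:
  assumes h: "h \<in> carrier (PSL2 :: 'f mat set monoid)" "h \<noteq> \<one>\<^bsub>PSL2\<^esub>" "h \<otimes>\<^bsub>PSL2\<^esub> h \<otimes>\<^bsub>PSL2\<^esub> h = \<one>\<^bsub>PSL2\<^esub>"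
  shows "\<exists>y\<in>carrier PSL2. y \<otimes>\<^bsub>PSL2\<^esub> h \<otimes>\<^bsub>PSL2\<^esub> inv\<^bsub>PSL2\<^esub> y = inv\<^bsub>PSL2\<^esub> h"
proof -
  obtain A0 where A0: "A0 \<in> carrier SL2" "h = pclass A0" using h(1) by (rule PSL2_cases)
  have "pclass (A0 * A0 * A0) = pclass (1\<^sub>m 2)"
    using h(3) A0 by (simp add: pclass_mult SL2_mult_closed one_PSL2)
  then have "A0 * A0 * A0 = 1\<^sub>m 2 \<or> A0 * A0 * A0 = - 1\<^sub>m 2"
    using pclass_eq_iff[of "A0 * A0 * A0" "1\<^sub>m 2"] A0(1) SL2.one_closed[where 'a = 'f] by (simp add: SL2_mult_closed)
  \<comment> \<open>Replacing the lift by its negative changes the sign of the cube.\<close>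
  then have "\<exists>A. A \<in> carrier SL2 \<and> h = pclass A \<and> A * A * A = 1\<^sub>m 2"
  proof
    assume "A0 * A0 * A0 = - 1\<^sub>m 2"
    moreover have "- A0 * - A0 * - A0 = - (A0 * A0 * A0)" using A0(1) by (elim SL2_cases) simp
    ultimately have "- A0 * - A0 * - A0 = 1\<^sub>m 2" by (simp add: one_mat2)
    moreover have "h = pclass (- A0)"
      unfolding A0(2) using pclass_eq_iff[OF A0(1) SL2_uminus_closed[OF A0(1)]] A0(1) by (elim SL2_cases) simp
    ultimately show ?thesis using SL2_uminus_closed[OF A0(1)] by blast
  qed (use A0 in blast)
  then obtain A where A: "A \<in> carrier SL2" "h = pclass A" "A * A * A = 1\<^sub>m 2" by blast
  obtain a b c d where A2: "A = mat2 a b c d" "a * d - b * c = 1" using A(1) by (rule SL2_cases)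
  define t where "t = a + d"
  have bc: "b * c = a * d - 1" using A2(2) by (simp add: algebra_simps)
  \<comment> \<open>By Cayley-Hamilton A^2 = t A - 1, hence A^3 = (t^2 - 1) A - t.\<close>
  have cube: "A * A * A = mat2 ((t\<^sup>2 - 1) * a - t) ((t\<^sup>2 - 1) * b) ((t\<^sup>2 - 1) * c) ((t\<^sup>2 - 1) * d - t)"
  proof -
    have sq: "A * A = mat2 (t * a - 1) (t * b) (t * c) (t * d - 1)"
      unfolding A2(1) t_def using bc by (simp add: algebra_simps)
    have e1: "(t * a - 1) * a + t * b * c = (t\<^sup>2 - 1) * a - t"
    proof -
      have "(t * a - 1) * a + t * b * c = t * a * a - a + t * (b * c)" by (simp add: algebra_simps)
      then show ?thesis unfolding bc t_def by (simp add: algebra_simps power2_eq_square)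
    qed
    have e2: "t * c * b + (t * d - 1) * d = (t\<^sup>2 - 1) * d - t"
    proof -
      have "t * c * b + (t * d - 1) * d = t * (b * c) + t * d * d - d" by (simp add: algebra_simps)
      then show ?thesis unfolding bc t_def by (simp add: algebra_simps power2_eq_square)
    qed
    have e3: "(t * a - 1) * b + t * b * d = (t\<^sup>2 - 1) * b" "t * c * a + (t * d - 1) * c = (t\<^sup>2 - 1) * c"
      unfolding t_def by (simp_all add: algebra_simps power2_eq_square)
    show ?thesis unfolding sq unfolding A2(1) using e1 e2 e3 by simp
  qed
  have eqs: "(t\<^sup>2 - 1) * a - t = 1" "(t\<^sup>2 - 1) * b = 0" "(t\<^sup>2 - 1) * c = 0" "(t\<^sup>2 - 1) * d - t = 1"
    using cube A(3) by (simp_all only: one_mat2 mat2_eq_iff)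
  \<comment> \<open>Otherwise A would be scalar of determinant 1, that is 1 or -1, and h
    trivial.\<close>
  have t1: "t\<^sup>2 = 1"
  proof (rule ccontr)
    assume "t\<^sup>2 \<noteq> 1"
    then have bc0: "b = 0" "c = 0" using eqs by simp_all
    have "(t\<^sup>2 - 1) * a = (t\<^sup>2 - 1) * d" using eqs(1,4) by (metis diff_add_cancel)
    then have "a = d" using \<open>t\<^sup>2 \<noteq> 1\<close> by simp
    then have "a * a = 1" using A2(2) bc0 by simp
    then have "(a - 1) * (a + 1) = 0" by (simp add: algebra_simps)
    then have "a = 1 \<or> a = - 1" by (auto simp: eq_neg_iff_add_eq_0)
    then have "A = 1\<^sub>m 2 \<or> A = - 1\<^sub>m 2" using \<open>a = d\<close> bc0 by (auto simp: A2(1) one_mat2)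
    then have "h = \<one>\<^bsub>PSL2\<^esub>" unfolding A(2) one_PSL2 using A(1) SL2.one_closed[where 'a = 'f] by (simp add: pclass_eq_iff)
    then show False using h(2) by simp
  qed
  have tm: "t = - 1" using eqs(1) t1 by (simp add: minus_equation_iff)
  then have d: "d = - 1 - a" unfolding t_def by (simp add: eq_diff_eq add.commute)
  define u where "u = a - d"
  have disc: "u * u + 4 * (b * c) = - 3"
    unfolding u_def bc d by (simp add: algebra_simps)
  have "\<exists>p q r. - (p * p) - q * r = 1 \<and> p * u + q * c + r * b = 0"
  proof (cases "c = 0")
    case True
    then have "u * u = - 3" using disc by simp
    then have u0: "u \<noteq> 0" using numeral_nonzero by auto
    \<comment> \<open>With r = 1 the linear condition determines p, and the determinant determines
      q.\<close>
    show ?thesis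
      by (rule exI[of _ "- b / u"], rule exI[of _ "- 1 - (b / u) * (b / u)"], rule exI[of _ 1])
        (use u0 True in \<open>simp add: algebra_simps\<close>)
  next
    case False
    \<comment> \<open>Eliminating q by the linear condition and completing the square with x = 2 c p
      - u r, the determinant condition becomes x^2 + 3 r^2 = -4 c^2.\<close>
    obtain x r where xr: "x\<^sup>2 + 3 * r\<^sup>2 = - 4 * (c * c)" using binary_form_represents by blast
    define p where "p = (x + u * r) / (2 * c)"
    define q where "q = - (p * u + r * b) / c"
    have x: "x = 2 * c * p - u * r" using False numeral_nonzero by (simp add: p_def)
    have qc: "q * c = - (p * u + r * b)" using False by (simp add: q_def)
    have "x\<^sup>2 + 3 * r\<^sup>2 = (2 * c * p - u * r) * (2 * c * p - u * r) - (- 3) * (r * r)" by (simp add: x power2_eq_square)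
    also have "\<dots> = 4 * c * (c * (p * p) - u * p * r - b * (r * r))"
      unfolding disc[symmetric] by (simp add: algebra_simps)
    finally have "4 * c * (c * (p * p) - u * p * r - b * (r * r)) = 4 * c * (- c)"
      using xr by (simp add: mult.assoc)
    moreover have "4 * c \<noteq> 0" using False numeral_nonzero by (metis no_zero_divisors)
    ultimately have "c * (p * p) - u * p * r - b * (r * r) = - c" by (metis mult_left_cancel)
    moreover have "c * (- (p * p) - q * r) = - (c * (p * p) - u * p * r - b * (r * r))"
    proof -
      have "c * (- (p * p) - q * r) = - (c * (p * p)) - (q * c) * r" by (simp add: algebra_simps)
      then show ?thesis unfolding qc by (simp add: algebra_simps)
    qed
    ultimately have "c * (- (p * p) - q * r) = c * 1" by simp
    then have "- (p * p) - q * r = 1" using False by (simp only: mult_cancel_left) simp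
    moreover have "p * u + q * c + r * b = 0" unfolding qc by simp
    ultimately show ?thesis by blast
  qed
  then obtain p q r where pqr: "- (p * p) - q * r = 1" "p * u + q * c + r * b = 0" by blast
  let ?Y = "mat2 p q r (- p)"
  have Y: "?Y \<in> carrier SL2" using pqr(1) by simp
  have invA: "inv\<^bsub>SL2\<^esub> A = mat2 d (- b) (- c) a" unfolding A2(1) by (rule inv_SL2_mat2[OF A2(2)])
  have "?Y * A = inv\<^bsub>SL2\<^esub> A * ?Y"
  proof -
    have "p * a + q * c = d * p - b * r" "r * b - p * d = - c * q - a * p"
      using pqr(2) unfolding u_def by (simp_all add: algebra_simps eq_neg_iff_add_eq_0)
    then show ?thesis unfolding invA unfolding A2(1) by (simp add: algebra_simps)
  qed
  then have "pclass ?Y \<otimes>\<^bsub>PSL2\<^esub> h = inv\<^bsub>PSL2\<^esub> h \<otimes>\<^bsub>PSL2\<^esub> pclass ?Y"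
    using Y A by (simp add: pclass_mult inv_pclass)
  then have "pclass ?Y \<otimes>\<^bsub>PSL2\<^esub> h \<otimes>\<^bsub>PSL2\<^esub> inv\<^bsub>PSL2\<^esub> (pclass ?Y) = inv\<^bsub>PSL2\<^esub> h"
    using pclass_in_PSL2[OF Y] h(1) by (simp add: PSL2.m_assoc)
  then show ?thesis using pclass_in_PSL2[OF Y] by blast
qed

text \<open>Elementary matrices lift because the integers map onto the field, and every matrix with
  nonzero lower left entry is a product of three of them.\<close>

lemma SL2_int_lift:
  assumes "M \<in> carrier (SL2 :: 'f mat monoid)"
  shows "\<exists>A\<in>carrier (SL2 :: int mat monoid). map_mat of_int A = M"
proof -
  define L where "L M \<longleftrightarrow> (\<exists>A\<in>carrier (SL2 :: int mat monoid). map_mat of_int A = M)" for M :: "'f mat"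
  have LU: "L (mat2 1 x 0 1)" for x
  proof -
    obtain k where "of_int k = x" using of_int_surj by blast
    then show ?thesis unfolding L_def by (intro bexI[of _ "mat2 1 k 0 1"]) simp_all
  qed
  have LL: "L (mat2 1 0 x 1)" for x
  proof -
    obtain k where "of_int k = x" using of_int_surj by blast
    then show ?thesis unfolding L_def by (intro bexI[of _ "mat2 1 0 k 1"]) simp_all
  qed
  have Lm: "L (M * M')" if "L M" "L M'" for M M'
  proof -
    from that obtain A A' where A: "A \<in> carrier SL2" "A' \<in> carrier SL2" "map_mat of_int A = M" "map_mat of_int A' = M'"
      unfolding L_def by blast
    have "map_mat of_int (A * A') = (map_mat of_int A * map_mat of_int A' :: 'f mat)"
      by (rule of_int_hom.mat_hom_mult[OF SL2_carrier_mat[OF A(1)] SL2_carrier_mat[OF A(2)]])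
    then show ?thesis unfolding L_def using A SL2_mult_closed[OF A(1,2)] by blast
  qed
  have Lc: "L (mat2 a b c d)" if "c \<noteq> 0" "a * d - b * c = 1" for a b c d :: 'f
  proof -
    define x where "x = (a - 1) / c"
    define y where "y = (d - 1) / c"
    have xy: "x * c = a - 1" "c * y = d - 1" using that(1) by (simp_all add: x_def y_def)
    have "c * b = c * ((1 + x * c) * y + x)"
    proof -
      have "c * ((1 + x * c) * y + x) = (1 + x * c) * (c * y) + x * c" by (simp add: algebra_simps)
      also have "\<dots> = a * d - 1" unfolding xy by (simp add: algebra_simps)
      finally show ?thesis using that(2) by (simp add: algebra_simps)
    qed
    then have "b = (1 + x * c) * y + x" using that(1) by (metis mult_left_cancel)
    moreover have "mat2 1 x 0 1 * mat2 1 0 c 1 * mat2 1 y 0 1 = mat2 (1 + x * c) ((1 + x * c) * y + x) c (c * y + 1)"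
      by simp
    ultimately have "mat2 a b c d = mat2 1 x 0 1 * mat2 1 0 c 1 * mat2 1 y 0 1" unfolding xy by simp
    with Lm[OF Lm[OF LU LL] LU, of x c y] show ?thesis by simp
  qed
  obtain a b c d where M: "M = mat2 a b c d" "a * d - b * c = 1" using assms by (rule SL2_cases)
  have "L M"
  proof (cases "c = 0")
    case True
    then have "d \<noteq> 0" using M(2) by auto
    \<comment> \<open>Adding the second column to the first makes the lower left entry
      nonzero.\<close>
    then have "L (mat2 (a + b) b d d)" using M(2) True by (intro Lc) (simp_all add: algebra_simps)
    then have "L (mat2 (a + b) b d d * mat2 1 0 (- 1) 1)" by (rule Lm[OF _ LL])
    then show ?thesis using True by (simp add: M(1))
  qed (use M Lc in simp)
  then show ?thesis unfolding L_def .
qed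

lemma lifts_nonempty:
  assumes "g \<in> carrier (PSL2 :: 'f mat set monoid)"
  obtains A where "A \<in> lifts g"
proof -
  obtain M where M: "M \<in> carrier SL2" "g = pclass M" using assms by (rule PSL2_cases)
  obtain A where "A \<in> carrier SL2" "map_mat of_int A = M" using SL2_int_lift[OF M(1)] by blast
  then have "A \<in> lifts g" using M by (simp add: lifts_def pclass_eq)
  then show ?thesis by (rule that)
qed

lemma map_mat_SL2: "A \<in> carrier (SL2 :: int mat monoid) \<Longrightarrow> map_mat of_int A \<in> carrier (SL2 :: 'f mat monoid)"
proof (elim SL2_cases)
  fix a b c d :: int assume A: "A = mat2 a b c d" "a * d - b * c = 1"
  have "of_int (a * d - b * c) = (1 :: 'f)" unfolding A(2) by simp
  then show ?thesis unfolding A(1) by simp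
qed

lemma lifts_eq:
  assumes "A \<in> lifts g" "g \<in> carrier (PSL2 :: 'f mat set monoid)"
  shows "A \<in> carrier SL2" "g = pclass (map_mat of_int A)"
proof -
  show A: "A \<in> carrier SL2" using assms(1) by (simp add: lifts_def)
  obtain M where M: "M \<in> carrier SL2" "g = pclass M" using assms(2) by (rule PSL2_cases)
  have "map_mat of_int A = M \<or> map_mat of_int A = - M" using assms(1) M by (auto simp: lifts_def pclass_eq)
  then show "g = pclass (map_mat of_int A)" using pclass_eq_iff[OF map_mat_SL2[OF A] M(1)] M(2) by simp
qed

lemma in_lifts_pclass:
  assumes "A \<in> carrier (SL2 :: int mat monoid)"
  shows "A \<in> lifts (pclass (map_mat of_int A :: 'f mat))"
  using assms map_mat_SL2[OF assms] by (simp add: lifts_def pclass_eq)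

lemma lifts_mult:
  assumes g: "g \<in> carrier (PSL2 :: 'f mat set monoid)" "h \<in> carrier PSL2" and A: "A \<in> lifts g" "B \<in> lifts h"
  shows "A * B \<in> lifts (g \<otimes>\<^bsub>PSL2\<^esub> h)"
proof -
  note l = lifts_eq[OF A(1) g(1)] lifts_eq[OF A(2) g(2)]
  have "map_mat of_int (A * B) = (map_mat of_int A * map_mat of_int B :: 'f mat)"
    by (rule of_int_hom.mat_hom_mult[OF SL2_carrier_mat[OF l(1)] SL2_carrier_mat[OF l(3)]])
  then have "g \<otimes>\<^bsub>PSL2\<^esub> h = pclass (map_mat of_int (A * B))"
    unfolding l(2,4) using pclass_mult[OF map_mat_SL2[OF l(1)] map_mat_SL2[OF l(3)]] by simp
  then show ?thesis using in_lifts_pclass[OF SL2_mult_closed[OF l(1) l(3)]] by simp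
qed

lemma lifts_inv:
  assumes g: "g \<in> carrier (PSL2 :: 'f mat set monoid)" and A: "A \<in> lifts g"
  shows "inv\<^bsub>SL2\<^esub> A \<in> lifts (inv\<^bsub>PSL2\<^esub> g)"
proof -
  note l = lifts_eq[OF A g]
  have i: "inv\<^bsub>SL2\<^esub> A \<in> carrier SL2" using l(1) by simp
  obtain a b c d where A2: "A = mat2 a b c d" "a * d - b * c = 1" using l(1) by (rule SL2_cases)
  have "of_int (a * d - b * c) = (1 :: 'f)" unfolding A2(2) by simp
  then have "inv\<^bsub>SL2\<^esub> (map_mat of_int A) = (map_mat of_int (inv\<^bsub>SL2\<^esub> A) :: 'f mat)"
    unfolding A2(1) inv_SL2_mat2[OF A2(2)] by (simp add: inv_SL2_mat2)
  then have "inv\<^bsub>PSL2\<^esub> g = pclass (map_mat of_int (inv\<^bsub>SL2\<^esub> A))"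
    unfolding l(2) using inv_pclass[OF map_mat_SL2[OF l(1)]] by simp
  then show ?thesis using in_lifts_pclass[OF i] by simp
qed

lemma one_in_lifts_one: "1\<^sub>m 2 \<in> lifts (\<one>\<^bsub>PSL2\<^esub> :: 'f mat set)"
  by (simp add: lifts_def one_PSL2 pclass_eq one_mat2)

lemma unip_pow: "unip [^]\<^bsub>PSL2\<^esub> k = pclass (mat2 1 (of_nat k) 0 (1 :: 'f))"
proof (induction k)
  case 0 show ?case by (simp add: one_PSL2 one_mat2)
next
  case (Suc k)
  then show ?case by (simp add: unip_def pclass_mult)
qed

lemma unip_carrier: "unip \<in> carrier (PSL2 :: 'f mat set monoid)"
  by (simp add: unip_def)

lemma unip_pow_eq_iff: "unip [^]\<^bsub>PSL2\<^esub> j = (unip [^]\<^bsub>PSL2\<^esub> k :: 'f mat set) \<longleftrightarrow> (of_nat j :: 'f) = of_nat k"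
proof -
  have "mat2 1 (of_nat j) 0 1 \<in> carrier (SL2 :: 'f mat monoid)" "mat2 1 (of_nat k) 0 1 \<in> carrier (SL2 :: 'f mat monoid)" by simp_all
  then show ?thesis unfolding unip_pow using neg_eq_iff[of 1] by (simp add: pclass_eq_iff)
qed

end

section \<open>Characters of cyclic groups of even order\<close>

text \<open>Covers the multiplicative group of the field, of order N - 1, and the norm-one group, of
  order N + 1. The element c is -1 in both, and k is half the order.\<close>

locale even_cyclic_group = group M for M (structure) +
  fixes \<gamma> c and k :: nat
  assumes finite_M: "finite (carrier M)" and gen: "generates M \<gamma>" and card_M: "card (carrier M) = 2 * k" and k_pos: "k > 0"
    and c: "c \<in> carrier M" "c \<noteq> \<one>" "c \<otimes> c = \<one>"
begin

lemma g_carrier: "\<gamma> \<in> carrier M"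
  using gen by (simp add: generates_def)

lemma ord_g: "ord \<gamma> = 2 * k"
  using generate_pow_card[OF g_carrier] gen card_M by (simp add: generates_def)

lemma carrier_pow: "x \<in> carrier M \<Longrightarrow> \<exists>i. x = \<gamma> [^] (i::nat)"
  using generate_pow_on_finite_carrier[OF finite_M g_carrier] gen by (auto simp: generates_def)

lemma pow_eq_one: "\<gamma> [^] (i::nat) = \<one> \<longleftrightarrow> 2 * k dvd i"
  using pow_eq_id[OF g_carrier] ord_g by simp

text \<open>Makes z to the discrete logarithm well defined, so that a character can be built from an
  arbitrary choice of exponent.\<close>

lemma pow_eq_pow:
  assumes "\<gamma> [^] (i::nat) = \<gamma> [^] (j::nat)" "z ^ (2 * k) = (1 :: complex)"
  shows "z ^ i = z ^ j"
  using assms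
proof (induction i j rule: linorder_wlog)
  case (le i j)
  have "\<gamma> [^] i \<otimes> \<gamma> [^] (j - i) = \<gamma> [^] j" using g_carrier le(1) by (simp only: nat_pow_mult le_add_diff_inverse)
  then have "\<gamma> [^] i \<otimes> \<gamma> [^] (j - i) = \<gamma> [^] i" using le(2) by simp
  then have "\<gamma> [^] (j - i) = \<one>" using g_carrier by (simp add: r_cancel_one')
  then have "2 * k dvd j - i" by (simp add: pow_eq_one)
  then obtain l where "j - i = 2 * k * l" by auto
  then have "z ^ (j - i) = 1" using le(3) by (simp add: power_mult)
  moreover have "z ^ j = z ^ i * z ^ (j - i)" using le(1) by (simp flip: power_add)
  ultimately show ?case by simp
qed metis

text \<open>A cyclic group of order 2 k has only one element of order two.\<close>

lemma c_pow: "c = \<gamma> [^] k"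
proof -
  obtain i where i: "c = \<gamma> [^] (i::nat)" using carrier_pow[OF c(1)] by blast
  then have "\<gamma> [^] (2 * i) = \<one>" using c(3) g_carrier by (simp add: nat_pow_mult mult_2)
  then have "k dvd i" by (simp add: pow_eq_one)
  then obtain l where l: "i = k * l" by auto
  have "odd l"
  proof
    assume "even l"
    then have "2 * k dvd i" unfolding l by auto
    then show False using i c(2) pow_eq_one by simp
  qed
  then obtain m where "l = 2 * m + 1" by (auto elim: oddE)
  then have im: "i = 2 * k * m + k" using l by (simp add: algebra_simps)
  have "c = \<gamma> [^] (2 * k * m) \<otimes> \<gamma> [^] k" unfolding i im using g_carrier by (simp add: nat_pow_mult)
  also have "\<gamma> [^] (2 * k * m) = \<one>" by (simp add: pow_eq_one)
  finally show ?thesis using g_carrier by simp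
qed

lemma chars_mult: "\<psi> \<in> complex_chars M \<Longrightarrow> x \<in> carrier M \<Longrightarrow> y \<in> carrier M \<Longrightarrow> \<psi> (x \<otimes> y) = \<psi> x * \<psi> y"
  by (simp add: complex_chars_def linear_char_def)

lemma chars_nonzero: "\<psi> \<in> complex_chars M \<Longrightarrow> x \<in> carrier M \<Longrightarrow> \<psi> x \<noteq> 0"
  by (simp add: complex_chars_def linear_char_def)

lemma chars_one: "\<psi> \<in> complex_chars M \<Longrightarrow> \<psi> \<one> = 1"
  using chars_mult[of \<psi> \<one> \<one>] chars_nonzero[of \<psi> \<one>] by simp

lemma chars_pow: "\<psi> \<in> complex_chars M \<Longrightarrow> \<psi> (\<gamma> [^] (i::nat)) = \<psi> \<gamma> ^ i"
  by (induction i) (simp_all add: chars_one chars_mult g_carrier mult.commute)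

lemma chars_ext: 
  assumes "\<psi> \<in> complex_chars M" "\<psi>' \<in> complex_chars M" "\<psi> \<gamma> = \<psi>' \<gamma>"
  shows "\<psi> = \<psi>'"
proof
  fix x
  show "\<psi> x = \<psi>' x"
  proof (cases "x \<in> carrier M")
    case True
    then obtain i where "x = \<gamma> [^] (i::nat)" using carrier_pow by blast
    then show ?thesis using chars_pow[OF assms(1), of i] chars_pow[OF assms(2), of i] assms(3) by simp
  next
    case False
    then show ?thesis using assms(1,2) by (simp add: complex_chars_def)
  qed
qed

lemma chars_exist:
  assumes z: "z ^ (2 * k) = 1"
  shows "\<exists>\<psi>\<in>complex_chars M. \<psi> \<gamma> = z"
proof -
  define \<psi> where "\<psi> x = (if x \<in> carrier M then z ^ (SOME i. x = \<gamma> [^] (i::nat)) else 0)" for x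
  have \<psi>: "\<psi> (\<gamma> [^] i) = z ^ i" for i :: nat
  proof -
    have "\<exists>j. \<gamma> [^] i = \<gamma> [^] (j::nat)" by blast
    from someI_ex[OF this] have "z ^ i = z ^ (SOME j. \<gamma> [^] i = \<gamma> [^] (j::nat))" by (rule pow_eq_pow[OF _ z])
    then show ?thesis using g_carrier by (simp add: \<psi>_def)
  qed
  have z0: "z \<noteq> 0" using z k_pos by (auto simp: power_0_left)
  have "\<psi> \<in> complex_chars M"
    unfolding complex_chars_def linear_char_def
  proof (intro CollectI conjI ballI allI impI)
    fix x assume "x \<in> carrier M"
    then obtain i where i: "x = \<gamma> [^] (i::nat)" using carrier_pow by blast
    then show "\<psi> x \<noteq> 0" using \<psi> z0 by simp
    fix y assume "y \<in> carrier M"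
    then obtain j where "y = \<gamma> [^] (j::nat)" using carrier_pow by blast
    then show "\<psi> (x \<otimes> y) = \<psi> x * \<psi> y" using i \<psi> g_carrier by (simp add: nat_pow_mult power_add)
  qed (simp add: \<psi>_def)
  moreover have "\<psi> \<gamma> = z" using \<psi>[of 1] g_carrier by simp
  ultimately show ?thesis by blast
qed

text \<open>The common form of \<open>W_params\<close> and \<open>X_params\<close>.\<close>

definition "params = {\<psi> \<in> complex_chars M. \<psi> c = 1 \<and> \<psi> \<noteq> inv_char \<psi>}"

lemma inv_char_chars: "\<psi> \<in> complex_chars M \<Longrightarrow> inv_char \<psi> \<in> complex_chars M"
  by (simp add: complex_chars_def linear_char_def inv_char_def)

lemma inv_char_inv_char: "inv_char (inv_char \<psi>) = \<psi>"
  by (simp add: inv_char_def)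

lemma inv_char_params: "\<psi> \<in> params \<Longrightarrow> inv_char \<psi> \<in> params"
  unfolding params_def using inv_char_chars[of \<psi>] inv_char_inv_char[of \<psi>] by (auto simp: inv_char_def)

lemma inv_char_eq_iff: "\<psi> \<in> complex_chars M \<Longrightarrow> \<psi> = inv_char \<psi> \<longleftrightarrow> \<psi> \<gamma> = 1 \<or> \<psi> \<gamma> = - 1"
proof -
  assume \<psi>: "\<psi> \<in> complex_chars M"
  have "\<psi> = inv_char \<psi> \<longleftrightarrow> \<psi> \<gamma> = inverse (\<psi> \<gamma>)"
    using chars_ext[OF \<psi> inv_char_chars[OF \<psi>]] by (auto simp: inv_char_def fun_eq_iff)
  also have "\<dots> \<longleftrightarrow> \<psi> \<gamma> ^ 2 = 1"
    using chars_nonzero[OF \<psi> g_carrier] by (auto simp: power2_eq_square field_simps)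
  finally show ?thesis by (simp add: power2_eq_1_iff)
qed

text \<open>A character is determined by its value z at the generator. Being trivial on c, the k-th
  power of the generator, means z^k = 1, and being its own inverse means z = 1 or z = -1.\<close>

lemma params_image: "(\<lambda>\<psi>. \<psi> \<gamma>) ` params = {z. z ^ k = 1} - {1, - 1}"
proof (intro equalityI subsetI)
  fix z assume "z \<in> (\<lambda>\<psi>. \<psi> \<gamma>) ` params"
  then show "z \<in> {z. z ^ k = 1} - {1, - 1}"
  proof
    fix \<psi> assume z: "z = \<psi> \<gamma>" and "\<psi> \<in> params"
    then have \<psi>: "\<psi> \<in> complex_chars M" "\<psi> c = 1" "\<psi> \<noteq> inv_char \<psi>" by (simp_all add: params_def)
    have "\<psi> \<gamma> ^ k = \<psi> c" unfolding c_pow by (rule chars_pow[OF \<psi>(1), symmetric])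
    then show ?thesis using z \<psi>(2,3) inv_char_eq_iff[OF \<psi>(1)] by simp
  qed
next
  fix z :: complex assume z: "z \<in> {z. z ^ k = 1} - {1, - 1}"
  then have "z ^ (2 * k) = 1" by (simp add: mult.commute[of 2] power_mult)
  then obtain \<psi> where \<psi>: "\<psi> \<in> complex_chars M" "\<psi> \<gamma> = z" using chars_exist by blast
  have "\<psi> c = \<psi> \<gamma> ^ k" unfolding c_pow by (rule chars_pow[OF \<psi>(1)])
  then have "\<psi> \<in> params" using z \<psi> inv_char_eq_iff[OF \<psi>(1)] by (simp add: params_def)
  then show "z \<in> (\<lambda>\<psi>. \<psi> \<gamma>) ` params" using \<psi>(2) by blast
qed

text \<open>-1 is a k-th root of unity only for even k, whence the two cases.\<close>

lemma card_params: "finite params" "card params = k - (if even k then 2 else 1)"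
proof -
  have inj: "inj_on (\<lambda>\<psi>. \<psi> \<gamma>) params" by (rule inj_onI) (auto simp: params_def intro: chars_ext)
  have fin: "finite {z::complex. z ^ k = 1}" using k_pos by (intro finite_roots_unity) simp
  then show "finite params" using finite_image_iff[OF inj] by (simp add: params_image)
  have "card params = card ({z::complex. z ^ k = 1} - {1, - 1})"
    using card_image[OF inj] by (simp add: params_image)
  also have "{z::complex. z ^ k = 1} - {1, - 1} = {z. z ^ k = 1} - (if even k then {1, - 1} else {1})"
    by auto
  also have "card \<dots> = card {z::complex. z ^ k = 1} - card (if even k then {1, - 1} else {1 :: complex})"
    by (rule card_Diff_subset) (use fin in \<open>auto simp: one_neq_neg_one\<close>)
  also have "card {z::complex. z ^ k = 1} = k" using k_pos by (simp add: card_roots_unity_eq)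
  finally show "card params = k - (if even k then 2 else 1)" by (simp add: numeral_2_eq_2)
qed

text \<open>Inversion has no fixed point among the parameters, so the list contains half of
  them.\<close>

lemma lists_up_to_inverse_length:
  assumes "lists_up_to_inverse params \<psi>s"
  shows "2 * length \<psi>s = k - (if even k then 2 else 1)"
proof -
  have l: "distinct \<psi>s" "set \<psi>s \<subseteq> params" and alt: "\<And>\<psi>. \<psi> \<in> params \<Longrightarrow> (\<psi> \<in> set \<psi>s) \<noteq> (inv_char \<psi> \<in> set \<psi>s)"
    using assms unfolding lists_up_to_inverse_def by blast+
  have "params = set \<psi>s \<union> inv_char ` set \<psi>s"
  proof (intro equalityI subsetI)
    fix \<psi> assume "\<psi> \<in> params"
    then show "\<psi> \<in> set \<psi>s \<union> inv_char ` set \<psi>s" using alt[of \<psi>] inv_char_inv_char[of \<psi>] by (metis UnCI image_eqI)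
  qed (use l(2) inv_char_params in auto)
  moreover have "set \<psi>s \<inter> inv_char ` set \<psi>s = {}"
    using alt l(2) by blast
  moreover have "card (inv_char ` set \<psi>s) = card (set \<psi>s)"
    by (rule card_image) (metis inj_onI inv_char_inv_char)
  ultimately have "card params = 2 * card (set \<psi>s)" by (simp add: card_Un_disjoint)
  then show ?thesis using card_params(2) distinct_card[OF l(1)] by simp
qed

text \<open>z + 1/z determines z up to inversion, and the list has only one member of each pair. So
  a single character value tells apart the members of the W family, and likewise of the X
  family.\<close>

lemma params_eqI:
  assumes "lists_up_to_inverse params \<psi>s" "\<psi> \<in> set \<psi>s" "\<psi>' \<in> set \<psi>s"
    and eq: "\<psi> \<gamma> + inverse (\<psi> \<gamma>) = \<psi>' \<gamma> + inverse (\<psi>' \<gamma>)"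
  shows "\<psi> = \<psi>'"
proof -
  have p: "\<psi> \<in> params" "\<psi>' \<in> params" and alt: "(\<psi> \<in> set \<psi>s) \<noteq> (inv_char \<psi> \<in> set \<psi>s)"
    using assms(1-3) unfolding lists_up_to_inverse_def by blast+
  then have ch: "\<psi> \<in> complex_chars M" "\<psi>' \<in> complex_chars M" by (simp_all add: params_def)
  note nz = chars_nonzero[OF ch(1) g_carrier] chars_nonzero[OF ch(2) g_carrier]
  have "(\<psi> \<gamma> - \<psi>' \<gamma>) * (\<psi> \<gamma> * \<psi>' \<gamma> - 1) = \<psi> \<gamma> * \<psi>' \<gamma> * ((\<psi> \<gamma> + inverse (\<psi> \<gamma>)) - (\<psi>' \<gamma> + inverse (\<psi>' \<gamma>)))"
    using nz by (simp add: field_simps)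
  also have "\<dots> = 0" unfolding eq by simp
  finally have "\<psi> \<gamma> = \<psi>' \<gamma> \<or> \<psi> \<gamma> * \<psi>' \<gamma> = 1" by simp
  then show ?thesis
  proof
    assume "\<psi> \<gamma> * \<psi>' \<gamma> = 1"
    then have "\<psi>' \<gamma> = inverse (\<psi> \<gamma>)" by (metis inverse_unique)
    then have "\<psi>' = inv_char \<psi>" using chars_ext[OF ch(2) inv_char_chars[OF ch(1)]] by (simp add: inv_char_def)
    then show ?thesis using alt assms(2,3) by simp
  qed (rule chars_ext[OF ch])
qed

end

section \<open>The split and the nonsplit torus\<close>

context prime_field begin

lemma group_unit_group: "group (unit_group :: 'f monoid)"
  by (rule groupI) (auto simp: unit_group_def intro!: bexI[of _ "inverse _"])

lemma even_cyclic_unit_group: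
  assumes "generates unit_group (\<epsilon> :: 'f)"
  shows "even_cyclic_group unit_group \<epsilon> (- 1) ((N - 1) div 2)"
proof -
  interpret group "unit_group :: 'f monoid" by (rule group_unit_group)
  show ?thesis
  proof
    show "finite (carrier (unit_group :: 'f monoid))" by simp
    have "card (carrier (unit_group :: 'f monoid)) = N - 1"
      using card_F by (simp add: unit_group_def card_Diff_singleton)
    then show "card (carrier (unit_group :: 'f monoid)) = 2 * ((N - 1) div 2)" using N_odd by auto
    show "(N - 1) div 2 > 0" using N7 by simp
    show "- 1 \<noteq> \<one>\<^bsub>unit_group :: 'f monoid\<^esub>" using neg_eq_iff[of 1] by (simp add: unit_group_def)
  qed (use assms in \<open>simp_all add: unit_group_def\<close>)
qed

text \<open>If \<epsilon> = s^2 with s = \<epsilon>^i, then \<epsilon>^(2i-1) = 1, against the even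
  order of \<epsilon>.\<close>

lemma nonsquare_gen:
  assumes "generates unit_group (\<epsilon> :: 'f)"
  shows "\<epsilon> \<noteq> s\<^sup>2"
proof
  interpret C: even_cyclic_group "unit_group :: 'f monoid" \<epsilon> "- 1" "(N - 1) div 2"
    by (rule even_cyclic_unit_group[OF assms])
  assume s: "\<epsilon> = s\<^sup>2"
  have e0: "\<epsilon> \<noteq> 0" using C.g_carrier by (simp add: unit_group_def)
  then have "s \<in> carrier unit_group" using s by (auto simp: unit_group_def)
  then obtain i where i: "s = \<epsilon> [^]\<^bsub>unit_group\<^esub> (i::nat)" using C.carrier_pow by blast
  have pow: "x [^]\<^bsub>unit_group\<^esub> (j::nat) = x ^ j" for x :: 'f and j
    by (induction j) (simp_all add: unit_group_def nat_pow_def mult.commute)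
  have "\<epsilon> ^ (2 * i) = \<epsilon>" using s i by (simp add: pow power_mult mult.commute[of 2])
  then have "i > 0" using e0 C.c(2) \<open>\<epsilon> ^ (2 * i) = \<epsilon>\<close>
  proof -
    have "\<epsilon> \<noteq> 1"
    proof
      assume "\<epsilon> = 1"
      then have "\<epsilon> [^]\<^bsub>unit_group\<^esub> (1::nat) = \<one>\<^bsub>unit_group\<^esub>" by (simp add: pow unit_group_def)
      then have "2 * ((N - 1) div 2) dvd 1" using C.pow_eq_one by blast
      then show False by auto
    qed
    then show ?thesis using \<open>\<epsilon> ^ (2 * i) = \<epsilon>\<close> by (cases i) auto
  qed
  then have "\<epsilon> ^ (2 * i) = \<epsilon> * \<epsilon> ^ (2 * i - 1)" by (cases i) simp_all
  then have "\<epsilon> ^ (2 * i - 1) = 1" using \<open>\<epsilon> ^ (2 * i) = \<epsilon>\<close> e0 by simp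
  then have "\<epsilon> [^]\<^bsub>unit_group\<^esub> (2 * i - 1) = \<one>\<^bsub>unit_group\<^esub>" unfolding pow by (simp add: unit_group_def)
  then have "2 * ((N - 1) div 2) dvd 2 * i - 1" using C.pow_eq_one by blast
  then have "even (2 * i - 1)" by (metis dvd_mult_left)
  then show False using \<open>i > 0\<close> by simp
qed

lemma group_norm_one: "group (norm_one_group (\<epsilon> :: 'f))"
proof (rule groupI)
  let ?T = "norm_one_group \<epsilon>"
  show "\<one>\<^bsub>?T\<^esub> \<in> carrier ?T" by (simp add: norm_one_group_def)
  fix s assume "s \<in> carrier ?T"
  then obtain x y where s: "s = (x, y)" "x\<^sup>2 - \<epsilon> * y\<^sup>2 = 1" by (auto simp: norm_one_group_def)
  show "\<one>\<^bsub>?T\<^esub> \<otimes>\<^bsub>?T\<^esub> s = s" by (simp add: norm_one_group_def s)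
  show "\<exists>t\<in>carrier ?T. t \<otimes>\<^bsub>?T\<^esub> s = \<one>\<^bsub>?T\<^esub>"
    by (rule bexI[of _ "(x, - y)"]) (use s in \<open>simp_all add: norm_one_group_def power2_eq_square algebra_simps\<close>)
  fix t assume "t \<in> carrier ?T"
  then obtain x' y' where t: "t = (x', y')" "x'\<^sup>2 - \<epsilon> * y'\<^sup>2 = 1" by (auto simp: norm_one_group_def)
  have "(x * x' + \<epsilon> * y * y')\<^sup>2 - \<epsilon> * (x * y' + y * x')\<^sup>2 = (x\<^sup>2 - \<epsilon> * y\<^sup>2) * (x'\<^sup>2 - \<epsilon> * y'\<^sup>2)"
    by (simp add: power2_eq_square algebra_simps)
  then show "s \<otimes>\<^bsub>?T\<^esub> t \<in> carrier ?T" using s t by (simp add: norm_one_group_def)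
  fix u assume "u \<in> carrier ?T"
  then obtain a b where "u = (a, b)" by (cases u)
  then show "s \<otimes>\<^bsub>?T\<^esub> t \<otimes>\<^bsub>?T\<^esub> u = s \<otimes>\<^bsub>?T\<^esub> (t \<otimes>\<^bsub>?T\<^esub> u)"
    unfolding s t by (simp add: norm_one_group_def algebra_simps)
qed

text \<open>Lines of slope t through (-1, 0) parametrise the conic. The denominator 1 - \<epsilon>
  t^2 never vanishes because \<epsilon> is not a square, so there are N points besides (-1,
  0).\<close>

lemma card_norm_one:
  assumes "generates unit_group (\<epsilon> :: 'f)"
  shows "card (carrier (norm_one_group \<epsilon>)) = N + 1"
proof -
  let ?T = "{(x, y). x\<^sup>2 - \<epsilon> * y\<^sup>2 = 1}"
  define f where "f t = ((1 + \<epsilon> * t\<^sup>2) / (1 - \<epsilon> * t\<^sup>2), 2 * t / (1 - \<epsilon> * t\<^sup>2))" for t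
  have nz: "1 - \<epsilon> * t\<^sup>2 \<noteq> 0" for t
  proof
    assume *: "1 - \<epsilon> * t\<^sup>2 = 0"
    then have "t \<noteq> 0" by auto
    then have "\<epsilon> = (1 / t)\<^sup>2" using * by (simp add: power_divide field_simps)
    with nonsquare_gen[OF assms] show False by blast
  qed
  have e0: "\<epsilon> \<noteq> 0" using assms by (simp add: generates_def unit_group_def)
  have f1: "fst (f t) + 1 = 2 / (1 - \<epsilon> * t\<^sup>2)" for t
  proof -
    have "(1 + \<epsilon> * t\<^sup>2) / (1 - \<epsilon> * t\<^sup>2) + 1 = ((1 + \<epsilon> * t\<^sup>2) + (1 - \<epsilon> * t\<^sup>2)) / (1 - \<epsilon> * t\<^sup>2)"
      using nz[of t] by (simp only: add_divide_distrib divide_self_if if_False)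
    then show ?thesis by (simp add: f_def)
  qed
  have f1n: "fst (f t) + 1 \<noteq> 0" for t unfolding f1 using nz[of t] numeral_nonzero by simp
  have f2: "snd (f t) = t * (fst (f t) + 1)" for t unfolding f1 by (simp add: f_def)
  have inj: "inj f"
  proof (rule injI)
    fix s t assume "f s = f t"
    then have "s * (fst (f t) + 1) = t * (fst (f t) + 1)" using f2[of s] f2[of t] by metis
    then show "s = t" using f1n[of t] by (metis mult_right_cancel)
  qed
  have "?T = insert (- 1, 0) (range f)"
  proof (intro equalityI subsetI)
    fix s assume "s \<in> ?T"
    then obtain x y where s: "s = (x, y)" "x\<^sup>2 - \<epsilon> * y\<^sup>2 = 1" by auto
    show "s \<in> insert (- 1, 0) (range f)"
    proof (cases "x + 1 = 0")
      case True
      then have "x = - 1" by (simp add: eq_neg_iff_add_eq_0)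
      then have "y = 0" using s(2) e0 by simp
      then show ?thesis using s \<open>x = - 1\<close> by simp
    next
      case False
      define t where "t = y / (x + 1)"
      have ty: "t * (x + 1) = y" using False by (simp add: t_def)
      have "(1 - \<epsilon> * t\<^sup>2) * (x + 1)\<^sup>2 = (x + 1)\<^sup>2 - \<epsilon> * (t * (x + 1))\<^sup>2" by (simp add: power2_eq_square algebra_simps)
      also have "\<dots> = 2 * (x + 1)" unfolding ty using s(2) by (simp add: power2_eq_square algebra_simps)
      finally have "(1 - \<epsilon> * t\<^sup>2) * (x + 1) * (x + 1) = 2 * (x + 1)" by (simp only: power2_eq_square mult.assoc)
      then have "(1 - \<epsilon> * t\<^sup>2) * (x + 1) = 2" using False by (metis mult_right_cancel)
      then have "fst (f t) + 1 = x + 1" unfolding f1 using nz[of t] by (simp add: divide_eq_eq mult.commute)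
      then have "f t = (x, y)" using f2[of t] ty by (metis add_right_cancel prod.collapse)
      then show ?thesis using s(1) by (metis insertI2 rangeI)
    qed
  next
    fix s assume "s \<in> insert (- 1, 0) (range f)"
    then show "s \<in> ?T"
    proof
      assume "s \<in> range f"
      then obtain t where t: "s = f t" by auto
      have "(1 + \<epsilon> * t\<^sup>2)\<^sup>2 - \<epsilon> * (2 * t)\<^sup>2 = (1 - \<epsilon> * t\<^sup>2)\<^sup>2" by (simp add: power2_eq_square algebra_simps)
      then have "(1 + \<epsilon> * t\<^sup>2)\<^sup>2 / (1 - \<epsilon> * t\<^sup>2)\<^sup>2 - \<epsilon> * ((2 * t)\<^sup>2 / (1 - \<epsilon> * t\<^sup>2)\<^sup>2) = 1"
        using nz[of t] by (simp add: diff_divide_distrib[symmetric] times_divide_eq_right)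
      then show ?thesis unfolding t f_def by (simp add: power_divide)
    qed simp
  qed
  moreover have "(- 1, 0) \<notin> range f"
  proof
    assume "(- 1, 0) \<in> range f"
    then obtain t where "f t = (- 1, 0)" by auto
    then show False using f1n[of t] by simp
  qed
  ultimately have "card ?T = Suc (card (range f))" by simp
  also have "card (range f) = N" using card_image[OF inj] card_F by simp
  finally show ?thesis by (simp add: norm_one_group_def)
qed

lemma even_cyclic_norm_one:
  assumes "generates unit_group (\<epsilon> :: 'f)" "generates (norm_one_group \<epsilon>) \<tau>"
  shows "even_cyclic_group (norm_one_group \<epsilon>) \<tau> (- 1, 0) ((N + 1) div 2)"
proof -
  interpret group "norm_one_group \<epsilon>" by (rule group_norm_one)
  show ?thesis
  proof
    show "finite (carrier (norm_one_group \<epsilon>))" by simp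
    show "card (carrier (norm_one_group \<epsilon>)) = 2 * ((N + 1) div 2)" using card_norm_one[OF assms(1)] N_odd by auto
    show "(N + 1) div 2 > 0" using N7 by simp
    show "(- 1, 0) \<noteq> \<one>\<^bsub>norm_one_group \<epsilon>\<^esub>" using neg_eq_iff[of 1] by (simp add: norm_one_group_def)
  qed (use assms(2) in \<open>simp_all add: norm_one_group_def\<close>)
qed

end

section \<open>The degree formulas for an abstract action\<close>

text \<open>What the degree formulas require of a curve: an action, and nonvanishing multiplicative
  functions on stabilizers compatible with conjugation. Faithfulness is asked for stabilizers of
  order at most N, which covers the orders 1, 2, 3, N and is what the reduction can provide.\<close>

locale curve_action = prime_field F N for F :: "'f::{field, finite} itself" and N +
  fixes X :: "'p set" and act :: "'f mat set \<Rightarrow> 'p \<Rightarrow> 'p" and \<theta> :: "'p \<Rightarrow> 'f mat set \<Rightarrow> 'k::field"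
  assumes act_closed: "P \<in> X \<Longrightarrow> g \<in> carrier PSL2 \<Longrightarrow> act g P \<in> X"
    and act_mult: "P \<in> X \<Longrightarrow> g \<in> carrier PSL2 \<Longrightarrow> h \<in> carrier PSL2 \<Longrightarrow> act (g \<otimes>\<^bsub>PSL2\<^esub> h) P = act g (act h P)"
    and act_one: "P \<in> X \<Longrightarrow> act \<one>\<^bsub>PSL2\<^esub> P = P"
    and \<theta>_nonzero: "P \<in> X \<Longrightarrow> h \<in> stab PSL2 act P \<Longrightarrow> \<theta> P h \<noteq> 0"
    and \<theta>_mult: "P \<in> X \<Longrightarrow> g \<in> stab PSL2 act P \<Longrightarrow> h \<in> stab PSL2 act P \<Longrightarrow>
      \<theta> P (g \<otimes>\<^bsub>PSL2\<^esub> h) = \<theta> P g * \<theta> P h"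
    and \<theta>_conj: "P \<in> X \<Longrightarrow> g \<in> carrier PSL2 \<Longrightarrow> h \<in> stab PSL2 act P \<Longrightarrow>
      \<theta> (act g P) (g \<otimes>\<^bsub>PSL2\<^esub> h \<otimes>\<^bsub>PSL2\<^esub> inv\<^bsub>PSL2\<^esub> g) = \<theta> P h"
    and \<theta>_faithful: "P \<in> X \<Longrightarrow> card (stab PSL2 act P) \<le> N \<Longrightarrow> h \<in> stab PSL2 act P \<Longrightarrow> \<theta> P h = 1 \<Longrightarrow> h = \<one>\<^bsub>PSL2\<^esub>"
begin

abbreviation "St P \<equiv> stab PSL2 act P"

lemma St_carrier: "h \<in> St P \<Longrightarrow> h \<in> carrier PSL2"
  by (simp add: stab_def)

lemma St_act: "h \<in> St P \<Longrightarrow> act h P = P"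
  by (simp add: stab_def)

lemma act_inv: "P \<in> X \<Longrightarrow> g \<in> carrier PSL2 \<Longrightarrow> act (inv\<^bsub>PSL2\<^esub> g) (act g P) = P"
  using act_mult[of P "inv\<^bsub>PSL2\<^esub> g" g] by (simp add: act_one)

lemma subgroup_St: "P \<in> X \<Longrightarrow> subgroup (St P) PSL2"
proof
  assume P: "P \<in> X"
  show "\<one>\<^bsub>PSL2\<^esub> \<in> St P" using act_one[OF P] by (simp add: stab_def)
  show "g \<otimes>\<^bsub>PSL2\<^esub> h \<in> St P" if "g \<in> St P" "h \<in> St P" for g h
    using that act_mult[OF P] by (simp add: stab_def)
  show "inv\<^bsub>PSL2\<^esub> g \<in> St P" if "g \<in> St P" for g
    using that act_inv[OF P, of g] by (simp add: stab_def)
qed (simp add: stab_def subset_iff)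

lemma finite_subgroup_St: "P \<in> X \<Longrightarrow> finite_subgroup PSL2 (St P)"
  by (intro finite_subgroup.intro finite_subgroup_axioms.intro group_PSL2 finite_PSL2 subgroup_St)

lemma finite_St: "P \<in> X \<Longrightarrow> finite (St P)"
  using finite_subset[OF _ finite_PSL2] St_carrier by (metis subsetI)

lemma St_act_eq:
  assumes P: "P \<in> X" and y: "y \<in> carrier PSL2"
  shows "St (act y P) = (\<lambda>h. y \<otimes>\<^bsub>PSL2\<^esub> h \<otimes>\<^bsub>PSL2\<^esub> inv\<^bsub>PSL2\<^esub> y) ` St P"
proof (intro equalityI subsetI)
  fix g assume g: "g \<in> St (act y P)"
  note gc = St_carrier[OF g]
  have Q: "act y P \<in> X" using act_closed P y by simp
  have "act (inv\<^bsub>PSL2\<^esub> y \<otimes>\<^bsub>PSL2\<^esub> g \<otimes>\<^bsub>PSL2\<^esub> y) P = P"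
    using P y gc Q St_act[OF g] act_inv[OF P y] by (simp add: act_mult)
  then have "inv\<^bsub>PSL2\<^esub> y \<otimes>\<^bsub>PSL2\<^esub> g \<otimes>\<^bsub>PSL2\<^esub> y \<in> St P" using y gc by (simp add: stab_def)
  moreover have "y \<otimes>\<^bsub>PSL2\<^esub> (inv\<^bsub>PSL2\<^esub> y \<otimes>\<^bsub>PSL2\<^esub> g \<otimes>\<^bsub>PSL2\<^esub> y) \<otimes>\<^bsub>PSL2\<^esub> inv\<^bsub>PSL2\<^esub> y = g"
  proof -
    have "y \<otimes>\<^bsub>PSL2\<^esub> (inv\<^bsub>PSL2\<^esub> y \<otimes>\<^bsub>PSL2\<^esub> g \<otimes>\<^bsub>PSL2\<^esub> y) \<otimes>\<^bsub>PSL2\<^esub> inv\<^bsub>PSL2\<^esub> y =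
       (y \<otimes>\<^bsub>PSL2\<^esub> inv\<^bsub>PSL2\<^esub> y) \<otimes>\<^bsub>PSL2\<^esub> g \<otimes>\<^bsub>PSL2\<^esub> (y \<otimes>\<^bsub>PSL2\<^esub> inv\<^bsub>PSL2\<^esub> y)"
      using y gc by (simp only: PSL2.m_assoc PSL2.m_closed PSL2.inv_closed)
    then show ?thesis using y gc by simp
  qed
  ultimately show "g \<in> (\<lambda>h. y \<otimes>\<^bsub>PSL2\<^esub> h \<otimes>\<^bsub>PSL2\<^esub> inv\<^bsub>PSL2\<^esub> y) ` St P" by (metis image_eqI)
next
  fix g assume "g \<in> (\<lambda>h. y \<otimes>\<^bsub>PSL2\<^esub> h \<otimes>\<^bsub>PSL2\<^esub> inv\<^bsub>PSL2\<^esub> y) ` St P"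
  then obtain h where h: "h \<in> St P" "g = y \<otimes>\<^bsub>PSL2\<^esub> h \<otimes>\<^bsub>PSL2\<^esub> inv\<^bsub>PSL2\<^esub> y" by auto
  have "act g (act y P) = act y P"
    using P y St_carrier[OF h(1)] St_act[OF h(1)] act_inv[OF P y] act_closed[OF P y] by (simp add: h(2) act_mult)
  then show "g \<in> St (act y P)" using y St_carrier[OF h(1)] by (simp add: stab_def h(2))
qed

lemma card_St_act: "P \<in> X \<Longrightarrow> y \<in> carrier PSL2 \<Longrightarrow> card (St (act y P)) = card (St P)"
  unfolding St_act_eq by (rule card_image, rule inj_onI) (simp add: St_carrier)

text \<open>The power -l of the ramification character; its induction \<open>I P l\<close> is the
  l-th summand of the equivariant degree.\<close>

definition "\<psi> P l = (\<lambda>h. inverse (\<theta> P h) ^ l)"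
definition "I P l = Ind PSL2 (St P) (char_rep (\<psi> P l))"

lemma linear_\<psi>: "P \<in> X \<Longrightarrow> linear_char PSL2 (St P) (\<psi> P l)"
  by (simp add: linear_char_def \<psi>_def \<theta>_nonzero \<theta>_mult power_mult_distrib)

lemma \<theta>_one: "P \<in> X \<Longrightarrow> \<theta> P \<one>\<^bsub>PSL2\<^esub> = 1"
  using \<theta>_mult[of P "\<one>\<^bsub>PSL2\<^esub>" "\<one>\<^bsub>PSL2\<^esub>"] \<theta>_nonzero[of P "\<one>\<^bsub>PSL2\<^esub>"] subgroup.one_closed[OF subgroup_St] by simp

lemma \<theta>_inj: "P \<in> X \<Longrightarrow> card (St P) \<le> N \<Longrightarrow> inj_on (\<theta> P) (St P)"
proof (rule inj_onI)
  fix g h assume P: "P \<in> X" "card (St P) \<le> N" and gh: "g \<in> St P" "h \<in> St P" "\<theta> P g = \<theta> P h"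
  have hi: "inv\<^bsub>PSL2\<^esub> h \<in> St P" using subgroup.m_inv_closed[OF subgroup_St[OF P(1)] gh(2)] .
  have "\<theta> P (g \<otimes>\<^bsub>PSL2\<^esub> inv\<^bsub>PSL2\<^esub> h) = \<theta> P (h \<otimes>\<^bsub>PSL2\<^esub> inv\<^bsub>PSL2\<^esub> h)"
    using \<theta>_mult[OF P(1)] gh hi by simp
  also have "\<dots> = 1" using \<theta>_one[OF P(1)] St_carrier[OF gh(2)] by simp
  finally have "g \<otimes>\<^bsub>PSL2\<^esub> inv\<^bsub>PSL2\<^esub> h = \<one>\<^bsub>PSL2\<^esub>"
    using \<theta>_faithful[OF P] subgroup.m_closed[OF subgroup_St[OF P(1)] gh(1) hi] by simp
  then show "g = h" using St_carrier gh by (metis PSL2.inv_closed PSL2.inv_inv PSL2.inv_equality)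
qed

text \<open>Translation by h permutes the stabilizer and multiplies the product of all values of
  \<open>\<theta> P\<close> by this power.\<close>

lemma \<theta>_card: 
  assumes "P \<in> X" "h \<in> St P"
  shows "\<theta> P h ^ card (St P) = 1"
proof -
  have "bij_betw (\<lambda>x. h \<otimes>\<^bsub>PSL2\<^esub> x) (St P) (St P)"
    by (rule bij_betw_byWitness[where f' = "\<lambda>x. inv\<^bsub>PSL2\<^esub> h \<otimes>\<^bsub>PSL2\<^esub> x"])
      (use assms St_carrier subgroup_St[OF assms(1)] in \<open>auto simp: subgroup.m_closed subgroup.m_inv_closed simp flip: PSL2.m_assoc\<close>)
  from prod.reindex_bij_betw[OF this, of "\<theta> P"]
  have "(\<Prod>x\<in>St P. \<theta> P x) = (\<Prod>x\<in>St P. \<theta> P (h \<otimes>\<^bsub>PSL2\<^esub> x))" by simp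
  also have "\<dots> = (\<Prod>x\<in>St P. \<theta> P h * \<theta> P x)" using assms by (intro prod.cong) (auto simp: \<theta>_mult)
  also have "\<dots> = \<theta> P h ^ card (St P) * (\<Prod>x\<in>St P. \<theta> P x)" by (simp add: prod.distrib)
  finally have "\<theta> P h ^ card (St P) * (\<Prod>x\<in>St P. \<theta> P x) = 1 * (\<Prod>x\<in>St P. \<theta> P x)" by simp
  moreover have "(\<Prod>x\<in>St P. \<theta> P x) \<noteq> 0" using \<theta>_nonzero[OF assms(1)] finite_St[OF assms(1)] by simp
  ultimately show ?thesis by (metis mult_right_cancel)
qed

text \<open>\<open>deg_eq\<close> recovers some point and some multiplicity from the divisor by
  choice. Evaluating the divisor at \<open>P\<close> shows that the multiplicity is r and that the
  chosen point lies in the orbit of \<open>P\<close>; conjugation then carries each summand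
  over.\<close>

lemma deg_eq_equiv:
  assumes P: "P \<in> X" and r: "r \<ge> 1"
  shows "rep_equiv PSL2 (deg_eq PSL2 X act \<theta> (mult_div r (reduced_orbit PSL2 act P))) (dsum (map (I P) [1..<Suc r]))"
proof -
  let ?E = "mult_div r (reduced_orbit PSL2 act P)"
  let ?Q = "\<lambda>(P', r'). P' \<in> X \<and> 1 \<le> r' \<and> ?E = mult_div r' (reduced_orbit PSL2 act P')"
  obtain P' r' where some: "(SOME x. ?Q x) = (P', r')" by (cases "SOME x. ?Q x") auto
  have "?Q (P, r)" using P r by simp
  then have "?Q (SOME x. ?Q x)" by (rule someI)
  then have P': "P' \<in> X" "1 \<le> r'" "?E = mult_div r' (reduced_orbit PSL2 act P')" unfolding some by auto
  have "\<exists>g\<in>carrier PSL2. P = act g P" by (rule bexI[of _ "\<one>\<^bsub>PSL2\<^esub>"]) (simp_all add: act_one[OF P])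
  then have "reduced_orbit PSL2 act P P = 1" by (simp add: reduced_orbit_def)
  \<comment> \<open>The orbit indicator takes only the values 0 and 1, and r is positive, so here it
    is 1.\<close>
  then have "int r = int r' * reduced_orbit PSL2 act P' P"
    using fun_cong[OF P'(3), of P] by (simp add: mult_div_def)
  then have rr: "reduced_orbit PSL2 act P' P = 1" "r' = r" using r by (auto simp: reduced_orbit_def split: if_splits)
  then obtain g where g: "g \<in> carrier PSL2" "P = act g P'" by (auto simp: reduced_orbit_def split: if_splits)
  define y where "y = inv\<^bsub>PSL2\<^esub> g"
  have y: "y \<in> carrier PSL2" "P' = act y P" using g act_inv[OF P'(1)] by (simp_all add: y_def)
  interpret A: finite_subgroup PSL2 "St P" by (rule finite_subgroup_St[OF P])
  interpret B: finite_subgroup PSL2 "St P'" by (rule finite_subgroup_St[OF P'(1)])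
  have e: "deg_eq PSL2 X act \<theta> ?E = Ind PSL2 (St P') (dsum (map char_rep (map (\<psi> P') [1..<Suc r])))"
    unfolding deg_eq_def some Let_def prod.case rr(2) by (simp add: comp_def \<psi>_def)
  have "rep_equiv PSL2 (deg_eq PSL2 X act \<theta> ?E)
      (dsum (map (\<lambda>\<phi>. Ind PSL2 (St P') (char_rep \<phi>)) (map (\<psi> P') [1..<Suc r])))"
    unfolding e by (rule B.Ind_dsum)
  also have "map (\<lambda>\<phi>. Ind PSL2 (St P') (char_rep \<phi>)) (map (\<psi> P') [1..<Suc r]) = map (I P') [1..<Suc r]"
    by (simp add: I_def[abs_def] comp_def del: upt_Suc)
  also have "rep_equiv PSL2 (dsum (map (I P') [1..<Suc r])) (dsum (map (I P) [1..<Suc r]))"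
  proof (rule dsum_cong)
    have "rep_equiv PSL2 (I P' l) (I P l)" for l
      unfolding I_def
    proof (rule Ind_conj[OF A.finite_subgroup_axioms B.finite_subgroup_axioms y(1)])
      show "St P' = (\<lambda>h. y \<otimes>\<^bsub>PSL2\<^esub> h \<otimes>\<^bsub>PSL2\<^esub> inv\<^bsub>PSL2\<^esub> y) ` St P" unfolding y(2) by (rule St_act_eq[OF P y(1)])
      show "linear_char PSL2 (St P) (\<psi> P l)" by (rule linear_\<psi>[OF P])
      show "\<psi> P' l (y \<otimes>\<^bsub>PSL2\<^esub> h \<otimes>\<^bsub>PSL2\<^esub> inv\<^bsub>PSL2\<^esub> y) = \<psi> P l h" if "h \<in> St P" for h
        unfolding \<psi>_def y(2) \<theta>_conj[OF P y(1) that] ..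
    qed
    then show "list_all2 (rep_equiv PSL2) (map (I P') [1..<Suc r]) (map (I P) [1..<Suc r])"
      by (simp add: list_all2_conv_all_nth)
  qed
  finally show ?thesis .
qed

lemma I_periodic: "P \<in> X \<Longrightarrow> I P (l + card (St P)) = I P l"
  unfolding I_def
  by (rule finite_subgroup.Ind_char_cong[OF finite_subgroup_St])
    (simp_all add: \<psi>_def power_add \<theta>_card power_inverse)

text \<open>A linear relation among the characters is a polynomial of degree below the order of the
  stabilizer that vanishes at all values of \<open>\<theta> P\<close>, and these are distinct by
  faithfulness.\<close>

lemma sum_I_regular:
  assumes P: "P \<in> X" "card (St P) \<le> N"
  shows "rep_equiv PSL2 (dsum (map (I P) [1..<Suc (card (St P))])) (regular_rep PSL2)"
proof -
  interpret A: finite_subgroup PSL2 "St P" by (rule finite_subgroup_St[OF P(1)])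
  let ?m = "card (St P)"
  let ?\<psi>s = "map (\<psi> P) [1..<Suc ?m]"
  have "rep_equiv PSL2 (dsum (map (\<lambda>\<psi>. Ind PSL2 (St P) (char_rep \<psi>)) ?\<psi>s)) (regular_rep PSL2)"
  proof (rule A.sum_Ind_regular)
    show "length ?\<psi>s = ?m" by simp
    show "linear_char PSL2 (St P) \<psi>" if "\<psi> \<in> set ?\<psi>s" for \<psi>
      using that linear_\<psi>[OF P(1)] by auto
    fix c :: "nat \<Rightarrow> 'k" assume c: "\<And>h. h \<in> St P \<Longrightarrow> (\<Sum>l<length ?\<psi>s. inverse ((?\<psi>s ! l) h) * c l) = 0"
    \<comment> \<open>The exponents of the characters start at 1; splitting off one factor
      \<open>\<theta> P h\<close> leaves a polynomial with exponents from 0.\<close>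
    define p where "p = (\<Sum>l<?m. Polynomial.monom (c l) l)"
    have root: "poly p (\<theta> P h) = 0" if h: "h \<in> St P" for h
    proof -
      have "\<theta> P h * poly p (\<theta> P h) = (\<Sum>l<length ?\<psi>s. inverse ((?\<psi>s ! l) h) * c l)"
        unfolding p_def by (simp add: poly_sum poly_monom sum_distrib_left \<psi>_def power_inverse mult_ac del: upt_Suc)
      then show ?thesis using c[OF h] \<theta>_nonzero[OF P(1) h] by simp
    qed
    have m0: "?m > 0" using A.H_one finite_St[OF P(1)] by (auto simp: card_gt_0_iff)
    have "p = 0"
    proof (rule ccontr)
      assume p0: "p \<noteq> 0"
      have "?m = card (\<theta> P ` St P)" using card_image[OF \<theta>_inj[OF P]] by simp
      also have "\<dots> \<le> card {x. poly p x = 0}"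
        using root poly_roots_finite[OF p0] by (intro card_mono) auto
      also have "\<dots> \<le> degree p" by (rule poly_roots_degree[OF p0])
      also have "\<dots> < ?m" unfolding p_def
        by (rule degree_sum_less) (use m0 in \<open>auto intro: le_less_trans[OF degree_monom_le]\<close>)
      finally show False by simp
    qed
    show "\<forall>l<length ?\<psi>s. c l = 0"
    proof (intro allI impI)
      fix l assume "l < length ?\<psi>s"
      then have "l < ?m" by (simp del: upt_Suc)
      then have "Polynomial.coeff p l = c l" unfolding p_def coeff_sum by (rule sum_single_eq) auto
      then show "c l = 0" using \<open>p = 0\<close> by simp
    qed
  qed
  then show ?thesis by (simp add: I_def[abs_def] comp_def del: upt_Suc)
qed

lemma rep_dim_regular_PSL2: "\<exists>n. rep_dim PSL2 n (regular_rep PSL2 :: ('f mat set, 'k) rep)"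
proof -
  interpret A: finite_subgroup "PSL2 :: 'f mat set monoid" "{\<one>\<^bsub>PSL2\<^esub>}"
    by (intro finite_subgroup.intro finite_subgroup_axioms.intro group_PSL2 finite_PSL2 PSL2.triv_subgroup)
  show ?thesis using A.rep_dim_regular by blast
qed

lemma rep_dim_I: "P \<in> X \<Longrightarrow> \<exists>n. rep_dim PSL2 n (I P l)"
  unfolding I_def using finite_subgroup.rep_dim_Ind_char[OF finite_subgroup_St] by blast

lemma rep_dim_dsum_ex: "(\<And>x. x \<in> set xs \<Longrightarrow> \<exists>n. rep_dim G n x) \<Longrightarrow> \<exists>n. rep_dim G n (dsum xs)"
proof (induction xs)
  case Nil
  show ?case by (rule exI[of _ 0]) (simp add: rep_dim_def dsum_Nil)
next
  case (Cons x xs)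
  then obtain a b where "rep_dim G a x" "rep_dim G b (dsum xs)" by (meson list.set_intros)
  then have "rep_dim G (a + b) (dsum (x # xs))" unfolding dsum_Cons[of x xs] by (rule rep_dim_dsum2)
  then show ?case by blast
qed

lemma dsum_nil_right: "dsum [dsum xs, dsum []] = dsum xs"
  using dsum_append[of xs "[]"] by simp

lemma I_list: 
  assumes "P \<in> X"
  shows "map (I P) [1..<Suc (card (St P) * r + s)] =
    concat (replicate r (map (I P) [1..<Suc (card (St P))])) @ map (I P) [1..<Suc s]"
proof (induction r)
  case (Suc r)
  let ?m = "card (St P)"
  have "[1..<Suc (?m * Suc r + s)] = [1..<Suc ?m] @ [1 + ?m..<Suc (?m * r + s) + ?m]"
    using upt_add_eq_append[of 1 "Suc ?m" "?m * r + s"] by (simp add: algebra_simps del: upt_Suc)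
  also have "[1 + ?m..<Suc (?m * r + s) + ?m] = map (\<lambda>l. l + ?m) [1..<Suc (?m * r + s)]"
    by (rule nth_equalityI) (simp_all del: upt_Suc)
  finally have "map (I P) [1..<Suc (?m * Suc r + s)] = map (I P) [1..<Suc ?m] @ map (\<lambda>l. I P (l + ?m)) [1..<Suc (?m * r + s)]"
    by (simp add: comp_def del: upt_Suc)
  also have "map (\<lambda>l. I P (l + ?m)) [1..<Suc (?m * r + s)] = map (I P) [1..<Suc (?m * r + s)]"
    by (simp only: I_periodic[OF assms])
  finally show ?case unfolding Suc by (simp del: upt_Suc)
qed simp

text \<open>The summands repeat with the order of the stabilizer as period, and each full period
  adds up to the regular representation.\<close>

lemma deg_eq_periodic:
  assumes P: "P \<in> X" "card (St P) \<le> N" and r: "card (St P) * r + s \<ge> 1"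
  shows "rep_equiv PSL2 (deg_eq PSL2 X act \<theta> (mult_div (card (St P) * r + s) (reduced_orbit PSL2 act P)))
    (dsum [copies r (regular_rep PSL2), dsum (map (I P) [1..<Suc s])])"
proof -
  let ?B = "map (I P) [1..<Suc (card (St P))]"
  have "rep_equiv PSL2 (deg_eq PSL2 X act \<theta> (mult_div (card (St P) * r + s) (reduced_orbit PSL2 act P)))
     (dsum (map (I P) [1..<Suc (card (St P) * r + s)]))" by (rule deg_eq_equiv[OF P(1) r])
  also have "dsum (map (I P) [1..<Suc (card (St P) * r + s)]) =
      dsum [dsum (map dsum (replicate r ?B)), dsum (map (I P) [1..<Suc s])]"
    unfolding I_list[OF P(1)] dsum_append dsum_flatten ..
  also have "rep_equiv PSL2 \<dots> (dsum [copies r (regular_rep PSL2), dsum (map (I P) [1..<Suc s])])"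
  proof (rule dsum_cong2)
    show "rep_equiv PSL2 (dsum (map dsum (replicate r ?B))) (copies r (regular_rep PSL2))"
      unfolding copies_def
      by (rule dsum_cong) (use sum_I_regular[OF P] in \<open>simp add: list_all2_conv_all_nth del: upt_Suc\<close>)
    obtain n where "rep_dim PSL2 n (dsum (map (I P) [1..<Suc s]))"
      using rep_dim_dsum_ex[of "map (I P) [1..<Suc s]" PSL2] rep_dim_I[OF P(1)] by auto
    then show "rep_equiv PSL2 (dsum (map (I P) [1..<Suc s])) (dsum (map (I P) [1..<Suc s]))" by (rule rep_equiv_refl)
  qed
  finally show ?thesis .
qed

lemma deg_eq_regular:
  assumes P: "P \<in> X" "card (St P) \<le> N" and r: "r \<ge> 1"
  shows "rep_equiv PSL2 (deg_eq PSL2 X act \<theta> (mult_div (card (St P) * r) (reduced_orbit PSL2 act P))) (copies r (regular_rep PSL2))"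
proof -
  have "card (St P) > 0"
    using finite_St[OF P(1)] subgroup.one_closed[OF subgroup_St[OF P(1)]] by (auto simp: card_gt_0_iff)
  then have "card (St P) * r + 0 \<ge> 1" using r by (simp add: Suc_leI)
  from deg_eq_periodic[OF P this] show ?thesis
    by (simp add: copies_def dsum_nil_right)
qed

lemma copies_regular_refl: "rep_equiv PSL2 (copies r (regular_rep PSL2)) (copies r (regular_rep PSL2 :: ('f mat set, 'k) rep))"
proof -
  obtain n where "rep_dim PSL2 n (copies r (regular_rep PSL2 :: ('f mat set, 'k) rep))"
    using rep_dim_dsum_ex[of "replicate r (regular_rep PSL2 :: ('f mat set, 'k) rep)" PSL2] rep_dim_regular_PSL2 
    unfolding copies_def by auto
  then show ?thesis by (rule rep_equiv_refl)
qed

theorem free_orbit: "free_orbit_formula X act \<theta>"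
  unfolding free_orbit_formula_def
proof (intro ballI allI impI, elim conjE)
  fix P D r assume P: "P \<in> X" and D: "card (St P) = 1" "D = reduced_orbit PSL2 act P" and r: "(1::nat) \<le> r"
  show "rep_equiv PSL2 (deg_eq PSL2 X act \<theta> (mult_div r D)) (copies r (regular_rep PSL2))"
    using deg_eq_regular[OF P _ r] D N7 by simp
qed

theorem order2: "order2_formula X act \<theta>"
  unfolding order2_formula_def
proof (intro ballI allI impI, elim conjE, intro conjI allI impI)
  fix P D H and \<theta>1 :: "'f mat set \<Rightarrow> 'k" and r :: nat
  assume P: "P \<in> X" and H: "H = St P" "card H = 2" and D: "D = reduced_orbit PSL2 act P" and nt: "nontrivial_char PSL2 H \<theta>1"
  have cN: "card (St P) \<le> N" using H N7 by simp
  interpret A: finite_subgroup PSL2 "St P" by (rule finite_subgroup_St[OF P])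
  show "rep_equiv PSL2 (deg_eq PSL2 X act \<theta> (mult_div (2 * r) D)) (copies r (regular_rep PSL2))" if "1 \<le> r"
    using deg_eq_regular[OF P cN that] H D by simp
  have "I P 1 = Ind PSL2 H (char_rep \<theta>1)"
    unfolding I_def H(1)
  proof (rule A.Ind_char_cong)
    fix x assume x: "x \<in> St P"
    obtain h where h: "h \<in> St P" "\<theta>1 h \<noteq> 1" using nt H(1) by (auto simp: nontrivial_char_def)
    have lin: "linear_char PSL2 (St P) \<theta>1" using nt H(1) by (simp add: nontrivial_char_def)
    have h1: "h \<noteq> \<one>\<^bsub>PSL2\<^esub>" using h(2) A.linear_char_one[OF lin] by auto
    have sub: "{\<one>\<^bsub>PSL2\<^esub>, h} = St P"
      using h1 h(1) A.H_one H finite_St[OF P] by (intro card_subset_eq) auto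
    have t2: "\<theta> P h ^ 2 = 1" using \<theta>_card[OF P h(1)] H by simp
    have tn: "\<theta> P h \<noteq> 1" using \<theta>_faithful[OF P cN h(1)] h1 by blast
    have "h \<otimes>\<^bsub>PSL2\<^esub> h = \<one>\<^bsub>PSL2\<^esub>"
      using \<theta>_inj[OF P cN] \<theta>_mult[OF P h(1) h(1)] t2 \<theta>_one[OF P] A.H_mult[OF h(1) h(1)] A.H_one
      by (simp add: inj_on_def power2_eq_square)
    then have "\<theta>1 h ^ 2 = 1"
      using A.linear_char_mult[OF lin h(1) h(1)] A.linear_char_one[OF lin] by (simp add: power2_eq_square)
    \<comment> \<open>The only square roots of 1 are 1 and -1, so both characters take the value -1
      at the nontrivial element.\<close>
    then have "\<theta>1 h = - 1" "\<theta> P h = - 1" using h(2) t2 tn by (simp_all add: power2_eq_1_iff)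
    then have "\<psi> P 1 h = \<theta>1 h" by (simp add: \<psi>_def)
    moreover have "\<psi> P 1 \<one>\<^bsub>PSL2\<^esub> = \<theta>1 \<one>\<^bsub>PSL2\<^esub>" using A.linear_char_one[OF lin] \<theta>_one[OF P] by (simp add: \<psi>_def)
    moreover have "x = \<one>\<^bsub>PSL2\<^esub> \<or> x = h" using x sub by blast
    ultimately show "\<psi> P 1 x = \<theta>1 x" by auto
  qed
  then show "rep_equiv PSL2 (deg_eq PSL2 X act \<theta> (mult_div (2 * r + 1) D))
      (dsum [copies r (regular_rep PSL2), Ind PSL2 H (char_rep \<theta>1)])"
    using deg_eq_periodic[OF P cN, of r 1] H D by simp
qed

theorem order3: "order3_formula X act \<theta>"
  unfolding order3_formula_def
proof (intro ballI allI impI, elim conjE)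
  fix P D H and \<theta>2 :: "'f mat set \<Rightarrow> 'k"
  assume P: "P \<in> X" and H: "H = St P" "card H = 3" and D: "D = reduced_orbit PSL2 act P" and nt: "nontrivial_char PSL2 H \<theta>2"
  have cN: "card (St P) \<le> N" using H N7 by simp
  interpret A: finite_subgroup PSL2 "St P" by (rule finite_subgroup_St[OF P])
  obtain h where h: "h \<in> St P" "\<theta>2 h \<noteq> 1" using nt H(1) by (auto simp: nontrivial_char_def)
  note hc = St_carrier[OF h(1)]
  have lin: "linear_char PSL2 (St P) \<theta>2" using nt H(1) by (simp add: nontrivial_char_def)
  have h1: "h \<noteq> \<one>\<^bsub>PSL2\<^esub>" using h(2) A.linear_char_one[OF lin] by auto
  let ?w = "\<theta> P h"
  have w3: "?w ^ 3 = 1" using \<theta>_card[OF P h(1)] H by simp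
  have w1: "?w \<noteq> 1" using \<theta>_faithful[OF P cN h(1)] h1 by blast
  have w0: "?w \<noteq> 0" by (rule \<theta>_nonzero[OF P h(1)])
  note hh = A.H_mult[OF h(1) h(1)]
  have h3: "h \<otimes>\<^bsub>PSL2\<^esub> h \<otimes>\<^bsub>PSL2\<^esub> h = \<one>\<^bsub>PSL2\<^esub>"
    using \<theta>_inj[OF P cN] \<theta>_mult[OF P hh h(1)] \<theta>_mult[OF P h(1) h(1)] w3 \<theta>_one[OF P] A.H_mult[OF hh h(1)] A.H_one
    by (simp add: inj_on_def power3_eq_cube)
  have w2: "?w ^ 2 \<noteq> 1" using w3 w1 by (metis power3_eq_cube power2_eq_square mult_1)
  have hi: "h \<otimes>\<^bsub>PSL2\<^esub> h = inv\<^bsub>PSL2\<^esub> h" using h3 hc by (metis PSL2.inv_equality PSL2.m_closed PSL2.inv_inv)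
  have hne: "inv\<^bsub>PSL2\<^esub> h \<noteq> h" "inv\<^bsub>PSL2\<^esub> h \<noteq> \<one>\<^bsub>PSL2\<^esub>"
  proof -
    show "inv\<^bsub>PSL2\<^esub> h \<noteq> \<one>\<^bsub>PSL2\<^esub>" using h1 hc by (metis PSL2.inv_inv PSL2.inv_one)
    show "inv\<^bsub>PSL2\<^esub> h \<noteq> h"
    proof
      assume "inv\<^bsub>PSL2\<^esub> h = h"
      then have "?w * ?w = ?w" using \<theta>_mult[OF P h(1) h(1)] hi by simp
      then show False using w0 w1 by simp
    qed
  qed
  have sub: "{\<one>\<^bsub>PSL2\<^esub>, h, inv\<^bsub>PSL2\<^esub> h} = St P"
    using h1 hne h(1) A.H_inv[OF h(1)] A.H_one H finite_St[OF P] by (intro card_subset_eq) auto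
  have wi: "\<theta> P (inv\<^bsub>PSL2\<^esub> h) = ?w ^ 2" using \<theta>_mult[OF P h(1) h(1)] hi by (simp add: power2_eq_square)
  have iw: "inverse ?w = ?w ^ 2" using w3 by (intro inverse_unique) (simp add: power3_eq_cube power2_eq_square mult.assoc)
  have iw2: "inverse (?w ^ 2) = ?w" using iw by (metis inverse_inverse_eq)
  have w4: "(?w ^ 2) ^ 2 = ?w" using w3 by (simp add: power3_eq_cube power2_eq_square mult.assoc[symmetric])
  have \<psi>h: "\<psi> P 1 h = ?w ^ 2" "\<psi> P 2 h = ?w" "\<psi> P 1 (inv\<^bsub>PSL2\<^esub> h) = ?w" "\<psi> P 2 (inv\<^bsub>PSL2\<^esub> h) = ?w ^ 2"
    by (simp_all only: \<psi>_def power_one_right wi iw iw2 w4)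
  obtain y where y: "y \<in> carrier PSL2" "y \<otimes>\<^bsub>PSL2\<^esub> h \<otimes>\<^bsub>PSL2\<^esub> inv\<^bsub>PSL2\<^esub> y = inv\<^bsub>PSL2\<^esub> h"
    using order3_conj_inverse[OF hc h1 h3] by blast
  have y2: "y \<otimes>\<^bsub>PSL2\<^esub> inv\<^bsub>PSL2\<^esub> h \<otimes>\<^bsub>PSL2\<^esub> inv\<^bsub>PSL2\<^esub> y = h"
  proof -
    have "inv\<^bsub>PSL2\<^esub> (y \<otimes>\<^bsub>PSL2\<^esub> h \<otimes>\<^bsub>PSL2\<^esub> inv\<^bsub>PSL2\<^esub> y) = y \<otimes>\<^bsub>PSL2\<^esub> inv\<^bsub>PSL2\<^esub> h \<otimes>\<^bsub>PSL2\<^esub> inv\<^bsub>PSL2\<^esub> y"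
      using y(1) hc by (simp add: PSL2.inv_mult_group PSL2.m_assoc)
    then show ?thesis using y(2) hc by simp
  qed
  \<comment> \<open>Conjugation by \<open>y\<close> inverts \<open>h\<close> and so exchanges the
    two nontrivial characters.\<close>
  have I12: "rep_equiv PSL2 (I P 2) (I P 1)"
    unfolding I_def
  proof (rule Ind_conj[OF A.finite_subgroup_axioms A.finite_subgroup_axioms y(1) _ linear_\<psi>[OF P]])
    show "St P = (\<lambda>h. y \<otimes>\<^bsub>PSL2\<^esub> h \<otimes>\<^bsub>PSL2\<^esub> inv\<^bsub>PSL2\<^esub> y) ` St P"
      unfolding sub[symmetric] using y y2 by auto
    show "\<psi> P 2 (y \<otimes>\<^bsub>PSL2\<^esub> x \<otimes>\<^bsub>PSL2\<^esub> inv\<^bsub>PSL2\<^esub> y) = \<psi> P 1 x" if "x \<in> St P" for x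
    proof -
      have "x = \<one>\<^bsub>PSL2\<^esub> \<or> x = h \<or> x = inv\<^bsub>PSL2\<^esub> h" using that sub by blast
      moreover have "\<psi> P 2 \<one>\<^bsub>PSL2\<^esub> = \<psi> P 1 \<one>\<^bsub>PSL2\<^esub>" using \<theta>_one[OF P] by (simp add: \<psi>_def)
      ultimately show ?thesis using y y2 \<psi>h by auto
    qed
  qed
  have t3: "\<theta>2 h ^ 3 = 1"
    using A.linear_char_mult[OF lin hh h(1)] A.linear_char_mult[OF lin h(1) h(1)] A.linear_char_one[OF lin] h3
    by (simp add: power3_eq_cube)
  have ti: "\<theta>2 (inv\<^bsub>PSL2\<^esub> h) = \<theta>2 h ^ 2" using A.linear_char_mult[OF lin h(1) h(1)] hi by (simp add: power2_eq_square)
  \<comment> \<open>Since 1 + w + w^2 = 0, the polynomial t^3 - 1 factors as (t - 1)(t - w)(t -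
    w^2); hence the given character is one of the two powers of \<open>\<theta> P\<close>.\<close>
  have "(\<theta>2 h - 1) * ((\<theta>2 h - ?w) * (\<theta>2 h - ?w ^ 2)) = 0"
  proof -
    have s: "1 + ?w + ?w ^ 2 = 0"
    proof -
      have "(?w - 1) * (1 + ?w + ?w ^ 2) = ?w ^ 3 - 1" by (simp add: algebra_simps power3_eq_cube power2_eq_square)
      then show ?thesis using w3 w1 by simp
    qed
    let ?t = "\<theta>2 h"
    have "(?t - 1) * ((?t - ?w) * (?t - ?w ^ 2)) = ?t ^ 3 - (1 + ?w + ?w ^ 2) * ?t ^ 2 + (?w + ?w ^ 2 + ?w ^ 3) * ?t - ?w ^ 3"
      by (simp add: algebra_simps power3_eq_cube power2_eq_square)
    also have "\<dots> = ?t ^ 3 - 0 * ?t ^ 2 + (1 + ?w + ?w ^ 2) * ?t - 1" unfolding s w3 using s by (simp add: add_ac)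
    also have "\<dots> = 0" unfolding s t3 by simp
    finally show ?thesis .
  qed
  then have "\<theta>2 h = ?w \<or> \<theta>2 h = ?w ^ 2" using h(2) by simp
  then have "Ind PSL2 H (char_rep \<theta>2) = I P 1 \<or> Ind PSL2 H (char_rep \<theta>2) = I P 2"
  proof
    have one: "\<psi> P l \<one>\<^bsub>PSL2\<^esub> = \<theta>2 \<one>\<^bsub>PSL2\<^esub>" for l using A.linear_char_one[OF lin] \<theta>_one[OF P] by (simp add: \<psi>_def)
    have cong: "Ind PSL2 H (char_rep \<theta>2) = I P l"
      if "\<theta>2 h = \<psi> P l h" "\<theta>2 (inv\<^bsub>PSL2\<^esub> h) = \<psi> P l (inv\<^bsub>PSL2\<^esub> h)" for l
      unfolding H(1) I_def
    proof (rule A.Ind_char_cong)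
      fix x assume "x \<in> St P"
      then have "x = \<one>\<^bsub>PSL2\<^esub> \<or> x = h \<or> x = inv\<^bsub>PSL2\<^esub> h" using sub by blast
      then show "\<theta>2 x = \<psi> P l x" using that one[of l] by auto
    qed
    show ?thesis if "\<theta>2 h = ?w" using cong[of 2] that ti \<psi>h by simp
    show ?thesis if "\<theta>2 h = ?w ^ 2" using cong[of 1] that ti \<psi>h w4 by simp
  qed
  then have I1: "rep_equiv PSL2 (I P 1) (Ind PSL2 H (char_rep \<theta>2))" and I2: "rep_equiv PSL2 (I P 2) (Ind PSL2 H (char_rep \<theta>2))"
    using I12 rep_equiv_sym[OF I12] rep_dim_I[OF P] by (metis rep_equiv_refl)+
  show "(\<forall>r\<ge>1. rep_equiv PSL2 (deg_eq PSL2 X act \<theta> (mult_div (3 * r) D)) (copies r (regular_rep PSL2))) \<and>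
      (\<forall>r. rep_equiv PSL2 (deg_eq PSL2 X act \<theta> (mult_div (3 * r + 1) D))
          (dsum [copies r (regular_rep PSL2), Ind PSL2 H (char_rep \<theta>2)])) \<and>
      (\<forall>r. rep_equiv PSL2 (deg_eq PSL2 X act \<theta> (mult_div (3 * r + 2) D))
          (dsum [copies r (regular_rep PSL2), copies 2 (Ind PSL2 H (char_rep \<theta>2))]))"
  proof (intro conjI allI impI)
    fix r :: nat
    show "rep_equiv PSL2 (deg_eq PSL2 X act \<theta> (mult_div (3 * r) D)) (copies r (regular_rep PSL2))" if "1 \<le> r"
      using deg_eq_regular[OF P cN that] H D by simp
    have "rep_equiv PSL2 (deg_eq PSL2 X act \<theta> (mult_div (3 * r + 1) D)) (dsum [copies r (regular_rep PSL2), I P 1])"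
      using deg_eq_periodic[OF P cN, of r 1] H D by simp
    also have "rep_equiv PSL2 \<dots> (dsum [copies r (regular_rep PSL2), Ind PSL2 H (char_rep \<theta>2)])"
      by (rule dsum_cong2[OF copies_regular_refl I1])
    finally show "rep_equiv PSL2 (deg_eq PSL2 X act \<theta> (mult_div (3 * r + 1) D))
          (dsum [copies r (regular_rep PSL2), Ind PSL2 H (char_rep \<theta>2)])" .
    have "[1..<Suc 2] = [1, 2]" by (simp add: upt_rec numeral_2_eq_2)
    then have "rep_equiv PSL2 (deg_eq PSL2 X act \<theta> (mult_div (3 * r + 2) D))
        (dsum [copies r (regular_rep PSL2), dsum [I P 1, I P 2]])"
      using deg_eq_periodic[OF P cN, of r 2] H D by (simp del: upt_Suc)
    also have "rep_equiv PSL2 \<dots> (dsum [copies r (regular_rep PSL2), copies 2 (Ind PSL2 H (char_rep \<theta>2))])"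
      using dsum_cong2[OF copies_regular_refl dsum_cong2[OF I1 I2]] by (simp add: copies_def numeral_2_eq_2)
    finally show "rep_equiv PSL2 (deg_eq PSL2 X act \<theta> (mult_div (3 * r + 2) D))
          (dsum [copies r (regular_rep PSL2), copies 2 (Ind PSL2 H (char_rep \<theta>2))])" .
  qed
qed

end

section \<open>Counting residues and dimensions\<close>

context prime_field begin

lemma Legendre_cases:
  assumes "a \<in> {1..<N}"
  shows "Legendre (int a) (int N) = (if \<exists>s::'f. s\<^sup>2 = of_nat a then 1 else - 1)"
proof -
  have "\<not> N dvd a" using assms by (auto dest: dvd_imp_le)
  then have a0: "\<not> [int a = 0] (mod int N)" by (simp add: cong_0_iff)
  have "QuadRes (int N) (int a) \<longleftrightarrow> (\<exists>s::'f. s\<^sup>2 = of_nat a)"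
  proof
    assume "QuadRes (int N) (int a)"
    then obtain y where "[y\<^sup>2 = int a] (mod int N)" by (auto simp: QuadRes_def)
    then have "of_int (y\<^sup>2) = (of_int (int a) :: 'f)" by (simp only: of_int_eq_iff_F)
    then have "(of_int y :: 'f)\<^sup>2 = of_nat a" by simp
    then show "\<exists>s::'f. s\<^sup>2 = of_nat a" by blast
  next
    assume "\<exists>s::'f. s\<^sup>2 = of_nat a"
    then obtain s :: 'f where s: "s\<^sup>2 = of_nat a" by blast
    obtain y where "of_int y = s" using of_int_surj by blast
    then have "of_int (y\<^sup>2) = (of_int (int a) :: 'f)" using s by simp
    then have "[y\<^sup>2 = int a] (mod int N)" by (simp only: of_int_eq_iff_F)
    then show "QuadRes (int N) (int a)" by (auto simp: QuadRes_def)
  qed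
  then show ?thesis using a0 by (simp add: Legendre_def)
qed

text \<open>The nonzero squares number at least (N - 1)/2, multiplication by the nonsquare
  \<epsilon> injects them into the nonsquares, and both numbers add up to N - 1.\<close>

lemma card_Legendre:
  assumes \<epsilon>: "generates unit_group (\<epsilon> :: 'f)"
  shows "card {a \<in> {1..<N}. Legendre (int a) (int N) = 1} = (N - 1) div 2"
    "card {a \<in> {1..<N}. Legendre (int a) (int N) = - 1} = (N - 1) div 2"
proof -
  let ?R = "{a \<in> {1..<N}. Legendre (int a) (int N) = 1}"
  let ?R' = "{a \<in> {1..<N}. Legendre (int a) (int N) = - 1}"
  let ?S = "range (\<lambda>x::'f. x\<^sup>2) - {0}"
  have e0: "\<epsilon> \<noteq> 0" using \<epsilon> by (simp add: generates_def unit_group_def)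
  have inj: "inj_on (of_nat :: nat \<Rightarrow> 'f) {..<N}"
  proof (rule inj_onI)
    fix i j assume "i \<in> {..<N}" "j \<in> {..<N}" "of_nat i = (of_nat j :: 'f)"
    then show "i = j" using of_int_eq_iff_F[of "int i" "int j"] by (simp add: cong_def)
  qed
  have nz: "of_nat a \<noteq> (0::'f)" if "a \<in> {1..<N}" for a
    using that unfolding of_nat_eq_0 by (auto dest: dvd_imp_le)
  have R: "of_nat ` ?R = ?S"
  proof (intro equalityI subsetI)
    fix x :: 'f assume "x \<in> of_nat ` ?R"
    then obtain a where a: "a \<in> {1..<N}" "Legendre (int a) (int N) = 1" "x = of_nat a" by auto
    have "\<exists>s::'f. s\<^sup>2 = of_nat a"
    proof (rule ccontr)
      assume "\<not> (\<exists>s::'f. s\<^sup>2 = of_nat a)"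
      then show False using Legendre_cases[OF a(1)] a(2) by simp
    qed
    then obtain s :: 'f where "x = s\<^sup>2" unfolding a(3) by metis
    then have "x \<in> range (\<lambda>x::'f. x\<^sup>2)" by (rule range_eqI)
    then show "x \<in> ?S" using nz[OF a(1)] a(3) by simp
  next
    fix x :: 'f assume x: "x \<in> ?S"
    obtain a where a: "a < N" "x = of_nat a" using of_nat_surj[of x] by auto
    then have "a \<in> {1..<N}" using x by (cases a) auto
    moreover have "\<exists>s::'f. s\<^sup>2 = of_nat a" using x a(2) by auto
    ultimately show "x \<in> of_nat ` ?R" using Legendre_cases[of a] a(2) by auto
  qed
  have "card (of_nat ` ?R :: 'f set) = card ?R" by (intro card_image) (use inj in \<open>auto intro: inj_on_subset\<close>)
  then have RS: "card ?R = card ?S" unfolding R by simp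
  have "0 \<in> range (\<lambda>x::'f. x\<^sup>2)" by (rule range_eqI[of _ _ 0]) simp
  then have "card ?S = card (range (\<lambda>x::'f. x\<^sup>2)) - 1" by (simp add: card_Diff_singleton)
  with RS have ge: "(N - 1) div 2 \<le> card ?R" using card_squares N7 by linarith
  have R': "(\<lambda>s. \<epsilon> * s) ` ?S \<subseteq> of_nat ` ?R'"
  proof
    fix x assume "x \<in> (\<lambda>s. \<epsilon> * s) ` ?S"
    then obtain y :: 'f where y: "x = \<epsilon> * y\<^sup>2" "y\<^sup>2 \<noteq> 0" by blast
    then have y0: "y \<noteq> 0" by auto
    obtain a where a: "a < N" "x = of_nat a" using of_nat_surj[of x] by auto
    have x0: "x \<noteq> 0" using y e0 by simp
    then have a1: "a \<in> {1..<N}" using a by (cases a) auto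
    have "\<not> (\<exists>s::'f. s\<^sup>2 = of_nat a)"
    proof
      assume "\<exists>s::'f. s\<^sup>2 = of_nat a"
      then obtain s where "s\<^sup>2 = \<epsilon> * y\<^sup>2" using a y by auto
      then have "\<epsilon> = (s / y)\<^sup>2" using y0 by (simp add: power_divide nonzero_eq_divide_eq)
      with nonsquare_gen[OF \<epsilon>] show False by blast
    qed
    then show "x \<in> of_nat ` ?R'" using Legendre_cases[OF a1] a1 a(2) by auto
  qed
  have "card ((\<lambda>s. \<epsilon> * s) ` ?S) = card ?S" using e0 by (intro card_image inj_onI) simp
  moreover have "card ((\<lambda>s. \<epsilon> * s) ` ?S) \<le> card (of_nat ` ?R' :: 'f set)" by (rule card_mono) (use R' in auto)
  moreover have "card (of_nat ` ?R' :: 'f set) = card ?R'" using inj by (intro card_image) (auto intro: inj_on_subset)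
  ultimately have le: "card ?R \<le> card ?R'" using RS by simp
  have "{1..<N} = ?R \<union> ?R'"
  proof (intro equalityI subsetI)
    fix a assume "a \<in> {1..<N}"
    then show "a \<in> ?R \<union> ?R'" using Legendre_cases[of a] by (simp split: if_splits)
  qed blast
  moreover have "card (?R \<union> ?R') = card ?R + card ?R'" by (rule card_Un_disjoint) auto
  ultimately have "card {1..<N} = card ?R + card ?R'" by (rule trans[OF arg_cong])
  then have "card ?R + card ?R' = N - 1" by simp
  then show "card ?R = (N - 1) div 2" "card ?R' = (N - 1) div 2" using ge le N_odd by presburger+
qed

lemma sum_indicator_pow:
  fixes \<zeta> :: complex
  assumes "S \<subseteq> {1..<N}" "finite S"
  shows "(\<Sum>k<N. of_int (if k \<in> S then 1 else 0) * \<zeta> ^ k) = (\<Sum>a\<in>S. \<zeta> ^ a)"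
    "(\<Sum>k<N. if k \<in> S then 1 else 0 :: int) = int (card S)"
proof -
  have "(\<Sum>k<N. of_int (if k \<in> S then 1 else 0) * \<zeta> ^ k) = (\<Sum>k\<in>S. \<zeta> ^ k)"
    by (rule sum.mono_neutral_cong_right) (use assms in auto)
  then show "(\<Sum>k<N. of_int (if k \<in> S then 1 else 0) * \<zeta> ^ k) = (\<Sum>a\<in>S. \<zeta> ^ a)" .
  have "(\<Sum>k<N. if k \<in> S then 1 else 0 :: int) = (\<Sum>k\<in>S. 1)"
    by (rule sum.mono_neutral_cong_right) (use assms in auto)
  then show "(\<Sum>k<N. if k \<in> S then 1 else 0 :: int) = int (card S)" by simp
qed

lemma sum_delta0:
  fixes \<zeta> :: complex
  shows "(\<Sum>k<N. of_int (if k = 0 then 1 else 0) * \<zeta> ^ k) = 1" "(\<Sum>k<N. if k = 0 then 1 else 0 :: int) = 1"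
proof -
  have N0: "0 < N" using N7 by simp
  show "(\<Sum>k<N. of_int (if k = 0 then 1 else 0) * \<zeta> ^ k) = 1" by (rule sum_single_eq[OF N0]) auto
  show "(\<Sum>k<N. if k = 0 then 1 else 0 :: int) = 1" by (rule sum_single_eq[OF N0]) auto
qed

text \<open>Here b and a are the lengths of the X and W families and e is the half-size dimension.
  The total must be the index (N^2 - 1)/2 of the stabilizer of a cusp; the parities of (N - 1)/2 and
  (N + 1)/2 depend on N modulo 4.\<close>

lemma index_sum:
  assumes "2 * a = (N - 1) div 2 - (if even ((N - 1) div 2) then 2 else 1)"
    "2 * b = (N + 1) div 2 - (if even ((N + 1) div 2) then 2 else 1)"
    "m * N = card (carrier PSL2 :: 'f mat set set)"
    "2 * e = (if N mod 4 = 1 then N + 1 else N - 1)"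
  shows "b * (N - 1) + (N + (a * (N + 1) + e)) = m"
proof -
  have "N * (2 * m) = N * ((N - 1) * (N + 1))" using card_PSL2 assms(3) by (simp only: ac_simps)
  then have m: "2 * m = (N - 1) * (N + 1)" using N7 by simp
  show ?thesis
  proof (cases "N mod 4 = 1")
    case True
    then obtain j where j: "N = 4 * j + 1" by (metis mod_div_mult_eq mult.commute add.commute)
    have j1: "j \<ge> 1" using N7 j by linarith
    have h: "(N - 1) div 2 = 2 * j" "(N + 1) div 2 = 2 * j + 1" unfolding j by simp_all
    have a: "a = j - 1" using assms(1) unfolding h by simp
    have b: "b = j" using assms(2) unfolding h by simp
    have e: "e = 2 * j + 1" using assms(4) True j by simp
    have "2 * m = 16 * j * j + 8 * j" using m unfolding j by (simp add: algebra_simps)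
    then have "m = 8 * j * j + 4 * j" by simp
    moreover obtain i where i: "j = Suc i" using j1 by (cases j) auto
    ultimately show ?thesis unfolding a b e j by (simp add: i algebra_simps)
  next
    case False
    have "N mod 4 = 3"
    proof -
      have "N mod 4 < 4" by simp
      moreover have "N mod 4 \<noteq> 0" "N mod 4 \<noteq> 2" using N_odd by presburger+
      ultimately show ?thesis using False by linarith
    qed
    then obtain j where j: "N = 4 * j + 3" by (metis mod_div_mult_eq mult.commute add.commute)
    have h: "(N - 1) div 2 = 2 * j + 1" "(N + 1) div 2 = 2 * j + 2" unfolding j by simp_all
    have a: "a = j" using assms(1) unfolding h by simp
    have b: "b = j" using assms(2) unfolding h by simp
    have e: "e = 2 * j + 1" using assms(4) False j by simp
    have "2 * m = 16 * j * j + 24 * j + 8" using m unfolding j by (simp add: algebra_simps)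
    then have "m = 8 * j * j + 12 * j + 4" by simp
    then show ?thesis unfolding a b e j by (simp add: algebra_simps)
  qed
qed

text \<open>Passing from r to r + 1 adds N - (r + 1) to the interval, so the half-size constituent
  belonging to l = r + 1 is counted by exactly one of the two numbers.\<close>

lemma mset_residues:
  fixes B :: "'r list"
  assumes "r \<le> N - 1"
  shows "mset (concat (map (\<lambda>l. B @ [if Legendre (int (N - l)) (int N) = 1 then E' else E'']) [1..<Suc r])) =
    mset (concat [concat (replicate r B), replicate (num_residues N r) E', replicate (num_nonresidues N r) E''])"
  using assms
proof (induction r)
  case 0
  \<comment> \<open>For r = 0 the interval from N to N - 1 is empty.\<close>
  have e: "{N - 0..N - 1} = {}" using N7 by simp
  show ?case unfolding num_residues_def num_nonresidues_def e by simp
next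
  case (Suc r)
  let ?a = "N - Suc r"
  have a: "?a \<in> {1..<N}" using Suc.prems N7 by auto
  have ins: "{N - Suc r..N - 1} = insert ?a {N - r..N - 1}" using Suc.prems N7 by auto
  have nin: "?a \<notin> {N - r..N - 1}" using Suc.prems N7 by auto
  have f1: "{b \<in> insert ?a {N - r..N - 1}. Q b} = (if Q ?a then insert ?a {b \<in> {N - r..N - 1}. Q b} else {b \<in> {N - r..N - 1}. Q b})" for Q
    by auto
  have n1: "num_residues N (Suc r) = num_residues N r + (if Legendre (int ?a) (int N) = 1 then 1 else 0)"
    unfolding num_residues_def ins f1 using nin by (simp del: atLeastAtMost_iff)
  have n2: "num_nonresidues N (Suc r) = num_nonresidues N r + (if Legendre (int ?a) (int N) = 1 then 0 else 1)"
    unfolding num_nonresidues_def ins f1 using nin Legendre_cases[OF a] by (simp del: atLeastAtMost_iff split: if_splits)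
  have "mset (concat (map (\<lambda>l. B @ [if Legendre (int (N - l)) (int N) = 1 then E' else E'']) [1..<Suc (Suc r)])) =
     mset (concat (map (\<lambda>l. B @ [if Legendre (int (N - l)) (int N) = 1 then E' else E'']) [1..<Suc r])) +
     mset B + {#if Legendre (int ?a) (int N) = 1 then E' else E''#}"
    by simp
  also have "\<dots> = mset (concat [concat (replicate (Suc r) B), replicate (num_residues N (Suc r)) E', replicate (num_nonresidues N (Suc r)) E''])"
    unfolding Suc.IH[OF Suc_leD[OF Suc.prems]] n1 n2 by simp
  finally show ?case .
qed

lemma rep_pow:
  assumes \<rho>: "is_rep G n \<rho>" and G: "group G" and g: "g \<in> carrier G"
  shows "\<rho> (g [^]\<^bsub>G\<^esub> (k::nat)) = \<rho> g ^\<^sub>m k"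
proof -
  interpret group G by fact
  show ?thesis
  proof (induction k)
    case 0 show ?case using is_rep_one[OF \<rho>] carrier_matD[OF is_rep_carrier[OF \<rho> g]] by simp
  next
    case (Suc k) then show ?case using is_rep_mult[OF \<rho> nat_pow_closed[OF g] g] by simp
  qed
qed

end

context curve_action begin

text \<open>The summands of \<open>Ind \<theta>\<^bsup>-l\<^esup>\<close> are found by Frobenius reciprocity from an eigenvector of \<open>unip\<close>.\<close>

lemma intertwiner_of_trace:
  fixes chr :: "'k mat \<Rightarrow> complex" and mu :: "nat \<Rightarrow> int"
  assumes chr: "trace_like chr lift"
    and lift: "lift 1 = 1" "\<forall>x y. x ^ N = 1 \<and> y ^ N = 1 \<longrightarrow> lift (x * y) = lift x * lift y" "inj_on lift {x. x ^ N = 1}"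
    and P: "P \<in> X" "St P = generate PSL2 {unip}" "card (St P) = N" and l: "1 \<le> l" "l \<le> N - 1"
    and \<rho>: "irr PSL2 n \<rho>"
    and mu: "chr (\<rho> unip) = (\<Sum>k<N. of_int (mu k) * lift (\<theta> P unip) ^ k)" "(\<Sum>k<N. mu k) = int n"
    and pos: "mu (N - l) > 0"
  shows "\<exists>T\<in>carrier_mat (finite_subgroup.m PSL2 (St P)) n. T \<noteq> 0\<^sub>m (finite_subgroup.m PSL2 (St P)) n \<and>
    (\<forall>g\<in>carrier PSL2. I P l g * T = T * \<rho> g)"
proof -
  interpret A: finite_subgroup PSL2 "St P" by (rule finite_subgroup_St[OF P(1)])
  let ?u = "unip :: 'f mat set"
  let ?w = "\<theta> P ?u"
  have \<rho>r: "is_rep PSL2 n \<rho>" using \<rho> by (simp add: irr_def)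
  have u: "?u \<in> St P" unfolding P(2) by (rule generate.incl) simp
  have cN: "card (St P) \<le> N" using P(3) by simp
  have wk: "\<theta> P (?u [^]\<^bsub>PSL2\<^esub> k) = ?w ^ k \<and> ?u [^]\<^bsub>PSL2\<^esub> k \<in> St P" for k :: nat
  proof (induction k)
    case 0 show ?case using \<theta>_one[OF P(1)] A.H_one by simp
  next
    case (Suc k)
    then have "?u [^]\<^bsub>PSL2\<^esub> k \<in> St P" by blast
    then show ?case using Suc \<theta>_mult[OF P(1) _ u] A.H_mult[OF _ u] by (simp add: mult.commute)
  qed
  have wN: "?w ^ N = 1" using \<theta>_card[OF P(1) u] P(3) by simp
  \<comment> \<open>The value at \<open>unip\<close> has exact order N, since
    \<open>\<theta> P\<close> is faithful and the first N powers of \<open>unip\<close> are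
    distinct.\<close>
  have winj: "inj_on (\<lambda>k. ?w ^ k) {..<N}"
  proof (rule inj_onI)
    fix i j assume ij: "i \<in> {..<N}" "j \<in> {..<N}" "?w ^ i = ?w ^ j"
    then have "\<theta> P (?u [^]\<^bsub>PSL2\<^esub> i) = \<theta> P (?u [^]\<^bsub>PSL2\<^esub> j)" using wk by simp
    then have "?u [^]\<^bsub>PSL2\<^esub> i = ?u [^]\<^bsub>PSL2\<^esub> j" using \<theta>_inj[OF P(1) cN] wk by (metis inj_onD)
    then have "(of_nat i :: 'f) = of_nat j" by (simp only: unip_pow_eq_iff)
    then show "i = j" using of_int_eq_iff_F[of "int i" "int j"] ij(1,2) by (simp add: cong_def)
  qed
  have wkN: "(?w ^ k) ^ N = 1" for k using wN by (metis power_mult mult.commute power_one)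
  have lw: "lift (?w ^ k) = lift ?w ^ k" for k
    by (induction k) (simp_all add: lift(1) lift(2)[rule_format, OF conjI[OF wN wkN]])
  have z: "lift ?w ^ N = 1" "lift ?w \<noteq> 1"
  proof -
    show "lift ?w ^ N = 1" using lw[of N] wN lift(1) by simp
    show "lift ?w \<noteq> 1"
    proof
      assume "lift ?w = 1"
      then have "?w = 1" using inj_onD[OF lift(3), of ?w 1] wN lift(1) by simp
      then show False using inj_onD[OF winj, of 0 1] N7 by simp
    qed
  qed
  have uN: "?u [^]\<^bsub>PSL2\<^esub> N = \<one>\<^bsub>PSL2\<^esub>"
    using unip_pow_eq_iff[of N 0] of_nat_eq_0[of N] by simp
  have rN: "\<rho> ?u ^\<^sub>m N = 1\<^sub>m n"
    using rep_pow[OF \<rho>r group_PSL2 unip_carrier, of N] uN is_rep_one[OF \<rho>r] by simp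
  have Nl: "N - l < N" using l N7 by simp
  from eigenvalue_of_trace[OF chr is_rep_carrier[OF \<rho>r unip_carrier] rN prime_N wN winj lw z mu Nl pos]
  obtain v where v: "v \<in> carrier_vec n" "v \<noteq> 0\<^sub>v n" "(\<rho> ?u)\<^sup>T *\<^sub>v v = ?w ^ (N - l) \<cdot>\<^sub>v v" by blast
  \<comment> \<open>The inverse power is rewritten with an exponent in 0, ..., N - 1, the range that
    labels the multiplicities. This is the origin of N - l.\<close>
  have wl: "?w ^ (N - l) = inverse ?w ^ l"
  proof -
    have "?w ^ l * ?w ^ (N - l) = 1" using wN l by (simp flip: power_add)
    then have "inverse (?w ^ l) = ?w ^ (N - l)" by (rule inverse_unique)
    then show ?thesis by (simp add: power_inverse)
  qed
  \<comment> \<open>\<open>unip\<close> generates the stabilizer, so its eigenvector is an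
    eigenvector of the whole subgroup.\<close>
  have ev: "(\<rho> h)\<^sup>T *\<^sub>v v = \<psi> P l h \<cdot>\<^sub>v v" if h: "h \<in> St P" for h
  proof -
    obtain k where k: "h = ?u [^]\<^bsub>PSL2\<^esub> (k::nat)"
      using h unfolding P(2) PSL2.generate_pow_on_finite_carrier[OF finite_PSL2 unip_carrier] by blast
    have "(\<rho> (?u [^]\<^bsub>PSL2\<^esub> k))\<^sup>T *\<^sub>v v = (?w ^ (N - l)) ^ k \<cdot>\<^sub>v v" for k :: nat
    proof (induction k)
      case 0 show ?case using is_rep_one[OF \<rho>r] v(1) by simp
    next
      case (Suc k)
      note c = is_rep_carrier[OF \<rho>r PSL2.nat_pow_closed[OF unip_carrier, of k]] is_rep_carrier[OF \<rho>r unip_carrier]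
      have tc: "(\<rho> (?u [^]\<^bsub>PSL2\<^esub> k))\<^sup>T \<in> carrier_mat n n" "(\<rho> ?u)\<^sup>T \<in> carrier_mat n n" using c by simp_all
      have "(\<rho> (?u [^]\<^bsub>PSL2\<^esub> Suc k))\<^sup>T *\<^sub>v v = ((\<rho> ?u)\<^sup>T * (\<rho> (?u [^]\<^bsub>PSL2\<^esub> k))\<^sup>T) *\<^sub>v v"
        using is_rep_mult[OF \<rho>r PSL2.nat_pow_closed[OF unip_carrier, of k] unip_carrier] transpose_mult[OF c] by simp
      also have "\<dots> = (\<rho> ?u)\<^sup>T *\<^sub>v ((?w ^ (N - l)) ^ k \<cdot>\<^sub>v v)"
        using assoc_mult_mat_vec[OF tc(2,1) v(1)] Suc by simp
      also have "\<dots> = (?w ^ (N - l)) ^ k \<cdot>\<^sub>v (?w ^ (N - l) \<cdot>\<^sub>v v)"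
        unfolding mult_mat_vec[OF tc(2) v(1)] v(3) ..
      also have "\<dots> = (?w ^ (N - l)) ^ Suc k \<cdot>\<^sub>v v" by (simp add: smult_smult_assoc mult.commute)
      finally show ?case .
    qed
    then have "(\<rho> h)\<^sup>T *\<^sub>v v = (inverse ?w ^ l) ^ k \<cdot>\<^sub>v v" unfolding k wl by simp
    also have "(inverse ?w ^ l) ^ k = \<psi> P l h"
    proof -
      have "(inverse ?w ^ l) ^ k = inverse (?w ^ k) ^ l" by (simp add: power_inverse power_mult[symmetric] mult.commute)
      then show ?thesis unfolding \<psi>_def k using wk by simp
    qed
    finally show ?thesis .
  qed
  show ?thesis unfolding I_def by (rule A.frobenius[OF \<rho>r v(1,2) ev])
qed

text \<open>For each l, those irreducible representations embed in which \<zeta>^(N-l) is an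
  eigenvalue of \<open>unip\<close>. Since N - l is not 0 modulo N, all X, V and W qualify, and of
  the half-size pair at least the member belonging to the residue class of N - l; the dimensions
  leave no room for more.\<close>

theorem cusp:
  fixes chr :: "'k mat \<Rightarrow> complex"
  assumes \<epsilon>: "generates unit_group (\<epsilon> :: 'f)" and \<tau>: "generates (norm_one_group \<epsilon>) \<tau>"
    and chr: "trace_like chr lift"
    and lift: "lift 1 = 1" "\<And>x y. x ^ N = 1 \<Longrightarrow> y ^ N = 1 \<Longrightarrow> lift (x * y) = lift x * lift y" "inj_on lift {x. x ^ N = 1}"
  shows "cusp_formula N \<epsilon> \<tau> X act \<theta> chr lift"
  unfolding cusp_formula_def
proof (intro ballI allI impI, elim conjE)
  fix P P0 D \<zeta> V and W Y :: "_ \<Rightarrow> ('f mat set, 'k) rep" and E' E'' and \<alpha>s :: "('f \<Rightarrow> complex) list" and \<beta>s :: "('f \<times> 'f \<Rightarrow> complex) list" and r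
  assume P: "P \<in> X" "P0 \<in> X" "card (St P) = N" and D: "D = reduced_orbit PSL2 act P" "D P0 = 1"
    and st: "St P0 = generate PSL2 {unip}" and \<zeta>: "\<zeta> = lift (\<theta> P0 unip)"
    and V: "is_V N \<epsilon> chr V" and W: "\<forall>\<alpha>\<in>W_params. is_W N \<epsilon> chr \<alpha> (W \<alpha>)" and Y: "\<forall>\<beta>\<in>X_params \<epsilon>. is_X N \<epsilon> chr \<beta> (Y \<beta>)"
    and E: "is_half_pair N \<epsilon> \<tau> \<zeta> chr E' E''"
    and \<alpha>s: "lists_up_to_inverse W_params \<alpha>s" and \<beta>s: "lists_up_to_inverse (X_params \<epsilon>) \<beta>s"
    and r: "1 \<le> r" "r \<le> N - 1"
  interpret CW: even_cyclic_group "unit_group :: 'f monoid" \<epsilon> "- 1" "(N - 1) div 2"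
    by (rule even_cyclic_unit_group[OF \<epsilon>])
  interpret CX: even_cyclic_group "norm_one_group \<epsilon>" \<tau> "(- 1, 0)" "(N + 1) div 2"
    by (rule even_cyclic_norm_one[OF \<epsilon> \<tau>])
  interpret A: finite_subgroup PSL2 "St P0" by (rule finite_subgroup_St[OF P(2)])
  have Wp: "(W_params :: ('f \<Rightarrow> complex) set) = CW.params" by (simp add: W_params_def CW.params_def)
  have Xp: "X_params \<epsilon> = CX.params" by (simp add: X_params_def CX.params_def)
  obtain g where g: "g \<in> carrier PSL2" "P0 = act g P" using D by (auto simp: reduced_orbit_def split: if_splits)
  have P0: "card (St P0) = N" using card_St_act[OF P(1) g(1)] P(3) g(2) by simp
  \<comment> \<open>Both points have the same orbit, so the computation can be done at the point
    whose stabilizer is generated by \<open>unip\<close>.\<close>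
  have DP0: "D = reduced_orbit PSL2 act P0"
  proof
    fix Q
    have "(\<exists>h\<in>carrier PSL2. Q = act h P) \<longleftrightarrow> (\<exists>h\<in>carrier PSL2. Q = act h P0)"
    proof
      assume "\<exists>h\<in>carrier PSL2. Q = act h P"
      then obtain h where h: "h \<in> carrier PSL2" "Q = act h P" by blast
      then have "Q = act (h \<otimes>\<^bsub>PSL2\<^esub> inv\<^bsub>PSL2\<^esub> g) P0" using g act_inv[OF P(1) g(1)] P(2) by (simp add: act_mult)
      then show "\<exists>h\<in>carrier PSL2. Q = act h P0" using h(1) g(1) by blast
    next
      assume "\<exists>h\<in>carrier PSL2. Q = act h P0"
      then obtain h where h: "h \<in> carrier PSL2" "Q = act h P0" by blast
      then have "Q = act (h \<otimes>\<^bsub>PSL2\<^esub> g) P" using g P(1) by (simp add: act_mult)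
      then show "\<exists>h\<in>carrier PSL2. Q = act h P" using h(1) g(1) by blast
    qed
    then show "D Q = reduced_orbit PSL2 act P0 Q" unfolding D(1) reduced_orbit_def by simp
  qed
  let ?R = "{a \<in> {1..<N}. Legendre (int a) (int N) = 1}" and ?R' = "{a \<in> {1..<N}. Legendre (int a) (int N) = - 1}"
  have qs: "residue_sum N \<zeta> = (\<Sum>a\<in>?R. \<zeta> ^ a)" "nonresidue_sum N \<zeta> = (\<Sum>a\<in>?R'. \<zeta> ^ a)"
    by (simp_all add: residue_sum_def nonresidue_sum_def)
  have RS: "?R \<subseteq> {1..<N}" "?R' \<subseteq> {1..<N}" "finite ?R" "finite ?R'" by auto
  have cR: "int (card ?R) = (int N - 1) div 2" "int (card ?R') = (int N - 1) div 2"
    unfolding card_Legendre[OF \<epsilon>] using N7 by (simp_all add: of_nat_diff zdiv_int)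
  have odd: "2 * ((int N - 1) div 2) = int N - 1" using N_odd by simp
  \<comment> \<open>\<zeta> is a nontrivial N-th root of unity, transported from the base field by
    the injective \<open>lift\<close>.\<close>
  have geo: "(\<Sum>k<N. \<zeta> ^ k) = 0"
  proof -
    let ?w = "\<theta> P0 unip"
    have u: "unip \<in> St P0" unfolding st by (rule generate.incl) simp
    have wN: "?w ^ N = 1" using \<theta>_card[OF P(2) u] P0 by simp
    have w1: "?w \<noteq> 1"
    proof
      assume "?w = 1"
      then have "(unip :: 'f mat set) = \<one>\<^bsub>PSL2\<^esub>" using \<theta>_faithful[OF P(2) _ u] P0 by simp
      then have "(unip :: 'f mat set) [^]\<^bsub>PSL2\<^esub> (1::nat) = unip [^]\<^bsub>PSL2\<^esub> (0::nat)" using unip_carrier by simp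
      then have "(1 :: 'f) = 0" by (simp only: unip_pow_eq_iff of_nat_1 of_nat_0)
      then show False by simp
    qed
    have wk: "(?w ^ k) ^ N = 1" for k using wN by (metis power_mult mult.commute power_one)
    have lw: "lift (?w ^ k) = \<zeta> ^ k" for k
      by (induction k) (simp_all add: lift(1) lift(2)[OF wN wk] \<zeta>)
    have "\<zeta> \<noteq> 1" using inj_onD[OF lift(3), of ?w 1] wN lift(1) w1 \<zeta> by auto
    moreover have "\<zeta> ^ N = 1" using lw[of N] wN lift(1) by simp
    ultimately show ?thesis by (simp add: geometric_sum)
  qed
  have one: "chr (\<rho> (pclass (1\<^sub>m 2))) = of_nat n" if "irr PSL2 n \<rho>" for \<rho> n
    using that is_rep_one[of PSL2 n \<rho>] trace_like_one[OF chr lift(1)] by (simp add: irr_def one_PSL2)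
  \<comment> \<open>The value at the identity is the dimension that \<open>irreducible_rep\<close>
    leaves hidden.\<close>
  have irrD: "irr PSL2 n \<rho>" if "irrep_with_values \<epsilon> chr d a b b' t \<rho>" "d = of_nat n" for d a b b' t \<rho> n
  proof -
    have "irreducible_rep PSL2 \<rho>" using that(1) by (simp add: irrep_with_values_def)
    then obtain n' where n': "irr PSL2 n' \<rho>" unfolding irreducible_rep_iff_irr by blast
    have "(of_nat n' :: complex) = of_nat n" using one[OF n'] that by (simp add: irrep_with_values_def)
    then show ?thesis using n' by simp
  qed
  have uval: "chr (\<rho> unip) = b" if "irrep_with_values \<epsilon> chr d a b b' t \<rho>" for d a b b' t \<rho>
    using that by (simp add: irrep_with_values_def unip_def)
  have N1: "N \<ge> 1" using N7 by simp
  have irrV: "irr PSL2 N V" using V by (auto simp: is_V_def intro: irrD)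
  have irrW: "irr PSL2 (N + 1) (W \<alpha>)" if "\<alpha> \<in> set \<alpha>s" for \<alpha>
  proof -
    have "is_W N \<epsilon> chr \<alpha> (W \<alpha>)" using that \<alpha>s W by (auto simp: lists_up_to_inverse_def)
    then show ?thesis unfolding is_W_def by (rule irrD) simp
  qed
  have irrY: "irr PSL2 (N - 1) (Y \<beta>)" if "\<beta> \<in> set \<beta>s" for \<beta>
  proof -
    have "\<beta> \<in> X_params \<epsilon>" using that \<beta>s by (auto simp: lists_up_to_inverse_def)
    then show ?thesis using Y N1 by (intro irrD) (auto simp: is_X_def of_nat_diff)
  qed
  \<comment> \<open>The common dimension of the half-size pair.\<close>
  define e where "e = (if N mod 4 = 1 then N + 1 else N - 1) div 2"
  have e2: "2 * e = (if N mod 4 = 1 then N + 1 else N - 1)" unfolding e_def using N_odd by auto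
  have e2c: "of_nat e = (if N mod 4 = 1 then (of_nat N + 1) / 2 else (of_nat N - 1) / 2 :: complex)"
  proof -
    have "2 * (of_nat e :: complex) = of_nat (2 * e)" by simp
    also have "\<dots> = (if N mod 4 = 1 then of_nat N + 1 else of_nat N - 1)" unfolding e2 using N1 by (simp add: of_nat_diff)
    finally show ?thesis by (auto simp: field_simps)
  qed
  \<comment> \<open>Multiplicity of the eigenvalue 1 in \<open>E'\<close> and \<open>E''\<close>:
    one for N = 1 mod 4, zero for N = 3 mod 4.\<close>
  let ?d0 = "\<lambda>k::nat. if N mod 4 = 1 \<and> k = 0 then 1 else 0 :: int"
  have Ed: "\<exists>d a b b' t. irrep_with_values \<epsilon> chr d a b b' t E' \<and> d = of_nat e \<and>
      b = (if N mod 4 = 1 then 1 else 0) + residue_sum N \<zeta>"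
    "\<exists>d a b b' t. irrep_with_values \<epsilon> chr d a b b' t E'' \<and> d = of_nat e \<and>
      b = (if N mod 4 = 1 then 1 else 0) + nonresidue_sum N \<zeta>"
    using E unfolding is_half_pair_def Let_def e2c by (auto split: if_splits)
  have irrE: "irr PSL2 e E'" "irr PSL2 e E''" using Ed irrD by blast+
  have Eu: "chr (E' unip) = (if N mod 4 = 1 then 1 else 0) + residue_sum N \<zeta>"
    "chr (E'' unip) = (if N mod 4 = 1 then 1 else 0) + nonresidue_sum N \<zeta>" using Ed uval by blast+
  let ?B = "map Y \<beta>s @ [V] @ map W \<alpha>s"
  let ?El = "\<lambda>l. if Legendre (int (N - l)) (int N) = 1 then E' else E''"
  have decomp: "rep_equiv PSL2 (I P0 l) (dsum (?B @ [?El l]))" if l: "1 \<le> l" "l \<le> N - 1" for l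
  proof -
    have lift2: "\<forall>x y. x ^ N = 1 \<and> y ^ N = 1 \<longrightarrow> lift (x * y) = lift x * lift y" using lift(2) by blast
    note int = intertwiner_of_trace[OF chr lift(1) lift2 lift(3) P(2) st P0 l]
    have l0: "N - l \<noteq> 0" "N - l \<in> {1..<N}" using l N7 by auto
    have irrEl: "irr PSL2 e (?El l)" using irrE by simp
    let ?ns = "map (\<lambda>_. N - 1) \<beta>s @ [N] @ map (\<lambda>_. N + 1) \<alpha>s @ [e]"
    have dims: "list_all2 (irr PSL2) ?ns (?B @ [?El l])"
      using irrV irrW irrY irrEl by (auto simp: list_all2_append list.rel_map list.rel_refl_strong list_all2_conv_all_nth nth_append nth_Cons split: nat.splits)
    let ?T = "\<lambda>\<rho> n. \<exists>T\<in>carrier_mat A.m n. T \<noteq> 0\<^sub>m A.m n \<and> (\<forall>g\<in>carrier PSL2. I P0 l g * T = T * \<rho> g)"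
    \<comment> \<open>On the unipotent subgroup V looks like the regular representation: every
      eigenvalue occurs once.\<close>
    have TV: "?T V N"
    proof (rule int[OF irrV, of "\<lambda>_. 1"])
      have "chr (V unip) = 0" using V uval unfolding is_V_def by blast
      then show "chr (V unip) = (\<Sum>k<N. of_int 1 * lift (\<theta> P0 unip) ^ k)" using geo \<zeta> by simp
    qed simp_all
    \<comment> \<open>In W every eigenvalue occurs once, except 1, which occurs twice.\<close>
    have TW: "?T (W \<alpha>) (N + 1)" if "\<alpha> \<in> set \<alpha>s" for \<alpha>
    proof (rule int[OF irrW[OF that], of "\<lambda>k. 1 + (if k = 0 then 1 else 0)"])
      have "\<alpha> \<in> W_params" using that \<alpha>s by (auto simp: lists_up_to_inverse_def)
      then have "chr (W \<alpha> unip) = 1" using W uval unfolding is_W_def by blast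
      moreover have "(\<Sum>k<N. of_int (1 + (if k = 0 then 1 else 0)) * \<zeta> ^ k) = (\<Sum>k<N. \<zeta> ^ k) + (\<Sum>k<N. of_int (if k = 0 then 1 else 0) * \<zeta> ^ k)"
        by (simp only: of_int_add of_int_1 distrib_right mult_1 sum.distrib)
      ultimately show "chr (W \<alpha> unip) = (\<Sum>k<N. of_int (1 + (if k = 0 then 1 else 0)) * lift (\<theta> P0 unip) ^ k)"
        using geo sum_delta0(1) unfolding \<zeta> by simp
      show "(\<Sum>k<N. 1 + (if k = 0 then 1 else 0)) = int (N + 1)" unfolding sum.distrib sum_delta0(2) by simp
    qed simp
    \<comment> \<open>In X every eigenvalue except 1 occurs once, and l < N keeps N - l away from
      0.\<close>
    have TY: "?T (Y \<beta>) (N - 1)" if "\<beta> \<in> set \<beta>s" for \<beta>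
    proof (rule int[OF irrY[OF that], of "\<lambda>k. 1 - (if k = 0 then 1 else 0)"])
      have "\<beta> \<in> X_params \<epsilon>" using that \<beta>s by (auto simp: lists_up_to_inverse_def)
      then have "chr (Y \<beta> unip) = - 1" using Y uval unfolding is_X_def by blast
      moreover have "(\<Sum>k<N. of_int (1 - (if k = 0 then 1 else 0)) * \<zeta> ^ k) = (\<Sum>k<N. \<zeta> ^ k) - (\<Sum>k<N. of_int (if k = 0 then 1 else 0) * \<zeta> ^ k)"
        by (simp only: of_int_diff of_int_1 left_diff_distrib mult_1 sum_subtractf)
      ultimately show "chr (Y \<beta> unip) = (\<Sum>k<N. of_int (1 - (if k = 0 then 1 else 0)) * lift (\<theta> P0 unip) ^ k)"
        using geo sum_delta0(1) unfolding \<zeta> by simp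
      show "(\<Sum>k<N. 1 - (if k = 0 then 1 else 0)) = int (N - 1)" unfolding sum_subtractf sum_delta0(2) using N1 by (simp add: of_nat_diff)
    qed (use l0 in simp)
    \<comment> \<open>The nontrivial eigenvalues are \<zeta>^a for a in S, each occurring once; S is
      the set of residues or of nonresidues.\<close>
    have half: "?T E0 e" if E0: "irr PSL2 e E0" "chr (E0 unip) = (if N mod 4 = 1 then 1 else 0) + (\<Sum>a\<in>S. \<zeta> ^ a)"
      and S: "S \<subseteq> {1..<N}" "finite S" "int (card S) = (int N - 1) div 2" "N - l \<in> S" for E0 S
    proof (rule int[OF E0(1), of "\<lambda>k. ?d0 k + (if k \<in> S then 1 else 0)"])
      have d0: "(\<Sum>k<N. of_int (?d0 k) * \<zeta> ^ k) = (if N mod 4 = 1 then 1 else 0)" "(\<Sum>k<N. ?d0 k) = (if N mod 4 = 1 then 1 else 0)"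
        using sum_delta0(1)[of \<zeta>] sum_delta0(2) by (cases "N mod 4 = 1"; simp)+
      have "(\<Sum>k<N. of_int (?d0 k + (if k \<in> S then 1 else 0)) * \<zeta> ^ k) =
          (\<Sum>k<N. of_int (?d0 k) * \<zeta> ^ k) + (\<Sum>k<N. of_int (if k \<in> S then 1 else 0) * \<zeta> ^ k)"
        by (simp only: of_int_add distrib_right sum.distrib)
      then show "chr (E0 unip) = (\<Sum>k<N. of_int (?d0 k + (if k \<in> S then 1 else 0)) * lift (\<theta> P0 unip) ^ k)"
        unfolding d0 sum_indicator_pow(1)[OF S(1,2)] E0(2) unfolding \<zeta> by simp
      have "2 * int e = (if N mod 4 = 1 then int N + 1 else int N - 1)" using arg_cong[OF e2, of int] N1 by (simp add: of_nat_diff)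
      then show "(\<Sum>k<N. ?d0 k + (if k \<in> S then 1 else 0)) = int e"
        unfolding sum.distrib d0 sum_indicator_pow(2)[OF S(1,2)] S(3) using odd by (simp split: if_splits)
      show "?d0 (N - l) + (if N - l \<in> S then 1 else 0) > 0" using S(4) by simp
    qed
    \<comment> \<open>The member of the pair is the one whose exponent set contains N - l.\<close>
    have TE: "?T (?El l) e"
    proof (cases "Legendre (int (N - l)) (int N) = 1")
      case True
      then have "N - l \<in> ?R" using l0 by simp
      from half[OF irrE(1) Eu(1)[unfolded qs] RS(1,3) cR(1) this] show ?thesis using True by simp
    next
      case False
      then have "Legendre (int (N - l)) (int N) = - 1" using Legendre_cases[OF l0(2)] by (auto split: if_splits)
      then have "N - l \<in> ?R'" using l0 by simp
      from half[OF irrE(2) Eu(2)[unfolded qs] RS(2,4) cR(2) this] show ?thesis using False by simp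
    qed
    have "list_all2 ?T (?B @ [?El l]) ?ns" unfolding append_assoc
    proof (intro list_all2_appendI)
      show "list_all2 ?T (map Y \<beta>s) (map (\<lambda>_. N - 1) \<beta>s)" using TY by (simp add: list_all2_conv_all_nth del: Bex_def)
      show "list_all2 ?T (map W \<alpha>s) (map (\<lambda>_. N + 1) \<alpha>s)" using TW by (simp add: list_all2_conv_all_nth del: Bex_def)
      show "list_all2 ?T [V] [N]" "list_all2 ?T [?El l] [e]" using TV TE by (simp_all del: Bex_def)
    qed
    then have ints: "?T ((?B @ [?El l]) ! i) (?ns ! i)" if "i < length (?B @ [?El l])" for i
      using that by (rule list_all2_nthD)
    \<comment> \<open>The dimensions separate the different kinds; only members of one family have
      to be told apart by a further character value.\<close>
    have neq: "\<not> rep_equiv PSL2 \<rho> \<sigma>" if "irr PSL2 n \<rho>" "irr PSL2 n' \<sigma>" "n \<noteq> n'" for n n' and \<rho> \<sigma> :: "('f mat set, 'k) rep"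
    proof
      assume "rep_equiv PSL2 \<rho> \<sigma>"
      then have "chr (\<rho> (pclass (1\<^sub>m 2))) = chr (\<sigma> (pclass (1\<^sub>m 2)))"
        by (rule trace_like_rep_equiv[OF chr]) (simp add: one_mat2)
      then have "(of_nat n :: complex) = of_nat n'" using one[OF that(1)] one[OF that(2)] by simp
      then show False using that(3) by simp
    qed
    have dist: "distinct \<alpha>s" "distinct \<beta>s" using \<alpha>s \<beta>s by (auto simp: lists_up_to_inverse_def)
    \<comment> \<open>At the generator of the split torus the value is \<alpha>(\<epsilon>) +
      1/\<alpha>(\<epsilon>), which determines \<alpha> within the list.\<close>
    have Wne: "\<not> rep_equiv PSL2 (W \<alpha>) (W \<alpha>')" if "\<alpha> \<in> set \<alpha>s" "\<alpha>' \<in> set \<alpha>s" "\<alpha> \<noteq> \<alpha>'" for \<alpha> \<alpha>'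
    proof
      assume eq: "rep_equiv PSL2 (W \<alpha>) (W \<alpha>')"
      have p: "\<alpha> \<in> W_params" "\<alpha>' \<in> W_params" using that \<alpha>s by (auto simp: lists_up_to_inverse_def)
      have ch: "\<alpha> \<in> complex_chars unit_group" "\<alpha>' \<in> complex_chars unit_group" using p by (simp_all add: W_params_def)
      have e0: "\<epsilon> \<noteq> 0" using CW.g_carrier by (simp add: unit_group_def)
      have pw: "\<epsilon> [^]\<^bsub>unit_group\<^esub> (j::nat) = \<epsilon> ^ j" for j
        by (induction j) (simp_all add: unit_group_def nat_pow_def mult.commute)
      have ne: "\<epsilon> ^ j \<noteq> 1" if "0 < j" "j < 2 * ((N - 1) div 2)" for j
        using CW.pow_eq_one[of j] that unfolding pw by (auto simp: unit_group_def dest: dvd_imp_le)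
      \<comment> \<open>The tabulated values exclude x = 1 and x = -1; the order N - 1 of \<epsilon>
        exceeds 2.\<close>
      have "\<epsilon> \<noteq> 1" "\<epsilon> \<noteq> - 1" 
      proof -
        have "1 < 2 * ((N - 1) div 2)" "2 < 2 * ((N - 1) div 2)" using N7 by presburger+
        then show "\<epsilon> \<noteq> 1" "\<epsilon> \<noteq> - 1" using ne[of 1] ne[of 2] by auto
      qed
      then have v: "chr (W \<alpha> (pclass (mat2 \<epsilon> 0 0 (inverse \<epsilon>)))) = \<alpha> \<epsilon> + \<alpha> (inverse \<epsilon>)"
        "chr (W \<alpha>' (pclass (mat2 \<epsilon> 0 0 (inverse \<epsilon>)))) = \<alpha>' \<epsilon> + \<alpha>' (inverse \<epsilon>)"
        using W p e0 by (simp_all add: is_W_def irrep_with_values_def)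
      have inv: "\<gamma> (inverse \<epsilon>) = inverse (\<gamma> \<epsilon>)" if "\<gamma> \<in> complex_chars unit_group" for \<gamma>
      proof -
        have "\<gamma> \<epsilon> * \<gamma> (inverse \<epsilon>) = 1"
          using CW.chars_mult[OF that, of \<epsilon> "inverse \<epsilon>"] CW.chars_one[OF that] e0 by (simp add: unit_group_def)
        then show ?thesis by (metis inverse_unique)
      qed
      have "chr (W \<alpha> (pclass (mat2 \<epsilon> 0 0 (inverse \<epsilon>)))) = chr (W \<alpha>' (pclass (mat2 \<epsilon> 0 0 (inverse \<epsilon>))))"
        by (rule trace_like_rep_equiv[OF chr eq]) (simp add: e0)
      then have "\<alpha> \<epsilon> + inverse (\<alpha> \<epsilon>) = \<alpha>' \<epsilon> + inverse (\<alpha>' \<epsilon>)" unfolding v inv[OF ch(1)] inv[OF ch(2)] .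
      from CW.params_eqI[OF \<alpha>s[unfolded Wp] that(1,2) this] show False using that(3) by simp
    qed
    \<comment> \<open>The same argument at the generator of the nonsplit torus, where (x, -y) is the
      inverse of (x, y).\<close>
    have Yne: "\<not> rep_equiv PSL2 (Y \<beta>) (Y \<beta>')" if "\<beta> \<in> set \<beta>s" "\<beta>' \<in> set \<beta>s" "\<beta> \<noteq> \<beta>'" for \<beta> \<beta>'
    proof
      assume eq: "rep_equiv PSL2 (Y \<beta>) (Y \<beta>')"
      have p: "\<beta> \<in> X_params \<epsilon>" "\<beta>' \<in> X_params \<epsilon>" using that \<beta>s by (auto simp: lists_up_to_inverse_def)
      have ch: "\<beta> \<in> complex_chars (norm_one_group \<epsilon>)" "\<beta>' \<in> complex_chars (norm_one_group \<epsilon>)" using p by (simp_all add: X_params_def)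
      obtain x y where xy: "\<tau> = (x, y)" by (cases \<tau>)
      have T: "(x, y) \<in> carrier (norm_one_group \<epsilon>)" using CX.g_carrier xy by simp
      have nrm: "x * x - \<epsilon> * (y * y) = 1" using T by (simp add: norm_one_group_def power2_eq_square)
      \<comment> \<open>With y = 0 the generator would have order at most 2, but its order is N +
        1.\<close>
      have y0: "y \<noteq> 0"
      proof
        assume "y = 0"
        then have "\<tau> \<otimes>\<^bsub>norm_one_group \<epsilon>\<^esub> \<tau> = \<one>\<^bsub>norm_one_group \<epsilon>\<^esub>" using nrm xy by (simp add: norm_one_group_def)
        then have "\<tau> [^]\<^bsub>norm_one_group \<epsilon>\<^esub> (2::nat) = \<one>\<^bsub>norm_one_group \<epsilon>\<^esub>" using CX.g_carrier by (simp add: numeral_2_eq_2)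
        then have "2 * ((N + 1) div 2) dvd 2" using CX.pow_eq_one by blast
        then show False using N7 by (auto dest: dvd_imp_le)
      qed
      have v: "chr (Y \<beta> (pclass (mat2 x (\<epsilon> * y) y x))) = - \<beta> (x, y) - \<beta> (x, - y)"
        "chr (Y \<beta>' (pclass (mat2 x (\<epsilon> * y) y x))) = - \<beta>' (x, y) - \<beta>' (x, - y)"
        using Y p T y0 by (simp_all add: is_X_def irrep_with_values_def)
      have inv: "\<gamma> (x, - y) = inverse (\<gamma> (x, y))" if "\<gamma> \<in> complex_chars (norm_one_group \<epsilon>)" for \<gamma>
      proof -
        have m1: "(x, - y) \<in> carrier (norm_one_group \<epsilon>)" using T by (simp add: norm_one_group_def)
        have m2: "(x, y) \<otimes>\<^bsub>norm_one_group \<epsilon>\<^esub> (x, - y) = \<one>\<^bsub>norm_one_group \<epsilon>\<^esub>"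
          using nrm by (simp add: norm_one_group_def algebra_simps)
        have "\<gamma> (x, y) * \<gamma> (x, - y) = 1"
          using CX.chars_mult[OF that T m1] CX.chars_one[OF that] unfolding m2 by simp
        then show ?thesis by (metis inverse_unique)
      qed
      have "chr (Y \<beta> (pclass (mat2 x (\<epsilon> * y) y x))) = chr (Y \<beta>' (pclass (mat2 x (\<epsilon> * y) y x)))"
        by (rule trace_like_rep_equiv[OF chr eq]) (use nrm in \<open>simp add: mult_ac\<close>)
      then have "\<beta> \<tau> + inverse (\<beta> \<tau>) = \<beta>' \<tau> + inverse (\<beta>' \<tau>)" unfolding v inv[OF ch(1)] inv[OF ch(2)] xy by (simp add: algebra_simps)
      from CX.params_eqI[OF \<beta>s[unfolded Xp] that(1,2) this] show False using that(3) by simp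
    qed
    have eN: "e \<noteq> N" "e \<noteq> N + 1" "e \<noteq> N - 1" using e2 N7 by (auto split: if_splits)
    have sorted: "sorted_wrt (\<lambda>\<rho> \<sigma>. \<not> rep_equiv PSL2 \<rho> \<sigma>) (?B @ [?El l])"
    proof -
      have "sorted_wrt (\<lambda>\<rho> \<sigma>. \<not> rep_equiv PSL2 \<rho> \<sigma>) (map W \<alpha>s)"
        unfolding sorted_wrt_iff_nth_less
      proof (intro allI impI)
        fix i j assume ij: "i < j" "j < length (map W \<alpha>s)"
        have "\<not> rep_equiv PSL2 (W (\<alpha>s ! i)) (W (\<alpha>s ! j))"
          by (rule Wne) (use ij dist(1) in \<open>simp_all add: nth_eq_iff_index_eq\<close>)
        then show "\<not> rep_equiv PSL2 (map W \<alpha>s ! i) (map W \<alpha>s ! j)" using ij by simp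
      qed
      moreover have "sorted_wrt (\<lambda>\<rho> \<sigma>. \<not> rep_equiv PSL2 \<rho> \<sigma>) (map Y \<beta>s)"
        unfolding sorted_wrt_iff_nth_less
      proof (intro allI impI)
        fix i j assume ij: "i < j" "j < length (map Y \<beta>s)"
        have "\<not> rep_equiv PSL2 (Y (\<beta>s ! i)) (Y (\<beta>s ! j))"
          by (rule Yne) (use ij dist(2) in \<open>simp_all add: nth_eq_iff_index_eq\<close>)
        then show "\<not> rep_equiv PSL2 (map Y \<beta>s ! i) (map Y \<beta>s ! j)" using ij by simp
      qed
      moreover have "\<not> rep_equiv PSL2 (Y \<beta>) V" "\<not> rep_equiv PSL2 (Y \<beta>) (?El l)" if "\<beta> \<in> set \<beta>s" for \<beta>
        using neq[OF irrY[OF that] irrV] neq[OF irrY[OF that] irrEl] eN N1 by auto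
      moreover have "\<not> rep_equiv PSL2 (Y \<beta>) (W \<alpha>)" if "\<beta> \<in> set \<beta>s" "\<alpha> \<in> set \<alpha>s" for \<alpha> \<beta>
        using neq[OF irrY[OF that(1)] irrW[OF that(2)]] by auto
      moreover have "\<not> rep_equiv PSL2 V (W \<alpha>)" "\<not> rep_equiv PSL2 (W \<alpha>) (?El l)" if "\<alpha> \<in> set \<alpha>s" for \<alpha>
        using neq[OF irrV irrW[OF that]] neq[OF irrW[OF that] irrEl] eN by auto
      moreover have "\<not> rep_equiv PSL2 V (?El l)" using neq[OF irrV irrEl] eN by auto
      ultimately show ?thesis by (simp add: sorted_wrt_append del: if_split)
    qed
    have "sum_list ?ns = length \<beta>s * (N - 1) + (N + (length \<alpha>s * (N + 1) + e))"
      by (simp add: sum_list_triv)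
    also have "\<dots> = A.m"
      by (rule index_sum[OF CW.lists_up_to_inverse_length CX.lists_up_to_inverse_length _ e2])
        (use \<alpha>s \<beta>s Wp Xp A.card_transversal P0 in auto)
    finally have sum: "sum_list ?ns = A.m" .
    have rd: "rep_dim PSL2 A.m (I P0 l)" unfolding I_def by (rule A.rep_dim_Ind_char)
    show ?thesis by (rule multiplicity_free_equiv[OF dims sorted rd ints sum])
  qed
  \<comment> \<open>\<open>?L\<close> lists the constituents by l, \<open>?M\<close> by kind; both
    have the same multiset.\<close>
  let ?L = "concat (map (\<lambda>l. ?B @ [?El l]) [1..<Suc r])"
  let ?M = "[concat (replicate r ?B), replicate (num_residues N r) E', replicate (num_nonresidues N r) E'']"
  have "rep_equiv PSL2 (deg_eq PSL2 X act \<theta> (mult_div r D)) (dsum (map (I P0) [1..<Suc r]))"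
    unfolding DP0 by (rule deg_eq_equiv[OF P(2) r(1)])
  also have "rep_equiv PSL2 (dsum (map (I P0) [1..<Suc r])) (dsum (map dsum (map (\<lambda>l. ?B @ [?El l]) [1..<Suc r])))"
  proof (rule dsum_cong, unfold list.rel_map map_map o_apply, rule list.rel_refl_strong)
    fix l assume "l \<in> set [1..<Suc r]"
    then have "1 \<le> l" "l \<le> N - 1" using r(2) by (auto simp del: upt_Suc)
    then show "rep_equiv PSL2 (I P0 l) (dsum (?B @ [?El l]))" by (rule decomp)
  qed
  also have "dsum (map dsum (map (\<lambda>l. ?B @ [?El l]) [1..<Suc r])) = dsum ?L" by (rule dsum_flatten)
  also have "rep_equiv PSL2 (dsum ?L) (dsum (concat ?M))"
  proof (rule dsum_perm[OF mset_residues[OF r(2)]])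
    fix x assume "x \<in> set ?L"
    then have "x \<in> Y ` set \<beta>s \<or> x = V \<or> x \<in> W ` set \<alpha>s \<or> x = E' \<or> x = E''" by (auto simp del: upt_Suc split: if_splits)
    then show "\<exists>n. rep_dim PSL2 n x" using irrY irrV irrW irrE irr_rep_dim by blast
  qed
  also have "dsum (concat ?M) = dsum (map dsum ?M)" by (rule dsum_flatten[symmetric])
  also have "dsum (map dsum ?M) = dsum [copies r (dsum [dsum (map Y \<beta>s), V, dsum (map W \<alpha>s)]),
                 copies (num_residues N r) E', copies (num_nonresidues N r) E'']"
  proof -
    have "dsum [dsum (map Y \<beta>s), V, dsum (map W \<alpha>s)] = dsum (map dsum [map Y \<beta>s, [V], map W \<alpha>s])" by simp
    also have "\<dots> = dsum ?B" by (subst dsum_flatten) simp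
    finally have "copies r (dsum [dsum (map Y \<beta>s), V, dsum (map W \<alpha>s)]) = dsum (map dsum (replicate r ?B))"
      by (simp add: copies_def)
    also have "\<dots> = dsum (concat (replicate r ?B))" by (rule dsum_flatten)
    finally show ?thesis by (simp add: copies_def)
  qed
  finally show "rep_equiv PSL2 (deg_eq PSL2 X act \<theta> (mult_div r D))
          (dsum [copies r (dsum [dsum (map Y \<beta>s), V, dsum (map W \<alpha>s)]),
                 copies (num_residues N r) E', copies (num_nonresidues N r) E''])" .
qed

end

section \<open>Cotangent spaces\<close>

lemma ideal_square_zero: "0 \<in> ideal_square M"
  unfolding ideal_square_def by (auto intro!: exI[of _ "0::nat"])

lemma ideal_square_add_mult:
  assumes "x \<in> ideal_square M" "a \<in> M" "b \<in> M"
  shows "x + a * b \<in> ideal_square M"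
proof -
  obtain n :: nat and a' b' where *: "\<forall>i<n. a' i \<in> M \<and> b' i \<in> M" "x = (\<Sum>i<n. a' i * b' i)"
    using assms(1) unfolding ideal_square_def by blast
  have "x + a * b = (\<Sum>i<Suc n. (if i = n then a else a' i) * (if i = n then b else b' i))"
    unfolding *(2) by simp
  moreover have "\<forall>i<Suc n. (if i = n then a else a' i) \<in> M \<and> (if i = n then b else b' i) \<in> M"
    using *(1) assms(2,3) by (auto simp: less_Suc_eq)
  ultimately show ?thesis
    unfolding ideal_square_def by (intro CollectI exI[of _ "Suc n"] exI) (rule conjI)
qed

text \<open>Lets membership in the square be used one product at a time instead of through indexed
  sums.\<close>

lemma ideal_square_induct [consumes 1, case_names zero add_mult]:
  assumes "x \<in> ideal_square M" "Q 0"
    and "\<And>x a b. x \<in> ideal_square M \<Longrightarrow> Q x \<Longrightarrow> a \<in> M \<Longrightarrow> b \<in> M \<Longrightarrow> Q (x + a * b)"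
  shows "Q x"
proof -
  obtain n :: nat and a b where *: "\<forall>i<n. a i \<in> M \<and> b i \<in> M" "x = (\<Sum>i<n. a i * b i)"
    using assms(1) unfolding ideal_square_def by blast
  have "Q (\<Sum>i<m. a i * b i)" if "m \<le> n" for m
    using that
  proof (induction m)
    case (Suc m)
    have "(\<Sum>i<m. a i * b i) \<in> ideal_square M"
      unfolding ideal_square_def using Suc.prems *(1) by (intro CollectI exI[of _ m] exI[of _ a] exI[of _ b]) auto
    then show ?case using Suc assms(3) *(1) by simp
  qed (simp add: assms(2))
  then show ?thesis unfolding *(2) by blast
qed

lemma ideal_square_mult: "a \<in> M \<Longrightarrow> b \<in> M \<Longrightarrow> a * b \<in> ideal_square M"
  using ideal_square_add_mult[OF ideal_square_zero] by fastforce

lemma ideal_square_add: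
  assumes "x \<in> ideal_square M" "y \<in> ideal_square M"
  shows "x + y \<in> ideal_square M"
  using assms(2)
proof (induction rule: ideal_square_induct)
  case (add_mult y a b)
  then show ?case using ideal_square_add_mult[of "x + y"] by (simp add: add.assoc)
qed (simp add: assms(1))

lemma ideal_square_image:
  assumes "x \<in> ideal_square M" "s 0 = 0" "\<And>x y. s (x + y) = s x + s y"
    "\<And>a b. a \<in> M \<Longrightarrow> b \<in> M \<Longrightarrow> s (a * b) \<in> ideal_square M'"
  shows "s x \<in> ideal_square M'"
  using assms(1)
proof (induction rule: ideal_square_induct)
  case (add_mult x a b)
  then show ?case unfolding assms(3) by (intro ideal_square_add assms(4))
qed (simp add: assms(2) ideal_square_zero)

text \<open>An action on points together with a compatible action \<open>s\<close> on functions; \<open>\<kappa>\<close> embeds the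
  constants, and the ideals \<open>M P\<close> have one-dimensional cotangent spaces.\<close>

locale cotangent_action = prime_field F N for F :: "'f::{field, finite} itself" and N +
  fixes X :: "'p set" and act :: "'f mat set \<Rightarrow> 'p \<Rightarrow> 'p"
    and \<kappa> :: "'k::field \<Rightarrow> 'r::comm_ring_1" and M :: "'p \<Rightarrow> 'r set" and s :: "'f mat set \<Rightarrow> 'r \<Rightarrow> 'r"
  assumes act_closed: "P \<in> X \<Longrightarrow> g \<in> carrier PSL2 \<Longrightarrow> act g P \<in> X"
    and act_mult: "P \<in> X \<Longrightarrow> g \<in> carrier PSL2 \<Longrightarrow> h \<in> carrier PSL2 \<Longrightarrow> act (g \<otimes>\<^bsub>PSL2\<^esub> h) P = act g (act h P)"
    and act_one: "P \<in> X \<Longrightarrow> act \<one>\<^bsub>PSL2\<^esub> P = P"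
    and \<kappa>: "\<kappa> 1 = 1" "\<kappa> (x + y) = \<kappa> x + \<kappa> y" "\<kappa> (x * y) = \<kappa> x * \<kappa> y"
    and M_smult: "P \<in> X \<Longrightarrow> f \<in> M P \<Longrightarrow> \<kappa> c * f \<in> M P"
    and M_line: "P \<in> X \<Longrightarrow> \<exists>t\<in>M P. \<forall>f\<in>M P. \<exists>!c. f - \<kappa> c * t \<in> ideal_square (M P)"
    and s_closed: "P \<in> X \<Longrightarrow> g \<in> carrier PSL2 \<Longrightarrow> f \<in> M P \<Longrightarrow> s g f \<in> M (act g P)"
    and s_add: "g \<in> carrier PSL2 \<Longrightarrow> s g (f + f') = s g f + s g f'"
    and s_times: "g \<in> carrier PSL2 \<Longrightarrow> s g (f * f') = s g f * s g f'"
    and s_const: "g \<in> carrier PSL2 \<Longrightarrow> s g (\<kappa> c) = \<kappa> c"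
    and s_mult: "g \<in> carrier PSL2 \<Longrightarrow> h \<in> carrier PSL2 \<Longrightarrow> s (g \<otimes>\<^bsub>PSL2\<^esub> h) f = s g (s h f)"
    and s_one: "P \<in> X \<Longrightarrow> f \<in> M P \<Longrightarrow> s \<one>\<^bsub>PSL2\<^esub> f - f \<in> ideal_square (M P)"
begin

abbreviation "ram P h \<equiv> cotangent_scalar (\<lambda>c f. \<kappa> c * f) (M P) (s h)"

lemma \<kappa>_zero [simp]: "\<kappa> 0 = 0"
  using \<kappa>(2)[of 0 0] by simp

lemma s_zero: "g \<in> carrier PSL2 \<Longrightarrow> s g 0 = 0"
  using s_add[of g 0 0] by simp

lemma \<kappa>_diff: "\<kappa> (x - y) = \<kappa> x - \<kappa> y"
  using \<kappa>(2)[of "x - y" y] by simp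

lemma s_diff: "g \<in> carrier PSL2 \<Longrightarrow> s g (f - f') = s g f - s g f'"
  using s_add[of g "f - f'" f'] by simp

lemma square_smult:
  assumes P: "P \<in> X" and x: "x \<in> ideal_square (M P)"
  shows "\<kappa> c * x \<in> ideal_square (M P)"
  using x
proof (rule ideal_square_image)
  show "\<kappa> c * (a * b) \<in> ideal_square (M P)" if "a \<in> M P" "b \<in> M P" for a b
    using ideal_square_mult[OF M_smult[OF P that(1)] that(2)] by (simp add: mult.assoc)
qed (simp_all add: distrib_left)

lemma square_diff:
  assumes P: "P \<in> X" and x: "x \<in> ideal_square (M P)" "y \<in> ideal_square (M P)"
  shows "x - y \<in> ideal_square (M P)"
  using ideal_square_add[OF x(1) square_smult[OF P x(2), of "- 1"]] \<kappa>_diff[of 0 1] by (simp add: \<kappa>(1))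

lemma square_s:
  assumes P: "P \<in> X" and g: "g \<in> carrier PSL2" and x: "x \<in> ideal_square (M P)"
  shows "s g x \<in> ideal_square (M (act g P))"
  using x s_zero[OF g] s_add[OF g]
proof (rule ideal_square_image)
  show "s g (a * b) \<in> ideal_square (M (act g P))" if "a \<in> M P" "b \<in> M P" for a b
    unfolding s_times[OF g] by (intro ideal_square_mult s_closed P g that)
qed

text \<open>The class of t spans the cotangent line, so the scalar is the coefficient of
  \<open>s h t\<close>; every f is a multiple of t modulo the square, and the square is
  stable.\<close>

lemma ram_exists:
  assumes P: "P \<in> X" and h: "h \<in> carrier PSL2" "act h P = P"
  shows "\<exists>!c. \<forall>f\<in>M P. s h f - \<kappa> c * f \<in> ideal_square (M P)"
proof -
  obtain t where t: "t \<in> M P" "\<And>f. f \<in> M P \<Longrightarrow> \<exists>!c. f - \<kappa> c * t \<in> ideal_square (M P)"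
    using M_line[OF P] by blast
  have sM: "s h f \<in> M P" if "f \<in> M P" for f using s_closed[OF P h(1) that] h(2) by simp
  have sq: "s h x \<in> ideal_square (M P)" if "x \<in> ideal_square (M P)" for x using square_s[OF P h(1) that] h(2) by simp
  obtain c where c: "s h t - \<kappa> c * t \<in> ideal_square (M P)" using t(2)[OF sM[OF t(1)]] by blast
  show ?thesis
  proof (intro ex1I[of _ c] ballI)
    fix f assume f: "f \<in> M P"
    obtain d where d: "f - \<kappa> d * t \<in> ideal_square (M P)" using t(2)[OF f] by blast
    have "s h f - \<kappa> c * f = s h (f - \<kappa> d * t) - \<kappa> c * (f - \<kappa> d * t) + \<kappa> d * (s h t - \<kappa> c * t)"
      by (simp add: s_diff[OF h(1)] s_times[OF h(1)] s_const[OF h(1)] algebra_simps)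
    also have "\<dots> \<in> ideal_square (M P)"
      by (intro ideal_square_add square_diff[OF P] square_smult[OF P] sq c d)
    finally show "s h f - \<kappa> c * f \<in> ideal_square (M P)" .
  next
    fix c' assume "\<forall>f\<in>M P. s h f - \<kappa> c' * f \<in> ideal_square (M P)"
    then show "c' = c" using c t(2)[OF sM[OF t(1)]] t(1) by blast
  qed
qed

lemma ram:
  assumes "P \<in> X" "h \<in> carrier PSL2" "act h P = P" "f \<in> M P"
  shows "s h f - \<kappa> (ram P h) * f \<in> ideal_square (M P)"
  using theI'[OF ram_exists[OF assms(1-3)]] assms(4) unfolding cotangent_scalar_def by blast

lemma ram_eqI:
  assumes "P \<in> X" "h \<in> carrier PSL2" "act h P = P"
    and "\<And>f. f \<in> M P \<Longrightarrow> s h f - \<kappa> c * f \<in> ideal_square (M P)"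
  shows "ram P h = c"
  unfolding cotangent_scalar_def by (rule the1_equality[OF ram_exists[OF assms(1-3)]]) (use assms(4) in blast)

text \<open>The identity is asked to act trivially only modulo the square: in the complex model
  functions are also defined off \<open>XC N\<close>, where \<open>XC_act\<close> of the identity
  need not fix its argument.\<close>

lemma ram_one: "P \<in> X \<Longrightarrow> ram P \<one>\<^bsub>PSL2\<^esub> = 1"
  by (rule ram_eqI) (simp_all add: act_one \<kappa>(1) s_one)

lemma ram_mult:
  assumes P: "P \<in> X" and g: "g \<in> carrier PSL2" "act g P = P" and h: "h \<in> carrier PSL2" "act h P = P"
  shows "ram P (g \<otimes>\<^bsub>PSL2\<^esub> h) = ram P g * ram P h"
proof (rule ram_eqI[OF P])
  show "g \<otimes>\<^bsub>PSL2\<^esub> h \<in> carrier PSL2" "act (g \<otimes>\<^bsub>PSL2\<^esub> h) P = P"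
    using act_mult[OF P g(1) h(1)] g h by simp_all
  fix f assume f: "f \<in> M P"
  have "s (g \<otimes>\<^bsub>PSL2\<^esub> h) f - \<kappa> (ram P g * ram P h) * f =
      s g (s h f - \<kappa> (ram P h) * f) + \<kappa> (ram P h) * (s g f - \<kappa> (ram P g) * f)"
    by (simp add: s_mult[OF g(1) h(1)] s_diff[OF g(1)] s_times[OF g(1)] s_const[OF g(1)] \<kappa>(3) algebra_simps)
  also have "\<dots> \<in> ideal_square (M P)"
    using square_s[OF P g(1) ram[OF P h f]] square_smult[OF P ram[OF P g f]] unfolding g(2) by (rule ideal_square_add)
  finally show "s (g \<otimes>\<^bsub>PSL2\<^esub> h) f - \<kappa> (ram P g * ram P h) * f \<in> ideal_square (M P)" .
qed

text \<open>Pull f back to P by the inverse of g, apply h there and push forward again; the round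
  trip changes f only by an element of the square.\<close>

lemma ram_conj:
  assumes P: "P \<in> X" and g: "g \<in> carrier PSL2" and h: "h \<in> carrier PSL2" "act h P = P"
  shows "ram (act g P) (g \<otimes>\<^bsub>PSL2\<^esub> h \<otimes>\<^bsub>PSL2\<^esub> inv\<^bsub>PSL2\<^esub> g) = ram P h"
proof (rule ram_eqI)
  let ?i = "inv\<^bsub>PSL2\<^esub> g" and ?P = "act g P"
  have i: "?i \<in> carrier PSL2" using g by simp
  have iP: "act ?i ?P = P" using act_mult[OF P i g] act_one[OF P] g by simp
  show PX: "?P \<in> X" by (rule act_closed[OF P g])
  show "g \<otimes>\<^bsub>PSL2\<^esub> h \<otimes>\<^bsub>PSL2\<^esub> ?i \<in> carrier PSL2" using g h by simp
  show "act (g \<otimes>\<^bsub>PSL2\<^esub> h \<otimes>\<^bsub>PSL2\<^esub> ?i) ?P = ?P"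
    using act_mult[OF PX, of "g \<otimes>\<^bsub>PSL2\<^esub> h" ?i] act_mult[OF P g h(1)] iP g h by simp
  fix f assume f: "f \<in> M ?P"
  define f' where "f' = s ?i f"
  have f': "f' \<in> M P" using s_closed[OF PX i f] iP by (simp add: f'_def)
  have gf': "s g f' = s \<one>\<^bsub>PSL2\<^esub> f" using s_mult[OF g i, of f] g by (simp add: f'_def)
  have "s (g \<otimes>\<^bsub>PSL2\<^esub> h \<otimes>\<^bsub>PSL2\<^esub> ?i) f = s g (s h f')"
    using s_mult[of "g \<otimes>\<^bsub>PSL2\<^esub> h" ?i f] s_mult[OF g h(1), of f'] g h i by (simp add: f'_def)
  then have "s (g \<otimes>\<^bsub>PSL2\<^esub> h \<otimes>\<^bsub>PSL2\<^esub> ?i) f - \<kappa> (ram P h) * f =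
      s g (s h f' - \<kappa> (ram P h) * f') + \<kappa> (ram P h) * (s \<one>\<^bsub>PSL2\<^esub> f - f)"
    unfolding gf'[symmetric] by (simp add: s_diff[OF g] s_times[OF g] s_const[OF g] algebra_simps)
  also have "\<dots> \<in> ideal_square (M ?P)"
    by (intro ideal_square_add square_s[OF P g] square_smult[OF PX] ram[OF P h f'] s_one[OF PX f])
  finally show "s (g \<otimes>\<^bsub>PSL2\<^esub> h \<otimes>\<^bsub>PSL2\<^esub> ?i) f - \<kappa> (ram P h) * f \<in> ideal_square (M ?P)" .
qed

lemma curve_action:
  assumes "\<And>P h. P \<in> X \<Longrightarrow> card (stab PSL2 act P) \<le> N \<Longrightarrow> h \<in> stab PSL2 act P \<Longrightarrow> ram P h = 1 \<Longrightarrow> h = \<one>\<^bsub>PSL2\<^esub>"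
  shows "curve_action N X act (\<lambda>P h. ram P h)"
proof (intro curve_action.intro curve_action_axioms.intro prime_field_axioms)
  fix P h assume P: "P \<in> X" and h: "h \<in> stab PSL2 act P"
  have h': "h \<in> carrier PSL2" "act h P = P" using h by (simp_all add: stab_def)
  have i: "inv\<^bsub>PSL2\<^esub> h \<in> carrier PSL2" "act (inv\<^bsub>PSL2\<^esub> h) P = P"
    using h' act_mult[OF P, of "inv\<^bsub>PSL2\<^esub> h" h] act_one[OF P] by simp_all
  have "ram P h * ram P (inv\<^bsub>PSL2\<^esub> h) = 1"
    using ram_mult[OF P h' i] ram_one[OF P] h'(1) by simp
  then show "ram P h \<noteq> 0" by auto
next
  fix P and g h :: "'f mat set" assume "P \<in> X" "g \<in> carrier PSL2" "h \<in> stab PSL2 act P"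
  then show "ram (act g P) (g \<otimes>\<^bsub>PSL2\<^esub> h \<otimes>\<^bsub>PSL2\<^esub> inv\<^bsub>PSL2\<^esub> g) = ram P h"
    by (intro ram_conj) (simp_all add: stab_def)
next
  fix P g h assume "P \<in> X" "g \<in> stab PSL2 act P" "h \<in> stab PSL2 act P"
  then show "ram P (g \<otimes>\<^bsub>PSL2\<^esub> h) = ram P g * ram P h"
    by (intro ram_mult) (simp_all add: stab_def)
qed (use assms act_closed act_mult act_one in auto)

end

section \<open>Moebius transformations and modular functions\<close>

lemma moebius_mat2: "moebius (mat2 a b c d) z = (of_int a * z + of_int b) / (of_int c * z + of_int d)"
  by (simp add: moebius_def)

lemma SL2_denominator_nonzero:
  assumes "a * d - b * c = (1::int)" "z \<in> upper_half"
  shows "of_int c * z + of_int d \<noteq> 0"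
proof
  assume *: "of_int c * z + of_int d = 0"
  then have "Im (of_int c * z + of_int d) = 0" by simp
  then have "c = 0" using assms(2) by (simp add: upper_half_def)
  then have "d = 0" using * by simp
  with \<open>c = 0\<close> show False using assms(1) by simp
qed

lemma Im_moebius_mat2:
  assumes "a * d - b * c = (1::int)" "z \<in> upper_half"
  shows "Im (moebius (mat2 a b c d) z) = Im z / (cmod (of_int c * z + of_int d))\<^sup>2"
proof -
  let ?w = "of_int c * z + of_int d"
  have "(of_int a * z + of_int b) / ?w = (of_int a * z + of_int b) * cnj ?w / of_real ((cmod ?w)\<^sup>2)"
    by (rule trans[OF complex_div_cnj]) (simp only: of_real_power)
  then have "Im (moebius (mat2 a b c d) z) = Im ((of_int a * z + of_int b) * cnj ?w) / (cmod ?w)\<^sup>2"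
    unfolding moebius_mat2 by (simp only: Im_divide_of_real)
  also have "Im ((of_int a * z + of_int b) * cnj ?w) = of_int (a * d - b * c) * Im z"
    by (simp add: algebra_simps)
  finally show ?thesis using assms(1) by simp
qed

lemma moebius_upper_half:
  assumes A: "A \<in> carrier SL2" and z: "z \<in> upper_half"
  shows "moebius A z \<in> upper_half"
proof -
  obtain a b c d where A2: "A = mat2 a b c d" "a * d - b * c = 1" using A by (rule SL2_cases)
  show ?thesis
    using z SL2_denominator_nonzero[OF A2(2) z] unfolding A2(1) upper_half_def mem_Collect_eq Im_moebius_mat2[OF A2(2) z] by simp
qed

lemma moebius_mult:
  assumes A: "A \<in> carrier SL2" and B: "B \<in> carrier SL2" and z: "z \<in> upper_half"
  shows "moebius (A * B) z = moebius A (moebius B z)"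
proof -
  obtain a b c d where A2: "A = mat2 a b c d" "a * d - b * c = 1" using A by (rule SL2_cases)
  obtain a' b' c' d' where B2: "B = mat2 a' b' c' d'" "a' * d' - b' * c' = 1" using B by (rule SL2_cases)
  let ?w = "of_int c' * z + of_int d'"
  have w: "?w \<noteq> 0" by (rule SL2_denominator_nonzero[OF B2(2) z])
  have "moebius (A * B) z = (of_int a * (of_int a' * z + of_int b') + of_int b * ?w) / (of_int c * (of_int a' * z + of_int b') + of_int d * ?w)"
    unfolding A2 B2 mat2_mult moebius_mat2 by (simp add: algebra_simps)
  also have "\<dots> = moebius A (moebius B z)"
    unfolding A2 B2 moebius_mat2 using w by (simp add: divide_simps)
  finally show ?thesis .
qed

lemma moebius_one: "moebius (1\<^sub>m 2) z = z"
  by (simp add: one_mat2 moebius_mat2)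

lemma principal_cong_mat2:
  "mat2 a b c d \<in> principal_cong N \<longleftrightarrow> a * d - b * c = 1 \<and> [a = 1] (mod int N) \<and> [b = 0] (mod int N) \<and>
    [c = 0] (mod int N) \<and> [d = 1] (mod int N)"
  by (auto simp: principal_cong_def less_two_cases)

lemma principal_cong_SL2: "A \<in> principal_cong N \<Longrightarrow> A \<in> carrier SL2"
  by (simp add: principal_cong_def)

lemma (in prime_field) principal_cong_iff:
  assumes A: "A \<in> carrier SL2"
  shows "A \<in> principal_cong N \<longleftrightarrow> map_mat of_int A = (1\<^sub>m 2 :: 'f mat)"
proof -
  obtain a b c d where A2: "A = mat2 a b c d" "a * d - b * c = 1" using A by (rule SL2_cases)
  show ?thesis unfolding A2 principal_cong_mat2 using A2(2) by (auto simp: one_mat2 of_int_eq_iff_F[symmetric])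
qed

lemma (in prime_field) map_mat_mult_SL2:
  "A \<in> carrier SL2 \<Longrightarrow> B \<in> carrier SL2 \<Longrightarrow> map_mat of_int (A * B) = (map_mat of_int A * map_mat of_int B :: 'f mat)"
  by (rule of_int_hom.mat_hom_mult[OF SL2_carrier_mat SL2_carrier_mat])

lemma (in prime_field) principal_cong_conj:
  assumes A: "A \<in> carrier SL2" and C: "C \<in> principal_cong N"
  shows "A * C * inv\<^bsub>SL2\<^esub> A \<in> principal_cong N"
proof -
  note Cc = principal_cong_SL2[OF C]
  have i: "inv\<^bsub>SL2\<^esub> A \<in> carrier SL2" using A by simp
  have "map_mat of_int (A * C * inv\<^bsub>SL2\<^esub> A) = (map_mat of_int (A * inv\<^bsub>SL2\<^esub> A) :: 'f mat)"
    using C principal_cong_iff[OF Cc] SL2_carrier_mat[OF map_mat_SL2[OF A]]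
    by (simp add: map_mat_mult_SL2 SL2_mult_closed A Cc i)
  also have "\<dots> = 1\<^sub>m 2" using SL2.r_inv[OF A] by (simp add: one_mat2)
  finally show ?thesis using principal_cong_iff[of "A * C * inv\<^bsub>SL2\<^esub> A"] by (simp add: SL2_mult_closed A Cc i)
qed

text \<open>Normality of \<Gamma>(N) keeps the composite invariant, and its expansions at B are
  those of f at A B. So the action used in \<open>is_reduction\<close> stays inside the coordinate
  ring.\<close>

lemma integral_modular_functions_moebius:
  assumes pf: "prime_field TYPE('f::{field, finite}) N"
    and f: "f \<in> integral_modular_functions N" and A: "A \<in> carrier SL2"
  shows "on_upper_half (f \<circ> moebius A) \<in> integral_modular_functions N"
proof -
  interpret prime_field "TYPE('f)" N by fact
  note f' = f[unfolded integral_modular_functions_def mem_Collect_eq]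
  have i: "inv\<^bsub>SL2\<^esub> A \<in> carrier SL2" using A by simp
  obtain a b c d where A2: "A = mat2 a b c d" "a * d - b * c = 1" using A by (rule SL2_cases)
  have "moebius A holomorphic_on upper_half" unfolding A2(1) moebius_mat2
    using SL2_denominator_nonzero[OF A2(2)] by (intro holomorphic_intros) auto
  moreover have "moebius A ` upper_half \<subseteq> upper_half" using moebius_upper_half[OF A] by blast
  ultimately have "(f \<circ> moebius A) holomorphic_on upper_half"
    using f' by (intro holomorphic_on_compose_gen) auto
  then have 1: "on_upper_half (f \<circ> moebius A) holomorphic_on upper_half"
    by (rule holomorphic_transform) (simp add: on_upper_half_def)
  have 2: "on_upper_half (f \<circ> moebius A) z = 0" if "z \<notin> upper_half" for z
    using that by (simp add: on_upper_half_def)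
  have 3: "on_upper_half (f \<circ> moebius A) (moebius C z) = on_upper_half (f \<circ> moebius A) z"
    if C: "C \<in> principal_cong N" and z: "z \<in> upper_half" for C z
  proof -
    note Cc = principal_cong_SL2[OF C]
    have "A * C = A * C * inv\<^bsub>SL2\<^esub> A * A"
      using SL2.m_assoc[of "A * C" "inv\<^bsub>SL2\<^esub> A" A] SL2.l_inv[OF A] SL2_mult_closed[OF A Cc] A i SL2.r_one[of "A * C"] by simp
    then have "moebius A (moebius C z) = moebius (A * C * inv\<^bsub>SL2\<^esub> A) (moebius A z)"
      using moebius_mult[OF A Cc z] moebius_mult[OF principal_cong_SL2[OF principal_cong_conj[OF A C]] A z] by simp
    then show ?thesis
      using f' principal_cong_conj[OF A C] moebius_upper_half[OF A z] moebius_upper_half[OF Cc z] z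
      by (simp add: on_upper_half_def)
  qed
  have 4: "\<exists>(m::nat) a. (\<forall>n. a n \<in> base_ring N) \<and>
        (\<forall>z\<in>upper_half. let q = exp (2 * of_real pi * \<i> * z / of_nat N) in
           (\<lambda>n. a n * q ^ n) sums (q ^ m * on_upper_half (f \<circ> moebius A) (moebius B z)))"
    if B: "B \<in> carrier SL2" for B
  proof -
    have "on_upper_half (f \<circ> moebius A) (moebius B z) = f (moebius (A * B) z)" if "z \<in> upper_half" for z
      using moebius_mult[OF A B that] moebius_upper_half[OF B that] by (simp add: on_upper_half_def)
    moreover have "\<exists>(m::nat) a. (\<forall>n. a n \<in> base_ring N) \<and>
        (\<forall>z\<in>upper_half. let q = exp (2 * of_real pi * \<i> * z / of_nat N) in
           (\<lambda>n. a n * q ^ n) sums (q ^ m * f (moebius (A * B) z)))"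
      using f' SL2_mult_closed[OF A B] by blast
    ultimately show ?thesis by (simp add: Let_def)
  qed
  show ?thesis unfolding integral_modular_functions_def mem_Collect_eq
    by (intro conjI ballI allI impI 1 2 3 4)
qed

section \<open>Discrete valuation rings\<close>

locale discrete_valuation_ring =
  fixes emb :: "'k::field \<Rightarrow> 'K::field" and V
  assumes emb: "ring_hom_on UNIV emb" and V: "V \<in> curve_points emb"
begin

abbreviation "\<mm> \<equiv> valuation_ideal V"

lemma emb_hom: "emb 1 = 1" "emb (x + y) = emb x + emb y" "emb (x * y) = emb x * emb y"
  using emb by (simp_all add: ring_hom_on_def)

lemma emb_zero: "emb 0 = 0"
  using emb_hom(2)[of 0 0] by (simp only: add_0_right add_cancel_right_right)

lemma emb_diff: "emb (x - y) = emb x - emb y"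
  using emb_hom(2)[of "x - y" y] by simp

lemma emb_in [simp, intro]: "emb c \<in> V" and diff_in [intro]: "x \<in> V \<Longrightarrow> y \<in> V \<Longrightarrow> x - y \<in> V"
  and mult_in [intro]: "x \<in> V \<Longrightarrow> y \<in> V \<Longrightarrow> x * y \<in> V"
  using V by (auto simp: curve_points_def)

lemma residue_exists: "f \<in> V \<Longrightarrow> \<exists>c. f - emb c \<in> \<mm>"
  using V by (auto simp: curve_points_def)

lemma zero_in [simp, intro]: "0 \<in> V" and one_in [simp, intro]: "1 \<in> V"
  using emb_in[of 0] emb_in[of 1] by (simp_all only: emb_zero emb_hom)

lemma add_in [intro]: "x \<in> V \<Longrightarrow> y \<in> V \<Longrightarrow> x + y \<in> V"
  using diff_in[of x "0 - y"] diff_in[of 0 y] by simp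

lemma power_in [intro]: "x \<in> V \<Longrightarrow> x ^ n \<in> V"
  by (induction n) auto

definition uniformizer where
  "uniformizer t \<longleftrightarrow> t \<in> V \<and> t \<noteq> 0 \<and> inverse t \<notin> V \<and>
     (\<forall>f. f \<noteq> 0 \<longrightarrow> (\<exists>(n::int) u. u \<in> V \<and> u \<noteq> 0 \<and> inverse u \<in> V \<and> f = u * t powi n))"

lemma uniformizer_exists: "\<exists>t. uniformizer t"
  using V by (auto simp: curve_points_def uniformizer_def)

context
  fixes t assumes t: "uniformizer t"
begin

lemma t_in: "t \<in> V" and t_nonzero: "t \<noteq> 0" and inverse_t: "inverse t \<notin> V"
  using t by (simp_all add: uniformizer_def)

text \<open>Separates zeros from poles so that only natural powers of t occur; a pole of order n is
  expressed by f t^n being a unit.\<close>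

lemma valuation_cases:
  assumes "f \<noteq> 0"
  obtains (nonneg) u and n :: nat where "u \<in> V" "u \<noteq> 0" "inverse u \<in> V" "f = u * t ^ n"
  | (neg) u and n :: nat where "n > 0" "u \<in> V" "u \<noteq> 0" "inverse u \<in> V" "f * t ^ n = u"
proof -
  obtain n :: int and u where *: "u \<in> V" "u \<noteq> 0" "inverse u \<in> V" "f = u * t powi n"
    using t assms unfolding uniformizer_def by blast
  show ?thesis
  proof (cases "n \<ge> 0")
    case True
    then show ?thesis using nonneg[of u "nat n"] * by (simp add: power_int_def)
  next
    case False
    then have "f * t ^ nat (- n) = u" using * t_nonzero by (simp add: power_int_def field_simps)
    then show ?thesis using neg[of "nat (- n)" u] * False by simp
  qed
qed

text \<open>Otherwise inverse t = f t^(n-1) inverse u would lie in \<open>V\<close>.\<close>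

lemma pole_not_in:
  assumes "f \<noteq> 0" "n > 0" "inverse u \<in> V" "u \<noteq> 0" "f * t ^ n = u"
  shows "f \<notin> V"
proof
  assume f: "f \<in> V"
  obtain m where m: "n = Suc m" using assms(2) by (cases n) auto
  have "inverse t = f * t ^ m * inverse u"
    using assms t_nonzero unfolding m assms(5)[symmetric] by (simp add: field_simps)
  then show False using f assms(3) t_in inverse_t by (auto intro!: mult_in power_in)
qed

text \<open>With this form t V of the maximal ideal, and t^2 V for its square, membership becomes
  divisibility.\<close>

lemma valuation_ideal_iff: "f \<in> \<mm> \<longleftrightarrow> (\<exists>v\<in>V. f = t * v)"
proof
  assume f: "f \<in> \<mm>"
  show "\<exists>v\<in>V. f = t * v"
  proof (cases "f = 0")
    case False
    then show ?thesis
    proof (cases rule: valuation_cases)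
      case (nonneg u n)
      have "n \<noteq> 0" using f False nonneg by (auto simp: valuation_ideal_def)
      then obtain k where "n = Suc k" by (cases n) auto
      then have "f = t * (u * t ^ k)" using nonneg by simp
      moreover have "u * t ^ k \<in> V" using nonneg(1) t_in by blast
      ultimately show ?thesis by blast
    next
      case (neg u n)
      then show ?thesis using pole_not_in[OF False neg(1,4,3,5)] f by (simp add: valuation_ideal_def)
    qed
  qed (use zero_in in force)
next
  assume "\<exists>v\<in>V. f = t * v"
  then obtain v where v: "v \<in> V" "f = t * v" by blast
  have "inverse f \<notin> V" if "f \<noteq> 0"
  proof
    assume "inverse f \<in> V"
    then have "v * inverse f \<in> V" using v(1) by blast
    moreover have "v * inverse f = inverse t" using that v(2) by (simp add: field_simps)
    ultimately show False using inverse_t by simp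
  qed
  then show "f \<in> \<mm>" using v t_in by (auto simp: valuation_ideal_def)
qed

lemma ideal_square_iff: "f \<in> ideal_square \<mm> \<longleftrightarrow> (\<exists>v\<in>V. f = t\<^sup>2 * v)"
proof
  assume "f \<in> ideal_square \<mm>"
  then show "\<exists>v\<in>V. f = t\<^sup>2 * v"
  proof (induction rule: ideal_square_induct)
    case zero show ?case using zero_in by force
  next
    case (add_mult x a b)
    then obtain v a' b' where *: "v \<in> V" "x = t\<^sup>2 * v" "a' \<in> V" "a = t * a'" "b' \<in> V" "b = t * b'"
      unfolding valuation_ideal_iff by blast
    have "x + a * b = t\<^sup>2 * (v + a' * b')" using * by (simp add: algebra_simps power2_eq_square)
    moreover have "v + a' * b' \<in> V" using * by blast
    ultimately show ?case by blast
  qed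
next
  assume "\<exists>v\<in>V. f = t\<^sup>2 * v"
  then obtain v where v: "v \<in> V" "f = (t * 1) * (t * v)" by (auto simp: power2_eq_square algebra_simps)
  then show "f \<in> ideal_square \<mm>" unfolding v(2) by (intro ideal_square_mult) (auto simp: valuation_ideal_iff)
qed

lemma emb_in_ideal_iff: "emb c \<in> \<mm> \<longleftrightarrow> c = 0"
proof
  assume *: "emb c \<in> \<mm>"
  show "c = 0"
  proof (rule ccontr)
    assume c: "c \<noteq> 0"
    then have "emb c * emb (inverse c) = 1" using emb_hom(3)[of c "inverse c"] emb_hom(1) by simp
    then have "inverse (emb c) = emb (inverse c)" "emb c \<noteq> 0" by (auto intro: inverse_unique)
    then show False using * emb_in by (auto simp: valuation_ideal_def)
  qed
qed (simp add: emb_zero valuation_ideal_def)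

text \<open>Dividing by t identifies the cotangent line with the residue field, which consists of
  the constants.\<close>

lemma cotangent_line:
  assumes f: "f \<in> \<mm>"
  shows "\<exists>!c. f - emb c * t \<in> ideal_square \<mm>"
proof -
  obtain v where v: "v \<in> V" "f = t * v" using f valuation_ideal_iff by blast
  have *: "f - emb c * t \<in> ideal_square \<mm> \<longleftrightarrow> v - emb c \<in> \<mm>" for c
  proof -
    have "f - emb c * t = t * (v - emb c)" unfolding v(2) by (simp add: algebra_simps)
    then show ?thesis unfolding ideal_square_iff valuation_ideal_iff using t_nonzero by (simp add: power2_eq_square mult.assoc)
  qed
  obtain c where c: "v - emb c \<in> \<mm>" using residue_exists[OF v(1)] by blast
  show ?thesis
  proof (rule ex1I[of _ c])
    fix d assume "f - emb d * t \<in> ideal_square \<mm>"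
    then have "v - emb d \<in> \<mm>" using * by blast
    with c obtain x y where xy: "x \<in> V" "v - emb c = t * x" "y \<in> V" "v - emb d = t * y" unfolding valuation_ideal_iff by blast
    have "emb (d - c) = t * (x - y)" using xy unfolding emb_diff by (simp add: algebra_simps)
    then have "emb (d - c) \<in> \<mm>" using xy valuation_ideal_iff by blast
    then show "d = c" using emb_in_ideal_iff by simp
  qed (use c * in blast)
qed

text \<open>A unit times t^n is not divisible by t^(n+1), and an element with a pole is not even
  divisible by t^0.\<close>

lemma divisible_by_powers_imp_zero:
  assumes "\<And>n. \<exists>v\<in>V. f = t ^ n * v"
  shows "f = 0"
proof (rule ccontr)
  assume "f \<noteq> 0"
  then show False
  proof (cases rule: valuation_cases)
    case (nonneg u n)
    obtain v where v: "v \<in> V" "f = t ^ Suc n * v" using assms by blast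
    then have "t * v = u" using nonneg t_nonzero by simp
    then have "inverse t = v * inverse u" using t_nonzero nonneg(2) by (simp add: field_simps)
    then show False using v nonneg inverse_t by auto
  next
    case (neg u n)
    obtain v where "v \<in> V" "f = t ^ 0 * v" using assms by blast
    then show False using pole_not_in[OF \<open>f \<noteq> 0\<close> neg(1,4,3,5)] by simp
  qed
qed

lemma unit_of_residue:
  assumes "v \<in> V" "c \<noteq> 0" "x - emb c = t * v"
  shows "x \<noteq> 0 \<and> x \<in> V \<and> inverse x \<in> V"
proof -
  have x: "x = emb c + t * v" using assms(3) by (simp add: algebra_simps)
  have xV: "x \<in> V" unfolding x using assms(1) t_in by blast
  have "x \<notin> \<mm>"
  proof
    assume "x \<in> \<mm>"
    then obtain w where w: "w \<in> V" "x = t * w" using valuation_ideal_iff by blast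
    then have "emb c = t * (w - v)" using x by (simp add: algebra_simps)
    then have "emb c \<in> \<mm>" using valuation_ideal_iff w(1) assms(1) by blast
    then show False using emb_in_ideal_iff assms(2) by simp
  qed
  then show ?thesis using xV by (simp add: valuation_ideal_def)
qed

end

lemma V_or_inverse: "f \<in> V \<or> inverse f \<in> V"
proof (cases "f = 0")
  case False
  obtain t where t: "uniformizer t" using uniformizer_exists by blast
  show ?thesis
  proof (cases rule: valuation_cases[OF t False, case_names nonneg neg])
    case (nonneg u n) then show ?thesis using t_in[OF t] by blast
  next
    case (neg u n)
    then have "inverse f = t ^ n * inverse u" using False t_nonzero[OF t] by (simp add: field_simps)
    then show ?thesis using neg t_in[OF t] by auto
  qed
qed simp

text \<open>An automorphism of finite order prime to the characteristic that acts trivially on the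
  cotangent line fixes the uniformizer obtained by averaging, hence all of \<open>V\<close>, as the powers of the maximal ideal meet in \<open>0\<close>.\<close>

lemma automorphism_trivial:
  assumes s: "\<And>x y. s (x + y) = s x + s y" "\<And>x y. s (x * y) = s x * s y" "\<And>c. s (emb c) = emb c"
    and sV: "s ` V \<subseteq> V" and ord: "\<And>x. (s ^^ m) x = x" and m: "of_nat m \<noteq> (0 :: 'k)"
    and triv: "\<And>f. f \<in> \<mm> \<Longrightarrow> s f - f \<in> ideal_square \<mm>"
  shows "s x = x"
proof -
  obtain t where t: "uniformizer t" using uniformizer_exists by blast
  have s0: "s 0 = 0" using s(1)[of 0 0] by (simp only: add_0_right add_cancel_right_right)
  have s1: "s 1 = 1" using s(3)[of 1] emb_hom(1) by simp
  have sd: "s (x - y) = s x - s y" for x y using s(1)[of "x - y" y] by simp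
  have emb_nat: "emb (of_nat n) = of_nat n" for n by (induction n) (simp_all add: emb_zero emb_hom)
  have tm: "t \<in> \<mm>" using valuation_ideal_iff[OF t] one_in by force
  have sm: "s f \<in> \<mm>" if "f \<in> \<mm>" for f
  proof -
    have "s f - f \<in> ideal_square \<mm>" by (rule triv[OF that])
    then obtain v where v: "v \<in> V" "s f - f = t\<^sup>2 * v" unfolding ideal_square_iff[OF t] by (elim bexE)
    obtain w where w: "w \<in> V" "f = t * w" using \<open>f \<in> \<mm>\<close> unfolding valuation_ideal_iff[OF t] by (elim bexE)
    have "s f = t\<^sup>2 * v + t * w" using v(2) w(2) by (simp add: diff_eq_eq)
    then have "s f = t * (w + t * v)" by (simp add: algebra_simps power2_eq_square)
    moreover have "w + t * v \<in> V" using v w t_in[OF t] by blast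
    ultimately show ?thesis using valuation_ideal_iff[OF t] by blast
  qed
  have si: "(s ^^ i) t \<in> \<mm> \<and> (s ^^ i) t - t \<in> ideal_square \<mm>" for i
  proof (induction i)
    case 0 show ?case using tm ideal_square_zero by simp
  next
    case (Suc i)
    then have "s ((s ^^ i) t) - (s ^^ i) t \<in> ideal_square \<mm>" using triv by blast
    then have "s ((s ^^ i) t) - (s ^^ i) t + ((s ^^ i) t - t) \<in> ideal_square \<mm>" using Suc by (intro ideal_square_add) auto
    then show ?case using Suc sm by simp
  qed
  \<comment> \<open>The sum of the iterates of t: it is fixed by s because s^m = 1, and it is
    congruent to m t modulo the square.\<close>
  define \<tau> where "\<tau> = (\<Sum>i<m. (s ^^ i) t)"
  have "\<tau> - of_nat m * t = (\<Sum>i<m. (s ^^ i) t - t)" by (simp add: \<tau>_def sum_subtractf)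
  moreover have "(\<Sum>i<n. (s ^^ i) t - t) \<in> ideal_square \<mm>" for n
    by (induction n) (use si in \<open>auto intro: ideal_square_zero ideal_square_add\<close>)
  ultimately obtain v where v: "v \<in> V" "\<tau> - of_nat m * t = t\<^sup>2 * v" using ideal_square_iff[OF t] by metis
  have "s (\<Sum>i<n. (s ^^ i) t) = (\<Sum>i<n. (s ^^ Suc i) t)" for n by (induction n) (simp_all add: s0 s(1))
  then have "s \<tau> + t = (\<Sum>i<Suc m. (s ^^ i) t)" unfolding \<tau>_def sum.lessThan_Suc_shift by simp
  then have s\<tau>: "s \<tau> = \<tau>" using ord[of t] by (simp add: \<tau>_def)
  \<comment> \<open>As m is nonzero in the field of constants, u is a unit and \<tau> = t u is again
    a uniformizer.\<close>
  define u where "u = of_nat m + t * v"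
  have u: "u \<noteq> 0" "u \<in> V" "inverse u \<in> V" using unit_of_residue[OF t v(1) m, of u] by (simp_all add: u_def emb_nat)
  have \<tau>u: "\<tau> = t * u" using v(2) by (simp add: u_def algebra_simps power2_eq_square)
  \<comment> \<open>Write f = c + \<tau> f' with c constant. Since c and \<tau> are fixed, s f - f =
    \<tau> (s f' - f'), and the exponent grows by induction.\<close>
  have tau_pow: "\<exists>w\<in>V. s f - f = \<tau> ^ n * w" if "f \<in> V" for f n
    using that
  proof (induction n arbitrary: f)
    case 0 then show ?case using sV by auto
  next
    case (Suc n)
    obtain c w where cw: "w \<in> V" "f - emb c = t * w" using residue_exists[OF Suc.prems] valuation_ideal_iff[OF t] by blast
    have f: "f = emb c + \<tau> * (inverse u * w)" using cw(2) u(1) by (simp add: \<tau>u algebra_simps)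
    have "inverse u * w \<in> V" using u cw by blast
    then obtain w' where w': "w' \<in> V" "s (inverse u * w) - inverse u * w = \<tau> ^ n * w'" using Suc.IH by blast
    have "s f - f = \<tau> * (s (inverse u * w) - inverse u * w)"
      by (subst (1 2) f) (simp only: s(1) s(3) s(2)[of \<tau>] s\<tau> algebra_simps add_diff_cancel_left)
    then have "s f - f = \<tau> ^ Suc n * w'" using w'(2) by simp
    then show ?case using w'(1) by blast
  qed
  have fixV: "s f = f" if fV: "f \<in> V" for f
  proof -
    have "\<exists>w\<in>V. s f - f = t ^ n * w" for n
    proof -
      obtain w where "w \<in> V" "s f - f = \<tau> ^ n * w" using tau_pow[OF fV] by blast
      then have "s f - f = t ^ n * (u ^ n * w)" "u ^ n * w \<in> V" using u(2) by (auto simp: \<tau>u power_mult_distrib)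
      then show ?thesis by blast
    qed
    from divisible_by_powers_imp_zero[OF t this] show ?thesis by simp
  qed
  show "s x = x"
  proof (cases "x \<in> V")
    case False
    then have "x \<noteq> 0" "s (inverse x) = inverse x" using V_or_inverse[of x] fixV by auto
    then have "s x * inverse x = 1" using s(2)[of x "inverse x"] s1 by simp
    then show ?thesis using \<open>x \<noteq> 0\<close> by (simp add: field_simps)
  qed (rule fixV)
qed

end

section \<open>The reduction in positive characteristic\<close>

locale field_automorphism =
  fixes emb :: "'k::field \<Rightarrow> 'K::field" and s :: "'K \<Rightarrow> 'K"
  assumes s_bij: "bij s" and s_hom: "ring_hom_on UNIV s" and s_emb: "s (emb c) = emb c"
begin

lemma hom_simps: "s 1 = 1" "s (x + y) = s x + s y" "s (x * y) = s x * s y"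
  using s_hom by (simp_all add: ring_hom_on_def)

lemma s_zero: "s 0 = 0"
  using hom_simps(2)[of 0 0] by (simp only: add_0_right add_cancel_right_right)

lemma s_diff: "s (x - y) = s x - s y"
  using hom_simps(2)[of "x - y" y] by simp

lemma s_eq_iff: "s x = s y \<longleftrightarrow> x = y"
  using s_bij by (auto simp: bij_def inj_on_def)

lemma s_eq_0_iff: "s x = 0 \<longleftrightarrow> x = 0"
  using s_eq_iff[of x 0] by (simp add: s_zero)

lemma s_inverse: "s (inverse x) = inverse (s x)"
proof (cases "x = 0")
  case False
  then have "s x * s (inverse x) = 1" using hom_simps(3)[of x "inverse x"] hom_simps(1) by simp
  then show ?thesis by (simp add: inverse_unique)
qed (simp add: s_zero)

lemma s_power_int: "s (x powi n) = s x powi n"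
proof -
  have "s (y ^ k) = s y ^ k" for y and k :: nat by (induction k) (simp_all add: hom_simps)
  then show ?thesis by (simp add: power_int_def s_inverse)
qed

lemma s_in_image_iff: "s x \<in> s ` V \<longleftrightarrow> x \<in> V"
  by (auto simp: s_eq_iff)

lemma valuation_ideal_image: "valuation_ideal (s ` V) = s ` valuation_ideal V"
  by (auto simp: valuation_ideal_def s_eq_0_iff s_eq_iff simp flip: s_inverse)

text \<open>Transport of structure along an automorphism over the constants; the image of a
  uniformizer is a uniformizer.\<close>

lemma curve_points_image:
  assumes V: "V \<in> curve_points emb"
  shows "s ` V \<in> curve_points emb"
  unfolding curve_points_def
proof (intro CollectI conjI)
  note V' = V[unfolded curve_points_def mem_Collect_eq]
  show "range emb \<subseteq> s ` V"
  proof
    fix x assume "x \<in> range emb"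
    then obtain c where "x = s (emb c)" by (auto simp: s_emb)
    then show "x \<in> s ` V" using V' by blast
  qed
  show "\<forall>x\<in>s ` V. \<forall>y\<in>s ` V. x - y \<in> s ` V \<and> x * y \<in> s ` V"
    using V' by (auto simp flip: s_diff hom_simps)
  obtain t where t: "t \<in> V" "t \<noteq> 0" "inverse t \<notin> V"
    "\<And>f. f \<noteq> 0 \<Longrightarrow> \<exists>(n::int) u. u \<in> V \<and> u \<noteq> 0 \<and> inverse u \<in> V \<and> f = u * t powi n" using V' by blast
  show "\<exists>t\<in>s ` V. t \<noteq> 0 \<and> inverse t \<notin> s ` V \<and>
        (\<forall>f. f \<noteq> 0 \<longrightarrow> (\<exists>(n::int) u. u \<in> s ` V \<and> u \<noteq> 0 \<and> inverse u \<in> s ` V \<and> f = u * t powi n))"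
  proof (intro bexI[of _ "s t"] conjI allI impI)
    show "s t \<noteq> 0" "s t \<in> s ` V" using t by (auto simp: s_eq_0_iff)
    show "inverse (s t) \<notin> s ` V" using t(3) by (simp add: s_in_image_iff flip: s_inverse)
    fix f :: 'K assume f: "f \<noteq> 0"
    obtain f' where f': "f = s f'" using s_bij by (metis bij_pointE)
    then have "f' \<noteq> 0" using f by (simp add: s_eq_0_iff)
    from t(4)[OF this] obtain n :: int and u where u: "u \<in> V" "u \<noteq> 0" "inverse u \<in> V" "f' = u * t powi n" by blast
    have "s u \<in> s ` V \<and> s u \<noteq> 0 \<and> inverse (s u) \<in> s ` V \<and> f = s u * s t powi n"
      unfolding f' u(4) using u by (simp add: s_eq_0_iff s_in_image_iff hom_simps s_power_int flip: s_inverse)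
    then show "\<exists>(n::int) u. u \<in> s ` V \<and> u \<noteq> 0 \<and> inverse u \<in> s ` V \<and> f = u * s t powi n" by blast
  qed
  show "\<forall>f\<in>s ` V. \<exists>c. f - emb c \<in> valuation_ideal (s ` V)"
  proof
    fix f assume "f \<in> s ` V"
    then obtain f' where f': "f' \<in> V" "f = s f'" by blast
    then obtain c where "f' - emb c \<in> valuation_ideal V" using V' by blast
    then have "s (f' - emb c) \<in> valuation_ideal (s ` V)" unfolding valuation_ideal_image by blast
    then show "\<exists>c. f - emb c \<in> valuation_ideal (s ` V)" by (auto simp: s_diff s_emb f'(2))
  qed
qed

end

section \<open>The function field of the reduction and its group action\<close>

locale modular_reduction = prime_field F N for F :: "'f::{field, finite} itself" and N +
  fixes \<phi> :: "complex \<Rightarrow> 'k::field" and emb :: "'k \<Rightarrow> 'K::field"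
    and red :: "(complex \<Rightarrow> complex) \<Rightarrow> 'K" and \<sigma> :: "'f mat set \<Rightarrow> 'K \<Rightarrow> 'K"
  assumes red: "is_reduction N \<phi> emb red \<sigma>"
    and good: "\<not> CHAR('k) dvd card (carrier (PSL2 :: 'f mat set monoid))"
begin

lemma emb_hom: "ring_hom_on UNIV emb"
  using red unfolding is_reduction_def Let_def by blast

lemma fractions: "\<exists>n c b n' c' b'. (\<forall>i<n::nat. b i \<in> integral_modular_functions N) \<and>
    (\<forall>i<n'::nat. b' i \<in> integral_modular_functions N) \<and>
    x = (\<Sum>i<n. emb (c i) * red (b i)) / (\<Sum>i<n'. emb (c' i) * red (b' i))"
proof -
  let ?k = "{\<Sum>i<n. emb (c i) * red (b i) | (n::nat) c b. \<forall>i<n. b i \<in> integral_modular_functions N}"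
  have "\<forall>x. \<exists>u\<in>?k. \<exists>v\<in>?k. v \<noteq> 0 \<and> x = u / v"
    using red unfolding is_reduction_def Let_def by (elim conjE)
  then obtain u v where uv: "u \<in> ?k" "v \<in> ?k" "x = u / v" by blast
  obtain n c b where 1: "u = (\<Sum>i<n. emb (c i) * red (b i))" "\<forall>i<n::nat. b i \<in> integral_modular_functions N"
    using uv(1) by blast
  obtain n' c' b' where 2: "v = (\<Sum>i<n'. emb (c' i) * red (b' i))" "\<forall>i<n'::nat. b' i \<in> integral_modular_functions N"
    using uv(2) by blast
  show ?thesis
    by (intro exI[of _ n] exI[of _ c] exI[of _ b] exI[of _ n'] exI[of _ c'] exI[of _ b'] conjI 1 2) (simp only: uv(3) 1 2)
qed

lemma \<sigma>_automorphism:
  assumes g: "g \<in> carrier PSL2"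
  shows "field_automorphism emb (\<sigma> g)"
proof -
  have *: "\<forall>g\<in>carrier PSL2. bij (\<sigma> g) \<and> ring_hom_on UNIV (\<sigma> g) \<and> (\<forall>c. \<sigma> g (emb c) = emb c) \<and>
        (\<forall>A\<in>lifts (inv\<^bsub>PSL2\<^esub> g). \<forall>f\<in>integral_modular_functions N. \<sigma> g (red f) = red (on_upper_half (f \<circ> moebius A)))"
    using red unfolding is_reduction_def Let_def by (elim conjE)
  then show ?thesis using g by (simp add: field_automorphism_def)
qed

lemma \<sigma>_red:
  assumes "g \<in> carrier PSL2" "A \<in> lifts (inv\<^bsub>PSL2\<^esub> g)" "f \<in> integral_modular_functions N"
  shows "\<sigma> g (red f) = red (on_upper_half (f \<circ> moebius A))"
proof -
  have *: "\<forall>g\<in>carrier PSL2. bij (\<sigma> g) \<and> ring_hom_on UNIV (\<sigma> g) \<and> (\<forall>c. \<sigma> g (emb c) = emb c) \<and>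
        (\<forall>A\<in>lifts (inv\<^bsub>PSL2\<^esub> g). \<forall>f\<in>integral_modular_functions N. \<sigma> g (red f) = red (on_upper_half (f \<circ> moebius A)))"
    using red unfolding is_reduction_def Let_def by (elim conjE)
  then show ?thesis using assms by simp
qed

text \<open>Every element of K is a quotient of constant combinations of reductions, so a
  homomorphism over the constants is determined by its values on reductions.\<close>

lemma hom_eqI:
  assumes a: "ring_hom_on UNIV (a :: 'K \<Rightarrow> 'K)" "\<And>c. a (emb c) = emb c"
    and b: "ring_hom_on UNIV b" "\<And>c. b (emb c) = emb c"
    and eq: "\<And>f. f \<in> integral_modular_functions N \<Longrightarrow> a (red f) = b (red f)"
  shows "a x = b x"
proof -
  have hom: "h (x / y) = h x / h y" "h (\<Sum>i<n. x' i) = (\<Sum>i<n. h (x' i))" "h (x * y) = h x * h y"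
    if h: "ring_hom_on UNIV h" for h :: "'K \<Rightarrow> 'K" and x y x' and n :: nat
  proof -
    have *: "h 1 = 1" "h (x + y) = h x + h y" "h (x * y) = h x * h y" for x y
      using h by (simp_all add: ring_hom_on_def)
    have h0: "h 0 = 0" using *(2)[of 0 0] by (simp only: add_0_right add_cancel_right_right)
    show "h (x / y) = h x / h y"
    proof (cases "y = 0")
      case False
      then have "h y * h (inverse y) = 1" using *(3)[of y "inverse y"] *(1) by simp
      then have "inverse (h y) = h (inverse y)" by (rule inverse_unique)
      then show ?thesis by (simp add: divide_inverse *)
    qed (simp add: h0)
    show "h (\<Sum>i<n. x' i) = (\<Sum>i<n. h (x' i))" by (induction n) (simp_all add: h0 *)
    show "h (x * y) = h x * h y" by (rule *)
  qed
  obtain n c f n' c' f' where *: "\<forall>i<n::nat. f i \<in> integral_modular_functions N" "\<forall>i<n'::nat. f' i \<in> integral_modular_functions N"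
    "x = (\<Sum>i<n. emb (c i) * red (f i)) / (\<Sum>i<n'. emb (c' i) * red (f' i))"
    using fractions by blast
  show ?thesis unfolding *(3) using *(1,2) by (simp add: hom[OF a(1)] hom[OF b(1)] a(2) b(2) eq)
qed

text \<open>The action composes functions with lifts of inverses, so the order is reversed twice. It
  suffices to check this on reductions.\<close>

lemma \<sigma>_mult:
  assumes g: "g \<in> carrier PSL2" "h \<in> carrier PSL2"
  shows "\<sigma> (g \<otimes>\<^bsub>PSL2\<^esub> h) x = \<sigma> g (\<sigma> h x)"
proof -
  interpret g: field_automorphism emb "\<sigma> g" by (rule \<sigma>_automorphism[OF g(1)])
  interpret h: field_automorphism emb "\<sigma> h" by (rule \<sigma>_automorphism[OF g(2)])
  interpret gh: field_automorphism emb "\<sigma> (g \<otimes>\<^bsub>PSL2\<^esub> h)" by (rule \<sigma>_automorphism) (use g in simp)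
  show ?thesis
  proof (rule hom_eqI[where b = "\<lambda>x. \<sigma> g (\<sigma> h x)"])
    show "ring_hom_on UNIV (\<lambda>x. \<sigma> g (\<sigma> h x))"
      by (simp add: ring_hom_on_def g.hom_simps h.hom_simps)
    fix f assume f: "f \<in> integral_modular_functions N"
    have i: "inv\<^bsub>PSL2\<^esub> g \<in> carrier PSL2" "inv\<^bsub>PSL2\<^esub> h \<in> carrier PSL2" using g by simp_all
    obtain A where A: "A \<in> lifts (inv\<^bsub>PSL2\<^esub> g)" using lifts_nonempty[OF i(1)] by blast
    obtain C where C: "C \<in> lifts (inv\<^bsub>PSL2\<^esub> h)" using lifts_nonempty[OF i(2)] by blast
    note Ac = lifts_eq(1)[OF A i(1)] and Cc = lifts_eq(1)[OF C i(2)]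
    have CA: "C * A \<in> lifts (inv\<^bsub>PSL2\<^esub> (g \<otimes>\<^bsub>PSL2\<^esub> h))"
      using lifts_mult[OF i(2,1) C A] g by (simp add: PSL2.inv_mult_group)
    note f' = integral_modular_functions_moebius[OF prime_field_axioms f Cc]
    have "\<sigma> g (\<sigma> h (red f)) = red (on_upper_half (on_upper_half (f \<circ> moebius C) \<circ> moebius A))"
      unfolding \<sigma>_red[OF g(2) C f] \<sigma>_red[OF g(1) A f'] ..
    also have "on_upper_half (on_upper_half (f \<circ> moebius C) \<circ> moebius A) = on_upper_half (f \<circ> moebius (C * A))"
      by (rule ext) (simp add: on_upper_half_def moebius_upper_half[OF Ac] moebius_mult[OF Cc Ac])
    also have "red \<dots> = \<sigma> (g \<otimes>\<^bsub>PSL2\<^esub> h) (red f)"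
      by (rule \<sigma>_red[OF _ CA f, symmetric]) (use g in simp)
    finally show "\<sigma> (g \<otimes>\<^bsub>PSL2\<^esub> h) (red f) = \<sigma> g (\<sigma> h (red f))" ..
  qed (simp_all add: gh.s_hom gh.s_emb g.s_emb h.s_emb)
qed

lemma \<sigma>_one: "\<sigma> \<one>\<^bsub>PSL2\<^esub> x = x"
proof -
  interpret g: field_automorphism emb "\<sigma> \<one>\<^bsub>PSL2\<^esub>" by (rule \<sigma>_automorphism) simp
  show ?thesis
  proof (rule hom_eqI[where b = "\<lambda>x. x"])
    fix f assume f: "f \<in> integral_modular_functions N"
    have "on_upper_half (f \<circ> moebius (1\<^sub>m 2)) = f"
      using f by (auto simp: on_upper_half_def moebius_one integral_modular_functions_def)
    then show "\<sigma> \<one>\<^bsub>PSL2\<^esub> (red f) = red f"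
      using \<sigma>_red[OF PSL2.one_closed _ f, of "1\<^sub>m 2"] one_in_lifts_one by simp
  qed (rule g.s_hom, rule g.s_emb, simp_all add: ring_hom_on_def)
qed

lemma dvr: "V \<in> curve_points emb \<Longrightarrow> discrete_valuation_ring emb V"
  by (simp add: discrete_valuation_ring_def emb_hom)

sublocale cotangent_action F N "curve_points emb" "place_act \<sigma>" emb valuation_ideal \<sigma>
proof (unfold_locales)
  fix V and g h :: "'f mat set" and f f' :: 'K and c x y :: 'k
  show "emb 1 = 1" "emb (x + y) = emb x + emb y" "emb (x * y) = emb x * emb y"
    using emb_hom by (simp_all add: ring_hom_on_def)
  {
    assume g: "g \<in> carrier PSL2"
    interpret s: field_automorphism emb "\<sigma> g" by (rule \<sigma>_automorphism[OF g])
    show "\<sigma> g (f + f') = \<sigma> g f + \<sigma> g f'" "\<sigma> g (f * f') = \<sigma> g f * \<sigma> g f'" "\<sigma> g (emb c) = emb c"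
      by (simp_all add: s.hom_simps s.s_emb)
    show "f \<in> valuation_ideal V \<Longrightarrow> \<sigma> g f \<in> valuation_ideal (place_act \<sigma> g V)"
      by (simp add: place_act_def s.valuation_ideal_image)
    show "V \<in> curve_points emb \<Longrightarrow> place_act \<sigma> g V \<in> curve_points emb"
      unfolding place_act_def by (rule s.curve_points_image)
    assume h: "h \<in> carrier PSL2"
    then show "\<sigma> (g \<otimes>\<^bsub>PSL2\<^esub> h) f = \<sigma> g (\<sigma> h f)" by (rule \<sigma>_mult[OF g])
    show "place_act \<sigma> (g \<otimes>\<^bsub>PSL2\<^esub> h) V = place_act \<sigma> g (place_act \<sigma> h V)"
      unfolding place_act_def image_image by (rule image_cong[OF refl \<sigma>_mult[OF g h]])
  }
  show "place_act \<sigma> \<one>\<^bsub>PSL2\<^esub> V = V" by (simp add: place_act_def \<sigma>_one)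
  show "\<sigma> \<one>\<^bsub>PSL2\<^esub> f - f \<in> ideal_square (valuation_ideal V)" by (simp add: \<sigma>_one ideal_square_zero)
  assume V: "V \<in> curve_points emb"
  interpret dv: discrete_valuation_ring emb V by (rule dvr[OF V])
  obtain t where t: "dv.uniformizer t" using dv.uniformizer_exists by blast
  show "\<exists>t\<in>valuation_ideal V. \<forall>f\<in>valuation_ideal V. \<exists>!c. f - emb c * t \<in> ideal_square (valuation_ideal V)"
  proof (intro bexI[of _ t] ballI)
    show "t \<in> valuation_ideal V" unfolding dv.valuation_ideal_iff[OF t] using dv.one_in by (intro bexI[of _ 1]) simp_all
  qed (rule dv.cotangent_line[OF t])
  assume f: "f \<in> valuation_ideal V"
  then obtain v where v: "v \<in> V" "f = t * v" using dv.valuation_ideal_iff[OF t] by blast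
  have "emb c * f = t * (emb c * v)" unfolding v(2) by (simp add: mult_ac)
  then show "emb c * f \<in> valuation_ideal V" using dv.valuation_ideal_iff[OF t] v(1) by blast
qed

lemma ram_faithful:
  assumes V: "V \<in> curve_points emb" and card: "card (stab PSL2 (place_act \<sigma>) V) \<le> N"
    and h: "h \<in> stab PSL2 (place_act \<sigma>) V" and triv: "ram V h = 1"
  shows "h = \<one>\<^bsub>PSL2\<^esub>"
proof (rule ccontr)
  assume h1: "h \<noteq> \<one>\<^bsub>PSL2\<^esub>"
  interpret dv: discrete_valuation_ring emb V by (rule dvr[OF V])
  let ?m = "card (carrier (PSL2 :: 'f mat set monoid))"
  have hc: "h \<in> carrier PSL2" and hV: "place_act \<sigma> h V = V" using h by (simp_all add: stab_def)
  interpret s: field_automorphism emb "\<sigma> h" by (rule \<sigma>_automorphism[OF hc])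
  have pow: "(\<sigma> h ^^ i) x = \<sigma> (h [^]\<^bsub>PSL2\<^esub> i) x" for i x
  proof (induction i)
    case 0 show ?case by (simp add: \<sigma>_one)
  next
    case (Suc i)
    have "\<sigma> (h [^]\<^bsub>PSL2\<^esub> Suc i) x = \<sigma> (h \<otimes>\<^bsub>PSL2\<^esub> h [^]\<^bsub>PSL2\<^esub> i) x"
      using hc by (simp only: PSL2.nat_pow_Suc2)
    then show ?case using Suc \<sigma>_mult[OF hc, of "h [^]\<^bsub>PSL2\<^esub> i"] hc by simp
  qed
  have "\<sigma> h x = x" for x
  \<comment> \<open>The group order annihilates h and is nonzero in the field of constants, so it
    can serve as the exponent of the averaging argument.\<close>
  proof (rule dv.automorphism_trivial[of "\<sigma> h" ?m])
    show "\<sigma> h ` V \<subseteq> V" using hV by (simp add: place_act_def)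
    show "(\<sigma> h ^^ ?m) y = y" for y
      using PSL2.pow_order_eq_1[OF hc] unfolding pow by (simp add: order_def \<sigma>_one)
    show "of_nat ?m \<noteq> (0 :: 'k)" using good by (simp only: of_nat_eq_0_iff_char_dvd not_False_eq_True)
    show "\<sigma> h f - f \<in> ideal_square (valuation_ideal V)" if "f \<in> valuation_ideal V" for f
      using ram[OF V hc hV that] triv \<kappa>(1) by simp
  qed (simp_all add: s.hom_simps s.s_emb)
  then have triv: "\<sigma> h = id" by auto
  \<comment> \<open>The elements acting trivially on the field form a normal subset. They fix every
    place, so they lie in the stabilizer, which has at most N elements.\<close>
  define K where "K = {g \<in> carrier PSL2. \<sigma> g = id}"
  have "card K > N"
  proof (rule conjugates_many[of K h])
    show "K \<subseteq> carrier PSL2" "h \<in> K" using hc triv by (auto simp: K_def)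
    have "\<sigma> \<one>\<^bsub>PSL2\<^esub> = id" using \<sigma>_one by auto
    then show "\<one>\<^bsub>PSL2\<^esub> \<in> K" by (simp add: K_def)
    fix g k :: "'f mat set" assume g: "g \<in> carrier PSL2" and k: "k \<in> K"
    have kc: "k \<in> carrier PSL2" "\<sigma> k = id" using k by (auto simp: K_def)
    have "\<sigma> (g \<otimes>\<^bsub>PSL2\<^esub> k \<otimes>\<^bsub>PSL2\<^esub> inv\<^bsub>PSL2\<^esub> g) x = \<sigma> (g \<otimes>\<^bsub>PSL2\<^esub> inv\<^bsub>PSL2\<^esub> g) x" for x
      using g kc by (simp only: \<sigma>_mult PSL2.m_closed PSL2.inv_closed id_apply)
    then show "g \<otimes>\<^bsub>PSL2\<^esub> k \<otimes>\<^bsub>PSL2\<^esub> inv\<^bsub>PSL2\<^esub> g \<in> K" using g kc by (auto simp: K_def \<sigma>_one)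
  qed (rule h1)
  moreover have "card K \<le> card (stab PSL2 (place_act \<sigma>) V)"
    by (rule card_mono) (auto simp: K_def stab_def place_act_def intro: finite_subset[OF _ finite_PSL2])
  ultimately show False using card by simp
qed

lemma curve_action_reduction:
  "curve_action N (curve_points emb) (place_act \<sigma>) (place_ram emb \<sigma>)"
  unfolding place_ram_def by (rule curve_action) (rule ram_faithful)

end

text \<open>Since \<open>N\<close> divides \<open>|G|\<close>, the embedding of roots of unity applies to \<open>N\<close>-th roots.\<close>

theorem (in modular_reduction) reduction_formulas:
  assumes lift: "root_embedding (card (carrier (PSL2 :: 'f mat set monoid))) lift"
    and gen: "generates unit_group (\<epsilon> :: 'f)" "generates (norm_one_group \<epsilon>) \<tau>"
  shows "free_orbit_formula (curve_points emb) (place_act \<sigma>) (place_ram emb \<sigma>)"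
    "order2_formula (curve_points emb) (place_act \<sigma>) (place_ram emb \<sigma>)"
    "order3_formula (curve_points emb) (place_act \<sigma>) (place_ram emb \<sigma>)"
    "cusp_formula N \<epsilon> \<tau> (curve_points emb) (place_act \<sigma>) (place_ram emb \<sigma>) (brauer lift) lift"
proof -
  interpret curve_action "TYPE('f)" N "curve_points emb" "place_act \<sigma>" "place_ram emb \<sigma>"
    by (rule curve_action_reduction)
  let ?m = "card (carrier (PSL2 :: 'f mat set monoid))"
  show "free_orbit_formula (curve_points emb) (place_act \<sigma>) (place_ram emb \<sigma>)" by (rule free_orbit)
  show "order2_formula (curve_points emb) (place_act \<sigma>) (place_ram emb \<sigma>)" by (rule order2)
  show "order3_formula (curve_points emb) (place_act \<sigma>) (place_ram emb \<sigma>)" by (rule order3)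
  have "N dvd 2 * ?m" unfolding card_PSL2 by simp
  moreover have "coprime N 2" using N_odd by simp
  ultimately obtain j where j: "?m = N * j" using coprime_dvd_mult_right_iff by blast
  have root: "x ^ ?m = 1" if "x ^ N = 1" for x :: 'k using that by (simp add: j power_mult)
  have L: "lift x \<noteq> 0" "lift (x * y) = lift x * lift y" if "x ^ ?m = 1" "y ^ ?m = 1" for x y
    using lift that by (auto simp: root_embedding_def)
  show "cusp_formula N \<epsilon> \<tau> (curve_points emb) (place_act \<sigma>) (place_ram emb \<sigma>) (brauer lift) lift"
  proof (rule cusp[OF gen trace_like_brauer])
    \<comment> \<open>\<open>lift 1\<close> is a nonzero idempotent.\<close>
    have "lift 1 \<noteq> 0" "lift (1 * 1) = lift 1 * lift 1" using L[of 1 1] by simp_all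
    then show "lift 1 = 1" by simp
    show "lift (x * y) = lift x * lift y" if "x ^ N = 1" "y ^ N = 1" for x y
      by (rule L(2)) (use that root in auto)
    show "inj_on lift {x. x ^ N = 1}"
      using lift root unfolding root_embedding_def by (auto intro: inj_on_subset)
  qed
qed

section \<open>The complex modular curve\<close>

text \<open>Homogeneous coordinates make the action of \<open>SL\<^sub>2(\<int>)\<close> on the sphere linear.\<close>

definition hpoint :: "complex \<Rightarrow> complex \<Rightarrow> sphere" where
  "hpoint x y = (if y = 0 then Inf else Fin (x / y))"

lemma hpoint_surj:
  obtains x y where "P = hpoint x y" "x \<noteq> 0 \<or> y \<noteq> 0"
proof (cases P)
  case (Fin z) then show ?thesis using that[of z 1] by (simp add: hpoint_def)
next
  case Inf then show ?thesis using that[of 1 0] by (simp add: hpoint_def)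
qed

lemma moebius_sphere_hpoint:
  assumes "x \<noteq> 0 \<or> y \<noteq> 0"
  shows "moebius_sphere (mat2 a b c d) (hpoint x y) =
    hpoint (of_int a * x + of_int b * y) (of_int c * x + of_int d * y)"
proof (cases "y = 0")
  case True then show ?thesis using assms by (simp add: hpoint_def)
next
  case False
  have "of_int c * (x / y) + of_int d = (of_int c * x + of_int d * y) / y"
    "of_int a * (x / y) + of_int b = (of_int a * x + of_int b * y) / y"
    using False by (simp_all add: field_simps)
  then show ?thesis using False by (simp add: hpoint_def moebius_mat2)
qed

lemma moebius_sphere_mult:
  assumes A: "A \<in> carrier SL2" and B: "B \<in> carrier SL2"
  shows "moebius_sphere (A * B) P = moebius_sphere A (moebius_sphere B P)"
proof -
  obtain a b c d where A2: "A = mat2 a b c d" "a * d - b * c = 1" using A by (rule SL2_cases)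
  obtain a' b' c' d' where B2: "B = mat2 a' b' c' d'" "a' * d' - b' * c' = 1" using B by (rule SL2_cases)
  obtain x y where P: "P = hpoint x y" "x \<noteq> 0 \<or> y \<noteq> 0" by (rule hpoint_surj)
  let ?x = "of_int a' * x + of_int b' * y" and ?y = "of_int c' * x + of_int d' * y"
  have "of_int (a' * d' - b' * c') = (1 :: complex)" unfolding B2(2) by simp
  then have det: "of_int a' * of_int d' - of_int b' * of_int c' = (1 :: complex)" by simp
  \<comment> \<open>Inverting the matrix recovers x and y, so the image coordinates do not both
    vanish.\<close>
  have "of_int d' * ?x - of_int b' * ?y = (of_int a' * of_int d' - of_int b' * of_int c') * x"
    "of_int a' * ?y - of_int c' * ?x = (of_int a' * of_int d' - of_int b' * of_int c') * y"
    by (simp_all add: algebra_simps)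
  then have "?x \<noteq> 0 \<or> ?y \<noteq> 0" unfolding det using P(2) by auto
  then show ?thesis
    unfolding A2(1) B2(1) P(1) mat2_mult moebius_sphere_hpoint[OF P(2)]
    by (simp add: moebius_sphere_hpoint algebra_simps)
qed

lemma moebius_sphere_one: "moebius_sphere (1\<^sub>m 2) P = P"
  by (cases P) (simp_all add: one_mat2 moebius_mat2)

lemma moebius_sphere_uminus: "A \<in> carrier SL2 \<Longrightarrow> moebius_sphere (- A) P = moebius_sphere A P"
proof (erule SL2_cases)
  fix a b c d assume A: "A = mat2 a b c d"
  have eq: "- (of_int c * z) - of_int d = - (of_int c * z + of_int d)" "- (of_int a * z) - of_int b = - (of_int a * z + of_int b)" for z :: complex
    by simp_all
  show ?thesis by (cases P) (simp_all add: A moebius_mat2 eq neg_equal_0_iff_equal del: minus_add_distrib minus_diff_eq)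
qed

lemma moebius_sphere_Fin:
  assumes "A \<in> carrier SL2" "z \<in> upper_half"
  shows "moebius_sphere A (Fin z) = Fin (moebius A z)"
proof -
  obtain a b c d where A2: "A = mat2 a b c d" "a * d - b * c = 1" using assms(1) by (rule SL2_cases)
  show ?thesis using SL2_denominator_nonzero[OF A2(2) assms(2)] by (simp add: A2(1))
qed

lemma moebius_sphere_inv:
  assumes A: "A \<in> carrier SL2"
  shows "moebius_sphere (inv\<^bsub>SL2\<^esub> A) (moebius_sphere A P) = P" "moebius_sphere A (moebius_sphere (inv\<^bsub>SL2\<^esub> A) P) = P"
  using moebius_sphere_mult[of "inv\<^bsub>SL2\<^esub> A" A P] moebius_sphere_mult[of A "inv\<^bsub>SL2\<^esub> A" P] A
    SL2.l_inv[OF A] SL2.r_inv[OF A] by (simp_all add: moebius_sphere_one)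

text \<open>A rational a/c in lowest terms is the image of infinity under a matrix with first column
  (a, c), completed by Bezout; so all cusps form one orbit.\<close>

lemma Hstar_cases:
  assumes "P \<in> Hstar"
  obtains (interior) z where "P = Fin z" "z \<in> upper_half"
  | (cusp) A where "P = moebius_sphere A Inf" "A \<in> carrier SL2"
proof -
  consider "P \<in> Fin ` upper_half" | q where "P = Fin q" "q \<in> \<rat>" | "P = Inf" using assms by (auto simp: Hstar_def)
  then show ?thesis
  proof cases
    case 1 then show ?thesis using interior by blast
  next
    case (2 q)
    then obtain r where r: "q = of_rat r" by (auto simp: Rats_def)
    obtain a c where ac: "quotient_of r = (a, c)" by (cases "quotient_of r")
    then have c: "c > 0" "coprime a c" "r = of_int a / of_int c"
      using quotient_of_denom_pos quotient_of_coprime quotient_of_div by blast+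
    obtain x y where "x * a + y * c = gcd a c" using bezout_int by blast
    then have "a * x - (- y) * c = 1" using c(2) by (simp add: coprime_iff_gcd_eq_1 mult.commute)
    then have "mat2 a (- y) c x \<in> carrier SL2" by simp
    moreover have "P = moebius_sphere (mat2 a (- y) c x) Inf" using c 2 r by (simp add: of_rat_divide)
    ultimately show ?thesis using cusp by blast
  next
    case 3 then show ?thesis using cusp[of "1\<^sub>m 2"] SL2.one_closed by (simp add: moebius_sphere_one)
  qed
qed

lemma moebius_sphere_Inf_notin:
  assumes "A \<in> carrier SL2" "z \<in> upper_half"
  shows "moebius_sphere A Inf \<noteq> Fin z"
proof -
  obtain a b c d where A2: "A = mat2 a b c d" using assms(1) by (rule SL2_cases)
  have "Im (of_int a / of_int c) = 0" by (simp add: Im_divide)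
  then show ?thesis using assms(2) by (auto simp: A2 upper_half_def split: if_splits)
qed

lemma Fin_in_Hstar: "z \<in> upper_half \<Longrightarrow> Fin z \<in> Hstar"
  by (simp add: Hstar_def)

lemma moebius_sphere_Inf_in_Hstar: "A \<in> carrier SL2 \<Longrightarrow> moebius_sphere A Inf \<in> Hstar"
  by (erule SL2_cases) (auto simp: Hstar_def intro!: image_eqI)

lemma moebius_sphere_Hstar:
  assumes "A \<in> carrier SL2" "P \<in> Hstar"
  shows "moebius_sphere A P \<in> Hstar"
  using assms(2)
proof (cases rule: Hstar_cases)
  case (interior z)
  then show ?thesis
    using assms(1) by (simp add: moebius_sphere_Fin Fin_in_Hstar moebius_upper_half del: moebius_sphere.simps)
next
  case (cusp B)
  then show ?thesis
    using moebius_sphere_Inf_in_Hstar[OF SL2_mult_closed[OF assms(1) cusp(2)]] by (simp only: cusp(1) moebius_sphere_mult[OF assms(1) cusp(2)])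
qed

lemma fixes_Inf_cases:
  assumes "A \<in> carrier SL2" "moebius_sphere A Inf = Inf"
  obtains k where "A = mat2 1 k 0 1 \<or> A = - mat2 1 k 0 (1 :: int)"
proof -
  obtain a b c d where A2: "A = mat2 a b c d" "a * d - b * c = 1" using assms(1) by (rule SL2_cases)
  have "c = 0" using assms(2) by (simp add: A2 split: if_splits)
  then have "a * d = 1" using A2 by simp
  then have "a = 1 \<and> d = 1 \<or> a = - 1 \<and> d = - 1" by (rule zmult_eq_1_iff[THEN iffD1])
  then show ?thesis using that[of b] that[of "- b"] A2 \<open>c = 0\<close> by auto
qed

section \<open>Congruence orbits and the action on points\<close>

context prime_field begin

lemma principal_cong_mult: "A \<in> principal_cong N \<Longrightarrow> B \<in> principal_cong N \<Longrightarrow> A * B \<in> principal_cong N"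
  using principal_cong_iff[of "A * B"] principal_cong_iff[of A] principal_cong_iff[of B] principal_cong_SL2
  by (simp add: SL2_mult_closed map_mat_mult_SL2)

lemma principal_cong_one: "1\<^sub>m 2 \<in> principal_cong N"
  by (simp add: one_mat2 principal_cong_mat2)

lemma principal_cong_inv:
  assumes A: "A \<in> principal_cong N"
  shows "inv\<^bsub>SL2\<^esub> A \<in> principal_cong N"
proof -
  note Ac = principal_cong_SL2[OF A]
  have i: "inv\<^bsub>SL2\<^esub> A \<in> carrier SL2" using Ac by simp
  have "map_mat of_int (inv\<^bsub>SL2\<^esub> A) = (map_mat of_int A * map_mat of_int (inv\<^bsub>SL2\<^esub> A) :: 'f mat)"
    using A principal_cong_iff[OF Ac] SL2_carrier_mat[OF map_mat_SL2[OF i]] by simp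
  also have "\<dots> = map_mat of_int (1\<^sub>m 2)"
    using map_mat_mult_SL2[OF Ac i] SL2.r_inv[OF Ac] by simp
  finally show ?thesis using principal_cong_iff[OF i] by (simp add: one_mat2)
qed

lemma cong_orbit_self: "P \<in> cong_orbit N P"
  unfolding cong_orbit_def using principal_cong_one moebius_sphere_one by (metis imageI)

lemma cong_orbit_eqI:
  assumes C: "C \<in> principal_cong N"
  shows "cong_orbit N (moebius_sphere C P) = cong_orbit N P"
  unfolding cong_orbit_def
proof (intro equalityI subsetI)
  note Cc = principal_cong_SL2[OF C]
  fix Q
  { assume "Q \<in> (\<lambda>A. moebius_sphere A (moebius_sphere C P)) ` principal_cong N"
    then obtain A where "A \<in> principal_cong N" "Q = moebius_sphere (A * C) P"
      using moebius_sphere_mult[OF principal_cong_SL2 Cc] by auto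
    then show "Q \<in> (\<lambda>A. moebius_sphere A P) ` principal_cong N" using principal_cong_mult[OF _ C] by blast }
  { assume "Q \<in> (\<lambda>A. moebius_sphere A P) ` principal_cong N"
    then obtain A where A: "A \<in> principal_cong N" "Q = moebius_sphere A P" by blast
    note i = principal_cong_inv[OF C]
    have "Q = moebius_sphere (A * inv\<^bsub>SL2\<^esub> C) (moebius_sphere C P)"
      unfolding A(2) moebius_sphere_mult[OF principal_cong_SL2[OF A(1)] principal_cong_SL2[OF i]] moebius_sphere_inv[OF Cc] ..
    then show "Q \<in> (\<lambda>A. moebius_sphere A (moebius_sphere C P)) ` principal_cong N"
      using principal_cong_mult[OF A(1) i] by blast }
qed

lemma cong_orbit_eqD:
  assumes "cong_orbit N P = cong_orbit N Q"
  obtains C where "C \<in> principal_cong N" "Q = moebius_sphere C P"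
  using cong_orbit_self[of Q] assms unfolding cong_orbit_def by blast

lemma in_lifts_one_cases:
  assumes "A \<in> lifts (\<one>\<^bsub>PSL2\<^esub> :: 'f mat set)"
  shows "A \<in> principal_cong N \<or> - A \<in> principal_cong N"
proof -
  note Ac = lifts_eq(1)[OF assms PSL2.one_closed]
  have "map_mat of_int A = (1\<^sub>m 2 :: 'f mat) \<or> map_mat of_int A = - (1\<^sub>m 2 :: 'f mat)"
    using assms by (simp add: lifts_def one_PSL2 pclass_eq one_mat2)
  moreover have "map_mat of_int (- A) = - (map_mat of_int A :: 'f mat)" using Ac by (elim SL2_cases) simp
  moreover have "- (- (1\<^sub>m 2)) = (1\<^sub>m 2 :: 'f mat)" by (simp add: one_mat2)
  ultimately show ?thesis using principal_cong_iff[OF Ac] principal_cong_iff[OF SL2_uminus_closed[OF Ac]] by auto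
qed

lemma principal_cong_in_lifts_one:
  assumes "C \<in> principal_cong N"
  shows "C \<in> lifts (\<one>\<^bsub>PSL2\<^esub> :: 'f mat set)"
  using principal_cong_iff[OF principal_cong_SL2[OF assms]] assms
  by (simp add: lifts_def one_PSL2 pclass_eq one_mat2 principal_cong_SL2)

lemma lifts_quotient:
  assumes g: "g \<in> carrier (PSL2 :: 'f mat set monoid)" "h \<in> carrier PSL2" and A: "A \<in> lifts (g \<otimes>\<^bsub>PSL2\<^esub> h)" and B: "B \<in> lifts h"
  obtains C where "C \<in> lifts g" "A = C * B"
proof
  have i: "inv\<^bsub>PSL2\<^esub> h \<in> carrier PSL2" "g \<otimes>\<^bsub>PSL2\<^esub> h \<in> carrier PSL2" using g by simp_all
  note c = lifts_eq(1)[OF A i(2)] lifts_eq(1)[OF B g(2)]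
  have ib: "inv\<^bsub>SL2\<^esub> B \<in> carrier SL2" using c by simp
  have "A * inv\<^bsub>SL2\<^esub> B \<in> lifts (g \<otimes>\<^bsub>PSL2\<^esub> h \<otimes>\<^bsub>PSL2\<^esub> inv\<^bsub>PSL2\<^esub> h)" by (rule lifts_mult[OF i(2,1) A lifts_inv[OF g(2) B]])
  then show "A * inv\<^bsub>SL2\<^esub> B \<in> lifts g" using g by (simp add: PSL2.m_assoc)
  show "A = A * inv\<^bsub>SL2\<^esub> B * B"
    using SL2.m_assoc[OF c(1) ib c(2)] SL2.l_inv[OF c(2)] SL2.r_one[OF c(1)] by simp
qed

lemma XC_act_mult:
  assumes g: "g \<in> carrier (PSL2 :: 'f mat set monoid)" "h \<in> carrier PSL2"
  shows "XC_act (g \<otimes>\<^bsub>PSL2\<^esub> h) P = XC_act g (XC_act h P)"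
proof (intro equalityI subsetI)
  fix Q assume "Q \<in> XC_act (g \<otimes>\<^bsub>PSL2\<^esub> h) P"
  then obtain A z where A: "A \<in> lifts (g \<otimes>\<^bsub>PSL2\<^esub> h)" "z \<in> P" "Q = moebius_sphere A z" by (auto simp: XC_act_def)
  obtain B where B: "B \<in> lifts h" using lifts_nonempty[OF g(2)] by blast
  obtain C where C: "C \<in> lifts g" "A = C * B" using lifts_quotient[OF g A(1) B] by blast
  have "Q = moebius_sphere C (moebius_sphere B z)"
    unfolding A(3) C(2) by (rule moebius_sphere_mult[OF lifts_eq(1)[OF C(1) g(1)] lifts_eq(1)[OF B g(2)]])
  then show "Q \<in> XC_act g (XC_act h P)" using A(2) B C(1) by (auto simp: XC_act_def)
next
  fix Q assume "Q \<in> XC_act g (XC_act h P)"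
  then obtain A B z where AB: "A \<in> lifts g" "B \<in> lifts h" "z \<in> P" "Q = moebius_sphere A (moebius_sphere B z)"
    by (auto simp: XC_act_def)
  have "Q = moebius_sphere (A * B) z"
    unfolding AB(4) by (rule moebius_sphere_mult[OF lifts_eq(1)[OF AB(1) g(1)] lifts_eq(1)[OF AB(2) g(2)], symmetric])
  then show "Q \<in> XC_act (g \<otimes>\<^bsub>PSL2\<^esub> h) P" using lifts_mult[OF g AB(1,2)] AB(3) by (auto simp: XC_act_def)
qed

text \<open>\<open>XC_act\<close> uses all lifts at once. Two lifts differ by an element of
  \<Gamma>(N) up to sign, and -1 acts trivially, so any single lift computes the action on
  orbits.\<close>

lemma XC_act_cong_orbit:
  assumes g: "g \<in> carrier (PSL2 :: 'f mat set monoid)" and A: "A \<in> lifts g"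
  shows "XC_act g (cong_orbit N P) = cong_orbit N (moebius_sphere A P)"
proof (intro equalityI subsetI)
  note Ac = lifts_eq(1)[OF A g]
  fix Q assume "Q \<in> XC_act g (cong_orbit N P)"
  then obtain A' C where A': "A' \<in> lifts g" "C \<in> principal_cong N" "Q = moebius_sphere A' (moebius_sphere C P)"
    by (auto simp: XC_act_def cong_orbit_def)
  note A'c = lifts_eq(1)[OF A'(1) g] and Cc = principal_cong_SL2[OF A'(2)]
  have "A' * C \<in> lifts (g \<otimes>\<^bsub>PSL2\<^esub> \<one>\<^bsub>PSL2\<^esub>)"
    by (rule lifts_mult[OF g PSL2.one_closed A'(1) principal_cong_in_lifts_one[OF A'(2)]])
  then have "A' * C \<in> lifts (\<one>\<^bsub>PSL2\<^esub> \<otimes>\<^bsub>PSL2\<^esub> g)" using g by simp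
  then obtain D where D: "D \<in> lifts (\<one>\<^bsub>PSL2\<^esub> :: 'f mat set)" "A' * C = D * A" using lifts_quotient[OF PSL2.one_closed g _ A] by blast
  note Dc = lifts_eq(1)[OF D(1) PSL2.one_closed]
  have "Q = moebius_sphere D (moebius_sphere A P)"
    unfolding A'(3) using moebius_sphere_mult[OF A'c Cc] moebius_sphere_mult[OF Dc Ac] D(2) by simp
  then show "Q \<in> cong_orbit N (moebius_sphere A P)"
    using in_lifts_one_cases[OF D(1)] moebius_sphere_uminus[OF Dc] unfolding cong_orbit_def by (metis imageI)
next
  note Ac = lifts_eq(1)[OF A g]
  fix Q assume "Q \<in> cong_orbit N (moebius_sphere A P)"
  then obtain C where C: "C \<in> principal_cong N" "Q = moebius_sphere (C * A) P"
    using moebius_sphere_mult[OF principal_cong_SL2 Ac] by (auto simp: cong_orbit_def)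
  have "C * A \<in> lifts (\<one>\<^bsub>PSL2\<^esub> \<otimes>\<^bsub>PSL2\<^esub> g)"
    by (rule lifts_mult[OF PSL2.one_closed g principal_cong_in_lifts_one[OF C(1)] A])
  then have "C * A \<in> lifts g" using g by simp
  then show "Q \<in> XC_act g (cong_orbit N P)" using C(2) cong_orbit_self by (auto simp: XC_act_def)
qed

lemma XC_act_one: "P \<in> XC N \<Longrightarrow> XC_act (\<one>\<^bsub>PSL2\<^esub> :: 'f mat set) P = P"
  using XC_act_cong_orbit[OF PSL2.one_closed one_in_lifts_one] by (auto simp: XC_def moebius_sphere_one)

lemma XC_act_closed:
  assumes "P \<in> XC N" "g \<in> carrier (PSL2 :: 'f mat set monoid)"
  shows "XC_act g P \<in> XC N"
proof -
  obtain A where A: "A \<in> lifts g" using lifts_nonempty[OF assms(2)] by blast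
  show ?thesis using assms(1) XC_act_cong_orbit[OF assms(2) A] moebius_sphere_Hstar[OF lifts_eq(1)[OF A assms(2)]]
    by (auto simp: XC_def)
qed

end

section \<open>Local behaviour of the action and injectivity of charts\<close>

lemma moebius_deriv:
  assumes "a * d - b * c = (1::int)" "z \<in> upper_half"
  shows "(moebius (mat2 a b c d) has_field_derivative 1 / (of_int c * z + of_int d)\<^sup>2) (at z)"
proof -
  let ?w = "of_int c * z + of_int d"
  have w: "?w \<noteq> 0" by (rule SL2_denominator_nonzero[OF assms])
  have "of_int (a * d - b * c) = (1 :: complex)" unfolding assms(1) by simp
  then have det: "of_int a * ?w - (of_int a * z + of_int b) * of_int c = (1 :: complex)" by (simp add: algebra_simps)
  show ?thesis
    unfolding moebius_mat2[abs_def] det[symmetric] power2_eq_square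
    by (rule DERIV_divide) (auto intro!: derivative_eq_intros simp: w)
qed

lemma open_upper_half: "open upper_half"
  unfolding upper_half_def by (rule open_halfspace_Im_gt)

lemma eventually_upper_half: "z \<in> upper_half \<Longrightarrow> \<forall>\<^sub>F u in nhds 0. z + u \<in> upper_half"
proof -
  assume z: "z \<in> upper_half"
  have "((\<lambda>u. z + u) \<longlongrightarrow> z + 0) (nhds 0)" by (intro tendsto_intros filterlim_ident)
  then show ?thesis using topological_tendstoD[OF _ open_upper_half] z by simp
qed

lemma moebius_analytic:
  assumes "A \<in> carrier SL2" "z \<in> upper_half"
  shows "moebius A analytic_on {z}"
proof -
  obtain a b c d where A2: "A = mat2 a b c d" "a * d - b * c = 1" using assms(1) by (rule SL2_cases)
  show ?thesis unfolding A2(1) moebius_mat2[abs_def]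
    using SL2_denominator_nonzero[OF A2(2) assms(2)] by (intro analytic_intros) auto
qed

context prime_field begin

text \<open>\<open>\<Gamma>(N)\<close> acts freely and properly discontinuously on the upper half-plane; the trace of an element
  moving a point only slightly must be \<open>2\<close>.\<close>

lemma principal_cong_locally_free:
  assumes z: "z \<in> upper_half"
  obtains \<delta> where "\<delta> > 0" "\<And>C w. C \<in> principal_cong N \<Longrightarrow> w \<in> ball z \<delta> \<Longrightarrow> w \<in> upper_half \<Longrightarrow>
    moebius C w \<in> ball z \<delta> \<Longrightarrow> moebius C w = w"
proof -
  define y where "y = Im z"
  have y: "y > 0" using z by (simp add: y_def upper_half_def)
  \<comment> \<open>The bound 1/24 controls |c w + d| and yields |a + d| < 3; the bound 1/(4 y)
    excludes nonzero translations; the bound y^2/72 excludes nonzero c.\<close>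
  define e where "e = Min {1 / 24, 1 / (4 * y), y\<^sup>2 / 72}"
  have e: "e > 0" using y by (simp add: e_def)
  have e1: "e \<le> 1 / 24" "e \<le> 1 / (4 * y)" "e \<le> y\<^sup>2 / 72" by (simp_all add: e_def)
  have e2: "e * y \<le> 1 / 4" using e1(2) y by (simp add: field_simps)
  show ?thesis
  proof (rule that[of "e * y"])
    show "e * y > 0" using e y by simp
    fix C w assume C: "C \<in> principal_cong N" and w: "w \<in> ball z (e * y)" "w \<in> upper_half"
      and w': "moebius C w \<in> ball z (e * y)"
    obtain a b c d where C2: "C = mat2 a b c d" "a * d - b * c = 1" using principal_cong_SL2[OF C] by (rule SL2_cases)
    let ?w' = "moebius C w" and ?L = "of_int c * w + of_int d"
    have L: "?L \<noteq> 0" by (rule SL2_denominator_nonzero[OF C2(2) w(2)])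
    have im: "\<bar>Im v - y\<bar> < e * y" if "v \<in> ball z (e * y)" for v
    proof -
      have "\<bar>Im (z - v)\<bar> \<le> cmod (z - v)" by (rule abs_Im_le_cmod)
      also have "\<dots> < e * y" using that by (simp add: dist_norm)
      finally show ?thesis by (simp add: y_def abs_minus_commute)
    qed
    have imw: "Im w < (1 + e) * y" "(1 - e) * y < Im w" "(1 - e) * y < Im ?w'"
      using im[OF w(1)] im[OF w'] by (auto simp: abs_less_iff algebra_simps)
    have e3: "(1 - e) * y > 0" using e1(1) y by simp
    \<comment> \<open>Both imaginary parts are close to y, so their quotient |c w + d|^2 is at most
      1 + 3 e.\<close>
    have "Im ?w' * (cmod ?L)\<^sup>2 = Im w" unfolding C2(1) using Im_moebius_mat2[OF C2(2) w(2)] L by simp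
    moreover have "(1 - e) * y * (cmod ?L)\<^sup>2 \<le> Im ?w' * (cmod ?L)\<^sup>2" using imw(3) by (intro mult_right_mono) auto
    ultimately have "(1 - e) * y * (cmod ?L)\<^sup>2 \<le> (1 + e) * y" using imw(1) by linarith
    then have "y * ((1 - e) * (cmod ?L)\<^sup>2) \<le> y * (1 + e)" by (simp only: ac_simps)
    then have "(1 - e) * (cmod ?L)\<^sup>2 \<le> 1 + e" using y by simp
    also have "1 + e \<le> (1 - e) * (1 + 3 * e)"
    proof -
      have "e * e \<le> e * (1 / 24)" using e e1(1) by (intro mult_left_mono) auto
      then have "3 * (e * e) \<le> e" using e by linarith
      then show ?thesis by (simp add: algebra_simps)
    qed
    finally have L2: "(cmod ?L)\<^sup>2 \<le> 1 + 3 * e" using e1(1) by simp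
    define p s where "p = of_int c * Re w + of_int d" and "s = of_int c * Im w"
    have ps: "(cmod ?L)\<^sup>2 = p\<^sup>2 + s\<^sup>2" by (simp add: cmod_power2 p_def s_def)
    have "p\<^sup>2 \<le> (1 + 3 * e)\<^sup>2"
    proof -
      have "p\<^sup>2 \<le> 1 + 3 * e" using L2 ps by (smt (verit) zero_le_power2)
      also have "\<dots> \<le> (1 + 3 * e)\<^sup>2" using e by (simp add: power2_eq_square algebra_simps)
      finally show ?thesis .
    qed
    then have p: "\<bar>p\<bar> \<le> 1 + 3 * e" using abs_le_square_iff[of p "1 + 3 * e"] e by simp
    have "(cmod ?L)\<^sup>2 \<le> 2\<^sup>2" using L2 e1(1) by simp
    then have L1: "cmod ?L \<le> 2" by (rule power2_le_imp_le) simp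
    have "cmod (?w' - w) \<le> dist ?w' z + dist z w" unfolding dist_norm[symmetric] by (rule dist_triangle)
    also have "\<dots> \<le> 2 * (e * y)" using w(1) w' by (simp add: dist_commute)
    finally have diff: "cmod (?w' - w) \<le> 2 * (e * y)" .
    \<comment> \<open>The imaginary part of this product is Im w (a + d - 2 p), which ties the trace
      to p, the real part of c w + d.\<close>
    have "(?w' - w) * ?L = of_int a * w + of_int b - w * ?L" unfolding C2(1) moebius_mat2 using L by (simp add: field_simps)
    then have "Im ((?w' - w) * ?L) = Im w * (of_int (a + d) - 2 * p)" by (simp add: p_def algebra_simps)
    moreover have "\<bar>Im ((?w' - w) * ?L)\<bar> \<le> cmod (?w' - w) * cmod ?L" by (metis abs_Im_le_cmod norm_mult)
    moreover have "cmod (?w' - w) * cmod ?L \<le> 2 * (e * y) * 2" using diff L1 e y by (intro mult_mono) auto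
    ultimately have "\<bar>Im w\<bar> * \<bar>of_int (a + d) - 2 * p\<bar> \<le> 4 * (e * y)" by (simp flip: abs_mult)
    moreover have imw2: "2 / 3 * y \<le> \<bar>Im w\<bar>"
    proof -
      have "2 / 3 * y \<le> (1 - e) * y" using e1(1) y by (intro mult_right_mono) auto
      then show ?thesis using imw(2) by linarith
    qed
    moreover have "2 / 3 * y * \<bar>of_int (a + d) - 2 * p\<bar> \<le> \<bar>Im w\<bar> * \<bar>of_int (a + d) - 2 * p\<bar>"
      by (rule mult_right_mono[OF imw2]) simp
    ultimately have "y * \<bar>of_int (a + d) - 2 * p\<bar> \<le> y * (6 * e)" by (simp add: algebra_simps)
    then have tr: "\<bar>of_int (a + d) - 2 * p\<bar> \<le> 6 * e" using y by simp
    have "\<bar>of_int (a + d)\<bar> < (3 :: real)" using tr p e1(1) by linarith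
    then have "\<bar>a + d\<bar> < 3" by linarith
    \<comment> \<open>Elements of \<Gamma>(N) have trace 2 modulo N; together with |a + d| < 3 and N
      at least 7 this makes the trace equal to 2.\<close>
    moreover have "int N dvd a + d - 2"
    proof -
      have "[a + d = 1 + 1] (mod int N)" using C unfolding C2(1) principal_cong_mat2 by (intro cong_add) auto
      then show ?thesis by (simp add: cong_iff_dvd_diff)
    qed
    then have "int N dvd 2 - (a + d)" by (simp only: dvd_diff_commute)
    ultimately have ad: "a + d = 2" using N7 zdvd_imp_le[of "int N" "2 - (a + d)"] by linarith
    \<comment> \<open>Trace 2 puts p near 1, and the bound on p^2 + s^2 then leaves little room for
      s = c Im w.\<close>
    then have "\<bar>1 - p\<bar> \<le> 3 * e" using tr by simp
    then have "(1 - 3 * e)\<^sup>2 \<le> p\<^sup>2" using e1(1) by (intro power_mono) linarith+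
    then have "s\<^sup>2 \<le> 1 + 3 * e - (1 - 3 * e)\<^sup>2" using L2 ps by linarith
    also have "\<dots> \<le> 9 * e" by (simp add: power2_eq_square algebra_simps)
    finally have s: "s\<^sup>2 \<le> 9 * e" .
    have c: "c = 0"
    proof (rule ccontr)
      assume "c \<noteq> 0"
      then have c1: "1 \<le> \<bar>of_int c :: real\<bar>" by linarith
      have "2 / 3 * y \<le> \<bar>of_int c\<bar> * \<bar>Im w\<bar>" using mult_mono[OF c1 imw2] y by simp
      then have "(2 / 3 * y)\<^sup>2 \<le> \<bar>s\<bar>\<^sup>2" using y by (intro power_mono) (auto simp: s_def abs_mult)
      then have "4 / 9 * y\<^sup>2 \<le> 9 * e" using s by (simp add: power_mult_distrib power_divide)
      moreover have "72 * e \<le> y\<^sup>2" using e1(3) by simp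
      ultimately show False using e by linarith
    qed
    then have "a * d = 1" using C2 by simp
    then have "a = 1" "d = 1" using ad by (auto simp: zmult_eq_1_iff)
    then have w'b: "?w' = w + of_int b" by (simp add: C2(1) c moebius_mat2)
    then have "\<bar>of_int b :: real\<bar> \<le> 1 / 2" using diff e2 by simp
    then have "b = 0" by linarith
    then show "?w' = w" using w'b by simp
  qed
qed

text \<open>Equivalent points near z are related by an element of \<Gamma>(N) that keeps a point
  near z, and such an element fixes that point.\<close>

lemma interior_chart_inj:
  assumes z: "z \<in> upper_half"
  shows "\<exists>\<delta>>0. inj_on (interior_chart N z) (ball 0 \<delta>)"
proof -
  obtain \<delta> where \<delta>: "\<delta> > 0" "\<And>C w. C \<in> principal_cong N \<Longrightarrow> w \<in> ball z \<delta> \<Longrightarrow> w \<in> upper_half \<Longrightarrow>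
    moebius C w \<in> ball z \<delta> \<Longrightarrow> moebius C w = w" using principal_cong_locally_free[OF z] by blast
  obtain \<eta> where \<eta>: "\<eta> > 0" "\<And>u. dist u 0 < \<eta> \<Longrightarrow> z + u \<in> upper_half"
    using eventually_upper_half[OF z] unfolding eventually_nhds_metric by blast
  have "inj_on (interior_chart N z) (ball 0 (min \<delta> \<eta>))"
  proof (rule inj_onI)
    fix u v assume u: "u \<in> ball 0 (min \<delta> \<eta>)" and v: "v \<in> ball 0 (min \<delta> \<eta>)" and eq: "interior_chart N z u = interior_chart N z v"
    obtain C where C: "C \<in> principal_cong N" "Fin (z + v) = moebius_sphere C (Fin (z + u))"
      using cong_orbit_eqD[OF eq[unfolded interior_chart_def]] by blast
    have zu: "z + u \<in> upper_half" using \<eta>(2)[of u] u by simp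
    have mv: "moebius C (z + u) = z + v" using C(2) unfolding moebius_sphere_Fin[OF principal_cong_SL2[OF C(1)] zu] by simp
    have "moebius C (z + u) = z + u" by (rule \<delta>(2)[OF C(1) _ zu]) (use u v mv in \<open>auto simp: dist_norm\<close>)
    then show "u = v" using mv by simp
  qed
  then show ?thesis using \<delta>(1) \<eta>(1) by (intro exI[of _ "min \<delta> \<eta>"]) simp
qed

text \<open>The local parameter at a cusp; \<open>cusp_chart\<close> inverts it by a
  logarithm.\<close>

definition qpar :: "complex \<Rightarrow> complex" where
  "qpar w = exp (2 * of_real pi * \<i> * w / of_nat N)"

lemma qpar_nonzero: "qpar w \<noteq> 0"
  by (simp add: qpar_def)

lemma qpar_add: "qpar (v + w) = qpar v * qpar w"
  by (simp add: qpar_def exp_add ring_distribs add_divide_distrib)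

lemma qpar_eq_iff: "qpar v = qpar w \<longleftrightarrow> (\<exists>j::int. v = w + of_int (int N * j))"
proof -
  have N0: "(of_nat N :: complex) \<noteq> 0" using N7 by simp
  have "qpar v = qpar w \<longleftrightarrow> (\<exists>j::int. 2 * of_real pi * \<i> * v / of_nat N = 2 * of_real pi * \<i> * w / of_nat N + of_real (of_int (2 * j) * pi) * \<i>)"
    unfolding qpar_def by (rule exp_eq)
  also have "\<dots> \<longleftrightarrow> (\<exists>j::int. v = w + of_int (int N * j))"
  proof (rule arg_cong[where f = Ex], rule ext)
    fix j :: int
    have "2 * of_real pi * \<i> * w / of_nat N + of_real (of_int (2 * j) * pi) * \<i> = 2 * of_real pi * \<i> * (w + of_int (int N * j)) / of_nat N"
      using N0 by (simp add: field_simps)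
    then show "(2 * of_real pi * \<i> * v / of_nat N = 2 * of_real pi * \<i> * w / of_nat N + of_real (of_int (2 * j) * pi) * \<i>) = (v = w + of_int (int N * j))"
      using N0 by (simp add: divide_cancel_right)
  qed
  finally show ?thesis .
qed

lemma qpar_surj:
  assumes "q \<noteq> 0"
  shows "qpar (of_nat N * Ln q / (2 * of_real pi * \<i>)) = q"
  using assms N7 by (simp add: qpar_def)

lemma norm_qpar: "cmod (qpar w) = exp (- (2 * pi * Im w / real N))"
  by (simp add: qpar_def Re_divide_of_nat)

lemma qpar_cases:
  assumes "q \<noteq> 0" "cmod q < exp (- (2 * pi * t / real N))"
  obtains w where "q = qpar w" "Im w > t"
proof -
  let ?w = "of_nat N * Ln q / (2 * of_real pi * \<i>)"
  note q = qpar_surj[OF assms(1)]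
  have "exp (- (2 * pi * Im ?w / real N)) < exp (- (2 * pi * t / real N))"
    unfolding norm_qpar[symmetric] q by (rule assms(2))
  then have "2 * pi * t / real N < 2 * pi * Im ?w / real N" by (simp only: exp_less_cancel_iff neg_less_iff_less)
  then have "Im ?w > t" using N7 by (simp only: divide_less_cancel) simp
  then show ?thesis using that[OF q[symmetric]] by blast
qed

lemma translate_in_SL2: "mat2 1 k 0 (1::int) \<in> carrier SL2"
  by simp

lemma moebius_sphere_translate: "moebius_sphere (mat2 1 k 0 1) (Fin w) = Fin (w + of_int k)" "moebius_sphere (mat2 1 k 0 1) Inf = Inf"
  by (simp_all add: moebius_mat2)

lemma cong_orbit_conj:
  assumes A: "A \<in> carrier SL2" and C: "C \<in> principal_cong N"
  shows "cong_orbit N (moebius_sphere A (moebius_sphere C P)) = cong_orbit N (moebius_sphere A P)"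
proof -
  note Cc = principal_cong_SL2[OF C] and D = principal_cong_conj[OF A C]
  have i: "inv\<^bsub>SL2\<^esub> A \<in> carrier SL2" using A by simp
  have "moebius_sphere (A * C * inv\<^bsub>SL2\<^esub> A) (moebius_sphere A P) = moebius_sphere A (moebius_sphere C P)"
    using A Cc i SL2_mult_closed[OF A Cc] by (simp add: moebius_sphere_mult moebius_sphere_inv)
  then show ?thesis using cong_orbit_eqI[OF D, of "moebius_sphere A P"] by simp
qed

text \<open>Another value of the logarithm changes w by a multiple of N, which is a translation in
  \<Gamma>(N); so the branch chosen by \<open>Ln\<close> is immaterial.\<close>

lemma cusp_chart_qpar:
  assumes A: "A \<in> carrier SL2"
  shows "cusp_chart N A (qpar w) = cong_orbit N (moebius_sphere A (Fin w))"
proof -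
  let ?w = "of_nat N * Ln (qpar w) / (2 * of_real pi * \<i>)"
  obtain j :: int where j: "?w = w + of_int (int N * j)" using qpar_surj[OF qpar_nonzero, of w] unfolding qpar_eq_iff by blast
  have C: "mat2 1 (int N * j) 0 1 \<in> principal_cong N" by (simp add: principal_cong_mat2 cong_0_iff)
  show ?thesis using cong_orbit_conj[OF A C, of "Fin w"] qpar_nonzero[of w]
    unfolding cusp_chart_def moebius_sphere_translate(1) j by simp
qed

lemma cusp_chart_zero: "cusp_chart N A 0 = cong_orbit N (moebius_sphere A Inf)"
  by (simp add: cusp_chart_def)

lemma cusp_chart_cases:
  assumes "cmod q < 1"
  obtains "q = 0" | w where "q = qpar w" "w \<in> upper_half"
proof (cases "q = 0")
  case False
  from qpar_cases[of q 0] False assms obtain w where "q = qpar w" "Im w > 0" by auto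
  then show ?thesis using that(2) by (simp add: upper_half_def)
qed (rule that(1))

text \<open>The radius corresponds to Im w > 1. An element with c nonzero sends such a point to
  imaginary part at most 1, so only translations identify points of this disc.\<close>

lemma cusp_chart_inj:
  assumes A: "A \<in> carrier SL2"
  shows "inj_on (cusp_chart N A) (ball 0 (exp (- (2 * pi * 1 / real N))))"
proof (rule inj_onI)
  fix q q' assume q: "q \<in> ball 0 (exp (- (2 * pi * 1 / real N)))" "q' \<in> ball 0 (exp (- (2 * pi * 1 / real N)))"
    and eq: "cusp_chart N A q = cusp_chart N A q'"
  \<comment> \<open>Conjugation by \<open>A\<close> moves the cusp to infinity, and normality keeps
    the element in \<Gamma>(N).\<close>
  have pull: "\<exists>B\<in>principal_cong N. P' = moebius_sphere B P"
    if PP: "cong_orbit N (moebius_sphere A P) = cong_orbit N (moebius_sphere A P')" for P P'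
  proof -
    obtain C where C: "C \<in> principal_cong N" "moebius_sphere A P' = moebius_sphere C (moebius_sphere A P)" using cong_orbit_eqD[OF PP] by blast
    have i: "inv\<^bsub>SL2\<^esub> A \<in> carrier SL2" using A by simp
    note Cc = principal_cong_SL2[OF C(1)]
    have "inv\<^bsub>SL2\<^esub> A * C * A \<in> principal_cong N" using principal_cong_conj[OF i C(1)] A by simp
    moreover have "P' = moebius_sphere (inv\<^bsub>SL2\<^esub> A * C * A) P"
      using moebius_sphere_inv(1)[OF A, of P'] C(2) A Cc i SL2_mult_closed[OF i Cc] by (simp add: moebius_sphere_mult)
    ultimately show ?thesis by blast
  qed
  have no_mix: False if w: "Im w > 1" "cusp_chart N A 0 = cusp_chart N A (qpar w)" for w
  proof -
    obtain B where "B \<in> principal_cong N" "moebius_sphere B Inf = Fin w"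
      using pull[OF w(2)[unfolded cusp_chart_zero cusp_chart_qpar[OF A]]] by metis
    then show False using moebius_sphere_Inf_notin[OF principal_cong_SL2, of B N w] w(1) by (simp add: upper_half_def del: moebius_sphere.simps)
  qed
  have cases: "q = 0 \<or> (\<exists>w. q = qpar w \<and> Im w > 1)" if "q \<in> ball 0 (exp (- (2 * pi * 1 / real N)))" for q
  proof (cases "q = 0")
    case False
    from qpar_cases[of q 1] False that show ?thesis by auto
  qed simp
  show "q = q'"
  proof (cases "q = 0 \<or> q' = 0")
    case True then show ?thesis using no_mix cases[OF q(1)] cases[OF q(2)] eq by metis
  next
    case False
    then obtain w w' where w: "q = qpar w" "Im w > 1" "q' = qpar w'" "Im w' > 1" using cases[OF q(1)] cases[OF q(2)] by blast
    obtain B where B: "B \<in> principal_cong N" "Fin w' = moebius_sphere B (Fin w)"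
      using eq pull unfolding w cusp_chart_qpar[OF A] by blast
    have wH: "w \<in> upper_half" using w(2) by (simp add: upper_half_def)
    obtain a b c d where B2: "B = mat2 a b c d" "a * d - b * c = 1" using principal_cong_SL2[OF B(1)] by (rule SL2_cases)
    let ?L = "of_int c * w + of_int d"
    have w': "w' = moebius (mat2 a b c d) w" 
    proof -
      have "Fin w' = Fin (moebius B w)" using B(2) moebius_sphere_Fin[OF principal_cong_SL2[OF B(1)] wH] by simp
      then show ?thesis by (simp add: B2(1))
    qed
    have "c = 0"
    proof (rule ccontr)
      assume "c \<noteq> 0"
      then have "1 \<le> \<bar>of_int c :: real\<bar>" by linarith
      then have "1 * Im w \<le> \<bar>of_int c\<bar> * Im w" using w(2) by (intro mult_right_mono) auto
      also have "\<dots> = \<bar>Im ?L\<bar>" using w(2) by (simp add: abs_mult)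
      also have "\<dots> \<le> cmod ?L" by (rule abs_Im_le_cmod)
      finally have L: "Im w \<le> cmod ?L" by simp
      then have "Im w * 1 \<le> cmod ?L * cmod ?L" using w(2) by (intro mult_mono) auto
      then have "Im w \<le> (cmod ?L)\<^sup>2" by (simp add: power2_eq_square)
      moreover have "(cmod ?L)\<^sup>2 > 0" using L w(2) by auto
      ultimately have "Im w' \<le> 1" unfolding w' Im_moebius_mat2[OF B2(2) wH] by (simp add: divide_le_eq)
      then show False using w(4) by simp
    qed
    then have "a * d = 1" using B2 by simp
    then have "a = 1 \<and> d = 1 \<or> a = - 1 \<and> d = - 1" by (rule zmult_eq_1_iff[THEN iffD1])
    \<comment> \<open>Of the two signs only a = d = 1 is compatible with the congruence.\<close>
    moreover have "\<not> [- 1 = 1] (mod int N)" using N7 zdvd_imp_le[of "int N" 2] by (auto simp: cong_iff_dvd_diff)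
    ultimately have "a = 1" "d = 1" "[b = 0] (mod int N)" using B(1) unfolding B2(1) principal_cong_mat2 by auto
    moreover then obtain j where "b = int N * j" by (auto simp: cong_0_iff)
    ultimately have "w' = w + of_int (int N * j)" unfolding w' \<open>c = 0\<close> by (simp add: moebius_mat2)
    then have "qpar w' = qpar w" unfolding qpar_eq_iff by blast
    then show ?thesis using w by simp
  qed
qed

end

text \<open>The local expression of the action between charts centred at a point and at its
  image.\<close>

definition reparam :: "(complex \<Rightarrow> complex) \<Rightarrow> bool" where
  "reparam r \<longleftrightarrow> r analytic_on {0} \<and> r 0 = 0"

lemma reparam_tendsto:
  assumes "reparam r"
  shows "(r \<longlongrightarrow> 0) (nhds 0)"
proof -
  have "isCont r 0" using assms analytic_at_imp_isCont by (auto simp: reparam_def)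
  then show ?thesis using assms by (simp add: isCont_def tendsto_nhds_iff reparam_def)
qed

lemma analytic_compose_reparam:
  assumes "h analytic_on {0}" "reparam r"
  shows "(\<lambda>u. h (r u)) analytic_on {0}"
  using analytic_on_compose[of r "{0}" h] assms by (simp add: reparam_def o_def)

section \<open>Coordinate changes and cotangent lines\<close>

context prime_field begin

lemma XC_charts_cases:
  assumes "\<phi> \<in> XC_charts N P"
  obtains (interior) z where "\<phi> = interior_chart N z" "z \<in> upper_half" "P = cong_orbit N (Fin z)"
  | (cusp) A where "\<phi> = cusp_chart N A" "A \<in> carrier SL2" "P = cong_orbit N (moebius_sphere A Inf)"
  using assms unfolding XC_charts_def by blast

lemma chart_zero: "\<phi> \<in> XC_charts N P \<Longrightarrow> \<phi> 0 = P"
  by (erule XC_charts_cases) (simp_all only: interior_chart_def cusp_chart_zero add_0_right)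

lemma eventually_norm_less: "t > 0 \<Longrightarrow> \<forall>\<^sub>F q in nhds (0::complex). cmod q < t"
  unfolding eventually_nhds_metric by (auto simp: dist_norm)

lemma chart_in_XC:
  assumes "\<phi> \<in> XC_charts N P"
  shows "\<forall>\<^sub>F u in nhds 0. \<phi> u \<in> XC N"
  using assms
proof (cases rule: XC_charts_cases)
  case (interior z)
  show ?thesis using eventually_upper_half[OF interior(2)]
    by eventually_elim (simp add: interior(1) interior_chart_def XC_def Fin_in_Hstar)
next
  case (cusp A)
  have "\<phi> q \<in> XC N" if "cmod q < 1" for q
    using that
  proof (cases rule: cusp_chart_cases)
    case 1 then show ?thesis using cusp moebius_sphere_Inf_in_Hstar by (simp add: cusp_chart_zero XC_def del: moebius_sphere.simps)
  next
    case (2 w)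
    then show ?thesis using cusp moebius_sphere_Hstar[OF cusp(2) Fin_in_Hstar]
      by (simp add: cusp_chart_qpar XC_def del: moebius_sphere.simps)
  qed
  then show ?thesis using eventually_norm_less[of 1] by (auto elim: eventually_mono)
qed

lemma chart_exists:
  assumes "P \<in> XC N"
  obtains \<phi> \<delta> where "\<phi> \<in> XC_charts N P" "\<delta> > 0" "inj_on \<phi> (ball 0 \<delta>)"
proof -
  obtain p where p: "p \<in> Hstar" "P = cong_orbit N p" using assms by (auto simp: XC_def)
  from p(1) show ?thesis
  proof (cases rule: Hstar_cases)
    case (interior z)
    then have "interior_chart N z \<in> XC_charts N P" using p(2) by (auto simp: XC_charts_def)
    then show ?thesis using interior_chart_inj[OF interior(2)] that by blast
  next
    case (cusp A)
    then have "cusp_chart N A \<in> XC_charts N P" using p(2) by (auto simp: XC_charts_def simp del: moebius_sphere.simps)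
    then show ?thesis using cusp_chart_inj[OF cusp(2)] that by (metis exp_gt_zero)
  qed
qed

lemma act_interior_chart:
  assumes g: "g \<in> carrier (PSL2 :: 'f mat set monoid)" and B: "B \<in> lifts g" and z: "z \<in> upper_half"
  shows "\<forall>\<^sub>F u in nhds 0. XC_act g (interior_chart N z u) = interior_chart N (moebius B z) (moebius B (z + u) - moebius B z)"
  using eventually_upper_half[OF z]
proof eventually_elim
  case (elim u)
  show ?case unfolding interior_chart_def XC_act_cong_orbit[OF g B] moebius_sphere_Fin[OF lifts_eq(1)[OF B g] elim] by simp
qed

lemma interior_reparam:
  assumes "B \<in> carrier SL2" "z \<in> upper_half"
  shows "reparam (\<lambda>u. moebius B (z + u) - moebius B z)"
proof -
  have "(\<lambda>u. z + u) analytic_on {0}" by (intro analytic_intros)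
  then have "(moebius B \<circ> (\<lambda>u. z + u)) analytic_on {0}"
    using moebius_analytic[OF assms] by (intro analytic_on_compose) simp_all
  then have "(\<lambda>u. moebius B (z + u) - moebius B z) analytic_on {0}" by (intro analytic_intros) (simp add: o_def)
  then show ?thesis by (simp add: reparam_def)
qed

lemma act_cusp_chart:
  assumes g: "g \<in> carrier (PSL2 :: 'f mat set monoid)" and B: "B \<in> lifts g" and A: "A \<in> carrier SL2"
  shows "XC_act g (cusp_chart N A q) = cusp_chart N (B * A) q"
  unfolding cusp_chart_def XC_act_cong_orbit[OF g B] moebius_sphere_mult[OF lifts_eq(1)[OF B g] A] ..

text \<open>Translation by k multiplies the parameter by exp(2 pi i k / N), and the sign acts
  trivially. This rotation is the source of the ramification character at a cusp.\<close>

lemma cusp_chart_translate: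
  assumes A: "A \<in> carrier SL2" and E: "E = mat2 1 k 0 1 \<or> E = - mat2 1 k 0 1" and q: "cmod q < 1"
  shows "cusp_chart N (A * E) q = cusp_chart N A (qpar (of_int k) * q)"
proof -
  have Ec: "E \<in> carrier SL2" using E by auto
  have E': "moebius_sphere E P = moebius_sphere (mat2 1 k 0 1) P" for P
    using E moebius_sphere_uminus[OF translate_in_SL2] by metis
  from q show ?thesis
  proof (cases rule: cusp_chart_cases)
    case 1
    then show ?thesis by (simp only: mult_zero_right cusp_chart_zero moebius_sphere_mult[OF A Ec] E' moebius_sphere_translate)
  next
    case (2 w)
    have "cusp_chart N (A * E) q = cong_orbit N (moebius_sphere A (Fin (of_int k + w)))"
      unfolding 2 cusp_chart_qpar[OF SL2_mult_closed[OF A Ec]] moebius_sphere_mult[OF A Ec] E' moebius_sphere_translate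
      by (simp only: add.commute)
    then show ?thesis unfolding 2(1) qpar_add[symmetric] cusp_chart_qpar[OF A] .
  qed
qed

text \<open>Multiplying a lift by \<Gamma>(N) on the left moves the image of p to any chosen
  representative of its orbit.\<close>

lemma lift_adjust:
  assumes g: "g \<in> carrier (PSL2 :: 'f mat set monoid)" and B: "B \<in> lifts g"
    and eq: "cong_orbit N (moebius_sphere B p) = cong_orbit N p'"
  obtains D where "D \<in> lifts g" "p' = moebius_sphere D p"
proof -
  obtain C where C: "C \<in> principal_cong N" "p' = moebius_sphere C (moebius_sphere B p)" using cong_orbit_eqD[OF eq] by blast
  have "C * B \<in> lifts (\<one>\<^bsub>PSL2\<^esub> \<otimes>\<^bsub>PSL2\<^esub> g)"
    by (rule lifts_mult[OF PSL2.one_closed g principal_cong_in_lifts_one[OF C(1)] B])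
  moreover have "p' = moebius_sphere (C * B) p"
    using C(2) moebius_sphere_mult[OF principal_cong_SL2[OF C(1)] lifts_eq(1)[OF B g]] by simp
  ultimately show ?thesis using that g by simp
qed

text \<open>Moving both cusps to infinity turns \<open>D\<close> into an element fixing infinity,
  that is a translation up to sign.\<close>

lemma fixes_cusp_cases:
  assumes D: "D \<in> carrier SL2" and A: "A \<in> carrier SL2" and A': "A' \<in> carrier SL2"
    and eq: "moebius_sphere A' Inf = moebius_sphere D (moebius_sphere A Inf)"
  obtains E k where "E = mat2 1 k 0 1 \<or> E = - mat2 1 k 0 1" "D * A = A' * E"
proof -
  have i: "inv\<^bsub>SL2\<^esub> A' \<in> carrier SL2" and DA: "D * A \<in> carrier SL2" using A' SL2_mult_closed[OF D A] by simp_all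
  define E where "E = inv\<^bsub>SL2\<^esub> A' * (D * A)"
  have Ec: "E \<in> carrier SL2" unfolding E_def by (rule SL2_mult_closed[OF i DA])
  have "moebius_sphere E Inf = Inf"
    unfolding E_def moebius_sphere_mult[OF i DA] moebius_sphere_mult[OF D A] eq[symmetric] by (rule moebius_sphere_inv(1)[OF A'])
  then obtain k where "E = mat2 1 k 0 1 \<or> E = - mat2 1 k 0 1" using fixes_Inf_cases[OF Ec] by blast
  moreover have "D * A = A' * E"
    using SL2.m_assoc[OF A' i DA] SL2.r_inv[OF A'] SL2.l_one[OF DA] by (simp add: E_def)
  ultimately show ?thesis by (rule that)
qed

text \<open>Charts of different kinds never face each other, because no cusp is equivalent to a
  point of the half-plane. In the interior the coordinate change is the Moebius map itself, at a
  cusp it is a rotation of q.\<close>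

lemma act_chart:
  assumes g: "g \<in> carrier (PSL2 :: 'f mat set monoid)"
    and \<phi>: "\<phi> \<in> XC_charts N P" and \<psi>: "\<psi> \<in> XC_charts N (XC_act g P)"
  obtains r where "reparam r" "\<forall>\<^sub>F u in nhds 0. XC_act g (\<phi> u) = \<psi> (r u)"
proof -
  obtain B where B: "B \<in> lifts g" using lifts_nonempty[OF g] by blast
  have adjust: "\<exists>D\<in>lifts g. p' = moebius_sphere D p" if "P = cong_orbit N p" "XC_act g P = cong_orbit N p'" for p p'
    using lift_adjust[OF g B, of p p'] that XC_act_cong_orbit[OF g B, of p] by metis
  from \<phi> show ?thesis
  proof (cases rule: XC_charts_cases)
    case z: (interior z)
    from \<psi> show ?thesis
    proof (cases rule: XC_charts_cases)
      case z': (interior z')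
      obtain D where D: "D \<in> lifts g" "Fin z' = moebius_sphere D (Fin z)" using adjust[OF z(3) z'(3)] by blast
      note Dc = lifts_eq(1)[OF D(1) g]
      have z'D: "z' = moebius D z" using D(2) moebius_sphere_Fin[OF Dc z(2)] by simp
      show ?thesis using that[OF interior_reparam[OF Dc z(2)]] act_interior_chart[OF g D(1) z(2)] unfolding z(1) z'(1) z'D .
    next
      case (cusp A)
      obtain D where D: "D \<in> lifts g" "moebius_sphere A Inf = moebius_sphere D (Fin z)" using adjust[OF z(3) cusp(3)] by blast
      note Dc = lifts_eq(1)[OF D(1) g]
      show ?thesis using D(2) moebius_sphere_Fin[OF Dc z(2)] moebius_sphere_Inf_notin[OF cusp(2) moebius_upper_half[OF Dc z(2)]] by metis
    qed
  next
    case A: (cusp A)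
    from \<psi> show ?thesis
    proof (cases rule: XC_charts_cases)
      case z: (interior z)
      obtain D where D: "D \<in> lifts g" "Fin z = moebius_sphere D (moebius_sphere A Inf)" using adjust[OF A(3) z(3)] by blast
      note Dc = lifts_eq(1)[OF D(1) g]
      show ?thesis using D(2) moebius_sphere_Inf_notin[OF SL2_mult_closed[OF Dc A(2)] z(2)] moebius_sphere_mult[OF Dc A(2)] by metis
    next
      case A': (cusp A')
      obtain D where D: "D \<in> lifts g" "moebius_sphere A' Inf = moebius_sphere D (moebius_sphere A Inf)" using adjust[OF A(3) A'(3)] by blast
      note Dc = lifts_eq(1)[OF D(1) g]
      obtain E k where k: "E = mat2 1 k 0 1 \<or> E = - mat2 1 k 0 1" and E: "D * A = A' * E"
        using fixes_cusp_cases[OF Dc A(2) A'(2) D(2)] by blast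
      have "XC_act g (\<phi> q) = \<psi> (qpar (of_int k) * q)" if "cmod q < 1" for q
        using cusp_chart_translate[OF A'(2) k that] unfolding A(1) A'(1) act_cusp_chart[OF g D(1) A(2)] E .
      then have "\<forall>\<^sub>F q in nhds 0. XC_act g (\<phi> q) = \<psi> (qpar (of_int k) * q)"
        by (rule eventually_mono[OF eventually_norm_less[of 1], rotated]) simp_all
      moreover have "reparam (\<lambda>q. qpar (of_int k) * q)" unfolding reparam_def by (auto intro!: analytic_intros)
      ultimately show ?thesis by (rule that[rotated])
    qed
  qed
qed

lemma max_ideal_transfer:
  assumes g: "g \<in> carrier (PSL2 :: 'f mat set monoid)"
    and \<phi>: "\<phi> \<in> XC_charts N P" and \<psi>: "\<psi> \<in> XC_charts N (XC_act g P)"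
    and f: "(f \<circ> \<psi>) analytic_on {0}"
  shows "(\<lambda>u. f (XC_act g (\<phi> u))) analytic_on {0}"
proof -
  obtain r where r: "reparam r" "\<forall>\<^sub>F u in nhds 0. XC_act g (\<phi> u) = \<psi> (r u)" using act_chart[OF g \<phi> \<psi>] by blast
  have "\<forall>\<^sub>F u in nhds 0. f (XC_act g (\<phi> u)) = (f \<circ> \<psi>) (r u)" using r(2) by eventually_elim simp
  from analytic_at_cong[OF this refl] show ?thesis using analytic_compose_reparam[OF f r(1)] by blast
qed

text \<open>Charts at the same point are related by \<open>act_chart\<close> for the identity, so
  holomorphy in one of them gives it in all.\<close>

lemma max_ideal_iff:
  assumes P: "P \<in> XC N" and \<phi>: "\<phi> \<in> XC_charts N P"
  shows "f \<in> XC_max_ideal N P \<longleftrightarrow> (f \<circ> \<phi>) analytic_on {0} \<and> f P = 0"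
proof -
  have "(f \<circ> \<psi>) analytic_on {0}" if f: "(f \<circ> \<phi>) analytic_on {0}" and \<psi>: "\<psi> \<in> XC_charts N P" for \<psi>
  proof -
    have "(\<lambda>u. f (XC_act (\<one>\<^bsub>PSL2\<^esub> :: 'f mat set) (\<psi> u))) analytic_on {0}"
      by (rule max_ideal_transfer[OF _ \<psi>, of "\<one>\<^bsub>PSL2\<^esub>" \<phi>]) (use f \<phi> XC_act_one[OF P] in simp_all)
    moreover have ev: "\<forall>\<^sub>F u in nhds 0. f (XC_act (\<one>\<^bsub>PSL2\<^esub> :: 'f mat set) (\<psi> u)) = (f \<circ> \<psi>) u"
      using chart_in_XC[OF \<psi>] by eventually_elim (simp add: XC_act_one)
    ultimately show ?thesis by (simp only: analytic_at_cong[OF ev refl])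
  qed
  then show ?thesis using \<phi> by (auto simp: XC_max_ideal_def)
qed

text \<open>Take the inverse of an injective chart near P, continued by the value 1; having no zero
  except P, it can be divided by everywhere else.\<close>

lemma coordinate_exists:
  assumes P: "P \<in> XC N"
  obtains \<phi> t where "\<phi> \<in> XC_charts N P" "t \<in> XC_max_ideal N P"
    "\<forall>\<^sub>F u in nhds 0. t (\<phi> u) = u" "\<And>Q. t Q = 0 \<Longrightarrow> Q = P"
proof -
  obtain \<phi> \<delta> where \<phi>: "\<phi> \<in> XC_charts N P" "\<delta> > 0" "inj_on \<phi> (ball 0 \<delta>)" using chart_exists[OF P] by blast
  define t where "t Q = (if Q \<in> \<phi> ` ball 0 \<delta> then the_inv_into (ball 0 \<delta>) \<phi> Q else 1)" for Q
  have t: "t (\<phi> u) = u" if "cmod u < \<delta>" for u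
    using the_inv_into_f_f[OF \<phi>(3), of u] that by (auto simp: t_def)
  have ev: "\<forall>\<^sub>F u in nhds 0. t (\<phi> u) = u" using eventually_norm_less[OF \<phi>(2)] by eventually_elim (rule t)
  then have "(t \<circ> \<phi>) analytic_on {0}" using analytic_at_cong[of "\<lambda>u. t (\<phi> u)" "\<lambda>u. u" 0 0] by (simp add: o_def analytic_on_ident)
  moreover have "t P = 0" using t[of 0] chart_zero[OF \<phi>(1)] \<phi>(2) by simp
  ultimately have "t \<in> XC_max_ideal N P" using max_ideal_iff[OF P \<phi>(1)] by blast
  moreover have "Q = P" if "t Q = 0" for Q
  proof -
    have "Q \<in> \<phi> ` ball 0 \<delta>" using that by (auto simp: t_def split: if_splits)
    then obtain u where "cmod u < \<delta>" "Q = \<phi> u" by auto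
    then show ?thesis using t that chart_zero[OF \<phi>(1)] by simp
  qed
  ultimately show ?thesis using that \<phi>(1) ev by blast
qed

text \<open>The product rule at a common zero of both factors.\<close>

lemma ideal_square_deriv:
  assumes P: "P \<in> XC N" and \<phi>: "\<phi> \<in> XC_charts N P" and f: "f \<in> ideal_square (XC_max_ideal N P)"
  shows "deriv (f \<circ> \<phi>) 0 = 0"
proof -
  have "(f \<circ> \<phi>) analytic_on {0} \<and> deriv (f \<circ> \<phi>) 0 = 0"
    using f
  proof (induction rule: ideal_square_induct)
    case zero show ?case by (simp add: o_def analytic_on_const)
  next
    case (add_mult x a b)
    have ab: "(a \<circ> \<phi>) analytic_on {0}" "(b \<circ> \<phi>) analytic_on {0}" "a (\<phi> 0) = 0" "b (\<phi> 0) = 0"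
      using add_mult max_ideal_iff[OF P \<phi>] chart_zero[OF \<phi>] by auto
    have eq: "(x + a * b) \<circ> \<phi> = (\<lambda>u. (x \<circ> \<phi>) u + (a \<circ> \<phi>) u * (b \<circ> \<phi>) u)" by (simp add: fun_eq_iff)
    have x: "(x \<circ> \<phi>) analytic_on {0}" "(x \<circ> \<phi> has_field_derivative 0) (at 0)"
      using add_mult.IH analytic_derivI[of "x \<circ> \<phi>" 0] by metis+
    have "((\<lambda>u. (x \<circ> \<phi>) u + (a \<circ> \<phi>) u * (b \<circ> \<phi>) u) has_field_derivative
        0 + ((a \<circ> \<phi>) 0 * deriv (b \<circ> \<phi>) 0 + deriv (a \<circ> \<phi>) 0 * (b \<circ> \<phi>) 0)) (at 0)"
      by (rule DERIV_add[OF x(2) DERIV_mult'[OF analytic_derivI[OF ab(1)] analytic_derivI[OF ab(2)]]])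
    then have "deriv ((x + a * b) \<circ> \<phi>) 0 = 0" unfolding eq using ab by (simp add: DERIV_imp_deriv)
    moreover have "((x + a * b) \<circ> \<phi>) analytic_on {0}" unfolding eq by (rule analytic_on_add[OF x(1) analytic_on_mult[OF ab(1,2)]])
    ultimately show ?case by blast
  qed
  then show ?thesis by blast
qed

text \<open>If the derivative of h = f - c t vanishes, then h/t extends holomorphically by 0 at P,
  so h is a product of two elements of the ideal. Hence the derivative in the chart is the
  coordinate on the cotangent line.\<close>

lemma max_ideal_line:
  assumes P: "P \<in> XC N" and \<phi>: "\<phi> \<in> XC_charts N P" and t: "t \<in> XC_max_ideal N P"
    "\<forall>\<^sub>F u in nhds 0. t (\<phi> u) = u" "\<And>Q. t Q = 0 \<Longrightarrow> Q = P" and f: "f \<in> XC_max_ideal N P"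
  shows "f - (\<lambda>_. c) * t \<in> ideal_square (XC_max_ideal N P) \<longleftrightarrow> c = deriv (f \<circ> \<phi>) 0"
proof -
  note iff = max_ideal_iff[OF P \<phi>]
  let ?h = "f - (\<lambda>_. c) * t"
  have fa: "(f \<circ> \<phi>) analytic_on {0}" "f P = 0" "(t \<circ> \<phi>) analytic_on {0}" "t P = 0" using f t(1) iff by auto
  have heq: "?h \<circ> \<phi> = (\<lambda>u. (f \<circ> \<phi>) u - c * (t \<circ> \<phi>) u)" by (simp add: fun_eq_iff)
  have dt: "deriv (t \<circ> \<phi>) 0 = 1"
    using deriv_cong_ev[of "t \<circ> \<phi>" "\<lambda>u. u" 0 0] t(2) by simp
  have "((\<lambda>u. (f \<circ> \<phi>) u - c * (t \<circ> \<phi>) u) has_field_derivative deriv (f \<circ> \<phi>) 0 - c * deriv (t \<circ> \<phi>) 0) (at 0)"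
    using analytic_derivI[OF fa(1)] analytic_derivI[OF fa(3)] by (intro DERIV_diff DERIV_cmult)
  then have dh: "deriv (?h \<circ> \<phi>) 0 = deriv (f \<circ> \<phi>) 0 - c" unfolding heq dt by (simp add: DERIV_imp_deriv)
  have ha: "(?h \<circ> \<phi>) analytic_on {0}"
    unfolding heq by (rule analytic_on_diff[OF fa(1) analytic_on_mult[OF analytic_on_const fa(3)]])
  show ?thesis
  proof
    assume "?h \<in> ideal_square (XC_max_ideal N P)"
    then show "c = deriv (f \<circ> \<phi>) 0" using ideal_square_deriv[OF P \<phi>] dh by simp
  next
    assume c: "c = deriv (f \<circ> \<phi>) 0"
    define g where "g Q = (if Q = P then 0 else ?h Q / t Q)" for Q
    have hg: "?h = t * g"
    proof
      fix Q show "?h Q = (t * g) Q"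
      proof (cases "Q = P")
        case False
        then have "t Q \<noteq> 0" using t(3) by blast
        then show ?thesis using False by (simp add: g_def)
      qed (simp add: fa)
    qed
    have "(g \<circ> \<phi>) analytic_on {0}"
    proof (rule pole_theorem_analytic_0[OF ha, where a = 0])
      obtain d where d: "d > 0" "\<And>u. dist u 0 < d \<Longrightarrow> t (\<phi> u) = u"
        using t(2) unfolding eventually_nhds_metric by blast
      fix z :: complex assume "z \<in> {0}"
      then have "\<forall>w\<in>ball z d - {0}. (?h \<circ> \<phi>) w = (w - 0) * (g \<circ> \<phi>) w"
        using d(2) unfolding hg by auto
      then show "\<exists>d>0. \<forall>w\<in>ball z d - {0}. (?h \<circ> \<phi>) w = (w - 0) * (g \<circ> \<phi>) w" using d(1) by blast
    qed (use dh c fa chart_zero[OF \<phi>] in \<open>simp_all add: g_def\<close>)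
    then have "g \<in> XC_max_ideal N P" using iff by (simp add: g_def)
    then show "?h \<in> ideal_square (XC_max_ideal N P)" unfolding hg by (rule ideal_square_mult[OF t(1)])
  qed
qed

lemma cotangent_action_XC:
  "cotangent_action N (XC N) (XC_act :: 'f mat set \<Rightarrow> _) (\<lambda>c _. c) (XC_max_ideal N) (\<lambda>g f. f \<circ> XC_act (inv\<^bsub>PSL2\<^esub> g))"
proof (unfold_locales)
  fix P and g h :: "'f mat set" and f f' :: "sphere set \<Rightarrow> complex" and c x y :: complex
  show "(\<lambda>_. 1) = (1 :: sphere set \<Rightarrow> complex)" "(\<lambda>_. x + y) = (\<lambda>_. x) + (\<lambda>_::sphere set. y)"
    "(\<lambda>_. x * y) = (\<lambda>_. x) * (\<lambda>_::sphere set. y)" by (simp_all add: fun_eq_iff)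
  show "(f + f') \<circ> XC_act (inv\<^bsub>PSL2\<^esub> g) = (f \<circ> XC_act (inv\<^bsub>PSL2\<^esub> g)) + (f' \<circ> XC_act (inv\<^bsub>PSL2\<^esub> g))"
    "f * f' \<circ> XC_act (inv\<^bsub>PSL2\<^esub> g) = (f \<circ> XC_act (inv\<^bsub>PSL2\<^esub> g)) * (f' \<circ> XC_act (inv\<^bsub>PSL2\<^esub> g))"
    "(\<lambda>_. c) \<circ> XC_act (inv\<^bsub>PSL2\<^esub> g) = (\<lambda>_. c)" by (simp_all add: fun_eq_iff)
  {
    assume P: "P \<in> XC N"
    show "XC_act (\<one>\<^bsub>PSL2\<^esub> :: 'f mat set) P = P" by (rule XC_act_one[OF P])
    obtain \<phi> t where \<phi>: "\<phi> \<in> XC_charts N P" and t: "t \<in> XC_max_ideal N P"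
      "\<forall>\<^sub>F u in nhds 0. t (\<phi> u) = u" "\<And>Q. t Q = 0 \<Longrightarrow> Q = P" using coordinate_exists[OF P] by blast
    note iff = max_ideal_iff[OF P \<phi>] and line = max_ideal_line[OF P \<phi> t]
    show "\<exists>t\<in>XC_max_ideal N P. \<forall>f\<in>XC_max_ideal N P. \<exists>!c. f - (\<lambda>_. c) * t \<in> ideal_square (XC_max_ideal N P)"
      using line t(1) by (intro bexI[of _ t] ballI ex1I) auto
    {
      assume f: "f \<in> XC_max_ideal N P"
      have "((\<lambda>_. c) * f \<circ> \<phi>) = (\<lambda>u. c * (f \<circ> \<phi>) u)" by (simp add: fun_eq_iff)
      then show "(\<lambda>_. c) * f \<in> XC_max_ideal N P"
        using f unfolding iff by (simp add: analytic_on_mult[OF analytic_on_const] del: o_apply)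
      have fa: "(f \<circ> \<phi>) analytic_on {0}" "f P = 0" using f iff by auto
      \<comment> \<open>The identity acts as the identity only on points of the curve. In the chart
        the difference \<open>d\<close> vanishes near 0, which already puts it in the
        square.\<close>
      define d where "d = (f \<circ> XC_act (inv\<^bsub>PSL2\<^esub> (\<one>\<^bsub>PSL2\<^esub> :: 'f mat set))) - f"
      have d: "d Q = f (XC_act (\<one>\<^bsub>PSL2\<^esub> :: 'f mat set) Q) - f Q" for Q by (simp add: d_def)
      have ev: "\<forall>\<^sub>F u in nhds 0. (d \<circ> \<phi>) u = 0"
        using chart_in_XC[OF \<phi>] by eventually_elim (simp add: d XC_act_one)
      have "(d \<circ> \<phi>) analytic_on {0}" by (simp only: analytic_at_cong[OF ev refl] analytic_on_const)
      then have "d \<in> XC_max_ideal N P" using iff XC_act_one[OF P] by (simp add: d)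
      moreover have "deriv (d \<circ> \<phi>) 0 = 0" by (rule trans[OF deriv_cong_ev[OF ev refl]]) simp
      moreover have "d - (\<lambda>_. 0) * t = d" by (simp add: fun_eq_iff)
      ultimately have "d \<in> ideal_square (XC_max_ideal N P)" using line[of d 0] by simp
      then show "(f \<circ> XC_act (inv\<^bsub>PSL2\<^esub> (\<one>\<^bsub>PSL2\<^esub> :: 'f mat set))) - f \<in> ideal_square (XC_max_ideal N P)" by (simp only: d_def)
    }
    assume g: "g \<in> carrier PSL2"
    show closed: "XC_act g P \<in> XC N" by (rule XC_act_closed[OF P g])
    assume f: "f \<in> XC_max_ideal N P"
    have i: "inv\<^bsub>PSL2\<^esub> g \<in> carrier PSL2" using g by simp
    have ret: "XC_act (inv\<^bsub>PSL2\<^esub> g) (XC_act g P) = P"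
      using XC_act_mult[OF i g, of P] XC_act_one[OF P] g by simp
    have "(f \<circ> XC_act (inv\<^bsub>PSL2\<^esub> g) \<circ> \<psi>) analytic_on {0}" if "\<psi> \<in> XC_charts N (XC_act g P)" for \<psi>
      using max_ideal_transfer[OF i that, of \<phi> f] \<phi> f iff[of f] unfolding ret by (simp add: o_def)
    then show "f \<circ> XC_act (inv\<^bsub>PSL2\<^esub> g) \<in> XC_max_ideal N (XC_act g P)"
      using ret f by (auto simp: XC_max_ideal_def simp del: comp_apply) (simp add: ret)
  }
  assume "g \<in> carrier PSL2" "h \<in> carrier PSL2"
  then show "XC_act (g \<otimes>\<^bsub>PSL2\<^esub> h) P = XC_act g (XC_act h P)"
    "f \<circ> XC_act (inv\<^bsub>PSL2\<^esub> (g \<otimes>\<^bsub>PSL2\<^esub> h)) = f \<circ> XC_act (inv\<^bsub>PSL2\<^esub> h) \<circ> XC_act (inv\<^bsub>PSL2\<^esub> g)"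
    by (simp_all add: fun_eq_iff PSL2.inv_mult_group XC_act_mult)
qed

end

section \<open>Faithfulness of the ramification character over the complex numbers\<close>

context prime_field begin

lemma lifts_principal_cong:
  assumes k: "k \<in> carrier (PSL2 :: 'f mat set monoid)" and D: "D \<in> lifts k" and or: "D \<in> principal_cong N \<or> - D \<in> principal_cong N"
  shows "k = \<one>\<^bsub>PSL2\<^esub>"
proof -
  note Dc = lifts_eq[OF D k]
  have "map_mat of_int (- D) = - (map_mat of_int D :: 'f mat)" using Dc(1) by (elim SL2_cases) simp
  moreover have "- (- (map_mat of_int D)) = (map_mat of_int D :: 'f mat)" using Dc(1) by (elim SL2_cases) simp
  ultimately have "map_mat of_int D = (1\<^sub>m 2 :: 'f mat) \<or> map_mat of_int D = - (1\<^sub>m 2 :: 'f mat)"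
    using or principal_cong_iff[OF Dc(1)] principal_cong_iff[OF SL2_uminus_closed[OF Dc(1)]] by metis
  then show ?thesis
    unfolding Dc(2) one_PSL2 by (subst pclass_eq_iff[OF map_mat_SL2[OF Dc(1)]]) (simp_all add: one_mat2)
qed

text \<open>The scalar is the derivative at the fixed point of the local expression of inverse h.
  Derivative 1 means (c z + d)^2 = 1 in the interior and a trivial rotation of q at a cusp; both
  force a lift lying in \<Gamma>(N) up to sign.\<close>

lemma XC_ram_faithful:
  assumes P: "P \<in> XC N" and h: "h \<in> stab PSL2 XC_act P" and ram: "XC_ram N P (h :: 'f mat set) = 1"
  shows "h = \<one>\<^bsub>PSL2\<^esub>"
proof -
  interpret complex: cotangent_action "TYPE('f)" N "XC N" XC_act "\<lambda>c _. c" "XC_max_ideal N" "\<lambda>g f. f \<circ> XC_act (inv\<^bsub>PSL2\<^esub> g)"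
    by (rule cotangent_action_XC)
  have ram: "complex.ram P h = 1" using ram by (simp add: XC_ram_def times_fun_def)
  have hc: "h \<in> carrier PSL2" and hP: "XC_act h P = P" using h by (simp_all add: stab_def)
  \<comment> \<open>Functions are pulled back along the inverse, so it is \<open>k\<close> that
    moves points in the chart.\<close>
  define k where "k = inv\<^bsub>PSL2\<^esub> h"
  have kc: "k \<in> carrier PSL2" using hc by (simp add: k_def)
  have kP: "XC_act k P = P"
    using XC_act_mult[OF kc hc, of P] XC_act_one[OF P] hP hc by (simp add: k_def)
  obtain B where B: "B \<in> lifts k" using lifts_nonempty[OF kc] by blast
  obtain \<phi> t where \<phi>: "\<phi> \<in> XC_charts N P" and t: "t \<in> XC_max_ideal N P"
    "\<forall>\<^sub>F u in nhds 0. t (\<phi> u) = u" "\<And>Q. t Q = 0 \<Longrightarrow> Q = P" using coordinate_exists[OF P] by blast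
  \<comment> \<open>Apply the scalar to the coordinate t: the function r u - u is the chart
    expression of an element of the square, so its derivative is 0.\<close>
  have deriv_one: "deriv r 0 = 1" if r: "reparam r" "\<forall>\<^sub>F u in nhds 0. XC_act k (\<phi> u) = \<phi> (r u)" for r
  proof -
    let ?d = "(t \<circ> XC_act (inv\<^bsub>PSL2\<^esub> h)) - (\<lambda>_. 1) * t"
    have "?d \<in> ideal_square (XC_max_ideal N P)" using complex.ram[OF P hc hP t(1)] unfolding ram .
    then have d0: "deriv (?d \<circ> \<phi>) 0 = 0" by (rule ideal_square_deriv[OF P \<phi>])
    have "\<forall>\<^sub>F u in nhds 0. t (\<phi> (r u)) = r u"
      using eventually_compose_filterlim[OF t(2) reparam_tendsto[OF r(1)]] .
    then have "\<forall>\<^sub>F u in nhds 0. (?d \<circ> \<phi>) u = r u - u"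
      using r(2) t(2) by eventually_elim (simp add: k_def)
    then have "deriv (\<lambda>u. r u - u) 0 = 0" using deriv_cong_ev[OF _ refl] d0 by metis
    moreover have "((\<lambda>u. r u - u) has_field_derivative deriv r 0 - 1) (at 0)"
      using r(1) by (intro DERIV_diff analytic_derivI DERIV_ident) (simp add: reparam_def)
    ultimately show ?thesis by (simp add: DERIV_imp_deriv)
  qed
  have adjust: "\<exists>D\<in>lifts k. p = moebius_sphere D p" if "P = cong_orbit N p" for p
    using lift_adjust[OF kc B, of p p] that XC_act_cong_orbit[OF kc B, of p] kP by metis
  have "k = \<one>\<^bsub>PSL2\<^esub>"
    using \<phi>
  proof (cases rule: XC_charts_cases)
    case (interior z)
    obtain D where D: "D \<in> lifts k" "Fin z = moebius_sphere D (Fin z)" using adjust[OF interior(3)] by blast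
    note Dc = lifts_eq(1)[OF D(1) kc]
    have fix_z: "moebius D z = z"
      using D(2) unfolding moebius_sphere_Fin[OF Dc interior(2)] by (simp only: sphere.inject)
    obtain a b c d where D2: "D = mat2 a b c d" "a * d - b * c = 1" using Dc by (rule SL2_cases)
    let ?r = "\<lambda>u. moebius D (z + u) - moebius D z"
    have "deriv ?r 0 = 1"
      using act_interior_chart[OF kc D(1) interior(2)] unfolding interior(1) fix_z
      by (intro deriv_one interior_reparam[OF Dc interior(2), unfolded fix_z]) (simp add: interior(1))
    moreover have "(?r has_field_derivative 1 / (of_int c * z + of_int d)\<^sup>2) (at 0)"
    proof -
      have "((\<lambda>u. moebius D (u + z)) has_field_derivative 1 / (of_int c * z + of_int d)\<^sup>2) (at 0)"
        by (subst DERIV_shift[symmetric]) (use moebius_deriv[OF D2(2) interior(2)] in \<open>simp add: D2(1)\<close>)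
      then have "((\<lambda>u. moebius D (z + u)) has_field_derivative 1 / (of_int c * z + of_int d)\<^sup>2) (at 0)"
        by (simp only: add.commute)
      then show ?thesis using DERIV_diff[OF _ DERIV_const] by fastforce
    qed
    ultimately have "1 / (of_int c * z + of_int d)\<^sup>2 = 1" by (simp add: DERIV_imp_deriv)
    then have "(of_int c * z + of_int d)\<^sup>2 = 1" by (simp add: divide_eq_1_iff)
    then have L: "of_int c * z + of_int d = 1 \<or> of_int c * z + of_int d = - 1" by (simp add: power2_eq_1_iff)
    \<comment> \<open>A real value of c z + d forces c = 0; after that, fixing z forces b =
      0.\<close>
    then have "Im (of_int c * z + of_int d) = Im 1 \<or> Im (of_int c * z + of_int d) = Im (- 1)" by metis
    then have c: "c = 0" using interior(2) by (simp add: upper_half_def)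
    then have "a * d = 1" using D2(2) by simp
    then have ad: "a = 1 \<and> d = 1 \<or> a = - 1 \<and> d = - 1" by (rule zmult_eq_1_iff[THEN iffD1])
    have "b = 0" using fix_z ad by (auto simp: D2(1) moebius_mat2 c)
    then have "D = 1\<^sub>m 2 \<or> - D = 1\<^sub>m 2" using ad c by (auto simp: D2(1) one_mat2)
    then show ?thesis using principal_cong_one by (intro lifts_principal_cong[OF kc D(1)]) auto
  next
    case (cusp A)
    obtain D where D: "D \<in> lifts k" "moebius_sphere A Inf = moebius_sphere D (moebius_sphere A Inf)" using adjust[OF cusp(3)] by blast
    note Dc = lifts_eq(1)[OF D(1) kc]
    obtain E j where j: "E = mat2 1 j 0 1 \<or> E = - mat2 1 j 0 1" and E: "D * A = A * E"
      using fixes_cusp_cases[OF Dc cusp(2) cusp(2) D(2)] by blast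
    have Ec: "E \<in> carrier SL2" using j by auto
    have i: "inv\<^bsub>SL2\<^esub> A \<in> carrier SL2" using cusp(2) by simp
    have "XC_act k (\<phi> q) = \<phi> (qpar (of_int j) * q)" if "cmod q < 1" for q
      using cusp_chart_translate[OF cusp(2) j that] unfolding cusp(1) act_cusp_chart[OF kc D(1) cusp(2)] E .
    then have "\<forall>\<^sub>F q in nhds 0. XC_act k (\<phi> q) = \<phi> (qpar (of_int j) * q)"
      by (rule eventually_mono[OF eventually_norm_less[of 1], rotated]) simp_all
    then have "deriv (\<lambda>q. qpar (of_int j) * q) 0 = 1"
      by (rule deriv_one[rotated]) (auto simp: reparam_def intro!: analytic_intros)
    \<comment> \<open>The periods of \<open>qpar\<close> are the multiples of N, so a trivial
      rotation means that N divides j.\<close>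
    then have "qpar (of_int j) = qpar 0" by (simp add: qpar_def)
    then obtain m :: int where "of_int j = (0::complex) + of_int (int N * m)" unfolding qpar_eq_iff by blast
    then have "(of_int j :: complex) = of_int (int N * m)" by (simp only: add_0_left)
    then have "j = int N * m" by (simp only: of_int_eq_iff)
    then have T: "mat2 1 j 0 1 \<in> principal_cong N" by (simp add: principal_cong_mat2 cong_0_iff)
    have DE: "D = A * E * inv\<^bsub>SL2\<^esub> A"
      using SL2.m_assoc[OF Dc cusp(2) i] SL2.r_inv[OF cusp(2)] SL2.r_one[OF Dc] by (simp add: E[symmetric])
    show ?thesis
    proof (rule lifts_principal_cong[OF kc D(1)], use j in \<open>elim disjE\<close>)
      assume "E = mat2 1 j 0 1"
      then show "D \<in> principal_cong N \<or> - D \<in> principal_cong N" using principal_cong_conj[OF cusp(2) T] DE by simp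
    next
      assume "E = - mat2 1 j 0 1"
      then have "- D = A * mat2 1 j 0 1 * inv\<^bsub>SL2\<^esub> A"
        unfolding DE using cusp(2) by (elim SL2_cases) (simp add: inv_SL2_mat2 algebra_simps)
      then show "D \<in> principal_cong N \<or> - D \<in> principal_cong N" using principal_cong_conj[OF cusp(2) T] by simp
    qed
  qed
  then have "inv\<^bsub>PSL2\<^esub> k = \<one>\<^bsub>PSL2\<^esub>" by simp
  then show ?thesis using hc by (simp add: k_def)
qed

theorem complex_formulas:
  assumes gen: "generates unit_group (\<epsilon> :: 'f)" "generates (norm_one_group \<epsilon>) \<tau>"
  shows "free_orbit_formula (XC N) (XC_act :: 'f mat set \<Rightarrow> _) (XC_ram N)"
    "order2_formula (XC N) (XC_act :: 'f mat set \<Rightarrow> _) (XC_ram N)"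
    "order3_formula (XC N) (XC_act :: 'f mat set \<Rightarrow> _) (XC_ram N)"
    "cusp_formula N \<epsilon> \<tau> (XC N) XC_act (XC_ram N) mat_trace id"
proof -
  interpret complex: cotangent_action "TYPE('f)" N "XC N" XC_act "\<lambda>c _. c" "XC_max_ideal N" "\<lambda>g f. f \<circ> XC_act (inv\<^bsub>PSL2\<^esub> g)"
    by (rule cotangent_action_XC)
  have ram: "XC_ram N P h = complex.ram P h" for P and h :: "'f mat set"
    by (simp add: XC_ram_def times_fun_def)
  have "curve_action N (XC N) XC_act (\<lambda>P (h :: 'f mat set). XC_ram N P h)"
    unfolding ram by (rule complex.curve_action) (rule XC_ram_faithful[unfolded ram])
  then interpret curve_action "TYPE('f)" N "XC N" XC_act "XC_ram N" .
  show "free_orbit_formula (XC N) (XC_act :: 'f mat set \<Rightarrow> _) (XC_ram N)" by (rule free_orbit)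
  show "order2_formula (XC N) (XC_act :: 'f mat set \<Rightarrow> _) (XC_ram N)" by (rule order2)
  show "order3_formula (XC N) (XC_act :: 'f mat set \<Rightarrow> _) (XC_ram N)" by (rule order3)
  show "cusp_formula N \<epsilon> \<tau> (XC N) XC_act (XC_ram N) mat_trace id"
    by (rule cusp[OF gen trace_like_mat_trace]) simp_all
qed

end

theorem mainTheorem4:
  fixes N :: nat
    and \<epsilon> :: "'f::{field, finite}" and \<tau> :: "'f \<times> 'f"
    and \<phi> :: "complex \<Rightarrow> 'k::field" and lift :: "'k \<Rightarrow> complex"
    and emb :: "'k \<Rightarrow> 'K::field" and red :: "(complex \<Rightarrow> complex) \<Rightarrow> 'K"
    and \<sigma> :: "'f mat set \<Rightarrow> 'K \<Rightarrow> 'K"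
  assumes "prime N" and "N \<ge> 7" and "CARD('f) = N"
    and "generates unit_group \<epsilon>" and "generates (norm_one_group \<epsilon>) \<tau>"
  shows
    "(\<comment> \<open>base field the complex numbers\<close>
      free_orbit_formula (XC N) (XC_act :: 'f mat set \<Rightarrow> _) (XC_ram N) \<and>
      order2_formula (XC N) (XC_act :: 'f mat set \<Rightarrow> _) (XC_ram N) \<and>
      order3_formula (XC N) (XC_act :: 'f mat set \<Rightarrow> _) (XC_ram N) \<and>
      cusp_formula N \<epsilon> \<tau> (XC N) XC_act (XC_ram N) mat_trace id) \<and>
     (\<comment> \<open>base field of good positive characteristic\<close>
      CHAR('k) > 0 \<and> \<not> CHAR('k) dvd card (carrier (PSL2 :: 'f mat set monoid)) \<and>
      has_primitive_root TYPE('k) (card (carrier (PSL2 :: 'f mat set monoid))) \<and>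
      root_embedding (card (carrier (PSL2 :: 'f mat set monoid))) lift \<and>
      is_reduction N \<phi> emb red \<sigma> \<longrightarrow>
        free_orbit_formula (curve_points emb) (place_act \<sigma>) (place_ram emb \<sigma>) \<and>
        order2_formula (curve_points emb) (place_act \<sigma>) (place_ram emb \<sigma>) \<and>
        order3_formula (curve_points emb) (place_act \<sigma>) (place_ram emb \<sigma>) \<and>
        cusp_formula N \<epsilon> \<tau> (curve_points emb) (place_act \<sigma>) (place_ram emb \<sigma>)
          (brauer lift) lift)"
proof -
  interpret prime_field "TYPE('f)" N by (rule prime_field.intro) (use assms in simp_all)
  note C = complex_formulas[OF assms(4,5)]
  show ?thesis
  proof (intro conjI[OF conjI[OF C(1) conjI[OF C(2) conjI[OF C(3,4)]]]] impI, elim conjE)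
    assume *: "\<not> CHAR('k) dvd card (carrier (PSL2 :: 'f mat set monoid))"
      "root_embedding (card (carrier (PSL2 :: 'f mat set monoid))) lift" "is_reduction N \<phi> emb red \<sigma>"
    interpret modular_reduction "TYPE('f)" N \<phi> emb red \<sigma> by unfold_locales (use * in simp_all)
    note R = reduction_formulas[OF *(2) assms(4,5)]
    show "free_orbit_formula (curve_points emb) (place_act \<sigma>) (place_ram emb \<sigma>) \<and>
        order2_formula (curve_points emb) (place_act \<sigma>) (place_ram emb \<sigma>) \<and>
        order3_formula (curve_points emb) (place_act \<sigma>) (place_ram emb \<sigma>) \<and>
        cusp_formula N \<epsilon> \<tau> (curve_points emb) (place_act \<sigma>) (place_ram emb \<sigma>) (brauer lift) lift"
      by (intro conjI R)
  qed
qed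

end
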